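(* Let $\mathcal M$ be an o-minimal expansion of an ordered group, with universe $M$ and language $\mathcal L$, let $P\subseteq M$ be a dense $\mathrm{dcl}$-independent set, and let $\mathcal N=\langle\mathcal M,P\rangle$. Equip the sets definable in $\mathcal N$ with the large dimension $\dim$. Then every group definable in $\mathcal N$ is definably isomorphic to a strongly large definable group.
   Context: "Definable" means definable in $\mathcal N$ with parameters; "$\mathcal L$-definable" means definable in $\mathcal M$ with parameters; $\mathrm{dcl}$ is definable closure in $\mathcal M$. A definable $X\subseteq M^n$ is small if there is no $\mathcal L$-definable map $f:M^{nk}\to M$ (any $k$) with $f(X^k)$ containing an open interval. Supercones $J\subseteq M^k$ and their shells $sh(J)$ are defined recursively: $M^0=\{0\}$ is a supercone with $sh(M^0)=M^0$; a definable $J\subseteq M^{n+1}$ is a supercone if its projection $\pi(J)$ to the first $n$ coordinates is a supercone and there are $\mathcal L$-definable continuous $h_1<h_2: sh(\pi(J))\to M\cup\{\pm\infty\}$ such that for each $a\in\pi(J)$ the fiber $J_a$ is contained in $(h_1(a),h_2(a))$ and $(h_1(a),h_2(a))\setminus J_a$ is small; then $sh(J)=\{(a,b):a\in sh(\pi(J)),\ h_1(a)<b<h_2(a)\}$. The large dimension of a nonempty definable $X\subseteq M^n$ is the maximal $k$ such that $X$ contains a set $f(J)$ with $J\subseteq M^k$ a supercone and $f:sh(J)\to M^n$ an $\mathcal L$-definable continuous injective map; $\dim\emptyset=-\infty$. $cl$ denotes topological closure; a definable set $X$ is strongly large if $\dim X=\dim cl(X)$; a definable group is strongly large if its universe is.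 *)

theory Defs
  imports Main "HOL-Library.Extended_Real" "HOL-Algebra.Group"
begin

text \<open>Structures have universe the whole type 'a; function symbols 'f and relation
symbols 'r are interpreted on argument lists.  n-tuples are lists of length n.\<close>

datatype 'f trm = Var nat | Fn 'f "'f trm list"

datatype ('f, 'r) fm =
    Eq "'f trm" "'f trm"
  | Rel 'r "'f trm list"
  | Neg "('f, 'r) fm"
  | Conj "('f, 'r) fm" "('f, 'r) fm"
  | Ex nat "('f, 'r) fm"

fun evalt :: "('f \<Rightarrow> 'a list \<Rightarrow> 'a) \<Rightarrow> (nat \<Rightarrow> 'a) \<Rightarrow> 'f trm \<Rightarrow> 'a" where
  "evalt F e (Var i) = e i"
| "evalt F e (Fn f ts) = F f (map (evalt F e) ts)"

fun sat :: "('f \<Rightarrow> 'a list \<Rightarrow> 'a) \<Rightarrow> ('r \<Rightarrow> 'a list \<Rightarrow> bool) \<Rightarrow> (nat \<Rightarrow> 'a)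
            \<Rightarrow> ('f, 'r) fm \<Rightarrow> bool" where
  "sat F R e (Eq s t) = (evalt F e s = evalt F e t)"
| "sat F R e (Rel r ts) = R r (map (evalt F e) ts)"
| "sat F R e (Neg \<phi>) = (\<not> sat F R e \<phi>)"
| "sat F R e (Conj \<phi> \<psi>) = (sat F R e \<phi> \<and> sat F R e \<psi>)"
| "sat F R e (Ex i \<phi>) = (\<exists>a. sat F R (e(i := a)) \<phi>)"

text \<open>Environment built from a tuple followed by parameters (indices wrap around, so
every variable receives a value from the tuple or the parameters).\<close>
definition tenv :: "'a list \<Rightarrow> nat \<Rightarrow> 'a" where
  "tenv l i = l ! (i mod length l)"

definition definable_over :: "('f \<Rightarrow> 'a list \<Rightarrow> 'a) \<Rightarrow> ('r \<Rightarrow> 'a list \<Rightarrow> bool) \<Rightarrow> 'a set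
      \<Rightarrow> nat \<Rightarrow> 'a list set \<Rightarrow> bool" where
  "definable_over F R A n X \<longleftrightarrow>
     (\<exists>(\<phi> :: ('f, 'r) fm) ps. set ps \<subseteq> A \<and>
        X = {xs. length xs = n \<and> sat F R (tenv (xs @ ps)) \<phi>})"

definition definable :: "('f \<Rightarrow> 'a list \<Rightarrow> 'a) \<Rightarrow> ('r \<Rightarrow> 'a list \<Rightarrow> bool)
      \<Rightarrow> nat \<Rightarrow> 'a list set \<Rightarrow> bool" where
  "definable F R n X \<longleftrightarrow> definable_over F R UNIV n X"

definition dcl :: "('f \<Rightarrow> 'a list \<Rightarrow> 'a) \<Rightarrow> ('r \<Rightarrow> 'a list \<Rightarrow> bool) \<Rightarrow> 'a set \<Rightarrow> 'a set" where
  "dcl F R A = {b. definable_over F R A 1 {[b]}}"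

definition expR :: "('r \<Rightarrow> 'a list \<Rightarrow> bool) \<Rightarrow> 'a set \<Rightarrow> 'r option \<Rightarrow> 'a list \<Rightarrow> bool" where
  "expR R P ro xs = (case ro of None \<Rightarrow> (\<exists>p\<in>P. xs = [p]) | Some r \<Rightarrow> R r xs)"

definition expands_ordered_group ::
    "('f \<Rightarrow> 'a::linordered_ab_group_add list \<Rightarrow> 'a) \<Rightarrow> ('r \<Rightarrow> 'a list \<Rightarrow> bool) \<Rightarrow> bool" where
  "expands_ordered_group F R \<longleftrightarrow>
     (\<exists>r. \<forall>x y. R r [x, y] \<longleftrightarrow> x < y) \<and> (\<exists>f. \<forall>x y. F f [x, y] = x + y)"

definition interval_or_point :: "'a::linorder set \<Rightarrow> bool" where
  "interval_or_point I \<longleftrightarrow>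
     (\<exists>a. I = {a}) \<or> (\<exists>a b. I = {x. a < x \<and> x < b}) \<or> (\<exists>a. I = {x. a < x})
     \<or> (\<exists>b. I = {x. x < b}) \<or> I = UNIV"

definition o_minimal :: "('f \<Rightarrow> 'a::linorder list \<Rightarrow> 'a) \<Rightarrow> ('r \<Rightarrow> 'a list \<Rightarrow> bool) \<Rightarrow> bool" where
  "o_minimal F R \<longleftrightarrow>
     (\<forall>X. definable F R 1 X \<longrightarrow>
        (\<exists>\<I>. finite \<I> \<and> (\<forall>I\<in>\<I>. interval_or_point I) \<and> X = {[x] | x. x \<in> \<Union>\<I>}))"

definition dense_in :: "'a::linorder set \<Rightarrow> bool" where
  "dense_in P \<longleftrightarrow> (\<forall>a b. a < b \<longrightarrow> (\<exists>p\<in>P. a < p \<and> p < b))"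

definition dcl_independent :: "('f \<Rightarrow> 'a list \<Rightarrow> 'a) \<Rightarrow> ('r \<Rightarrow> 'a list \<Rightarrow> bool) \<Rightarrow> 'a set \<Rightarrow> bool" where
  "dcl_independent F R P \<longleftrightarrow> (\<forall>p\<in>P. p \<notin> dcl F R (P - {p}))"

datatype 'a ext = NegInf | Fin 'a | PosInf

fun eless :: "'a::linorder ext \<Rightarrow> 'a ext \<Rightarrow> bool" where
  "eless NegInf (Fin _) = True"
| "eless NegInf PosInf = True"
| "eless (Fin a) (Fin b) = (a < b)"
| "eless (Fin _) PosInf = True"
| "eless _ _ = False"

definition ebox :: "'a::linorder ext list \<Rightarrow> 'a ext list \<Rightarrow> 'a list set" where
  "ebox a b = {y. length y = length a \<and>
                  (\<forall>i<length a. eless (a ! i) (Fin (y ! i)) \<and> eless (Fin (y ! i)) (b ! i))}"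

definition cl :: "nat \<Rightarrow> 'a::linorder list set \<Rightarrow> 'a list set" where
  "cl n X = {x. length x = n \<and>
     (\<forall>a b. length a = n \<and> length b = n \<and> x \<in> ebox a b \<longrightarrow> (\<exists>y\<in>X. y \<in> ebox a b))}"

definition cont_on :: "'a::linorder list set \<Rightarrow> ('a list \<Rightarrow> 'b::linorder list) \<Rightarrow> bool" where
  "cont_on D f \<longleftrightarrow> (\<forall>x\<in>D. \<forall>a b. length a = length (f x) \<and> length b = length (f x)
       \<and> f x \<in> ebox a b \<longrightarrow>
       (\<exists>c d. length c = length x \<and> length d = length x \<and> x \<in> ebox c d \<and>
              (\<forall>y\<in>D \<inter> ebox c d. f y \<in> ebox a b)))"

definition ebasis :: "'a::linorder ext set \<Rightarrow> bool" where
  "ebasis B \<longleftrightarrow> (\<exists>l u. B = {w. eless l w \<and> eless w u}) \<or> (\<exists>l. B = {w. eless l w})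
                \<or> (\<exists>u. B = {w. eless w u}) \<or> B = UNIV"

definition econt_on :: "'a::linorder list set \<Rightarrow> ('a list \<Rightarrow> 'a ext) \<Rightarrow> bool" where
  "econt_on D h \<longleftrightarrow> (\<forall>x\<in>D. \<forall>B. ebasis B \<and> h x \<in> B \<longrightarrow>
       (\<exists>c d. length c = length x \<and> length d = length x \<and> x \<in> ebox c d \<and>
              (\<forall>y\<in>D \<inter> ebox c d. h y \<in> B)))"

definition Ldef_map :: "('f \<Rightarrow> 'a list \<Rightarrow> 'a) \<Rightarrow> ('r \<Rightarrow> 'a list \<Rightarrow> bool) \<Rightarrow> nat \<Rightarrow> nat
      \<Rightarrow> 'a list set \<Rightarrow> ('a list \<Rightarrow> 'a list) \<Rightarrow> bool" where
  "Ldef_map F R k m D f \<longleftrightarrow> (\<forall>x\<in>D. length (f x) = m) \<and>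
       definable F R (k + m) {x @ f x | x. x \<in> D}"

definition Ldef_emap :: "('f \<Rightarrow> 'a list \<Rightarrow> 'a) \<Rightarrow> ('r \<Rightarrow> 'a list \<Rightarrow> bool) \<Rightarrow> nat
      \<Rightarrow> 'a list set \<Rightarrow> ('a list \<Rightarrow> 'a ext) \<Rightarrow> bool" where
  "Ldef_emap F R k D h \<longleftrightarrow>
       definable F R k {x \<in> D. h x = NegInf} \<and> definable F R k {x \<in> D. h x = PosInf} \<and>
       definable F R (Suc k) {x @ [c] | x c. x \<in> D \<and> h x = Fin c}"

definition tpow :: "'a list set \<Rightarrow> nat \<Rightarrow> 'a list set" where
  "tpow X k = {concat xs | xs. length xs = k \<and> set xs \<subseteq> X}"

definition small :: "('f \<Rightarrow> 'a::linordered_ab_group_add list \<Rightarrow> 'a) \<Rightarrow> ('r \<Rightarrow> 'a list \<Rightarrow> bool)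
      \<Rightarrow> 'a set \<Rightarrow> nat \<Rightarrow> 'a list set \<Rightarrow> bool" where
  "small F R P n X \<longleftrightarrow> definable F (expR R P) n X \<and>
     \<not> (\<exists>k (f :: 'a list \<Rightarrow> 'a) a b. a < b \<and>
          definable F R (n * k + 1) {x @ [f x] | x. length x = n * k} \<and>
          {c. a < c \<and> c < b} \<subseteq> f ` tpow X k)"

text \<open>supercone F R P k J S: J \<subseteq> M^k is a supercone with shell S
  (for some choice of the bounding functions).\<close>
inductive supercone :: "('f \<Rightarrow> 'a::linordered_ab_group_add list \<Rightarrow> 'a) \<Rightarrow> ('r \<Rightarrow> 'a list \<Rightarrow> bool)
      \<Rightarrow> 'a set \<Rightarrow> nat \<Rightarrow> 'a list set \<Rightarrow> 'a list set \<Rightarrow> bool"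
  for F R P where
  zero: "supercone F R P 0 {[]} {[]}"
| step: "\<lbrakk> supercone F R P n J' S';
           definable F (expR R P) (Suc n) J; J \<subseteq> {x. length x = Suc n}; butlast ` J = J';
           Ldef_emap F R n S' h1; Ldef_emap F R n S' h2; econt_on S' h1; econt_on S' h2;
           \<forall>a\<in>S'. eless (h1 a) (h2 a);
           \<forall>a\<in>J'. {b. a @ [b] \<in> J} \<subseteq> {b. eless (h1 a) (Fin b) \<and> eless (Fin b) (h2 a)};
           \<forall>a\<in>J'. small F R P 1
               {[b] | b. eless (h1 a) (Fin b) \<and> eless (Fin b) (h2 a) \<and> a @ [b] \<notin> J} \<rbrakk>
         \<Longrightarrow> supercone F R P (Suc n) J
               {a @ [b] | a b. a \<in> S' \<and> eless (h1 a) (Fin b) \<and> eless (Fin b) (h2 a)}"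

definition ldim :: "('f \<Rightarrow> 'a::linordered_ab_group_add list \<Rightarrow> 'a) \<Rightarrow> ('r \<Rightarrow> 'a list \<Rightarrow> bool)
      \<Rightarrow> 'a set \<Rightarrow> nat \<Rightarrow> 'a list set \<Rightarrow> ereal" where
  "ldim F R P n X = (if X = {} then -\<infinity> else
     Sup {ereal (real k) | k. \<exists>J S f. supercone F R P k J S \<and> Ldef_map F R k n S f \<and>
                                   cont_on S f \<and> inj_on f S \<and> f ` J \<subseteq> X})"

definition strongly_large :: "('f \<Rightarrow> 'a::linordered_ab_group_add list \<Rightarrow> 'a) \<Rightarrow> ('r \<Rightarrow> 'a list \<Rightarrow> bool)
      \<Rightarrow> 'a set \<Rightarrow> nat \<Rightarrow> 'a list set \<Rightarrow> bool" where
  "strongly_large F R P n X \<longleftrightarrow> ldim F R P n X = ldim F R P n (cl n X)"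

definition Ndef_group :: "('f \<Rightarrow> 'a::linordered_ab_group_add list \<Rightarrow> 'a) \<Rightarrow> ('r \<Rightarrow> 'a list \<Rightarrow> bool)
      \<Rightarrow> 'a set \<Rightarrow> nat \<Rightarrow> 'a list monoid \<Rightarrow> bool" where
  "Ndef_group F R P n G \<longleftrightarrow> group G \<and> carrier G \<subseteq> {x. length x = n} \<and>
     definable F (expR R P) n (carrier G) \<and>
     definable F (expR R P) (3 * n)
       {x @ y @ (x \<otimes>\<^bsub>G\<^esub> y) | x y. x \<in> carrier G \<and> y \<in> carrier G}"

end

theory Submission
  imports Defs "HOL-Library.Multiset"
begin

text \<open>
  Types are treated as ultrafilters U, and tuples of elements as families indexed by the underlying
  set of U; algebraic dependence modulo U is a pregeometry, with ranks over the constants (rkU U {})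
  and over the elements of P (rkP U). A back-and-forth argument shows that a type in the expansion is
  determined by its type in the o-minimal structure as soon as it is presented as a tuple independent
  over P together with finitely many elements of P (types_agree).

  Let G be a definable group and kmax the maximal rank over P of its types. If g and h are independent
  generic elements whose minimal supports in P have size l, then the support of the product contains
  both supports, so it has size at least 2l; taking l maximal forces l = 0. Hence a generic element
  is algebraic over kmax of its coordinates, i.e. it lies in a set definable in the o-minimal structure
  of dimension at most kmax, and by compactness finitely many translates of G into one such set Z
  cover G. Gluing these translates embeds G into finitely many copies of Z. The closure of a definable
  subset of dimension kmax of the o-minimal structure has the same dimension, and the generic type
  provides a supercone of dimension kmax inside the group, so the copy is strongly large.
\<close>


section \<open>Definable predicates on environments\<close>

text \<open>The obstacle is that large dimension does not see \<open>P\<close>: the set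
  \<open>P\<close> has dimension 0, but its closure is the whole line. Elements of \<open>P\<close>
  hidden in the coordinates of a group can thicken its closure in the same way, so the coordinates
  must be changed. Only generic elements can be freed from \<open>P\<close>; others may really
  involve it. Hence the cover by translates: a point multiplied by an independent generic element
  becomes generic. The doubling of supports uses that the group law can be solved for each variable.
  If z = x y, then x is in the closure of y and z, so its support is contained in the union of
  theirs; since independent x and y have disjoint supports, that of x lies in that of z, and
  likewise for y. Families modulo an ultrafilter play the role of elements of an elementary
  extension. Compactness is the choice of an ultrafilter containing a directed family, and
  independent realisations come from iterated products of ultrafilters. A type can be extended by
  one coordinate because \<open>P\<close> meets every interval, whereas boundedly many elements of
  \<open>P\<close> and finitely many parameters never generate all points of an interval.\<close>

fun fvt :: "'f trm \<Rightarrow> nat set" where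
  "fvt (Var i) = {i}"
| "fvt (Fn f ts) = (\<Union>t\<in>set ts. fvt t)"

fun fv :: "('f, 'r) fm \<Rightarrow> nat set" where
  "fv (Eq s t) = fvt s \<union> fvt t"
| "fv (Rel r ts) = (\<Union>t\<in>set ts. fvt t)"
| "fv (Neg \<phi>) = fv \<phi>"
| "fv (Conj \<phi> \<psi>) = fv \<phi> \<union> fv \<psi>"
| "fv (Ex i \<phi>) = fv \<phi> - {i}"

fun rent :: "(nat \<Rightarrow> nat) \<Rightarrow> 'f trm \<Rightarrow> 'f trm" where
  "rent h (Var i) = Var (h i)"
| "rent h (Fn f ts) = Fn f (map (rent h) ts)"

lemma finite_fvt: "finite (fvt t)"
  by (induction t) auto

lemma finite_fv: "finite (fv \<phi>)"
  by (induction \<phi>) (auto simp: finite_fvt)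

lemma evalt_cong: "(\<And>i. i \<in> fvt t \<Longrightarrow> e i = e' i) \<Longrightarrow> evalt F e t = evalt F e' t"
proof (induction t)
  case (Fn f ts)
  then have "map (evalt F e) ts = map (evalt F e') ts" by auto
  then show ?case by (simp only: evalt.simps)
qed simp

lemma map_evalt_cong:
  "(\<And>i. i \<in> (\<Union>t\<in>set ts. fvt t) \<Longrightarrow> e i = e' i) \<Longrightarrow> map (evalt F e) ts = map (evalt F e') ts"
  by (auto intro!: evalt_cong)

lemma sat_cong: "(\<And>i. i \<in> fv \<phi> \<Longrightarrow> e i = e' i) \<Longrightarrow> sat F R e \<phi> = sat F R e' \<phi>"
proof (induction \<phi> arbitrary: e e')
  case (Eq s t)
  then show ?case using evalt_cong[of s e e' F] evalt_cong[of t e e' F] by simp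
next
  case (Rel r ts)
  have "map (evalt F e) ts = map (evalt F e') ts"
    by (rule map_evalt_cong) (use Rel in simp)
  then show ?case by (simp only: sat.simps)
next
  case (Neg \<phi>)
  have "sat F R e \<phi> = sat F R e' \<phi>" by (rule Neg.IH) (use Neg.prems in simp)
  then show ?case by simp
next
  case (Conj \<phi> \<psi>)
  have "sat F R e \<phi> = sat F R e' \<phi>" by (rule Conj.IH(1)) (use Conj.prems in simp)
  moreover have "sat F R e \<psi> = sat F R e' \<psi>" by (rule Conj.IH(2)) (use Conj.prems in simp)
  ultimately show ?case by simp
next
  case (Ex i \<phi>)
  have "sat F R (e(i:=a)) \<phi> = sat F R (e'(i:=a)) \<phi>" for a
    using Ex.prems by (intro Ex.IH) auto
  then show ?case by simp
qed

lemma evalt_rent: "evalt F e (rent h t) = evalt F (\<lambda>k. e (h k)) t"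
proof (induction t)
  case (Fn f ts)
  then have "map (evalt F e) (map (rent h) ts) = map (evalt F (\<lambda>k. e (h k))) ts" by auto
  then show ?case by (metis evalt.simps(2) rent.simps(2))
qed simp

lemma map_evalt_rent: "map (evalt F e) (map (rent h) ts) = map (evalt F (\<lambda>k. e (h k))) ts"
  by (auto simp: evalt_rent)

lemma fvt_rent: "fvt (rent h t) = h ` fvt t"
  by (induction t) auto

lemma ex_fresh: "finite (X :: nat set) \<Longrightarrow> \<exists>w. w \<notin> X"
  using ex_new_if_finite infinite_UNIV_nat by blast

text \<open>The new formula is only asserted to exist: under a quantifier the bound variable is
  replaced by a fresh \<open>w\<close> outside the image of \<open>h\<close>, so nothing is captured
  and \<open>h\<close> may be arbitrary, also non-injective.\<close>

lemma subst_exists: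
  "\<exists>\<psi>. fv \<psi> \<subseteq> h ` fv \<phi> \<and> (\<forall>e. sat F R e \<psi> \<longleftrightarrow> sat F R (\<lambda>k. e (h k)) \<phi>)"
proof (induction \<phi> arbitrary: h)
  case (Eq s t)
  show ?case by (rule exI[of _ "Eq (rent h s) (rent h t)"]) (auto simp: evalt_rent fvt_rent)
next
  case (Rel r ts)
  show ?case
    by (rule exI[of _ "Rel r (map (rent h) ts)"])
      (simp only: sat.simps map_evalt_rent, auto simp: fvt_rent)
next
  case (Neg \<phi>)
  then obtain \<psi> where "fv \<psi> \<subseteq> h ` fv \<phi>" "\<forall>e. sat F R e \<psi> \<longleftrightarrow> sat F R (\<lambda>k. e (h k)) \<phi>" by blast
  then show ?case by (intro exI[of _ "Neg \<psi>"]) auto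
next
  case (Conj \<phi>1 \<phi>2)
  from Conj(1)[of h] obtain \<psi>1
    where 1: "fv \<psi>1 \<subseteq> h ` fv \<phi>1" "\<forall>e. sat F R e \<psi>1 \<longleftrightarrow> sat F R (\<lambda>k. e (h k)) \<phi>1" by blast
  from Conj(2)[of h] obtain \<psi>2
    where 2: "fv \<psi>2 \<subseteq> h ` fv \<phi>2" "\<forall>e. sat F R e \<psi>2 \<longleftrightarrow> sat F R (\<lambda>k. e (h k)) \<phi>2" by blast
  show ?case using 1 2 by (intro exI[of _ "Conj \<psi>1 \<psi>2"]) auto
next
  case (Ex i \<phi>)
  obtain w where w: "w \<notin> h ` fv \<phi>" using ex_fresh finite_fv by blast
  from Ex[of "h(i:=w)"] obtain \<psi>
    where 1: "fv \<psi> \<subseteq> (h(i:=w)) ` fv \<phi>" "\<forall>e. sat F R e \<psi> \<longleftrightarrow> sat F R (\<lambda>k. e ((h(i:=w)) k)) \<phi>" by blast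
  have "sat F R (\<lambda>k. (e(w:=a)) ((h(i:=w)) k)) \<phi> \<longleftrightarrow> sat F R ((\<lambda>k. e (h k))(i:=a)) \<phi>" for e a
    using w by (intro sat_cong) auto
  then have "sat F R e (Ex w \<psi>) \<longleftrightarrow> sat F R (\<lambda>k. e (h k)) (Ex i \<phi>)" for e
    using 1(2) by simp
  moreover have "fv (Ex w \<psi>) \<subseteq> h ` fv (Ex i \<phi>)" using 1(1) by (auto split: if_splits)
  ultimately show ?case by blast
qed

definition asg :: "(nat \<Rightarrow> nat + 'a) \<Rightarrow> (nat \<Rightarrow> 'a) \<Rightarrow> nat \<Rightarrow> 'a" where
  "asg \<tau> e k = (case \<tau> k of Inl j \<Rightarrow> e j | Inr c \<Rightarrow> c)"

text \<open>Definability is moved from sets of n-tuples to predicates on infinite environments. The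
  assignment \<open>\<tau>\<close> sends each formula variable to a slot or to a constant from
  \<open>C\<close>, so that connectives and quantifiers act on predicates without any counting of
  arities or parameters.\<close>

definition D :: "('f \<Rightarrow> 'a list \<Rightarrow> 'a) \<Rightarrow> ('r \<Rightarrow> 'a list \<Rightarrow> bool) \<Rightarrow> 'a set
    \<Rightarrow> ((nat \<Rightarrow> 'a) \<Rightarrow> bool) \<Rightarrow> bool" where
  "D F R C Q \<longleftrightarrow> (\<exists>(\<phi> :: ('f, 'r) fm) \<tau>. (\<forall>k\<in>fv \<phi>. \<forall>c. \<tau> k = Inr c \<longrightarrow> c \<in> C) \<and>
      (\<forall>e. Q e \<longleftrightarrow> sat F R (asg \<tau> e) \<phi>))"

definition dep :: "nat set \<Rightarrow> ((nat \<Rightarrow> 'a) \<Rightarrow> bool) \<Rightarrow> bool" where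
  "dep X Q \<longleftrightarrow> (\<forall>e e'. (\<forall>k\<in>X. e k = e' k) \<longrightarrow> Q e = Q e')"

lemma depD: "dep X Q \<Longrightarrow> (\<And>k. k \<in> X \<Longrightarrow> e k = e' k) \<Longrightarrow> Q e = Q e'"
  unfolding dep_def by blast

lemma D_E:
  assumes "D F R C Q"
  obtains \<phi> \<tau> where "\<And>k c. k \<in> fv \<phi> \<Longrightarrow> \<tau> k = Inr c \<Longrightarrow> c \<in> C"
    "\<And>e. Q e \<longleftrightarrow> sat F R (asg \<tau> e) \<phi>"
  using assms unfolding D_def by blast

lemma D_I:
  assumes "\<And>k c. k \<in> fv \<phi> \<Longrightarrow> \<tau> k = Inr c \<Longrightarrow> c \<in> C" "\<And>e. Q e \<longleftrightarrow> sat F R (asg \<tau> e) \<phi>"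
  shows "D F R C Q"
  unfolding D_def using assms by blast

lemma D_sat: "(\<And>k c. k \<in> fv \<phi> \<Longrightarrow> \<tau> k = Inr c \<Longrightarrow> c \<in> C) \<Longrightarrow> D F R C (\<lambda>e. sat F R (asg \<tau> e) \<phi>)"
  unfolding D_def by blast

lemma D_mono: "D F R C Q \<Longrightarrow> C \<subseteq> C' \<Longrightarrow> D F R C' Q"
  unfolding D_def by blast

lemma D_sub:
  assumes "D F R C Q" "\<And>k c. \<tau> k = Inr c \<Longrightarrow> c \<in> C"
  shows "D F R C (\<lambda>e. Q (asg \<tau> e))"
proof -
  obtain \<phi> \<tau>1 where 1: "\<And>k c. k \<in> fv \<phi> \<Longrightarrow> \<tau>1 k = Inr c \<Longrightarrow> c \<in> C"
    "\<And>e. Q e \<longleftrightarrow> sat F R (asg \<tau>1 e) \<phi>"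
    using D_E[OF assms(1)] by blast
  define \<tau>2 where "\<tau>2 k = (case \<tau>1 k of Inl j \<Rightarrow> \<tau> j | Inr c \<Rightarrow> Inr c)" for k
  have "asg \<tau>1 (asg \<tau> e) = asg \<tau>2 e" for e
    by (rule ext) (auto simp: asg_def \<tau>2_def split: sum.splits)
  then have "\<And>e. Q (asg \<tau> e) \<longleftrightarrow> sat F R (asg \<tau>2 e) \<phi>" using 1(2) by simp
  moreover have "c \<in> C" if "k \<in> fv \<phi>" "\<tau>2 k = Inr c" for k c
    using 1(1) assms(2) that by (auto simp: \<tau>2_def split: sum.splits)
  ultimately show ?thesis by (intro D_I)
qed

lemma D_var: "D F R C Q \<Longrightarrow> D F R C (\<lambda>e. Q (\<lambda>k. e (h k)))"
  using D_sub[of F R C Q "\<lambda>k. Inl (h k)"] by (simp add: asg_def[abs_def])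

lemma D_const:
  assumes "D F R C Q" "\<And>k c. f k = Some c \<Longrightarrow> c \<in> C"
  shows "D F R C (\<lambda>e. Q (\<lambda>k. case f k of Some c \<Rightarrow> c | None \<Rightarrow> e (h k)))"
proof -
  have "asg (\<lambda>k. case f k of Some c \<Rightarrow> Inr c | None \<Rightarrow> Inl (h k)) e
     = (\<lambda>k. case f k of Some c \<Rightarrow> c | None \<Rightarrow> e (h k))" for e
    by (rule ext) (auto simp: asg_def split: option.splits)
  moreover have "D F R C (\<lambda>e. Q (asg (\<lambda>k. case f k of Some c \<Rightarrow> Inr c | None \<Rightarrow> Inl (h k)) e))"
    by (rule D_sub[OF assms(1)]) (auto split: option.splits dest: assms(2))
  ultimately show ?thesis by simp
qed

lemma D_upd1:
  assumes "D F R C Q" "c \<in> C"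
  shows "D F R C (\<lambda>e. Q (e(j := c)))"
proof -
  have eq: "asg (\<lambda>k. if k = j then Inr c else Inl k) e = e(j := c)" for e
    by (rule ext) (auto simp: asg_def)
  have "D F R C (\<lambda>e. Q (asg (\<lambda>k. if k = j then Inr c else Inl k) e))"
    by (rule D_sub[OF assms(1)]) (use assms(2) in \<open>auto split: if_splits\<close>)
  then show ?thesis unfolding eq .
qed

lemma D_dep:
  fixes Q :: "(nat \<Rightarrow> 'a) \<Rightarrow> bool"
  assumes "D F R C Q" shows "\<exists>K. finite K \<and> dep K Q"
proof -
  obtain \<phi> \<tau> where "\<And>k c. k \<in> fv \<phi> \<Longrightarrow> \<tau> k = Inr c \<Longrightarrow> c \<in> C"
    and 1: "\<And>e. Q e \<longleftrightarrow> sat F R (asg \<tau> e) \<phi>"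
    using D_E[OF assms] by blast
  define K where "K = (\<lambda>k. projl (\<tau> k)) ` fv \<phi>"
  have "dep K Q" unfolding dep_def
  proof (intro allI impI)
    fix e e' :: "nat \<Rightarrow> 'a" assume a: "\<forall>k\<in>K. e k = e' k"
    have "sat F R (asg \<tau> e) \<phi> = sat F R (asg \<tau> e') \<phi>"
      using a by (intro sat_cong) (auto simp: K_def asg_def rev_image_eqI split: sum.splits)
    then show "Q e = Q e'" using 1 by simp
  qed
  then show ?thesis unfolding K_def using finite_fv by blast
qed

lemma D_not: "D F R C Q \<Longrightarrow> D F R C (\<lambda>e. \<not> Q e)"
proof -
  assume "D F R C Q"
  then obtain \<phi> \<tau> where "\<And>k c. k \<in> fv \<phi> \<Longrightarrow> \<tau> k = Inr c \<Longrightarrow> c \<in> C"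
    "\<And>e. Q e \<longleftrightarrow> sat F R (asg \<tau> e) \<phi>"
    using D_E by blast
  then show ?thesis by (intro D_I[of "Neg \<phi>" \<tau>]) auto
qed

text \<open>The two formulas come with unrelated assignments; placing their variables on the even
  and on the odd numbers yields one assignment that serves both.\<close>

lemma D_conj:
  assumes "D F R C Q1" "D F R C Q2"
  shows "D F R C (\<lambda>e. Q1 e \<and> Q2 e)"
proof -
  obtain \<phi>1 \<tau>1 where 1: "\<And>k c. k \<in> fv \<phi>1 \<Longrightarrow> \<tau>1 k = Inr c \<Longrightarrow> c \<in> C"
    "\<And>e. Q1 e \<longleftrightarrow> sat F R (asg \<tau>1 e) \<phi>1"
    using D_E[OF assms(1)] by blast
  obtain \<phi>2 \<tau>2 where 2: "\<And>k c. k \<in> fv \<phi>2 \<Longrightarrow> \<tau>2 k = Inr c \<Longrightarrow> c \<in> C"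
    "\<And>e. Q2 e \<longleftrightarrow> sat F R (asg \<tau>2 e) \<phi>2"
    using D_E[OF assms(2)] by blast
  obtain \<psi>1 where 3: "fv \<psi>1 \<subseteq> (\<lambda>k. 2*k) ` fv \<phi>1" "\<forall>e. sat F R e \<psi>1 \<longleftrightarrow> sat F R (\<lambda>k. e (2*k)) \<phi>1"
    using subst_exists[of "\<lambda>k. 2*k" \<phi>1 F R] by blast
  obtain \<psi>2 where 4: "fv \<psi>2 \<subseteq> (\<lambda>k. 2*k+1) ` fv \<phi>2" "\<forall>e. sat F R e \<psi>2 \<longleftrightarrow> sat F R (\<lambda>k. e (2*k+1)) \<phi>2"
    using subst_exists[of "\<lambda>k. 2*k+1" \<phi>2 F R] by blast
  define \<tau> where "\<tau> k = (if even k then \<tau>1 (k div 2) else \<tau>2 (k div 2))" for k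
  have e1: "(\<lambda>k. asg \<tau> e (2*k)) = asg \<tau>1 e" for e by (rule ext) (simp add: asg_def \<tau>_def)
  have e2: "(\<lambda>k. asg \<tau> e (2*k+1)) = asg \<tau>2 e" for e by (rule ext) (simp add: asg_def \<tau>_def)
  have "Q1 e \<and> Q2 e \<longleftrightarrow> sat F R (asg \<tau> e) (Conj \<psi>1 \<psi>2)" for e
    using 1(2) 2(2) 3(2) 4(2) e1 e2 by simp
  moreover have "c \<in> C" if k: "k \<in> fv (Conj \<psi>1 \<psi>2)" "\<tau> k = Inr c" for k c
  proof -
    consider j where "k = 2*j" "j \<in> fv \<phi>1" | j where "k = 2*j+1" "j \<in> fv \<phi>2"
      using k(1) 3(1) 4(1) by auto
    then show ?thesis using 1(1) 2(1) k(2) by cases (auto simp: \<tau>_def)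
  qed
  ultimately show ?thesis by (intro D_I)
qed

lemma D_ex:
  assumes "D F R C Q"
  shows "D F R C (\<lambda>e. \<exists>a. Q (e(j := a)))"
proof -
  obtain \<phi> \<tau> where 1: "\<And>k c. k \<in> fv \<phi> \<Longrightarrow> \<tau> k = Inr c \<Longrightarrow> c \<in> C"
    "\<And>e. Q e \<longleftrightarrow> sat F R (asg \<tau> e) \<phi>"
    using D_E[OF assms(1)] by blast
  \<comment> \<open>Several formula variables may point to slot \<open>j\<close>; all of them are
    merged into variable 0, the one to be quantified.\<close>
  define h where "h k = (if \<tau> k = Inl j then 0 else Suc k)" for k
  obtain \<psi> where 2: "fv \<psi> \<subseteq> h ` fv \<phi>" "\<forall>e. sat F R e \<psi> \<longleftrightarrow> sat F R (\<lambda>k. e (h k)) \<phi>"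
    using subst_exists[of h \<phi> F R] by blast
  define \<tau>' where "\<tau>' k = (if k = 0 then Inl j else \<tau> (k - 1))" for k
  have e: "(\<lambda>k. ((asg \<tau>' e)(0 := a)) (h k)) = asg \<tau> (e(j := a))" for e a
    by (rule ext) (auto simp: asg_def \<tau>'_def h_def split: sum.splits)
  have "(\<exists>a. Q (e(j := a))) \<longleftrightarrow> sat F R (asg \<tau>' e) (Ex 0 \<psi>)" for e
    using 1(2) 2(2) e by simp
  moreover have "c \<in> C" if k: "k \<in> fv (Ex 0 \<psi>)" "\<tau>' k = Inr c" for k c
  proof -
    from k(1) 2(1) obtain i where "k = h i" "i \<in> fv \<phi>" "k \<noteq> 0" by auto
    then show ?thesis using 1(1) k(2) by (auto simp: \<tau>'_def h_def split: if_splits)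
  qed
  ultimately show ?thesis by (intro D_I)
qed

lemma D_True: "D F R C (\<lambda>e. True)"
  by (rule D_I[of "Eq (Var 0) (Var 0)" "\<lambda>_. Inl 0"]) auto

lemma D_all: "D F R C Q \<Longrightarrow> D F R C (\<lambda>e. \<forall>a. Q (e(j := a)))"
  using D_not[OF D_ex[OF D_not, of F R C Q j]] by simp

lemma D_disj: "D F R C Q1 \<Longrightarrow> D F R C Q2 \<Longrightarrow> D F R C (\<lambda>e. Q1 e \<or> Q2 e)"
  using D_not[OF D_conj[OF D_not D_not, of F R C Q1 Q2]] by simp

lemma D_imp: "D F R C Q1 \<Longrightarrow> D F R C Q2 \<Longrightarrow> D F R C (\<lambda>e. Q1 e \<longrightarrow> Q2 e)"
  unfolding imp_conv_disj by (rule D_disj[OF D_not])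

lemma D_False: "D F R C (\<lambda>e. False)"
  using D_not[OF D_True] by simp

lemma D_Ball_finite: "finite A \<Longrightarrow> (\<And>x. x \<in> A \<Longrightarrow> D F R C (Q x)) \<Longrightarrow> D F R C (\<lambda>e. \<forall>x\<in>A. Q x e)"
  by (induction A rule: finite_induct) (auto simp: D_True intro: D_conj)

lemma D_Bex_finite: "finite A \<Longrightarrow> (\<And>x. x \<in> A \<Longrightarrow> D F R C (Q x)) \<Longrightarrow> D F R C (\<lambda>e. \<exists>x\<in>A. Q x e)"
  by (induction A rule: finite_induct) (auto simp: D_False intro: D_disj)

lemma D_eq: "D F R C (\<lambda>e. e i = e j)"
  by (rule D_I[of "Eq (Var 0) (Var 1)" "\<lambda>k. if k = 0 then Inl i else Inl j"])
    (auto simp: asg_def split: if_splits)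

lemma D_eqc: assumes "c \<in> C" shows "D F R C (\<lambda>e. e i = c)"
proof -
  have "D F R C (\<lambda>e. (e(Suc i := c)) i = (e(Suc i := c)) (Suc i))"
    by (rule D_upd1[OF D_eq assms])
  then show ?thesis by simp
qed

subsection \<open>Comparison with definable sets\<close>

definition upds :: "(nat \<Rightarrow> 'a) \<Rightarrow> nat \<Rightarrow> 'a list \<Rightarrow> nat \<Rightarrow> 'a" where
  "upds e a xs k = (if a \<le> k \<and> k < a + length xs then xs ! (k - a) else e k)"

abbreviation blk :: "(nat \<Rightarrow> 'a) \<Rightarrow> nat \<Rightarrow> nat \<Rightarrow> 'a list" where
  "blk e a n \<equiv> map e [a..<a+n]"

lemma blk_upds_same: "length xs = n \<Longrightarrow> blk (upds e a xs) a n = xs"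
  by (rule nth_equalityI) (auto simp: upds_def)

lemma blk_upds_other: "b + m \<le> a \<or> a + length xs \<le> b \<Longrightarrow> blk (upds e a xs) b m = blk e b m"
  by (auto simp: upds_def)

lemma dep_blk: "dep {..<n} (\<lambda>e. blk e 0 n \<in> X)"
  unfolding dep_def
proof (intro allI impI)
  fix e e' :: "nat \<Rightarrow> 'a" assume "\<forall>k\<in>{..<n}. e k = e' k"
  then have "blk e 0 n = blk e' 0 n" by auto
  then show "(blk e 0 n \<in> X) = (blk e' 0 n \<in> X)" by (simp only:)
qed

lemma blk_split: "blk e a (n + m) = blk e a n @ blk e (a + n) m"
  using upt_add_eq_append[of a "a+n" m] by (simp add: add.assoc flip: map_append)

lemma definable_imp_D:
  assumes "definable_over F R C n X" "length is = n"
  shows "D F R C (\<lambda>e. map e is \<in> X)"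
proof -
  obtain \<phi> ps where p: "set ps \<subseteq> C"
    "X = {xs. length xs = n \<and> sat F R (tenv (xs @ ps)) \<phi>}"
    using assms(1) unfolding definable_over_def by blast
  show ?thesis
  \<comment> \<open>An empty tuple without parameters leaves nothing for the wrapped index of
    \<open>tenv\<close> to point to; then \<open>is\<close> is empty and membership of the empty
    tuple is a fixed truth value.\<close>
  proof (cases "n + length ps = 0")
    case True
    then have "is = []" using assms(2) by simp
    then show ?thesis by (cases "[] \<in> X") (simp_all add: D_True D_False)
  next
    case False
    define N where "N = n + length ps"
    have N: "N > 0" using False N_def by simp
    define \<tau> where "\<tau> k = (if k mod N < n then Inl (is ! (k mod N)) else Inr (ps ! (k mod N - n)))" for k
    have "asg \<tau> e k = tenv (map e is @ ps) k" for e k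
      using assms(2) N by (auto simp: asg_def \<tau>_def tenv_def nth_append N_def)
    then have "asg \<tau> e = tenv (map e is @ ps)" for e by auto
    then have "map e is \<in> X \<longleftrightarrow> sat F R (asg \<tau> e) \<phi>" for e using p(2) assms(2) by simp
    moreover have "c \<in> C" if "\<tau> k = Inr c" for k c
    proof -
      have "k mod N < N" using N by simp
      then have "k mod N - n < length ps" "c = ps ! (k mod N - n)"
        using that by (auto simp: \<tau>_def N_def split: if_splits)
      then show ?thesis using p(1) nth_mem by blast
    qed
    ultimately show ?thesis by (intro D_I)
  qed
qed

lemma D_imp_definable:
  assumes "D F R C (\<lambda>e. blk e 0 n \<in> X)" "\<And>x. x \<in> X \<Longrightarrow> length x = n"
  shows "definable_over F R C n X"
proof -
  obtain \<phi> \<tau> where 1: "\<And>k c. k \<in> fv \<phi> \<Longrightarrow> \<tau> k = Inr c \<Longrightarrow> c \<in> C"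
    "\<And>e. blk e 0 n \<in> X \<longleftrightarrow> sat F R (asg \<tau> e) \<phi>"
    using D_E[OF assms(1)] by blast
  define cs where "cs = sorted_list_of_set {k \<in> fv \<phi>. \<exists>c. \<tau> k = Inr c}"
  have cs: "set cs = {k \<in> fv \<phi>. \<exists>c. \<tau> k = Inr c}" unfolding cs_def
    by (simp add: finite_fv)
  define ps where "ps = map (\<lambda>k. projr (\<tau> k)) cs"
  have ps: "set ps \<subseteq> C" using 1(1) cs unfolding ps_def by (auto simp: image_subset_iff)
  define pos where "pos k = (SOME i. i < length cs \<and> cs ! i = k)" for k
  have pos: "pos k < length cs \<and> cs ! (pos k) = k" if "k \<in> set cs" for k
    unfolding pos_def using that
    by (intro someI_ex[of "\<lambda>i. i < length cs \<and> cs ! i = k"]) (auto simp: in_set_conv_nth)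
  \<comment> \<open>Constants become positions behind the tuple, in the order of \<open>cs\<close>.
    A slot \<open>j\<close> at or beyond \<open>n\<close> reads a parameter or a wrapped entry; this
    is harmless because the equivalence for \<open>\<phi>\<close> holds in every
    environment.\<close>
  define h where "h k = (case \<tau> k of Inl j \<Rightarrow> j | Inr c \<Rightarrow> n + pos k)" for k
  obtain \<psi> where 2: "fv \<psi> \<subseteq> h ` fv \<phi>" "\<forall>e. sat F R e \<psi> \<longleftrightarrow> sat F R (\<lambda>k. e (h k)) \<phi>"
    using subst_exists[of h \<phi> F R] by blast
  have "xs \<in> X \<longleftrightarrow> sat F R (tenv (xs @ ps)) \<psi>" if len: "length xs = n" for xs
  proof -
    let ?e = "tenv (xs @ ps)"
    have val: "?e i = (xs @ ps) ! i" if "i < n + length ps" for i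
      using that len by (simp add: tenv_def)
    have "sat F R ?e \<psi> \<longleftrightarrow> sat F R (asg \<tau> ?e) \<phi>"
      unfolding 2(2)[rule_format]
    proof (rule sat_cong)
      fix k assume k: "k \<in> fv \<phi>"
      show "?e (h k) = asg \<tau> ?e k"
      proof (cases "\<tau> k")
        case (Inl j) then show ?thesis by (simp add: h_def asg_def)
      next
        case (Inr c)
        then have "k \<in> set cs" using k cs by auto
        from pos[OF this] have "pos k < length ps" "ps ! pos k = projr (\<tau> k)" by (auto simp: ps_def)
        then show ?thesis using Inr len val[of "n + pos k"] by (simp add: h_def asg_def nth_append)
      qed
    qed
    also have "\<dots> \<longleftrightarrow> blk ?e 0 n \<in> X" using 1(2) by simp
    also have "blk ?e 0 n = xs" using len val by (intro nth_equalityI) (auto simp: nth_append)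
    finally show ?thesis by simp
  qed
  then have "X = {xs. length xs = n \<and> sat F R (tenv (xs @ ps)) \<psi>}" using assms(2) by blast
  then show ?thesis unfolding definable_over_def using ps by blast
qed

lemma D_exs:
  fixes Q :: "(nat \<Rightarrow> 'a) \<Rightarrow> bool"
  shows "D F R C Q \<Longrightarrow> D F R C (\<lambda>e. \<exists>xs. length xs = n \<and> Q (upds e a xs))"
proof (induction n arbitrary: Q)
  case 0
  have "upds e a [] = e" for e :: "nat \<Rightarrow> 'a" by (rule ext) (auto simp: upds_def)
  then show ?case using 0 by simp
next
  case (Suc n)
  have "D F R C (\<lambda>e. \<exists>xs. length xs = n \<and> (\<exists>b. Q ((upds e a xs)(a + n := b))))"
    by (rule Suc.IH[OF D_ex[OF Suc.prems, of "a+n"]])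
  moreover have "(\<exists>xs. length xs = n \<and> (\<exists>b. Q ((upds e a xs)(a + n := b)))) \<longleftrightarrow>
     (\<exists>xs. length xs = Suc n \<and> Q (upds e a xs))" for e
  proof -
    have eq: "upds e a (xs @ [b]) = (upds e a xs)(a + n := b)" if "length xs = n" for xs b
      using that by (intro ext) (auto simp: upds_def nth_append)
    show ?thesis
    proof
      assume "\<exists>xs. length xs = n \<and> (\<exists>b. Q ((upds e a xs)(a + n := b)))"
      then show "\<exists>xs. length xs = Suc n \<and> Q (upds e a xs)"
        using eq by (metis length_append_singleton)
    next
      assume "\<exists>xs. length xs = Suc n \<and> Q (upds e a xs)"
      then obtain xs where "length xs = Suc n" "Q (upds e a xs)" by blast
      then show "\<exists>xs. length xs = n \<and> (\<exists>b. Q ((upds e a xs)(a + n := b)))"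
        using eq[of "butlast xs" "last xs"] append_butlast_last_id[of xs]
        by (intro exI[of _ "butlast xs"]) fastforce
    qed
  qed
  ultimately show ?case by simp
qed

lemma D_alls: "D F R C Q \<Longrightarrow> D F R C (\<lambda>e. \<forall>xs. length xs = n \<longrightarrow> Q (upds e a xs))"
  using D_not[OF D_exs[OF D_not, of F R C Q n a]] by simp

lemma D_updc:
  assumes "D F R C Q" "set cs \<subseteq> C" shows "D F R C (\<lambda>e. Q (upds e a cs))"
proof -
  let ?f = "\<lambda>k. if a \<le> k \<and> k < a + length cs then Some (cs ! (k - a)) else None"
  have "(\<lambda>k. case ?f k of Some c \<Rightarrow> c | None \<Rightarrow> e k) = upds e a cs" for e
    by (auto simp: upds_def)
  moreover have "c \<in> C" if "?f k = Some c" for k c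
    using that assms(2) by (auto split: if_splits)
  ultimately show ?thesis
    using D_const[OF assms(1), of ?f "\<lambda>k. k"] by simp
qed

subsection \<open>Passing to the expansion\<close>

lemma sat_expR: "sat F (expR R P) e (map_fm (\<lambda>x. x) Some \<phi>) = sat F R e \<phi>"
  by (induction \<phi> arbitrary: e) (auto simp: trm.map_ident expR_def comp_def)

lemma fv_map_fm: "fv (map_fm (\<lambda>x. x) g \<phi>) = fv \<phi>"
  by (induction \<phi>) (auto simp: trm.map_ident)

lemma D_expR: "D F R C Q \<Longrightarrow> D F (expR R P) C Q"
proof -
  assume "D F R C Q"
  then obtain \<phi> \<tau> where "\<And>k c. k \<in> fv \<phi> \<Longrightarrow> \<tau> k = Inr c \<Longrightarrow> c \<in> C"
    "\<And>e. Q e \<longleftrightarrow> sat F R (asg \<tau> e) \<phi>"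
    using D_E by blast
  then show ?thesis
    by (intro D_I[of "map_fm (\<lambda>x. x) Some \<phi>" \<tau>]) (simp_all add: sat_expR fv_map_fm)
qed

lemma D_P: "D F (expR R P) C (\<lambda>e. e i \<in> P)"
  by (rule D_I[of "Rel None [Var i]" "Inl"]) (auto simp: asg_def expR_def)

section \<open>Ultrafilters\<close>

definition ultra :: "'i filter \<Rightarrow> bool" where
  "ultra U \<longleftrightarrow> U \<noteq> bot \<and> (\<forall>Q. eventually Q U \<or> eventually (\<lambda>x. \<not> Q x) U)"

lemma ultra_not: "ultra U \<Longrightarrow> eventually (\<lambda>x. \<not> Q x) U \<longleftrightarrow> \<not> eventually Q U"
proof
  assume "ultra U" "eventually (\<lambda>x. \<not> Q x) U"
  then have "eventually (\<lambda>x. \<not> Q x \<and> Q x) U" if "eventually Q U"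
    using that by (intro eventually_conj)
  then show "\<not> eventually Q U" using \<open>ultra U\<close> by (auto simp: ultra_def trivial_limit_def)
next
  assume "ultra U" "\<not> eventually Q U"
  then show "eventually (\<lambda>x. \<not> Q x) U" by (auto simp: ultra_def)
qed

lemma ultra_disj: "ultra U \<Longrightarrow> eventually (\<lambda>x. Q x \<or> S x) U \<longleftrightarrow> eventually Q U \<or> eventually S U"
  using ultra_not[of U Q] ultra_not[of U S] ultra_not[of U "\<lambda>x. Q x \<or> S x"]
  by (auto simp: eventually_conj_iff)

lemma ultra_Bex:
  assumes "ultra U" "finite A"
  shows "eventually (\<lambda>x. \<exists>a\<in>A. Q a x) U \<longleftrightarrow> (\<exists>a\<in>A. eventually (Q a) U)"
  using assms(2)
proof (induction A rule: finite_induct)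
  case empty
  then show ?case using assms(1) by (simp add: ultra_def eventually_False)
next
  case (insert a A)
  then show ?case using ultra_disj[OF assms(1)] by simp
qed

lemma ultra_ex: "ultra U \<Longrightarrow> eventually Q U \<Longrightarrow> \<exists>x. Q x"
  unfolding ultra_def by (metis eventually_happens')

lemma ultra_const: "ultra U \<Longrightarrow> eventually (\<lambda>_. b) U \<longleftrightarrow> b"
  by (cases b) (auto simp: ultra_def eventually_False)

lemma ultra_filtermap: "ultra U \<Longrightarrow> ultra (filtermap g U)"
  by (auto simp: ultra_def eventually_filtermap filtermap_bot_iff)

lemma ultra_principal: "ultra (principal {x})"
  by (auto simp: ultra_def eventually_principal principal_eq_bot_iff)

text \<open>The working form of compactness: a directed family of satisfiable predicates has the
  finite intersection property, and by Zorn a maximal family of sets with this property is an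
  ultrafilter.\<close>

lemma ultra_from_base:
  fixes B :: "('i \<Rightarrow> bool) set"
  assumes "B \<noteq> {}" "\<And>Q S. Q \<in> B \<Longrightarrow> S \<in> B \<Longrightarrow> \<exists>T\<in>B. \<forall>x. T x \<longrightarrow> Q x \<and> S x"
    "\<And>Q. Q \<in> B \<Longrightarrow> \<exists>x. Q x"
  shows "\<exists>U. ultra U \<and> (\<forall>Q\<in>B. eventually Q U)"
proof -
  define fip where "fip C \<longleftrightarrow> (\<forall>X. finite X \<and> X \<subseteq> C \<longrightarrow> \<Inter>X \<noteq> {})" for C :: "'i set set"
  define B' where "B' = Collect ` B"
  define A where "A = {C. B' \<subseteq> C \<and> fip C}"
  have "fip B'" unfolding fip_def
  proof (intro allI impI)
    fix X assume X: "finite X \<and> X \<subseteq> B'"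
    then have "finite X" "X \<subseteq> B'" by auto
    then have "\<exists>T\<in>B. Collect T \<subseteq> \<Inter>X"
    proof (induction X rule: finite_induct)
      case empty then show ?case using assms(1) by auto
    next
      case (insert Y X)
      then obtain T where T: "T \<in> B" "Collect T \<subseteq> \<Inter>X" by auto
      obtain Q where Q: "Q \<in> B" "Y = Collect Q" using insert by (auto simp: B'_def)
      obtain T' where "T' \<in> B" "\<forall>x. T' x \<longrightarrow> Q x \<and> T x" using assms(2) Q(1) T(1) by blast
      then show ?case using Q(2) T(2) by (intro bexI[of _ T']) auto
    qed
    then show "\<Inter>X \<noteq> {}" using assms(3) by fastforce
  qed
  then have "A \<noteq> {}" unfolding A_def by blast
  moreover have "\<Union>C \<in> A" if C: "C \<noteq> {}" "subset.chain A C" for C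
  proof -
    have CA: "C \<subseteq> A" using C(2) by (simp add: subset.chain_def)
    have "B' \<subseteq> \<Union>C" using C(1) CA unfolding A_def by blast
    moreover have "fip (\<Union>C)" unfolding fip_def
    proof (intro allI impI)
      fix X assume X: "finite X \<and> X \<subseteq> \<Union>C"
      then obtain Y where "Y \<in> C" "X \<subseteq> Y"
        using finite_subset_Union_chain[of X C A] C by blast
      then show "\<Inter>X \<noteq> {}" using CA X unfolding A_def fip_def by blast
    qed
    ultimately show ?thesis unfolding A_def by blast
  qed
  ultimately obtain M where M: "M \<in> A" "\<And>X. X \<in> A \<Longrightarrow> M \<subseteq> X \<Longrightarrow> X = M"
    using subset_Zorn_nonempty[of A] by metis
  have fM: "fip M" and BM: "B' \<subseteq> M" using M(1) by (auto simp: A_def)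
  \<comment> \<open>Maximality in use: a set that meets every finite intersection from
    \<open>M\<close> can be added to \<open>M\<close> without losing the finite intersection
    property.\<close>
  have mem: "Y \<in> M" if "\<And>X. finite X \<Longrightarrow> X \<subseteq> M \<Longrightarrow> \<Inter>X \<inter> Y \<noteq> {}" for Y
  proof -
    have "fip (insert Y M)" unfolding fip_def
    proof (intro allI impI)
      fix X assume X: "finite X \<and> X \<subseteq> insert Y M"
      have "\<Inter>(X - {Y}) \<inter> Y \<noteq> {}" using X by (intro that) auto
      then show "\<Inter>X \<noteq> {}" by blast
    qed
    then have "insert Y M \<in> A" using BM by (auto simp: A_def)
    then have "insert Y M = M" using M(2) by blast
    then show ?thesis by blast
  qed
  have sup: "Y \<in> M" if "finite X" "X \<subseteq> M" "\<Inter>X \<subseteq> Y" for X Y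
  proof (rule mem)
    fix Z assume "finite Z" "Z \<subseteq> M"
    then have "\<Inter>(Z \<union> X) \<noteq> {}" using fM that(1,2) unfolding fip_def by (metis Un_least finite_UnI)
    then show "\<Inter>Z \<inter> Y \<noteq> {}" using that(3) by blast
  qed
  have flt: "is_filter (\<lambda>Q. Collect Q \<in> M)"
  proof
    show "Collect (\<lambda>x. True) \<in> M" by (rule sup[of "{}"]) auto
    show "Collect (\<lambda>x. P x \<and> Q x) \<in> M" if "Collect P \<in> M" "Collect Q \<in> M" for P Q
      by (rule sup[of "{Collect P, Collect Q}"]) (use that in auto)
    show "Collect Q \<in> M" if "\<forall>x. P x \<longrightarrow> Q x" "Collect P \<in> M" for P Q
      by (rule sup[of "{Collect P}"]) (use that in auto)
  qed
  define U where "U = Abs_filter (\<lambda>Q. Collect Q \<in> M)"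
  have ev: "eventually Q U \<longleftrightarrow> Collect Q \<in> M" for Q
    unfolding U_def by (rule eventually_Abs_filter[OF flt])
  have "{} \<notin> M" using fM[unfolded fip_def, rule_format, of "{{}}"] by auto
  then have "U \<noteq> bot" using ev[of "\<lambda>_. False"] by (auto simp: trivial_limit_def)
  moreover have "eventually Q U \<or> eventually (\<lambda>x. \<not> Q x) U" for Q
  proof (rule ccontr)
    assume "\<not> ?thesis"
    then have n: "Collect Q \<notin> M" "Collect (\<lambda>x. \<not> Q x) \<notin> M" using ev by auto
    obtain X where X: "finite X" "X \<subseteq> M" "\<Inter>X \<inter> Collect Q = {}" using n(1) mem[of "Collect Q"] by auto
    then have "\<Inter>X \<subseteq> Collect (\<lambda>x. \<not> Q x)" by blast
    then show False using sup X n(2) by blast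
  qed
  moreover have "eventually Q U" if "Q \<in> B" for Q using ev BM that by (auto simp: B'_def)
  ultimately show ?thesis unfolding ultra_def by blast
qed

lemma ultra_free:
  assumes "infinite A"
  shows "\<exists>U. ultra U \<and> eventually (\<lambda>x. x \<in> A) U \<and> (\<forall>T. finite T \<longrightarrow> eventually (\<lambda>x. x \<notin> T) U)"
proof -
  define B where "B = {\<lambda>x. x \<in> A \<and> x \<notin> T | T. finite T}"
  have "\<exists>U. ultra U \<and> (\<forall>Q\<in>B. eventually Q U)"
  proof (rule ultra_from_base)
    show "B \<noteq> {}" unfolding B_def by blast
    show "\<exists>T\<in>B. \<forall>x. T x \<longrightarrow> Q x \<and> S x" if QS: "Q \<in> B" "S \<in> B" for Q S
    proof -
      obtain T1 T2 where "finite T1" "finite T2" "Q = (\<lambda>x. x \<in> A \<and> x \<notin> T1)" "S = (\<lambda>x. x \<in> A \<and> x \<notin> T2)"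
        using QS by (auto simp: B_def)
      moreover from this have "(\<lambda>x. x \<in> A \<and> x \<notin> T1 \<union> T2) \<in> B"
        unfolding B_def by (intro CollectI exI[of _ "T1 \<union> T2"]) simp
      ultimately show ?thesis by (intro bexI[of _ "\<lambda>x. x \<in> A \<and> x \<notin> T1 \<union> T2"]) auto
    qed
    show "\<exists>x. Q x" if QB: "Q \<in> B" for Q
    proof -
      obtain T where T: "finite T" "Q = (\<lambda>x. x \<in> A \<and> x \<notin> T)" using QB by (auto simp: B_def)
      have "A - T \<noteq> {}" using Diff_infinite_finite[OF T(1) assms] by force
      then show ?thesis using T(2) by blast
    qed
  qed
  then obtain U where U: "ultra U" "\<And>Q. Q \<in> B \<Longrightarrow> eventually Q U" by blast
  have "eventually (\<lambda>x. x \<in> A \<and> x \<notin> T) U" if "finite T" for T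
    by (rule U(2)) (use that in \<open>auto simp: B_def\<close>)
  then show ?thesis using U(1) by (intro exI[of _ U]) (auto simp: eventually_conj_iff)
qed

text \<open>The iterated product: a first component following \<open>V\<close>, then a second one
  following the ultrafilter attached to it. Every function of the first component is constant in the
  inner step, which is what makes the second component independent of the first.\<close>

definition ubind :: "'i filter \<Rightarrow> ('i \<Rightarrow> 'j filter) \<Rightarrow> ('i \<times> 'j) filter" where
  "ubind V U = Abs_filter (\<lambda>Q. eventually (\<lambda>i. eventually (\<lambda>j. Q (i, j)) (U i)) V)"

lemma eventually_ubind:
  "eventually Q (ubind V U) \<longleftrightarrow> eventually (\<lambda>i. eventually (\<lambda>j. Q (i, j)) (U i)) V"
proof -
  have "is_filter (\<lambda>Q. eventually (\<lambda>i. eventually (\<lambda>j. Q (i, j)) (U i)) V)"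
  proof
    show "eventually (\<lambda>i. eventually (\<lambda>j. P (i, j) \<and> Q (i, j)) (U i)) V"
      if "eventually (\<lambda>i. eventually (\<lambda>j. P (i, j)) (U i)) V" "eventually (\<lambda>i. eventually (\<lambda>j. Q (i, j)) (U i)) V"
      for P Q using that by (simp add: eventually_conj_iff)
    show "eventually (\<lambda>i. eventually (\<lambda>j. Q (i, j)) (U i)) V"
      if "\<forall>x. P x \<longrightarrow> Q x" "eventually (\<lambda>i. eventually (\<lambda>j. P (i, j)) (U i)) V" for P Q
      using that(2) by (rule eventually_mono) (use that(1) in \<open>auto elim: eventually_mono\<close>)
  qed simp
  then show ?thesis unfolding ubind_def by (rule eventually_Abs_filter)
qed

lemma ultra_ubind: assumes "ultra V" "\<And>i. ultra (U i)" shows "ultra (ubind V U)"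
proof -
  have "eventually Q (ubind V U) \<or> eventually (\<lambda>x. \<not> Q x) (ubind V U)" for Q
    using assms by (simp add: eventually_ubind ultra_not)
  moreover have "ubind V U \<noteq> bot"
    using assms by (simp add: trivial_limit_def eventually_ubind ultra_const)
  ultimately show ?thesis by (simp add: ultra_def)
qed

section \<open>Exchange in o-minimal structures\<close>

text \<open>Density of the order and nontriviality are stated apart from o-minimality: in the final
  theorem the former comes from the density of \<open>P\<close>, and the one-point universe is
  treated on its own.\<close>

locale omin =
  fixes F :: "'f \<Rightarrow> 'a::linordered_ab_group_add list \<Rightarrow> 'a" and R :: "'r \<Rightarrow> 'a list \<Rightarrow> bool"
  assumes expands: "expands_ordered_group F R" and omin: "o_minimal F R"
    and dens: "\<And>a b::'a. a < b \<Longrightarrow> \<exists>c. a < c \<and> c < b"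
    and nontriv: "\<exists>a::'a. a \<noteq> 0"
begin

abbreviation DL :: "((nat \<Rightarrow> 'a) \<Rightarrow> bool) \<Rightarrow> bool" where "DL \<equiv> D F R UNIV"

lemma ex_pos: "\<exists>p::'a. p > 0"
  using nontriv by (metis neg_0_less_iff_less linorder_neqE)

lemma ex_greater: "\<exists>y::'a. x < y"
  using ex_pos less_add_same_cancel1 by blast

lemma ex_less: "\<exists>y::'a. y < x"
proof -
  obtain p :: 'a where "p > 0" using ex_pos by blast
  then have "x - p < x" by simp
  then show ?thesis by blast
qed

lemma infinite_interval: "a < b \<Longrightarrow> infinite {x::'a. a < x \<and> x < b}"
proof
  assume ab: "a < b" and fin: "finite {x. a < x \<and> x < b}"
  have "{x. a < x \<and> x < b} \<noteq> {}" using dens[OF ab] by blast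
  then have m: "Max {x. a < x \<and> x < b} \<in> {x. a < x \<and> x < b}" using fin Max_in by blast
  then obtain c where c: "Max {x. a < x \<and> x < b} < c" "c < b" using dens by blast
  then have "c \<in> {x. a < x \<and> x < b}" using m by auto
  then show False using c(1) Max_ge[OF fin] by (simp add: leD)
qed

lemma ex_half: "(e::'a) > 0 \<Longrightarrow> \<exists>d>0. d + d < e"
proof -
  assume "e > 0"
  then obtain a where a: "0 < a" "a < e" using dens by blast
  then have "0 < min a (e - a)" by simp
  then obtain d where d: "0 < d" "d < min a (e - a)" using dens by blast
  then have "d + d < a + (e - a)" by (intro add_strict_mono) auto
  then show ?thesis using d(1) by auto
qed

lemma D_less: "D F R C (\<lambda>e. e i < e j)"
proof -
  obtain r where r: "\<And>x y. R r [x, y] \<longleftrightarrow> x < y" using expands unfolding expands_ordered_group_def by blast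
  show ?thesis
    by (rule D_I[of "Rel r [Var 0, Var 1]" "\<lambda>k. if k = 0 then Inl i else Inl j"])
      (auto simp: asg_def r split: if_splits)
qed

lemma D_plus: "D F R C (\<lambda>e. e i + e j = e k)"
proof -
  obtain f where f: "\<And>x y. F f [x, y] = x + y" using expands unfolding expands_ordered_group_def by blast
  show ?thesis
    by (rule D_I[of "Eq (Fn f [Var 0, Var 1]) (Var 2)"
          "\<lambda>n. if n = 0 then Inl i else if n = 1 then Inl j else Inl k"])
      (auto simp: asg_def f split: if_splits)
qed

lemma D_zero: "D F R C (\<lambda>e. e i = 0)"
  using D_plus[of C i i i] by simp

lemma omin_set:
  assumes "DL (\<lambda>e. q (e 0))"
  shows "\<exists>\<I>. finite \<I> \<and> (\<forall>I\<in>\<I>. interval_or_point I) \<and> {x. q x} = \<Union>\<I>"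
proof -
  have "definable_over F R UNIV 1 {[x] | x. q x}"
    by (rule D_imp_definable) (use assms in auto)
  from omin[unfolded o_minimal_def definable_def, rule_format, OF this]
  obtain \<I> where "finite \<I>" "\<forall>I\<in>\<I>. interval_or_point I" "{[x] | x. q x} = {[x] | x. x \<in> \<Union>\<I>}"
    by (elim exE conjE)
  moreover from this(3) have "{x. q x} = \<Union>\<I>" by (auto simp: set_eq_iff)
  ultimately show ?thesis by blast
qed

lemma infinite_imp_interval:
  assumes "DL (\<lambda>e. q (e 0))" "infinite {x. q x}"
  shows "\<exists>u v. u < v \<and> (\<forall>x. u < x \<and> x < v \<longrightarrow> q x)"
proof -
  obtain \<I> where I: "finite \<I>" "\<forall>I\<in>\<I>. interval_or_point I" "{x. q x} = \<Union>\<I>"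
    using omin_set[OF assms(1)] by blast
  then obtain I where "I \<in> \<I>" "infinite I" using assms(2) finite_Union[of \<I>] by metis
  then have ip: "interval_or_point I" and sub: "\<And>x. x \<in> I \<Longrightarrow> q x" using I by auto
  from ip consider a where "I = {a}" | a b where "I = {x. a < x \<and> x < b}" | a where "I = {x. a < x}"
    | b where "I = {x. x < b}" | "I = UNIV" unfolding interval_or_point_def by blast
  then show ?thesis
  proof cases
    case 1 then show ?thesis using \<open>infinite I\<close> by simp
  next
    case (2 a b)
    then have "a < b" using \<open>infinite I\<close> by (metis (mono_tags, lifting) Collect_empty_eq finite.emptyI less_trans)
    then show ?thesis using sub 2 by blast
  next
    case (3 a) then show ?thesis using ex_greater[of a] sub by blast
  next
    case (4 b) then show ?thesis using ex_less[of b] sub by blast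
  next
    case 5 then show ?thesis using ex_pos sub by blast
  qed
qed

text \<open>The order need not be complete. The infimum is the least of the left ends of the
  finitely many intervals and points that make up the set.\<close>

lemma infimum_exists:
  assumes "DL (\<lambda>e. q (e 0))" "q x0" "\<And>x. q x \<Longrightarrow> b \<le> x"
  shows "\<exists>m. (\<forall>x. q x \<longrightarrow> m \<le> x) \<and> (\<forall>m'>m. \<exists>x<m'. q x)"
proof -
  obtain \<I> where I: "finite \<I>" "\<forall>I\<in>\<I>. interval_or_point I" "{x. q x} = \<Union>\<I>"
    using omin_set[OF assms(1)] by blast
  have one: "\<exists>m. (\<forall>x\<in>I. m \<le> x) \<and> (\<forall>m'>m. \<exists>x<m'. x \<in> I)"
    if ip: "interval_or_point I" and "I \<noteq> {}" and b: "\<And>x. x \<in> I \<Longrightarrow> b \<le> x" for I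
  proof -
    from ip consider a where "I = {a}" | a c where "I = {x. a < x \<and> x < c}" | a where "I = {x. a < x}"
      | c where "I = {x. x < c}" | "I = UNIV" unfolding interval_or_point_def by blast
    then show ?thesis
    proof cases
      case (1 a) then show ?thesis by auto
    next
      case (2 a c)
      then have "a < c" using \<open>I \<noteq> {}\<close> by auto
      have "\<exists>x<m'. x \<in> I" if "a < m'" for m'
      proof -
        have "a < min m' c" using that \<open>a < c\<close> by simp
        then obtain x where "a < x" "x < min m' c" using dens by blast
        then show ?thesis using 2 by auto
      qed
      then show ?thesis using 2 by (intro exI[of _ a]) auto
    next
      case (3 a)
      then show ?thesis using dens by (intro exI[of _ a]) auto
    next
      case (4 c)
      obtain y where "y < min b c" using ex_less by blast
      then show ?thesis using b[of y] 4 by auto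
    next
      case 5
      then show ?thesis using b ex_less[of b] by (metis UNIV_I leD)
    qed
  qed
  define \<J> where "\<J> = {I \<in> \<I>. I \<noteq> {}}"
  have "\<exists>m. (\<forall>x\<in>I. m \<le> x) \<and> (\<forall>m'>m. \<exists>x<m'. x \<in> I)" if "I \<in> \<J>" for I
    by (rule one) (use that I assms(3) in \<open>auto simp: \<J>_def\<close>)
  then obtain g where g: "\<And>I x. I \<in> \<J> \<Longrightarrow> x \<in> I \<Longrightarrow> g I \<le> x"
    "\<And>I m'. I \<in> \<J> \<Longrightarrow> m' > g I \<Longrightarrow> \<exists>x<m'. x \<in> I" by metis
  have J: "finite \<J>" "{x. q x} = \<Union>\<J>" using I by (auto simp: \<J>_def)
  then have ne: "g ` \<J> \<noteq> {}" "finite (g ` \<J>)" using assms(2) by auto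
  define m where "m = Min (g ` \<J>)"
  have "m \<le> x" if "q x" for x
  proof -
    obtain I where "I \<in> \<J>" "x \<in> I" using J(2) \<open>q x\<close> by auto
    then have "m \<le> g I" "g I \<le> x" using ne g(1) by (auto simp: m_def)
    then show ?thesis by simp
  qed
  moreover have "\<exists>x<m'. q x" if "m' > m" for m'
  proof -
    have "m \<in> g ` \<J>" unfolding m_def using ne by (rule_tac Min_in) auto
    then obtain I where "I \<in> \<J>" "m = g I" by blast
    then show ?thesis using g(2)[of I m'] that J(2) by auto
  qed
  ultimately show ?thesis by blast
qed

lemma D2_var: "DL (\<lambda>e. q (e 0) (e 1)) \<Longrightarrow> DL (\<lambda>e. q (e i) (e j))"
  using D_var[of F R UNIV "\<lambda>e. q (e 0) (e 1)" "\<lambda>k. if k = 0 then i else j"] by simp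

lemma D_lec: "DL (\<lambda>e. e i < c)" "DL (\<lambda>e. c < e i)"
proof -
  have "DL (\<lambda>e. (e(Suc i := c)) i < (e(Suc i := c)) (Suc i))"
    "DL (\<lambda>e. (e(Suc i := c)) (Suc i) < (e(Suc i := c)) i)"
    by (rule D_upd1[OF D_less UNIV_I])+
  then show "DL (\<lambda>e. e i < c)" "DL (\<lambda>e. c < e i)" by simp_all
qed

lemma D_addc: "DL (\<lambda>e. e i < e j + c)"
proof -
  have "DL (\<lambda>e. \<exists>a. (\<lambda>e. (e(i + j + 2 := c)) j + (e(i + j + 2 := c)) (i + j + 2) = (e(i + j + 2 := c)) (i + j + 1) \<and> e i < e (i + j + 1)) (e(i + j + 1 := a)))"
    by (intro D_ex D_conj D_less D_upd1[OF D_plus UNIV_I])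
  then show ?thesis by simp
qed

lemma D_addv: "i \<noteq> j \<Longrightarrow> i \<noteq> k \<Longrightarrow> j \<noteq> k \<Longrightarrow> DL (\<lambda>e. e i < e j + e k)"
proof -
  assume "i \<noteq> j" "i \<noteq> k" "j \<noteq> k"
  have "DL (\<lambda>e. \<exists>a. (\<lambda>e. e j + e k = e (i + j + k + 1) \<and> e i < e (i + j + k + 1)) (e(i + j + k + 1 := a)))"
    by (intro D_ex D_conj D_less D_plus)
  then show ?thesis by simp
qed

text \<open>The points that are maximal in some member of the family form a cofinal, hence infinite,
  definable set; on an interval of such points the members grow with their maxima, so that one of
  them contains an interval.\<close>

lemma no_finite_exhaustion:
  assumes q: "DL (\<lambda>e. q (e 0) (e 1))"
    and fin: "\<And>t. finite {x. q t x}"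
    and chain: "\<And>t t'. {x. q t x} \<subseteq> {x. q t' x} \<or> {x. q t' x} \<subseteq> {x. q t x}"
    and uv: "u < v" and cover: "\<And>x. u < x \<Longrightarrow> x < v \<Longrightarrow> \<exists>t. q t x"
  shows False
proof -
  define m where "m x \<longleftrightarrow> x < v \<and> (\<exists>t. q t x \<and> (\<forall>y. x < y \<and> y < v \<longrightarrow> \<not> q t y))" for x
  have "DL (\<lambda>e. e 0 < v \<and> (\<exists>t. (\<lambda>e. q (e 1) (e 0) \<and> (\<forall>y. (\<lambda>e. e 0 < e 2 \<and> e 2 < v \<longrightarrow> \<not> q (e 1) (e 2)) (e(2:=y)))) (e(1:=t))))"
    by (intro D_conj D_lec D_ex D_all D_imp D_less D_not D2_var[OF q])
  then have mD: "DL (\<lambda>e. m (e 0))" by (simp add: m_def)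
  have cof: "\<exists>y. w \<le> y \<and> m y" if "u < w" "w < v" for w
  proof -
    obtain t where t: "q t w" using cover \<open>u < w\<close> \<open>w < v\<close> by blast
    let ?S = "{x. q t x \<and> x < v}"
    have S: "finite ?S" "w \<in> ?S" using fin[of t] t \<open>w < v\<close> by auto
    then have M: "Max ?S \<in> ?S" using Max_in by blast
    have "\<not> q t y" if "Max ?S < y" "y < v" for y
      using Max_ge[OF S(1), of y] that by auto
    then have "m (Max ?S)" using M unfolding m_def by blast
    then show ?thesis using Max_ge[OF S(1,2)] by blast
  qed
  have "infinite {x. m x}"
  proof
    assume f: "finite {x. m x}"
    obtain w0 where w0: "u < w0" "w0 < v" using dens[OF uv] by blast
    then obtain y0 where y0: "w0 \<le> y0" "m y0" using cof by blast
    have "Max {x. m x} \<in> {x. m x}" using f y0 Max_in by blast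
    then have mx: "Max {x. m x} < v" by (simp add: m_def)
    have "u < Max {x. m x}" using Max_ge[OF f, of y0] y0 w0 by auto
    moreover obtain w where "Max {x. m x} < w" "w < v" using dens[OF mx] by blast
    ultimately obtain y where "w \<le> y" "m y" using cof[of w] less_trans by blast
    then show False using Max_ge[OF f, of y] \<open>Max {x. m x} < w\<close> by auto
  qed
  then obtain a b where ab: "a < b" "\<And>x. a < x \<Longrightarrow> x < b \<Longrightarrow> m x"
    using infinite_imp_interval[OF mD] by blast
  obtain y where y: "a < y" "y < b" using dens[OF ab(1)] by blast
  obtain s where s: "q s y" "y < v" using ab(2)[OF y] unfolding m_def by blast
  have "q s x" if x: "a < x" "x < y" for x
  proof -
    have "m x" using ab(2) x y by auto
    then obtain t where t: "q t x" "\<And>z. x < z \<Longrightarrow> z < v \<Longrightarrow> \<not> q t z" unfolding m_def by blast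
    then have "\<not> q t y" using x(2) s(2) by blast
    then show ?thesis using chain[of t s] s(1) t(1) by blast
  qed
  then have "{x. a < x \<and> x < y} \<subseteq> {x. q s x}" by blast
  then show False using infinite_interval[OF y(1)] fin[of s] finite_subset by blast
qed

text \<open>Being infinite is a first-order condition here: by o-minimality it means containing an
  interval. The ends of that interval are quantified in two slots \<open>x\<close> and
  \<open>y\<close> on which \<open>Q\<close> does not depend.\<close>

lemma D_infinite:
  assumes "D F R C Q"
  shows "D F R C (\<lambda>e. infinite {a. Q (e(j := a))})"
proof -
  obtain K where K: "finite K" "dep K Q" using D_dep[OF assms] by blast
  obtain x where x: "x \<notin> insert j K" using ex_fresh K(1) by (metis finite_insert)
  obtain y where y: "y \<notin> insert x (insert j K)" using ex_fresh K(1) by (metis finite_insert)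
  have eq: "Q (e(x := u, y := v, j := a)) = Q (e(j := a))" for e u v a
    by (rule depD[OF K(2)]) (use x y in auto)
  have *: "infinite {a. Q (e(j := a))} \<longleftrightarrow> (\<exists>u v. u < v \<and> (\<forall>a. u < a \<and> a < v \<longrightarrow> Q (e(j := a))))" for e
  proof
    assume inf: "infinite {a. Q (e(j := a))}"
    have "DL (\<lambda>e'. Q (\<lambda>k. case (if k = j then None else Some (e k)) of Some c \<Rightarrow> c | None \<Rightarrow> e' ((\<lambda>_. 0) k)))"
      by (rule D_const[OF D_mono[OF assms]]) auto
    moreover have "(\<lambda>k. case (if k = j then None else Some (e k)) of Some c \<Rightarrow> c | None \<Rightarrow> e' 0) = e(j := e' 0)" for e' :: "nat \<Rightarrow> 'a"
      by auto
    ultimately have "DL (\<lambda>e'. Q (e(j := e' 0)))" by simp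
    then show "\<exists>u v. u < v \<and> (\<forall>a. u < a \<and> a < v \<longrightarrow> Q (e(j := a)))"
      using infinite_imp_interval[of "\<lambda>a. Q (e(j := a))"] inf by blast
  next
    assume "\<exists>u v. u < v \<and> (\<forall>a. u < a \<and> a < v \<longrightarrow> Q (e(j := a)))"
    then obtain u v where uv: "u < v" "\<forall>a. u < a \<and> a < v \<longrightarrow> Q (e(j := a))" by blast
    then have "{a. u < a \<and> a < v} \<subseteq> {a. Q (e(j := a))}" by blast
    then show "infinite {a. Q (e(j := a))}" using infinite_interval[OF uv(1)] finite_subset by blast
  qed
  have "D F R C (\<lambda>e. \<exists>u. (\<lambda>e. \<exists>v. (\<lambda>e. e x < e y \<and> (\<forall>a. (\<lambda>e. e x < e j \<and> e j < e y \<longrightarrow> Q e) (e(j := a)))) (e(y := v))) (e(x := u)))"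
    by (intro D_ex D_conj D_all D_imp D_less assms)
  moreover have "(\<exists>u. (\<lambda>e. \<exists>v. (\<lambda>e. e x < e y \<and> (\<forall>a. (\<lambda>e. e x < e j \<and> e j < e y \<longrightarrow> Q e) (e(j := a)))) (e(y := v))) (e(x := u))) \<longleftrightarrow> infinite {a. Q (e(j := a))}" for e
    unfolding * using x y by (auto simp: eq)
  ultimately show ?thesis by simp
qed

lemma D_infinite2: "DL (\<lambda>e. q (e 0) (e 1)) \<Longrightarrow> i \<noteq> Suc i \<Longrightarrow> DL (\<lambda>e. infinite {a. q (e i) a})"
  "DL (\<lambda>e. q (e 0) (e 1)) \<Longrightarrow> DL (\<lambda>e. infinite {a. q a (e i)})"
proof -
  assume q: "DL (\<lambda>e. q (e 0) (e 1))"
  show "DL (\<lambda>e. infinite {a. q (e i) a})"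
    using D_infinite[OF D2_var[OF q, of i "Suc i"], of "Suc i"] by simp
  show "DL (\<lambda>e. infinite {a. q a (e i)})"
    using D_infinite[OF D2_var[OF q, of "Suc i" i], of "Suc i"] by simp
qed

text \<open>The infinite fibres contain intervals. Two exhaustion arguments yield infinitely many
  \<open>x\<close> whose fibres contain intervals of one length \<open>\<epsilon>\<close> with left
  ends in one bounded range. At the infimum of the critical left ends infinitely many of these
  intervals share a point, and the column of that point is infinite, against
  \<open>col\<close>.\<close>

lemma planar_core:
  assumes q: "DL (\<lambda>e. q (e 0) (e 1))"
    and col: "\<And>y. finite {x. q x y}"
    and inf: "infinite {x. infinite {y. q x y}}"
  shows False
proof -
  obtain u v where uv: "u < v" "\<And>x. u < x \<Longrightarrow> x < v \<Longrightarrow> infinite {y. q x y}"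
    using infinite_imp_interval[OF D_infinite2(1)[OF q, of 0]] inf by auto
  define w where "w t x \<longleftrightarrow> (\<exists>a. \<forall>y. a < y \<and> y < a + t \<longrightarrow> q x y)" for t x
  have "DL (\<lambda>e. 0 < e 0 \<and> u < e 1 \<and> e 1 < v \<and> (\<exists>a. (\<lambda>e. \<forall>y. (\<lambda>e. e 2 < e 3 \<and> e 3 < e 2 + e 0 \<longrightarrow> q (e 1) (e 3)) (e(3:=y))) (e(2:=a))))"
    by (intro D_ex D_conj D_all D_imp D_less D_lec D_addv D2_var[OF q]) auto
  then have wD: "DL (\<lambda>e. 0 < e 0 \<and> u < e 1 \<and> e 1 < v \<and> w (e 0) (e 1))" by (simp add: w_def)
  have wmono: "w t x" if w': "w t' x" and "t \<le> t'" for t t' x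
  proof -
    obtain a where a: "\<And>y. a < y \<Longrightarrow> y < a + t' \<Longrightarrow> q x y" using w' unfolding w_def by blast
    have "q x y" if "a < y" "y < a + t" for y
      by (rule a) (use that \<open>t \<le> t'\<close> in \<open>auto intro: less_le_trans\<close>)
    then show ?thesis unfolding w_def by blast
  qed
  have "\<exists>t. infinite {x. 0 < t \<and> u < x \<and> x < v \<and> w t x}"
  proof (rule ccontr)
    assume n: "\<not> ?thesis"
    show False
    proof (rule no_finite_exhaustion[of "\<lambda>t x. 0 < t \<and> u < x \<and> x < v \<and> w t x" u v])
      show "\<exists>t. 0 < t \<and> u < x \<and> x < v \<and> w t x" if x: "u < x" "x < v" for x
      proof -
        have "DL (\<lambda>e. q x (e 0))" using D_upd1[OF D2_var[OF q, of 1 0], of x 1] by simp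
        then obtain a b where ab: "a < b" "\<And>y. a < y \<Longrightarrow> y < b \<Longrightarrow> q x y"
          using infinite_imp_interval[of "\<lambda>y. q x y"] uv(2)[OF x] by blast
        then have "w (b - a) x" unfolding w_def by (intro exI[of _ a]) auto
        then show ?thesis using x ab(1) by (intro exI[of _ "b - a"]) auto
      qed
      show "{x. 0 < t \<and> u < x \<and> x < v \<and> w t x} \<subseteq> {x. 0 < t' \<and> u < x \<and> x < v \<and> w t' x} \<or>
          {x. 0 < t' \<and> u < x \<and> x < v \<and> w t' x} \<subseteq> {x. 0 < t \<and> u < x \<and> x < v \<and> w t x}" for t t'
        using wmono[of t _ t'] wmono[of t' _ t] by (cases "t \<le> t'"; cases "0 < t"; cases "0 < t'") auto
    qed (use n uv wD in auto)
  qed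
  then obtain \<epsilon> where \<epsilon>: "infinite {x. 0 < \<epsilon> \<and> u < x \<and> x < v \<and> w \<epsilon> x}" by blast
  then have \<epsilon>0: "\<epsilon> > 0" by (metis (mono_tags, lifting) Collect_empty_eq finite.emptyI)
  have "DL (\<lambda>e. 0 < \<epsilon> \<and> u < e 0 \<and> e 0 < v \<and> w \<epsilon> (e 0))"
    using D_upd1[OF D_var[OF wD, of "\<lambda>k. if k = 0 then 1 else 0"], of \<epsilon> 1] by simp
  then obtain u1 v1 where uv1: "u1 < v1" "\<And>x. u1 < x \<Longrightarrow> x < v1 \<Longrightarrow> w \<epsilon> x"
    using infinite_imp_interval[of "\<lambda>x. 0 < \<epsilon> \<and> u < x \<and> x < v \<and> w \<epsilon> x"] \<epsilon> by blast
  define g where "g c t x \<longleftrightarrow> u1 < x \<and> x < v1 \<and> (\<exists>a. c < a \<and> a < t \<and> (\<forall>y. a < y \<and> y < a + \<epsilon> \<longrightarrow> q x y))" for c t x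
  have "DL (\<lambda>e. u1 < e 1 \<and> e 1 < v1 \<and> (\<exists>a. (\<lambda>e. e 4 < e 2 \<and> e 2 < e 0 \<and> (\<forall>y. (\<lambda>e. e 2 < e 3 \<and> e 3 < e 2 + \<epsilon> \<longrightarrow> q (e 1) (e 3)) (e(3:=y)))) (e(2:=a))))"
    by (intro D_ex D_conj D_all D_imp D_less D_lec D_addc D2_var[OF q])
  then have gD: "DL (\<lambda>e. g (e 4) (e 0) (e 1))" by (simp add: g_def)
  have gmono: "g c t x \<Longrightarrow> c' \<le> c \<Longrightarrow> t \<le> t' \<Longrightarrow> g c' t' x" for c c' t t' x
    unfolding g_def by (meson le_less_trans less_le_trans)
  \<comment> \<open>The windows from \<open>- t\<close> to \<open>t\<close> grow with
    \<open>t\<close>; this supplies the chain condition of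
    \<open>no_finite_exhaustion\<close>.\<close>
  have "\<exists>t. infinite {x. g (- t) t x}"
  proof (rule ccontr)
    assume n: "\<not> ?thesis"
    have "DL (\<lambda>e. \<exists>z. (\<lambda>e. \<exists>o'. (\<lambda>e. e 5 = 0 \<and> e 4 + e 0 = e 5 \<and> g (e 4) (e 0) (e 1)) (e(5:=o'))) (e(4:=z)))"
      by (intro D_ex D_conj D_plus D_zero gD)
    moreover have "(\<exists>z. z + t = 0 \<and> g z t x) = g (- t) t x" for t x
      by (metis add.left_inverse minus_unique add.commute)
    ultimately have gD': "DL (\<lambda>e. g (- e 0) (e 0) (e 1))" by simp
    show False
    proof (rule no_finite_exhaustion[of "\<lambda>t x. g (- t) t x" u1 v1])
      show "\<exists>t. g (- t) t x" if x: "u1 < x" "x < v1" for x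
      proof -
        obtain a where a: "\<And>y. a < y \<Longrightarrow> y < a + \<epsilon> \<Longrightarrow> q x y" using uv1(2)[OF x] unfolding w_def by blast
        obtain t where "max a (- a) < t" using ex_greater by blast
        then have "- t < a" "a < t" by (auto simp: minus_less_iff)
        then show ?thesis using a x unfolding g_def by blast
      qed
      show "{x. g (- t) t x} \<subseteq> {x. g (- t') t' x} \<or> {x. g (- t') t' x} \<subseteq> {x. g (- t) t x}" for t t'
      proof (cases "t \<le> t'")
        case True then show ?thesis using gmono[of "- t" t _ "- t'" t'] by auto
      next
        case False then show ?thesis using gmono[of "- t'" t' _ "- t" t] by auto
      qed
    qed (use n uv1 gD' in auto)
  qed
  then obtain c where c: "infinite {x. g (- c) c x}" by blast
  have "DL (\<lambda>e. g (- c) (e 0) (e 1))" using D_upd1[OF gD, of "- c" 4] by simp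
  then have SD: "DL (\<lambda>e. infinite {x. g (- c) (e 0) x})" by (rule D_infinite2(1)) simp
  have bd: "- c \<le> t" if i: "infinite {x. g (- c) t x}" for t
  proof (rule ccontr)
    assume "\<not> - c \<le> t"
    then have "{x. g (- c) t x} = {}" unfolding g_def by auto
    then show False using i by simp
  qed
  \<comment> \<open>\<open>m\<close> is the infimum of the bounds \<open>t\<close> for which
    infinitely many fibres have an interval of length \<open>\<epsilon>\<close> starting between
    \<open>- c\<close> and \<open>t\<close>; below \<open>m\<close> only finitely many fibres have
    one.\<close>
  obtain m where m: "\<And>t. infinite {x. g (- c) t x} \<Longrightarrow> m \<le> t"
    "\<And>m'. m < m' \<Longrightarrow> \<exists>t<m'. infinite {x. g (- c) t x}"
    using infimum_exists[OF SD c bd] by blast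
  obtain d where d: "d > 0" "d + d < \<epsilon>" using ex_half[OF \<epsilon>0] by blast
  have f: "finite {x. g (- c) (m - d) x}"
  proof (rule ccontr)
    assume "infinite {x. g (- c) (m - d) x}"
    from m(1)[OF this] show False using d(1) by simp
  qed
  obtain t where t: "t < m + d" "infinite {x. g (- c) t x}" using m(2)[of "m + d"] d(1) by auto
  \<comment> \<open>An interval of length \<open>\<epsilon>\<close> that starts at or after
    \<open>m - d\<close> and before \<open>m + d\<close> contains \<open>m + d\<close>, because
    \<open>d + d < \<epsilon>\<close>.\<close>
  have "{x. g (- c) t x} \<subseteq> {x. g (- c) (m - d) x} \<union> {x. q x (m + d)}"
  proof
    fix x assume "x \<in> {x. g (- c) t x}"
    then obtain a where a: "u1 < x" "x < v1" "- c < a" "a < t" "\<And>y. a < y \<Longrightarrow> y < a + \<epsilon> \<Longrightarrow> q x y"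
      unfolding g_def by auto
    show "x \<in> {x. g (- c) (m - d) x} \<union> {x. q x (m + d)}"
    proof (cases "a < m - d")
      case True then show ?thesis using a unfolding g_def by auto
    next
      case False
      then have "m + d < a + \<epsilon>"
      proof -
        have "m + d = (m - d) + (d + d)" by (simp add: algebra_simps)
        also have "\<dots> < a + \<epsilon>" using False d(2) by (intro add_le_less_mono) auto
        finally show ?thesis .
      qed
      then show ?thesis using a t(1) by auto
    qed
  qed
  then show False using t(2) f col[of "m + d"] by (metis finite_Un finite_subset)
qed

text \<open>If only finitely many columns were infinite, deleting them would leave the fibres
  infinite and make all columns finite, which \<open>planar_core\<close> excludes.\<close>

lemma planar_exchange:
  assumes q: "DL (\<lambda>e. q (e 0) (e 1))" and inf: "infinite {x. infinite {y. q x y}}"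
  shows "infinite {y. infinite {x. q x y}}"
proof
  assume fin: "finite {y. infinite {x. q x y}}"
  show False
  proof (rule planar_core[of "\<lambda>x y. q x y \<and> \<not> infinite {x. q x y}"])
    show "DL (\<lambda>e. q (e 0) (e 1) \<and> \<not> infinite {x. q x (e 1)})"
      by (intro D_conj D_not q D_infinite2(2)[OF q])
    show "finite {x. q x y \<and> \<not> infinite {x. q x y}}" for y
      by (cases "finite {x. q x y}") auto
    have "infinite {y. q x y \<and> \<not> infinite {x. q x y}}" if "infinite {y. q x y}" for x
    proof -
      have "{y. q x y \<and> \<not> infinite {x. q x y}} = {y. q x y} - {y. infinite {x. q x y}}" by blast
      then show ?thesis using that fin by (metis Diff_infinite_finite)
    qed
    then have "{x. infinite {y. q x y}} \<subseteq> {x. infinite {y. q x y \<and> \<not> infinite {x. q x y}}}" by blast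
    then show "infinite {x. infinite {y. q x y \<and> \<not> infinite {x. q x y}}}" using inf finite_subset by blast
  qed
qed

lemma D_restrict2:
  assumes "D F R C Q" "x \<noteq> y"
  shows "DL (\<lambda>e'. Q (e(x := e' 0, y := e' 1)))"
proof -
  have "DL (\<lambda>e'. Q (\<lambda>k. case (if k = x \<or> k = y then None else Some (e k)) of Some c \<Rightarrow> c
      | None \<Rightarrow> e' ((\<lambda>k. if k = x then 0 else 1) k)))"
    by (rule D_const[OF D_mono[OF assms(1)]]) auto
  moreover have "(\<lambda>k. case (if k = x \<or> k = y then None else Some (e k)) of Some c \<Rightarrow> c
      | None \<Rightarrow> e' ((\<lambda>k. if k = x then 0 else 1) k)) = e(x := e' 0, y := e' 1)" for e' :: "nat \<Rightarrow> 'a"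
    using assms(2) by (auto simp: fun_eq_iff)
  ultimately show ?thesis by (simp only:)
qed

lemma infinite_fibre_interval:
  assumes "DL Q" "infinite {a. Q (e(w := a))}"
  shows "\<exists>u v. u < v \<and> (\<forall>a. u < a \<and> a < v \<longrightarrow> Q (e(w := a)))"
proof -
  have "DL (\<lambda>e'. Q (e(w := e' 0, Suc w := e' 1)))" by (rule D_restrict2[OF assms(1)]) simp
  from D_upd1[OF this UNIV_I, of 1 "e (Suc w)"] have "DL (\<lambda>e'. Q (e(w := e' 0, Suc w := e (Suc w))))" by simp
  moreover have "e(w := a, Suc w := e (Suc w)) = e(w := a)" for a by auto
  ultimately have "DL (\<lambda>e'. Q (e(w := e' 0)))" by simp
  from infinite_imp_interval[OF this assms(2)] show ?thesis .
qed

text \<open>Both the exchange law of the closure operator and the rearrangement of iterated infinity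
  quantifiers reduce to this commutation.\<close>

lemma infinite_swap:
  assumes "D F R C Q" "x \<noteq> y" "infinite {a. infinite {b. Q (e(x := a, y := b))}}"
  shows "infinite {b. infinite {a. Q (e(x := a, y := b))}}"
  by (rule planar_exchange[OF D_restrict2[OF assms(1,2), of e] assms(3)])

end

section \<open>Pregeometries\<close>

locale pregeometry =
  fixes cls :: "'b set \<Rightarrow> 'b set"
  assumes extensive: "B \<subseteq> cls B"
    and mono: "A \<subseteq> B \<Longrightarrow> cls A \<subseteq> cls B"
    and trans1: "a \<in> cls B \<Longrightarrow> b \<in> cls (insert a B) \<Longrightarrow> b \<in> cls B"
    and exchange: "b \<in> cls (insert a B) \<Longrightarrow> b \<notin> cls B \<Longrightarrow> a \<in> cls (insert b B)"
    and finchar: "b \<in> cls B \<Longrightarrow> \<exists>B0\<subseteq>B. finite B0 \<and> b \<in> cls B0"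
begin

lemma mem: "b \<in> B \<Longrightarrow> b \<in> cls B"
  using extensive by blast

lemma trans_finite:
  assumes "finite A" "A \<subseteq> cls B" "b \<in> cls (A \<union> B)" shows "b \<in> cls B"
  using assms
proof (induction A arbitrary: b rule: finite_induct)
  case (insert a A)
  have "a \<in> cls (A \<union> B)" using insert(4) mono[of B "A \<union> B"] by blast
  then have "b \<in> cls (A \<union> B)" using trans1[of a "A \<union> B" b] insert(5) by simp
  then show ?case using insert by blast
qed simp

lemma trans: assumes "A \<subseteq> cls B" "b \<in> cls (A \<union> B)" shows "b \<in> cls B"
proof -
  obtain B0 where B0: "B0 \<subseteq> A \<union> B" "finite B0" "b \<in> cls B0" using finchar[OF assms(2)] by blast
  have "b \<in> cls ((B0 \<inter> A) \<union> B)" using mono[of B0 "(B0 \<inter> A) \<union> B"] B0 by blast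
  then show ?thesis using trans_finite[of "B0 \<inter> A" B b] B0 assms(1) by blast
qed

lemma cls_subset: "A \<subseteq> cls B \<Longrightarrow> cls A \<subseteq> cls B"
proof
  fix b assume "A \<subseteq> cls B" "b \<in> cls A"
  then show "b \<in> cls B" using trans[of A B b] mono[of A "A \<union> B"] by blast
qed

lemma cls_cong: "A \<subseteq> cls B \<Longrightarrow> B \<subseteq> cls A \<Longrightarrow> cls A = cls B"
  using cls_subset by blast

lemma cls_Un_subset: "A \<subseteq> cls B \<Longrightarrow> cls (A \<union> B) = cls B"
  using cls_cong[of "A \<union> B" B] extensive mono[of B "A \<union> B"] by blast

lemma cls_Un_cong: "cls A = cls B \<Longrightarrow> cls (A \<union> X) = cls (B \<union> X)"
proof (rule cls_cong)
  assume "cls A = cls B"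
  then show "A \<union> X \<subseteq> cls (B \<union> X)" "B \<union> X \<subseteq> cls (A \<union> X)"
    using extensive[of A] extensive[of B] extensive[of "A \<union> X"] extensive[of "B \<union> X"] mono[of A "A \<union> X"] mono[of B "B \<union> X"] by blast+
qed

fun rk :: "'b set \<Rightarrow> 'b list \<Rightarrow> nat" where
  "rk B [] = 0"
| "rk B (x # xs) = (if x \<in> cls B then 0 else 1) + rk (insert x B) xs"

lemma rk_append: "rk B (xs @ ys) = rk B xs + rk (B \<union> set xs) ys"
  by (induction xs arbitrary: B) auto

lemma rk_cong: "cls B = cls B' \<Longrightarrow> rk B xs = rk B' xs"
proof (induction xs arbitrary: B B')
  case (Cons x xs)
  have "cls (insert x B) = cls (insert x B')" using cls_Un_cong[OF Cons(2), of "{x}"] by simp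
  then have "rk (insert x B) xs = rk (insert x B') xs" by (rule Cons.IH)
  then show ?case using Cons.prems by simp
qed simp

text \<open>The exchange law enters the theory of ranks here; invariance under all permutations
  follows from adjacent swaps.\<close>

lemma rk_swap: "rk B (x # y # xs) = rk B (y # x # xs)"
proof -
  have "rk (insert y (insert x B)) xs = rk (insert x (insert y B)) xs" by (simp add: insert_commute)
  moreover have "(if x \<in> cls B then 0 else 1::nat) + (if y \<in> cls (insert x B) then 0 else 1)
     = (if y \<in> cls B then 0 else 1) + (if x \<in> cls (insert y B) then 0 else 1)"
    using trans1[of x B y] trans1[of y B x] exchange[of x y B] exchange[of y x B]
      mono[of B "insert x B"] mono[of B "insert y B"] by auto
  ultimately show ?thesis by simp
qed

lemma rk_move: "rk B (ys @ x # zs) = rk B (x # ys @ zs)"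
proof (induction ys arbitrary: B)
  case (Cons y ys)
  have "rk B ((y # ys) @ x # zs) = rk B (y # x # ys @ zs)" using Cons by simp
  then show ?case using rk_swap by (metis append_Cons)
qed simp

lemma rk_perm: "mset xs = mset ys \<Longrightarrow> rk B xs = rk B ys"
proof (induction xs arbitrary: B ys)
  case (Cons x xs)
  then have "x \<in> set ys" by (metis list.set_intros(1) mset_eq_setD)
  then obtain y1 y2 where y: "ys = y1 @ x # y2" by (meson split_list)
  then have "mset xs = mset (y1 @ y2)" using Cons(2) by simp
  then have "rk (insert x B) xs = rk (insert x B) (y1 @ y2)" by (rule Cons(1))
  then show ?case using rk_move[of B y1 x y2] y by simp
qed simp

lemma rk_comm: "rk B (xs @ ys) = rk B (ys @ xs)"
  by (rule rk_perm) simp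

lemma rk_eq_0: "set xs \<subseteq> cls B \<Longrightarrow> rk B xs = 0"
proof (induction xs arbitrary: B)
  case (Cons x xs)
  then show ?case using mono[of B "insert x B"] by (simp add: subset_iff)
qed simp

lemma rk_0_imp: "rk B xs = 0 \<Longrightarrow> set xs \<subseteq> cls B"
proof (induction xs arbitrary: B)
  case (Cons x xs)
  then have x: "x \<in> cls B" "set xs \<subseteq> cls (insert x B)" by (auto split: if_splits)
  then show ?case using trans1 by auto
qed simp

lemma rk_le_length: "rk B xs \<le> length xs"
proof (induction xs arbitrary: B)
  case (Cons x xs)
  from this[of "insert x B"] show ?case by simp
qed simp

lemma rk_antimono: "B \<subseteq> B' \<Longrightarrow> rk B' xs \<le> rk B xs"
proof (induction xs arbitrary: B B')
  case (Cons x xs)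
  have "rk (insert x B') xs \<le> rk (insert x B) xs" by (rule Cons(1)) (use Cons(2) in blast)
  then show ?case using mono[OF Cons(2)] by auto
qed simp

lemma rk_le: "set ys \<subseteq> cls (B \<union> set xs) \<Longrightarrow> rk B ys \<le> rk B xs"
  using rk_append[of B xs ys] rk_append[of B ys xs] rk_comm[of B xs ys] rk_eq_0 by simp

lemma rk_eq: "set ys \<subseteq> cls (B \<union> set xs) \<Longrightarrow> set xs \<subseteq> cls (B \<union> set ys) \<Longrightarrow> rk B ys = rk B xs"
  using rk_le[of ys B xs] rk_le[of xs B ys] by simp

text \<open>The basis is returned as a list of positions, not of elements: in limits of types one
  list of positions has to serve many ultrafilters.\<close>

lemma rk_basis:
  "\<exists>ix. distinct ix \<and> set ix \<subseteq> {..<length xs} \<and> rk B (map ((!) xs) ix) = length ix \<and> length ix = rk B xs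
     \<and> set xs \<subseteq> cls (B \<union> set (map ((!) xs) ix))"
proof (induction xs rule: rev_induct)
  case (snoc x xs)
  then obtain ix where i: "distinct ix" "set ix \<subseteq> {..<length xs}" "rk B (map ((!) xs) ix) = length ix"
    "length ix = rk B xs" "set xs \<subseteq> cls (B \<union> set (map ((!) xs) ix))" by blast
  have m: "map ((!) (xs @ [x])) ix = map ((!) xs) ix" using i(2) by (auto simp: nth_append)
  have sub: "set (map ((!) xs) ix) \<subseteq> set xs" using i(2) by auto
  have c: "cls (B \<union> set (map ((!) xs) ix)) = cls (B \<union> set xs)"
    using cls_cong[of "B \<union> set (map ((!) xs) ix)" "B \<union> set xs"] i(5) sub
      extensive[of "B \<union> set xs"] extensive[of "B \<union> set (map ((!) xs) ix)"] by blast
  show ?case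
  proof (cases "x \<in> cls (B \<union> set xs)")
    case True
    then have "rk B (xs @ [x]) = rk B xs" by (simp add: rk_append)
    then show ?thesis using i True c by (intro exI[of _ "ix"]) (unfold m, auto)
  next
    case False
    let ?ix = "ix @ [length xs]"
    have m2: "map ((!) (xs @ [x])) ?ix = map ((!) xs) ix @ [x]" using m by simp
    have "rk B (map ((!) (xs @ [x])) ?ix) = length ?ix"
      unfolding m2 rk_append using i(3) False c by simp
    moreover have "rk B (xs @ [x]) = length ?ix" using False i(4) by (simp add: rk_append)
    moreover have "set (xs @ [x]) \<subseteq> cls (B \<union> set (map ((!) (xs @ [x])) ?ix))"
      unfolding m2 using i(5) extensive[of "B \<union> set (map ((!) xs) ix @ [x])"]
        mono[of "B \<union> set (map ((!) xs) ix)" "B \<union> set (map ((!) xs) ix @ [x])"] by auto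
    ultimately show ?thesis using i(1,2) by (intro exI[of _ ?ix]) auto
  qed
qed simp

text \<open>The rank of \<open>q\<close> together with \<open>bs\<close> over \<open>A\<close> is
  counted once with \<open>q\<close> last and once with \<open>q\<close> first.\<close>

lemma indep_drop:
  assumes "q \<in> cls (A \<union> set bs)" "rk (insert q A) bs = length bs"
  shows "q \<in> cls A"
proof -
  have "rk A (q # bs) = rk A (bs @ [q])" using rk_move[of A bs q "[]"] by simp
  also have "\<dots> = rk A bs" using assms(1) by (simp add: rk_append)
  finally show ?thesis using assms(2) rk_le_length[of A bs] by (auto split: if_splits)
qed

lemma rk_indep_antimono: "rk B' xs = length xs \<Longrightarrow> B \<subseteq> cls B' \<Longrightarrow> rk B xs = length xs"
proof -
  assume a: "rk B' xs = length xs" "B \<subseteq> cls B'"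
  have "rk B' xs = rk (B \<union> B') xs" using cls_Un_subset[OF a(2)] by (intro rk_cong) simp
  also have "\<dots> \<le> rk B xs" by (rule rk_antimono) simp
  finally show ?thesis using a(1) rk_le_length[of B xs] by simp
qed

end

section \<open>The closure operator on functions modulo an ultrafilter\<close>

lemma dep_UNIV: "dep UNIV Q"
proof -
  have "e = e'" if "\<forall>k\<in>UNIV. e k = e' k" for e e' :: "nat \<Rightarrow> 'a" using that by auto
  then show ?thesis unfolding dep_def by blast
qed

context omin begin

text \<open>Algebraicity in the ultrapower by \<open>U\<close>, over the constants \<open>C\<close>
  and the elements of \<open>B\<close>. Slot 0 carries the candidate, the other slots members of
  \<open>B\<close> or, as a filler, the zero function. The fibres of \<open>Q\<close> are finite in
  every environment; \<open>acl_I\<close> shows that finiteness almost everywhere is enough.\<close>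

definition acl :: "'a set \<Rightarrow> 'i filter \<Rightarrow> ('i \<Rightarrow> 'a) set \<Rightarrow> ('i \<Rightarrow> 'a) set" where
  "acl C U B = {b. \<exists>Q e. D F R C Q \<and> (\<forall>e. finite {a. Q (e(0 := a))}) \<and> range e \<subseteq> insert (\<lambda>_. 0) B \<and>
      eventually (\<lambda>i. Q ((\<lambda>k. e k i)(0 := b i))) U}"

abbreviation Acl :: "'i filter \<Rightarrow> ('i \<Rightarrow> 'a) set \<Rightarrow> ('i \<Rightarrow> 'a) set" where "Acl \<equiv> acl UNIV"

lemma acl_I0:
  assumes "D F R C Q" "\<And>e. finite {a. Q (e(0 := a))}" "\<And>k. e k \<in> insert (\<lambda>_. 0) B"
    "eventually (\<lambda>i. Q ((\<lambda>k. e k i)(0 := b i))) U"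
  shows "b \<in> acl C U B"
  unfolding acl_def using assms by blast

lemma acl_I:
  assumes Q: "D F R C Q" "dep K Q" and e: "\<And>k. k \<in> K \<Longrightarrow> k \<noteq> w \<Longrightarrow> e k \<in> insert (\<lambda>_. 0) B"
    and ev: "eventually (\<lambda>i. Q ((\<lambda>k. e k i)(w := b i)) \<and> finite {a. Q ((\<lambda>k. e k i)(w := a))}) U"
  shows "b \<in> acl C U B"
proof -
  \<comment> \<open>Conjoining the finiteness of the fibre, a definable condition, turns finiteness
    along \<open>U\<close> into finiteness in every environment.\<close>
  define S where "S e \<longleftrightarrow> Q e \<and> \<not> infinite {a. Q (e(w := a))}" for e
  have S: "D F R C S" unfolding S_def[abs_def] by (intro D_conj D_not Q D_infinite)
  let ?h = "\<lambda>k. if k = w then 0 else Suc k"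
  define e' where "e' k = (case k of 0 \<Rightarrow> (\<lambda>_. 0) | Suc k \<Rightarrow> if k \<in> K \<and> k \<noteq> w then e k else (\<lambda>_. 0))" for k
  show ?thesis
  proof (rule acl_I0[OF D_var[OF S, of ?h], of e'])
    fix f :: "nat \<Rightarrow> 'a"
    have eq: "(\<lambda>k. (f(0 := a)) (?h k)) = (\<lambda>k. f (?h k))(w := a)" for a by auto
    show "finite {a. S (\<lambda>k. (f(0 := a)) (?h k))}"
    proof (cases "infinite {a. Q ((\<lambda>k. f (?h k))(w := a))}")
      case True
      then have "{a. S (\<lambda>k. (f(0 := a)) (?h k))} = {}" unfolding eq S_def by simp
      then show ?thesis by simp
    next
      case False
      have "{a. S (\<lambda>k. (f(0 := a)) (?h k))} \<subseteq> {a. Q ((\<lambda>k. f (?h k))(w := a))}" unfolding eq S_def by blast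
      then show ?thesis using False finite_subset by blast
    qed
  next
    show "e' k \<in> insert (\<lambda>_. 0) B" for k using e by (auto simp: e'_def split: nat.splits)
    show "eventually (\<lambda>i. S (\<lambda>k. ((\<lambda>k. e' k i)(0 := b i)) (?h k))) U"
      using ev
    proof (rule eventually_mono)
      fix i assume a: "Q ((\<lambda>k. e k i)(w := b i)) \<and> finite {a. Q ((\<lambda>k. e k i)(w := a))}"
      define g where "g = (\<lambda>k. ((\<lambda>k. e' k i)(0 := b i)) (?h k))"
      have g: "Q (g(w := c)) = Q ((\<lambda>k. e k i)(w := c))" for c
        by (rule depD[OF Q(2)]) (auto simp: e'_def g_def)
      have "g(w := b i) = g" by (auto simp: g_def)
      then have "Q g" using g[of "b i"] a by simp
      moreover have "finite {c. Q (g(w := c))}" using a by (simp add: g)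
      ultimately show "S (\<lambda>k. ((\<lambda>k. e' k i)(0 := b i)) (?h k))" unfolding S_def g_def[symmetric] by simp
    qed
  qed
qed

lemma acl_E:
  assumes "b \<in> acl C U B"
  obtains Q e K where "D F R C Q" "\<And>e. finite {a. Q (e(0 := a))}" "\<And>k. e k \<in> insert (\<lambda>_. 0) B"
    "eventually (\<lambda>i. Q ((\<lambda>k. e k i)(0 := b i))) U" "finite K" "dep K Q" "\<And>k. k \<notin> K \<Longrightarrow> e k = (\<lambda>_. 0)"
proof -
  obtain Q e where Q: "D F R C Q" "\<And>e. finite {a. Q (e(0 := a))}" "range e \<subseteq> insert (\<lambda>_. 0) B"
    "eventually (\<lambda>i. Q ((\<lambda>k. e k i)(0 := b i))) U" using assms unfolding acl_def by auto
  obtain K where K: "finite K" "dep K Q" using D_dep[OF Q(1)] by blast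
  define e' where "e' k = (if k \<in> K then e k else (\<lambda>_. 0))" for k
  have "Q ((\<lambda>k. e' k i)(0 := b i)) = Q ((\<lambda>k. e k i)(0 := b i))" for i
    by (rule depD[OF K(2)]) (auto simp: e'_def)
  then have "eventually (\<lambda>i. Q ((\<lambda>k. e' k i)(0 := b i))) U" using Q(4) by simp
  moreover have "\<And>k. e' k \<in> insert (\<lambda>_. 0) B" using Q(3) by (auto simp: e'_def)
  moreover have "\<And>k. k \<notin> K \<Longrightarrow> e' k = (\<lambda>_. 0)" by (simp add: e'_def)
  ultimately show ?thesis using that[OF Q(1,2), of e' K] K by blast
qed

lemma acl_trans1:
  assumes "a \<in> acl C U B" "b \<in> acl C U (insert a B)"
  shows "b \<in> acl C U B"
proof -
  obtain Q1 e1 K1 where 1: "D F R C Q1" "\<And>e. finite {a. Q1 (e(0 := a))}" "\<And>k. e1 k \<in> insert (\<lambda>_. 0) B"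
    "eventually (\<lambda>i. Q1 ((\<lambda>k. e1 k i)(0 := a i))) U" using assms(1) by (rule acl_E) blast
  obtain Q2 e2 K2 where 2: "D F R C Q2" "\<And>e. finite {a. Q2 (e(0 := a))}"
    "\<And>k. e2 k \<in> insert (\<lambda>_. 0) (insert a B)"
    "eventually (\<lambda>i. Q2 ((\<lambda>k. e2 k i)(0 := b i))) U" using assms(2) by (rule acl_E) blast
  \<comment> \<open>Slot 0 holds \<open>b\<close> and slot 1 the eliminated \<open>a\<close>; the
    remaining arguments of \<open>Q1\<close> go to odd slots from 3 on, those of \<open>Q2\<close>
    to even slots from 4 on.\<close>
  let ?h1 = "\<lambda>k. if k = 0 then 1 else 2*k+1" and ?h2 = "\<lambda>k. if k = 0 then 0 else if e2 k = a then 1 else 2*k+2"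
  define Q where "Q e \<longleftrightarrow> (\<exists>z. Q1 (\<lambda>k. (e(1 := z)) (?h1 k)) \<and> Q2 (\<lambda>k. (e(1 := z)) (?h2 k)))" for e
  have QD: "D F R C Q" unfolding Q_def
    by (rule D_ex[of _ _ _ "\<lambda>e. Q1 (\<lambda>k. e (?h1 k)) \<and> Q2 (\<lambda>k. e (?h2 k))"]) (rule D_conj[OF D_var[OF 1(1)] D_var[OF 2(1)]])
  define e' where "e' j = (if odd j then e1 (j div 2) else if e2 (j div 2 - 1) = a then (\<lambda>_. 0) else e2 (j div 2 - 1))" for j
  show ?thesis
  proof (rule acl_I0[OF QD, of e'])
    fix e :: "nat \<Rightarrow> 'a"
    have x1: "(\<lambda>k. (e(0 := c, 1 := z)) (?h1 k)) = (\<lambda>k. e (?h1 k))(0 := z)" for c z by (rule ext) auto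
    have x2: "(\<lambda>k. (e(0 := c, 1 := z)) (?h2 k)) = (\<lambda>k. (e(1 := z)) (?h2 k))(0 := c)" for c z by (rule ext) auto
    have "{c. Q (e(0 := c))} \<subseteq> (\<Union>z\<in>{z. Q1 ((\<lambda>k. e (?h1 k))(0 := z))}. {c. Q2 ((\<lambda>k. (e(1 := z)) (?h2 k))(0 := c))})"
      unfolding Q_def x1 x2 by blast
    then show "finite {c. Q (e(0 := c))}" by (rule finite_subset) (intro finite_UN_I 1(2) 2(2))
  next
    show "e' k \<in> insert (\<lambda>_. 0) B" for k using 1(3)[of "k div 2"] 2(3)[of "k div 2 - 1"] by (auto simp: e'_def)
    show "eventually (\<lambda>i. Q ((\<lambda>k. e' k i)(0 := b i))) U"
      using 1(4) 2(4)
    proof eventually_elim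
      case (elim i)
      have "(\<lambda>k. ((\<lambda>k. e' k i)(0 := b i, 1 := a i)) (?h1 k)) = (\<lambda>k. e1 k i)(0 := a i)"
        by (rule ext) (auto simp: e'_def)
      moreover have "(\<lambda>k. ((\<lambda>k. e' k i)(0 := b i, 1 := a i)) (?h2 k)) = (\<lambda>k. e2 k i)(0 := b i)"
        by (rule ext) (auto simp: e'_def)
      ultimately show ?case unfolding Q_def using elim by (intro exI[of _ "a i"]) metis
    qed
  qed
qed

text \<open>\<open>S\<close> witnesses that \<open>b\<close> is algebraic over \<open>a\<close>.
  Almost everywhere only finitely many values can stand in for \<open>a\<close>: otherwise
  \<open>b\<close> would satisfy \<open>W\<close>, which has finite fibres by
  \<open>infinite_swap\<close>, and \<open>b\<close> would already be algebraic over
  \<open>B\<close>.\<close>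

lemma acl_exchange:
  assumes U: "ultra U" and b: "b \<in> acl C U (insert a B)" "b \<notin> acl C U B"
  shows "a \<in> acl C U (insert b B)"
proof -
  obtain Q e K where Q: "D F R C Q" "\<And>e. finite {a. Q (e(0 := a))}" "\<And>k. e k \<in> insert (\<lambda>_. 0) (insert a B)"
    "eventually (\<lambda>i. Q ((\<lambda>k. e k i)(0 := b i))) U" using b(1) by (rule acl_E) blast
  let ?h = "\<lambda>k. if k = 0 then 0 else if e k = a then 1 else k + 2"
  define S where "S e' \<longleftrightarrow> Q (\<lambda>k. e' (?h k))" for e'
  have SD: "D F R C S" unfolding S_def by (rule D_var[OF Q(1)])
  define W where "W e' \<longleftrightarrow> infinite {x. S (e'(1 := x))}" for e'
  have WD: "D F R C W" unfolding W_def by (rule D_infinite[OF SD])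
  define e' where "e' k = (if k < 2 \<or> e (k - 2) = a then (\<lambda>_. 0) else e (k - 2))" for k
  have e': "e' k \<in> insert (\<lambda>_. 0) B" for k using Q(3)[of "k - 2"] by (auto simp: e'_def)
  have Sfin: "finite {y. S (f(0 := y))}" for f
  proof -
    have "(\<lambda>k. (f(0 := y)) (?h k)) = (\<lambda>k. f (?h k))(0 := y)" for y by auto
    then show ?thesis unfolding S_def using Q(2) by simp
  qed
  have Wfin: "finite {y. W (f(0 := y))}" for f
  proof (rule ccontr)
    assume "infinite {y. W (f(0 := y))}"
    then have "infinite {y. infinite {x. S (f(0 := y, 1 := x))}}" by (simp add: W_def)
    then have "infinite {x. infinite {y. S (f(0 := y, 1 := x))}}" by (rule infinite_swap[OF SD, rotated]) simp
    moreover have "f(0 := y, 1 := x) = f(1 := x, 0 := y)" for x y by (rule fun_upd_twist) simp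
    ultimately show False using Sfin by simp
  qed
  have "\<not> eventually (\<lambda>i. W ((\<lambda>k. e' k i)(0 := b i))) U"
    using acl_I0[OF WD Wfin, of e'] e' b(2) by blast
  then have "eventually (\<lambda>i. \<not> W ((\<lambda>k. e' k i)(0 := b i))) U" using ultra_not[OF U] by blast
  with Q(4) have "eventually (\<lambda>i. S ((\<lambda>k. (e'(0 := b)) k i)(1 := a i)) \<and> finite {x. S ((\<lambda>k. (e'(0 := b)) k i)(1 := x))}) U"
  proof eventually_elim
    case (elim i)
    have x: "(\<lambda>k. (e'(0 := b)) k i) = (\<lambda>k. e' k i)(0 := b i)" by auto
    have "(\<lambda>k. ((\<lambda>k. (e'(0 := b)) k i)(1 := a i)) (?h k)) = (\<lambda>k. e k i)(0 := b i)"
      by (rule ext) (auto simp: e'_def)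
    then have "S ((\<lambda>k. (e'(0 := b)) k i)(1 := a i))" using elim(1) unfolding S_def by metis
    moreover have "finite {x. S ((\<lambda>k. (e'(0 := b)) k i)(1 := x))}" using elim(2) unfolding W_def x by simp
    ultimately show ?case by blast
  qed
  then show ?thesis
    by (rule acl_I[OF SD, of UNIV, rotated 2]) (use e' dep_UNIV in auto)
qed

lemma acl_mono: "A \<subseteq> B \<Longrightarrow> acl C U A \<subseteq> acl C U B"
  unfolding acl_def by blast

lemma acl_ext: "b \<in> B \<Longrightarrow> b \<in> acl C U B"
proof (rule acl_I0[OF D_eq[of F R C 0 1], of "\<lambda>_. b"])
  show "finite {a. (e(0 := a)) 0 = (e(0 := a)) (1::nat)}" for e :: "nat \<Rightarrow> 'a" by simp
qed auto

lemma acl_pregeometry: assumes "ultra U" shows "pregeometry (acl C U)"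
proof
  show "B \<subseteq> acl C U B" for B using acl_ext by blast
  show "\<exists>B0\<subseteq>B. finite B0 \<and> b \<in> acl C U B0" if b: "b \<in> acl C U B" for b B
  proof -
    obtain Q e K where Q: "D F R C Q" "\<And>e. finite {a. Q (e(0 := a))}" "\<And>k. e k \<in> insert (\<lambda>_. 0) B"
      "eventually (\<lambda>i. Q ((\<lambda>k. e k i)(0 := b i))) U" "finite K" "\<And>k. k \<notin> K \<Longrightarrow> e k = (\<lambda>_. 0)"
      using b by (rule acl_E) blast
    have "b \<in> acl C U (e ` K \<inter> B)"
    proof (rule acl_I0[OF Q(1,2) _ Q(4)])
      show "e k \<in> insert (\<lambda>_. 0) (e ` K \<inter> B)" for k using Q(3)[of k] Q(6)[of k] by blast
    qed
    then show ?thesis using Q(5) by blast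
  qed
qed (auto intro: acl_mono[THEN subsetD] acl_trans1 acl_exchange[OF assms])

lemma acl_const: "c \<in> C \<Longrightarrow> (\<lambda>_. c) \<in> acl C U B"
proof (rule acl_I0[OF D_eqc[of c C F R 0], of "\<lambda>_ _. 0"])
  show "finite {a. (e(0 := a)) (0::nat) = c}" for e :: "nat \<Rightarrow> 'a" by simp
qed auto

lemma acl_eventually_eq:
  "b \<in> acl C U B \<Longrightarrow> eventually (\<lambda>i. b i = b' i) U \<Longrightarrow> b' \<in> acl C U B"
proof -
  assume b: "b \<in> acl C U B" and ev: "eventually (\<lambda>i. b i = b' i) U"
  obtain Q e K where Q: "D F R C Q" "\<And>e. finite {a. Q (e(0 := a))}" "\<And>k. e k \<in> insert (\<lambda>_. 0) B"
    "eventually (\<lambda>i. Q ((\<lambda>k. e k i)(0 := b i))) U" using b by (rule acl_E) blast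
  from Q(4) ev have "eventually (\<lambda>i. Q ((\<lambda>k. e k i)(0 := b' i))) U" by eventually_elim auto
  then show ?thesis by (rule acl_I0[OF Q(1-3)])
qed

lemma acl_zero: "(\<lambda>_. 0) \<in> acl C U B"
proof (rule acl_I0[OF D_zero[of C 0], of "\<lambda>_ _. 0"])
  show "finite {a. (e(0 := a)) (0::nat) = 0}" for e :: "nat \<Rightarrow> 'a" by simp
qed auto

lemma acl_add: "(\<lambda>i. x i + y i) \<in> acl C U {x, y}"
proof (rule acl_I0[OF D_plus[of C 1 2 0], of "\<lambda>k. if k = 1 then x else y"])
  show "finite {a. (e(0 := a)) 1 + (e(0 := a)) 2 = (e(0 := a)) (0::nat)}" for e :: "nat \<Rightarrow> 'a" by simp
qed auto

lemma acl_diff: "(\<lambda>i. x i - y i) \<in> acl C U {x, y}"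
proof (rule acl_I0[OF D_plus[of C 0 2 1], of "\<lambda>k. if k = 1 then x else y"])
  show "finite {a. (e(0 := a)) 0 + (e(0 := a)) 2 = (e(0 := a)) (1::nat)}" for e :: "nat \<Rightarrow> 'a"
    by (rule finite_subset[of _ "{e 1 - e 2}"]) (auto simp: algebra_simps)
qed auto

text \<open>Algebraicity is expressed by a predicate on the environment of all \<open>x k\<close>
  that reads only the slots \<open>w\<close> and \<open>Y\<close>. In this form it can be compared
  between different ultrafilters.\<close>

lemma acl_nf:
  assumes "w \<notin> Y"
  shows "x w \<in> Acl U (x ` Y) \<longleftrightarrow> (\<exists>T. DL T \<and> (\<forall>f. finite {a. T (f(w := a))}) \<and>
     dep (insert w Y) T \<and> eventually (\<lambda>i. T (\<lambda>k. x k i)) U)" (is "_ \<longleftrightarrow> ?R")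
proof
  assume "x w \<in> Acl U (x ` Y)"
  then obtain Q e K where Q: "DL Q" "\<And>e. finite {a. Q (e(0 := a))}" "\<And>m. e m \<in> insert (\<lambda>_. 0) (x ` Y)"
    "eventually (\<lambda>i. Q ((\<lambda>m. e m i)(0 := x w i))) U" by (rule acl_E) blast
  define j where "j m = (SOME j. j \<in> Y \<and> e m = x j)" for m
  have j: "j m \<in> Y \<and> e m = x (j m)" if "e m \<noteq> (\<lambda>_. 0)" for m
    unfolding j_def using that Q(3)[of m] by (intro someI_ex[of "\<lambda>j. j \<in> Y \<and> e m = x j"]) auto
  define z where "z m \<longleftrightarrow> e m = (\<lambda>_. 0)" for m
  define \<tau> :: "nat \<Rightarrow> nat + 'a" where "\<tau> m = (if m = 0 then Inl w else if z m then Inr 0 else Inl (j m))" for m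
  have 1: "asg \<tau> (\<lambda>k. x k i) = (\<lambda>m. e m i)(0 := x w i)" for i
  proof
    fix m show "asg \<tau> (\<lambda>k. x k i) m = ((\<lambda>m. e m i)(0 := x w i)) m"
      using j[of m] by (cases "z m") (auto simp: asg_def \<tau>_def z_def)
  qed
  have jw: "\<not> z m \<Longrightarrow> j m \<noteq> w" for m using j[of m] assms by (auto simp: z_def)
  have 2: "asg \<tau> (f(w := a)) = (asg \<tau> f)(0 := a)" for f a
  proof
    fix m show "asg \<tau> (f(w := a)) m = ((asg \<tau> f)(0 := a)) m" using jw[of m] by (auto simp: asg_def \<tau>_def)
  qed
  have "DL (\<lambda>f. Q (asg \<tau> f))" by (rule D_sub[OF Q(1)]) simp
  moreover have "finite {a. Q (asg \<tau> (f(w := a)))}" for f unfolding 2 by (rule Q(2))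
  moreover have "dep (insert w Y) (\<lambda>f. Q (asg \<tau> f))" unfolding dep_def
  proof (intro allI impI)
    fix f f' :: "nat \<Rightarrow> 'a" assume "\<forall>k\<in>insert w Y. f k = f' k"
    then have "asg \<tau> f m = asg \<tau> f' m" for m using j[of m] by (auto simp: asg_def \<tau>_def z_def)
    then have "asg \<tau> f = asg \<tau> f'" by auto
    then show "Q (asg \<tau> f) = Q (asg \<tau> f')" by simp
  qed
  moreover have "eventually (\<lambda>i. Q (asg \<tau> (\<lambda>k. x k i))) U" unfolding 1 by (rule Q(4))
  ultimately show ?R by (intro exI[of _ "\<lambda>f. Q (asg \<tau> f)"]) simp
next
  assume ?R
  then obtain T where T: "DL T" "\<And>f. finite {a. T (f(w := a))}" "dep (insert w Y) T" "eventually (\<lambda>i. T (\<lambda>k. x k i)) U" by blast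
  have upd: "(\<lambda>k. x k i)(w := x w i) = (\<lambda>k. x k i)" for i by auto
  show "x w \<in> Acl U (x ` Y)"
    by (rule acl_I[OF T(1,3), of w x]) (use T(2,4) upd in auto)
qed

end

section \<open>A dense independent set\<close>

locale omin_pair = omin F R for F :: "'f \<Rightarrow> 'a::linordered_ab_group_add list \<Rightarrow> 'a"
    and R :: "'r \<Rightarrow> 'a list \<Rightarrow> bool" +
  fixes P :: "'a set"
  assumes Pdense: "\<And>a b. a < b \<Longrightarrow> \<exists>p\<in>P. a < p \<and> p < b"
    and Pindep: "dcl_independent F R P"
begin

abbreviation DN :: "((nat \<Rightarrow> 'a) \<Rightarrow> bool) \<Rightarrow> bool" where "DN \<equiv> D F (expR R P) UNIV"

abbreviation defN :: "nat \<Rightarrow> 'a list set \<Rightarrow> bool" where "defN \<equiv> definable F (expR R P)"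

text \<open>Parameter-free algebraic closure inside the structure itself, obtained from the
  one-point ultrafilter so that its pregeometry laws are instances of those for
  \<open>acl\<close>.\<close>

definition mcl :: "'a set \<Rightarrow> 'a set" where
  "mcl A = {b. (\<lambda>_. b) \<in> acl {} (principal {()}) ((\<lambda>a _. a) ` A)}"

lemma mcl_pregeometry: "pregeometry mcl"
proof -
  let ?U = "principal {()}" and ?\<kappa> = "(\<lambda>a _. a) :: 'a \<Rightarrow> unit \<Rightarrow> 'a"
  interpret p: pregeometry "acl {} ?U" by (rule acl_pregeometry[OF ultra_principal])
  show ?thesis
  proof
    show "B \<subseteq> mcl B" for B by (auto simp: mcl_def intro: p.mem)
    show "mcl A \<subseteq> mcl B" if "A \<subseteq> B" for A B
      using p.mono[OF image_mono[OF that, of ?\<kappa>]] by (auto simp: mcl_def)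
    show "b \<in> mcl B" if "a \<in> mcl B" "b \<in> mcl (insert a B)" for a b B
      using p.trans1[of "?\<kappa> a" "?\<kappa> ` B" "?\<kappa> b"] that by (simp add: mcl_def)
    show "a \<in> mcl (insert b B)" if "b \<in> mcl (insert a B)" "b \<notin> mcl B" for a b B
      using p.exchange[of "?\<kappa> b" "?\<kappa> a" "?\<kappa> ` B"] that by (simp add: mcl_def)
    show "\<exists>B0\<subseteq>B. finite B0 \<and> b \<in> mcl B0" if b: "b \<in> mcl B" for b B
    proof -
      obtain C where C: "C \<subseteq> ?\<kappa> ` B" "finite C" "?\<kappa> b \<in> acl {} ?U C"
        using p.finchar[of "?\<kappa> b" "?\<kappa> ` B"] b by (auto simp: mcl_def)
      then obtain B0 where "B0 \<subseteq> B" "finite B0" "C = ?\<kappa> ` B0" by (meson finite_subset_image)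
      then show ?thesis using C by (auto simp: mcl_def)
    qed
  qed
qed

interpretation m: pregeometry mcl by (rule mcl_pregeometry)

lemma mcl_zero: "0 \<in> mcl A"
  using acl_zero by (simp add: mcl_def)

lemma mcl_add: assumes "x \<in> mcl A" "y \<in> mcl A" shows "x + y \<in> mcl A"
proof -
  have "x + y \<in> mcl {x, y}" using acl_add[of "\<lambda>_. x" "\<lambda>_. y"] by (simp add: mcl_def)
  then show ?thesis using m.cls_subset[of "{x, y}" A] assms by auto
qed

lemma mcl_diff: assumes "x \<in> mcl A" "y \<in> mcl A" shows "x - y \<in> mcl A"
proof -
  have "x - y \<in> mcl {x, y}" using acl_diff[of "\<lambda>_. x" "\<lambda>_. y"] by (simp add: mcl_def)
  then show ?thesis using m.cls_subset[of "{x, y}" A] assms by auto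
qed

lemma mcl_sum: "finite S \<Longrightarrow> S \<subseteq> mcl A \<Longrightarrow> \<Sum>S \<in> mcl A"
  by (induction S rule: finite_induct) (auto simp: mcl_zero intro: mcl_add)

text \<open>In an ordered structure a member of a finite definable set is definable by its position:
  the minimum is split off repeatedly. Hence algebraic closure lies in definable closure, and
  \<open>dcl\<close>-independence of \<open>P\<close> becomes independence for
  \<open>mcl\<close>.\<close>

lemma finite_definable_element:
  "finite {x. q x} \<Longrightarrow> card {x. q x} = n \<Longrightarrow> D F R C (\<lambda>e. q (e 0)) \<Longrightarrow> q p \<Longrightarrow> D F R C (\<lambda>e. e 0 = p)"
proof (induction n arbitrary: q)
  case 0 then show ?case by auto
next
  case (Suc n)
  let ?m = "Min {x. q x}"
  have m: "q ?m" using Min_in[OF Suc(2)] Suc(5) by auto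
  have qv: "D F R C (\<lambda>e. q (e i))" for i using D_var[OF Suc(4), of "\<lambda>_. i"] by simp
  have "D F R C (\<lambda>e. \<exists>y. (\<lambda>e. e 1 < e 0 \<and> q (e 1)) (e(1 := y)))"
    by (intro D_ex D_conj D_less qv)
  then have lower: "D F R C (\<lambda>e. \<exists>y. y < e 0 \<and> q y)" by simp
  have low: "(\<exists>y. y < x \<and> q y) \<longleftrightarrow> ?m < x" for x
    using m Min_le[OF Suc(2)] by (auto intro: le_less_trans)
  show ?case
  proof (cases "p = ?m")
    case True
    have "D F R C (\<lambda>e. q (e 0) \<and> \<not> (\<exists>y. y < e 0 \<and> q y))" by (intro D_conj D_not qv lower)
    moreover have "q x \<and> \<not> (\<exists>y. y < x \<and> q y) \<longleftrightarrow> x = p" for x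
      unfolding low True using m Min_le[OF Suc(2), of x] by auto
    ultimately show ?thesis by simp
  next
    case False
    let ?q = "\<lambda>x. q x \<and> (\<exists>y. y < x \<and> q y)"
    have eq: "{x. ?q x} = {x. q x} - {?m}"
      unfolding low using Min_le[OF Suc(2)] by (auto simp: less_le)
    show ?thesis
    proof (rule Suc.IH[of ?q])
      show "finite {x. ?q x}" using Suc(2) by simp
      show "card {x. ?q x} = n" unfolding eq using Suc(2,3) m by simp
      show "D F R C (\<lambda>e. ?q (e 0))" by (intro D_conj qv lower)
      show "?q p" unfolding low using Suc(5) False Min_le[OF Suc(2), of p] by (auto simp: less_le)
    qed
  qed
qed

lemma mcl_imp_dcl: assumes "p \<in> mcl A" shows "p \<in> dcl F R A"
proof -
  have "(\<lambda>_. p) \<in> acl {} (principal {()}) ((\<lambda>a _. a) ` A)" using assms by (simp add: mcl_def)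
  then obtain Q e K where Q: "D F R {} Q" "\<And>e. finite {a. Q (e(0 := a))}" "\<And>k. e k \<in> insert (\<lambda>_. 0) ((\<lambda>a _. a) ` A)"
    "eventually (\<lambda>i. Q ((\<lambda>k. e k i)(0 := p))) (principal {()})" by (rule acl_E) blast
  define f where "f k = (if e k () \<in> A then Some (e k ()) else None)" for k
  define f0 where "f0 k = (if k = 0 then None else f k)" for k
  have e0: "f k = None \<Longrightarrow> e k () = 0" for k using Q(3)[of k] by (auto simp: f_def split: if_splits)
  let ?q = "\<lambda>x. Q (\<lambda>k. if k = 0 then x else e k ())"
  have "D F R A (\<lambda>e'. Q (\<lambda>k. case f0 k of Some c \<Rightarrow> c | None \<Rightarrow> e' (if k = 0 then 0 else 1)))"
    by (rule D_const[OF D_mono[OF Q(1)]]) (auto simp: f0_def f_def split: if_splits)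
  then have "D F R A (\<lambda>e'. \<exists>z. (\<lambda>e'. e' 1 = 0 \<and> Q (\<lambda>k. case f0 k of Some c \<Rightarrow> c | None \<Rightarrow> e' (if k = 0 then 0 else 1))) (e'(1 := z)))"
    by (intro D_ex D_conj D_zero)
  moreover have "(\<lambda>k. case f0 k of Some c \<Rightarrow> c | None \<Rightarrow> (e'(1 := 0)) (if k = 0 then 0 else 1)) = (\<lambda>k. if k = 0 then e' 0 else e k ())"
    for e' :: "nat \<Rightarrow> 'a"
    using e0 by (auto simp: f0_def f_def split: option.splits if_splits)
  ultimately have "D F R A (\<lambda>e'. ?q (e' 0))" by simp
  moreover have upd: "(\<lambda>k. if k = 0 then x else e k ()) = (\<lambda>k. e k ())(0 := x)" for x by auto
  have "finite {x. ?q x}" unfolding upd by (rule Q(2))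
  moreover have "?q p" unfolding upd using Q(4) by (simp add: eventually_principal)
  ultimately have "D F R A (\<lambda>e. e 0 = p)" using finite_definable_element[of ?q _ A p] by blast
  then have "definable_over F R A 1 {[p]}" by (intro D_imp_definable) auto
  then show ?thesis by (simp add: dcl_def)
qed

text \<open>Each new parameter costs at most finitely many points: if it makes some further point of
  \<open>P\<close> dependent, exchange puts it into the closure of \<open>A\<close> and
  \<open>P\<close>, hence into that of a finite set \<open>B\<close>, and only points of
  \<open>B\<close> are lost.\<close>

lemma exceptional_points:
  "finite A \<Longrightarrow> \<exists>P0. finite P0 \<and> (\<forall>p\<in>P - P0. p \<notin> mcl (A \<union> (P - {p})))"
proof (induction A rule: finite_induct)
  case empty
  then show ?case using Pindep mcl_imp_dcl unfolding dcl_independent_def by (intro exI[of _ "{}"]) auto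
next
  case (insert a A)
  then obtain P0 where P0: "finite P0" "\<And>p. p \<in> P - P0 \<Longrightarrow> p \<notin> mcl (A \<union> (P - {p}))" by blast
  show ?case
  proof (cases "\<forall>p\<in>P - P0. p \<notin> mcl (insert a A \<union> (P - {p}))")
    case True then show ?thesis using P0(1) by blast
  next
    case False
    then obtain p where p: "p \<in> P - P0" "p \<in> mcl (insert a (A \<union> (P - {p})))" by auto
    then have "a \<in> mcl (insert p (A \<union> (P - {p})))" using m.exchange P0(2) by blast
    moreover have "insert p (A \<union> (P - {p})) = A \<union> P" using p(1) by blast
    ultimately obtain B where B: "B \<subseteq> A \<union> P" "finite B" "a \<in> mcl B" using m.finchar by metis
    have "p' \<notin> mcl (insert a A \<union> (P - {p'}))" if p': "p' \<in> P - (P0 \<union> B)" for p'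
    proof
      assume *: "p' \<in> mcl (insert a A \<union> (P - {p'}))"
      have "a \<in> mcl (A \<union> (P - {p'}))" using B m.mono[of B "A \<union> (P - {p'})"] p' by blast
      then have "p' \<in> mcl (A \<union> (P - {p'}))" using m.trans1 * by auto
      then show False using P0(2) p' by blast
    qed
    then show ?thesis using P0(1) B(2) by (intro exI[of _ "P0 \<union> B"]) auto
  qed
qed

text \<open>The constants of \<open>T\<close> are collected in \<open>A\<close> and its slots in
  \<open>K\<close>, uniformly in the environment. This links predicates with parameters to the
  parameter-free \<open>mcl\<close>, with a fixed bound on the number of entries used.\<close>

lemma definable_fibre_mcl:
  assumes "DL T"
  shows "\<exists>A K. finite A \<and> finite K \<and> dep K T \<and> (\<forall>e w y. T (e(w := y)) \<longrightarrow> finite {a. T (e(w := a))} \<longrightarrow> y \<in> mcl (A \<union> e ` (K - {w})))"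
proof -
  obtain \<phi> \<tau> where 1: "\<And>k c. k \<in> fv \<phi> \<Longrightarrow> \<tau> k = Inr c \<Longrightarrow> c \<in> UNIV" "\<And>e. T e \<longleftrightarrow> sat F R (asg \<tau> e) \<phi>"
    using D_E[OF assms] by blast
  \<comment> \<open>The former constants are read from odd slots, so that \<open>T0\<close> is
    definable without parameters.\<close>
  define \<tau>' :: "nat \<Rightarrow> nat + 'a" where "\<tau>' k = (case \<tau> k of Inl j \<Rightarrow> Inl (2*j) | Inr c \<Rightarrow> Inl (2*k+1))" for k
  define T0 where "T0 e \<longleftrightarrow> sat F R (asg \<tau>' e) \<phi>" for e
  have T0: "D F R {} T0" unfolding T0_def by (rule D_sat) (auto simp: \<tau>'_def split: sum.splits)
  define A where "A = projr ` \<tau> ` fv \<phi>"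
  define K where "K = projl ` \<tau> ` fv \<phi>"
  define c where "c k = (if k \<in> fv \<phi> then projr (\<tau> k) else 0)" for k
  define mix where "mix e m = (if even m then e (m div 2) else c (m div 2))" for e :: "nat \<Rightarrow> 'a" and m
  have T: "T e = T0 (mix e)" for e unfolding 1(2) T0_def
    by (rule sat_cong) (auto simp: asg_def \<tau>'_def mix_def c_def split: sum.splits)
  have K0: "dep (((\<lambda>j. 2*j) ` K) \<union> ((\<lambda>k. 2*k+1) ` fv \<phi>)) T0" unfolding dep_def T0_def
  proof (intro allI impI sat_cong)
    fix e e' :: "nat \<Rightarrow> 'a" and i assume a: "\<forall>k\<in>((\<lambda>j. 2*j) ` K) \<union> ((\<lambda>k. 2*k+1) ` fv \<phi>). e k = e' k" "i \<in> fv \<phi>"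
    have "\<tau> i = Inl j \<Longrightarrow> j \<in> K" for j using a(2) unfolding K_def by force
    then show "asg \<tau>' e i = asg \<tau>' e' i" using a by (auto simp: asg_def \<tau>'_def split: sum.splits)
  qed
  have dK: "dep K T" unfolding dep_def
  proof (intro allI impI)
    fix e e' :: "nat \<Rightarrow> 'a" assume "\<forall>k\<in>K. e k = e' k"
    then show "T e = T e'" unfolding T by (intro depD[OF K0]) (auto simp: mix_def)
  qed
  have "y \<in> mcl (A \<union> e ` (K - {w}))" if y: "T (e(w := y))" "finite {a. T (e(w := a))}" for e w y
  proof -
    have mixu: "mix (e(w := b)) = (mix e)(2*w := b)" for b by (rule ext) (auto simp: mix_def)
    have "(\<lambda>_. y) \<in> acl {} (principal {()}) ((\<lambda>a _. a) ` (A \<union> e ` (K - {w})))"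
    proof (rule acl_I[OF T0 K0, of "2*w" "\<lambda>k _. mix e k"])
      show "(\<lambda>_. mix e k) \<in> insert (\<lambda>_. 0) ((\<lambda>a _. a) ` (A \<union> e ` (K - {w})))"
        if "k \<in> ((\<lambda>j. 2*j) ` K) \<union> ((\<lambda>k. 2*k+1) ` fv \<phi>)" "k \<noteq> 2*w" for k
        using that by (auto simp: mix_def A_def c_def)
      show "eventually (\<lambda>i. T0 ((\<lambda>k. mix e k)(2*w := y)) \<and> finite {a. T0 ((\<lambda>k. mix e k)(2*w := a))}) (principal {()})"
        using y by (simp add: eventually_principal T mixu)
    qed
    then show ?thesis by (simp add: mcl_def)
  qed
  moreover have "finite A" "finite K" by (simp_all add: A_def K_def finite_fv)
  ultimately show ?thesis using dK by blast
qed

text \<open>The elements are chosen one by one, each below what is left of \<open>\<epsilon>\<close>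
  and below all positive points of \<open>P0\<close>, which keeps it outside
  \<open>P0\<close>.\<close>

lemma small_sums:
  "finite P0 \<Longrightarrow> \<epsilon> > 0 \<Longrightarrow> \<exists>S\<subseteq>P - P0. finite S \<and> card S = n \<and> (\<forall>s\<in>S. 0 < s) \<and> \<Sum>S < \<epsilon>"
proof (induction n arbitrary: P0 \<epsilon>)
  case 0 then show ?case by (intro exI[of _ "{}"]) auto
next
  case (Suc n)
  define \<delta> where "\<delta> = Min (insert \<epsilon> {p \<in> P0. 0 < p})"
  have "\<delta> > 0" unfolding \<delta>_def using Suc(2,3) by (subst Min_gr_iff) auto
  then obtain p where p: "p \<in> P" "0 < p" "p < \<delta>" using Pdense by blast
  have le: "\<delta> \<le> \<epsilon>" "\<And>x. x \<in> P0 \<Longrightarrow> 0 < x \<Longrightarrow> \<delta> \<le> x" unfolding \<delta>_def using Suc(2) by (auto intro: Min_le)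
  have "p \<notin> P0" using p le(2) by (meson leD)
  obtain S where S: "S \<subseteq> P - insert p P0" "finite S" "card S = n" "\<forall>s\<in>S. 0 < s" "\<Sum>S < \<epsilon> - p"
    using Suc.IH[of "insert p P0" "\<epsilon> - p"] Suc(2) less_le_trans[OF p(3) le(1)] by auto
  have "p \<notin> S" using S(1) by blast
  then have "\<Sum>(insert p S) < \<epsilon>" "card (insert p S) = Suc n" using S by (auto simp: algebra_simps)
  then show ?case using S p \<open>p \<notin> P0\<close> by (intro exI[of _ "insert p S"]) auto
qed

text \<open>A point c + p0 + ... + pm with distinct non-exceptional p0, ..., pm depends on all of the
  pi, so it is not in the closure of c together with m elements of P.\<close>

lemma codense:
  assumes "finite A" "u < v"
  shows "\<exists>y. u < y \<and> y < v \<and> (\<forall>Q\<subseteq>P. finite Q \<longrightarrow> card Q \<le> m \<longrightarrow> y \<notin> mcl (A \<union> Q))"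
proof -
  obtain c where c: "u < c" "c < v" using dens[OF assms(2)] by blast
  obtain P0 where P0: "finite P0" "\<And>p. p \<in> P - P0 \<Longrightarrow> p \<notin> mcl (insert c A \<union> (P - {p}))"
    using exceptional_points[of "insert c A"] assms(1) by blast
  obtain S where S: "S \<subseteq> P - P0" "finite S" "card S = Suc m" "\<forall>s\<in>S. 0 < s" "\<Sum>S < v - c"
    using small_sums[OF P0(1), of "v - c" "Suc m"] c by auto
  have "\<Sum>S \<ge> 0" using S(4) by (intro sum_nonneg) (auto intro: less_imp_le)
  define y where "y = c + \<Sum>S"
  have y: "u < y" "y < v" using c S(5) \<open>\<Sum>S \<ge> 0\<close> by (auto simp: y_def algebra_simps intro: less_le_trans)
  have "y \<notin> mcl (A \<union> Q)" if Q: "Q \<subseteq> P" "finite Q" "card Q \<le> m" for Q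
  proof
    assume yQ: "y \<in> mcl (A \<union> Q)"
    have "\<not> S \<subseteq> Q" using card_mono[OF Q(2), of S] S(3) Q(3) by auto
    then obtain p where p: "p \<in> S" "p \<notin> Q" by blast
    let ?B = "insert c A \<union> (P - {p})"
    have "y \<in> mcl ?B" using yQ m.mono[of "A \<union> Q" ?B] Q(1) p(2) by blast
    moreover have "c \<in> mcl ?B" by (rule m.mem) simp
    moreover have "\<Sum>(S - {p}) \<in> mcl ?B" by (rule mcl_sum) (use S m.extensive[of ?B] in auto)
    ultimately have "y - c - \<Sum>(S - {p}) \<in> mcl ?B" by (intro mcl_diff)
    moreover have "y - c - \<Sum>(S - {p}) = p" unfolding y_def using sum.remove[OF S(2) p(1), of "\<lambda>x. x"] by simp
    ultimately show False using P0(2)[of p] p(1) S(1) by auto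
  qed
  then show ?thesis using y by blast
qed

section \<open>Elements of P modulo an ultrafilter\<close>

definition Pst :: "'i filter \<Rightarrow> ('i \<Rightarrow> 'a) set" where
  "Pst U = {f. eventually (\<lambda>i. f i \<in> P) U}"

definition nonconst :: "'i filter \<Rightarrow> ('i \<Rightarrow> 'a) \<Rightarrow> bool" where
  "nonconst U f \<longleftrightarrow> (\<forall>c. \<not> eventually (\<lambda>i. f i = c) U)"

text \<open>Pointwise this is independence of \<open>P\<close> away from the finitely many points
  that are exceptional for the constants involved; a nonconstant \<open>q\<close> avoids those
  points almost everywhere.\<close>

lemma Pst_independent:
  assumes U: "ultra U" and q: "q \<in> Pst U" "nonconst U q"
    and B: "\<And>b. b \<in> B \<Longrightarrow> b \<in> Pst U \<and> \<not> eventually (\<lambda>i. b i = q i) U"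
  shows "q \<notin> Acl U B"
proof
  assume "q \<in> Acl U B"
  then obtain Q e K0 where Q: "DL Q" "\<And>e. finite {a. Q (e(0 := a))}" "\<And>k. e k \<in> insert (\<lambda>_. 0) B"
    "eventually (\<lambda>i. Q ((\<lambda>k. e k i)(0 := q i))) U" by (rule acl_E) blast
  obtain A K where A: "finite A" "finite K"
    "\<And>e w y. T w \<Longrightarrow> Q (e(w := y)) \<Longrightarrow> finite {a. Q (e(w := a))} \<Longrightarrow> y \<in> mcl (A \<union> e ` (K - {w}))" for T :: "nat \<Rightarrow> bool"
    using definable_fibre_mcl[OF Q(1)] by metis
  obtain P0 where P0: "finite P0" "\<And>p. p \<in> P - P0 \<Longrightarrow> p \<notin> mcl (A \<union> (P - {p}))"
    using exceptional_points[OF A(1)] by blast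
  have e1: "eventually (\<lambda>i. \<forall>c\<in>P0. q i \<noteq> c) U"
    using q(2) ultra_not[OF U] by (intro eventually_ball_finite P0(1)) (auto simp: nonconst_def)
  have e2: "eventually (\<lambda>i. \<forall>k\<in>K. e k i = 0 \<or> e k i \<in> P - {q i}) U"
  proof (intro eventually_ball_finite A(2) ballI)
    fix k
    show "eventually (\<lambda>i. e k i = 0 \<or> e k i \<in> P - {q i}) U"
    proof (cases "e k = (\<lambda>_. 0)")
      case False
      then have "e k \<in> Pst U" "eventually (\<lambda>i. e k i \<noteq> q i) U" using Q(3)[of k] B ultra_not[OF U] by auto
      then show ?thesis unfolding Pst_def mem_Collect_eq by eventually_elim auto
    qed simp
  qed
  have "eventually (\<lambda>i. False) U"
    using Q(4) e1 e2 q(1)[unfolded Pst_def mem_Collect_eq]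
  proof eventually_elim
    case (elim i)
    have "q i \<in> mcl (A \<union> (\<lambda>k. e k i) ` (K - {0}))"
      by (rule A(3)[of "\<lambda>_. True"]) (use elim Q(2) in auto)
    moreover have "A \<union> (\<lambda>k. e k i) ` (K - {0}) \<subseteq> mcl (A \<union> (P - {q i}))"
      using elim(3) mcl_zero m.extensive[of "A \<union> (P - {q i})"] by fastforce
    ultimately have "q i \<in> mcl (A \<union> (P - {q i}))" using m.cls_subset by blast
    then show ?case using P0(2)[of "q i"] elim by blast
  qed
  then show False using U by (simp add: ultra_const)
qed

end

section \<open>Transfer between ultrafilters\<close>

text \<open>Equality of the types on the coordinates in \<open>X\<close> for all predicates, not
  only for definable ones. It records that an ultrafilter was changed outside \<open>X\<close>
  only.\<close>

definition coin :: "(nat \<Rightarrow> 'a) filter \<Rightarrow> (nat \<Rightarrow> 'a) filter \<Rightarrow> nat set \<Rightarrow> bool" where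
  "coin E V X \<longleftrightarrow> (\<forall>Q. dep X Q \<longrightarrow> (eventually Q E \<longleftrightarrow> eventually Q V))"

lemma coinD: "coin E V X \<Longrightarrow> dep X Q \<Longrightarrow> eventually Q E \<longleftrightarrow> eventually Q V"
  unfolding coin_def by blast

lemma coin_sym: "coin E V X \<Longrightarrow> coin V E X"
  unfolding coin_def by blast

lemma coin_trans: "coin E V X \<Longrightarrow> coin V W X \<Longrightarrow> coin E W X"
  unfolding coin_def by blast

lemma dep_mono: "dep X Q \<Longrightarrow> X \<subseteq> Y \<Longrightarrow> dep Y Q"
  unfolding dep_def by blast

lemma coin_mono: "coin E V Y \<Longrightarrow> X \<subseteq> Y \<Longrightarrow> coin E V X"
  unfolding coin_def using dep_mono by blast

lemma coin_filtermap:
  assumes "\<And>e k. k \<in> X \<Longrightarrow> g e k = e k"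
  shows "coin E (filtermap g E) X"
  unfolding coin_def
proof (intro allI impI)
  fix Q :: "(nat \<Rightarrow> 'a) \<Rightarrow> bool" assume "dep X Q"
  then have "Q (g e) = Q e" for e by (rule depD) (rule assms)
  then show "eventually Q E \<longleftrightarrow> eventually Q (filtermap g E)" by (simp add: eventually_filtermap)
qed

abbreviation (input) vr :: "nat \<Rightarrow> (nat \<Rightarrow> 'a) \<Rightarrow> 'a" where "vr k \<equiv> \<lambda>e. e k"

definition mix :: "(nat \<Rightarrow> 'a) \<Rightarrow> (nat \<Rightarrow> 'a) \<Rightarrow> nat \<Rightarrow> 'a" where
  "mix e \<rho> m = (if even m then e (m div 2) else \<rho> (m div 2))"

lemma mix_upd: "mix (e(w := a)) \<rho> = (mix e \<rho>)(2*w := a)"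
  by (rule ext) (auto simp: mix_def)

context omin begin

lemma acl_transfer:
  assumes "x k \<in> Acl U (x ` Y)"
    and tr: "\<And>R'. DL R' \<Longrightarrow> dep (insert k Y) R' \<Longrightarrow> eventually (\<lambda>i. R' (\<lambda>k. x k i)) U
      \<Longrightarrow> eventually (\<lambda>i. R' (\<lambda>k. x' k i)) U'"
  shows "x' k \<in> Acl U' (x' ` Y)"
proof (cases "k \<in> Y")
  case True then show ?thesis by (intro acl_ext) blast
next
  case False
  obtain T where T: "DL T" "\<forall>f. finite {a. T (f(k := a))}" "dep (insert k Y) T" "eventually (\<lambda>i. T (\<lambda>k. x k i)) U"
    using acl_nf[OF False, of x U] assms(1) by blast
  then show ?thesis using acl_nf[OF False, of x' U'] tr[OF T(1,3,4)] by blast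
qed

lemma acl_filtermap:
  "b \<in> acl C (filtermap g U) B \<longleftrightarrow> (\<lambda>i. b (g i)) \<in> acl C U ((\<lambda>f i. f (g i)) ` B)"
proof
  assume "b \<in> acl C (filtermap g U) B"
  then obtain Q e K where Q: "D F R C Q" "\<And>e. finite {a. Q (e(0 := a))}" "\<And>m. e m \<in> insert (\<lambda>_. 0) B"
    "eventually (\<lambda>i. Q ((\<lambda>m. e m i)(0 := b i))) (filtermap g U)" by (rule acl_E) blast
  show "(\<lambda>i. b (g i)) \<in> acl C U ((\<lambda>f i. f (g i)) ` B)"
  proof (rule acl_I0[OF Q(1,2), of "\<lambda>m i. e m (g i)"])
    show "(\<lambda>i. e k (g i)) \<in> insert (\<lambda>_. 0) ((\<lambda>f i. f (g i)) ` B)" for k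
      using Q(3)[of k] by (cases "e k = (\<lambda>_. 0)") auto
    show "eventually (\<lambda>i. Q ((\<lambda>k. e k (g i))(0 := b (g i)))) U" using Q(4) by (simp add: eventually_filtermap)
  qed
next
  assume "(\<lambda>i. b (g i)) \<in> acl C U ((\<lambda>f i. f (g i)) ` B)"
  then obtain Q e K where Q: "D F R C Q" "\<And>e. finite {a. Q (e(0 := a))}" "\<And>m. e m \<in> insert (\<lambda>_. 0) ((\<lambda>f i. f (g i)) ` B)"
    "eventually (\<lambda>i. Q ((\<lambda>m. e m i)(0 := b (g i)))) U" by (rule acl_E) blast
  have "\<exists>f\<in>insert (\<lambda>_. 0) B. \<forall>i. e m i = f (g i)" for m using Q(3)[of m] by auto
  then obtain h where h: "\<And>m. h m \<in> insert (\<lambda>_. 0) B" "\<And>m i. e m i = h m (g i)" by metis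
  have "eventually (\<lambda>i. Q ((\<lambda>m. h m i)(0 := b i))) (filtermap g U)"
    using Q(4) by (simp add: eventually_filtermap h(2))
  then show "b \<in> acl C (filtermap g U) B" by (rule acl_I0[OF Q(1,2) h(1)])
qed

end

context omin_pair begin

lemma P_nonempty: "\<exists>p. p \<in> P"
  using Pdense ex_pos by blast

text \<open>Even slots carry the tuple, odd slots arbitrary elements of \<open>P\<close>. When
  \<open>T\<close> has finite fibres at an even slot, \<open>bad T\<close> says that the entry there
  is algebraic over \<open>P\<close> and the other entries by way of \<open>T\<close>.\<close>

definition bad :: "((nat \<Rightarrow> 'a) \<Rightarrow> bool) \<Rightarrow> (nat \<Rightarrow> 'a) \<Rightarrow> bool" where
  "bad T e \<longleftrightarrow> (\<exists>\<rho>. range \<rho> \<subseteq> P \<and> T (mix e \<rho>))"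

text \<open>The elements of \<open>Pst U\<close> occurring in a witness are absorbed by an
  existential quantifier over sequences in \<open>P\<close>, so algebraicity over them becomes a
  property of the tuple alone; conversely the sequences are chosen index by index.\<close>

lemma aclP_nf:
  assumes "w \<notin> Y"
  shows "x w \<in> Acl U (Pst U \<union> x ` Y) \<longleftrightarrow> (\<exists>T. DL T \<and> (\<forall>f. finite {a. T (f(2*w := a))}) \<and>
     dep ((\<lambda>j. 2*j) ` insert w Y \<union> {m. odd m}) T \<and> eventually (\<lambda>i. \<exists>\<rho>. range \<rho> \<subseteq> P \<and> T (mix (\<lambda>k. x k i) \<rho>)) U)" (is "_ \<longleftrightarrow> ?R")
proof
  assume "x w \<in> Acl U (Pst U \<union> x ` Y)"
  then obtain Q e K where Q: "DL Q" "\<And>e. finite {a. Q (e(0 := a))}" "\<And>m. e m \<in> insert (\<lambda>_. 0) (Pst U \<union> x ` Y)"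
    "eventually (\<lambda>i. Q ((\<lambda>m. e m i)(0 := x w i))) U" "finite K" "dep K Q" by (rule acl_E) blast
  define j where "j m = (SOME j. j \<in> Y \<and> e m = x j)" for m
  have j: "j m \<in> Y \<and> e m = x (j m)" if "e m \<in> x ` Y" for m
    unfolding j_def using that by (intro someI_ex[of "\<lambda>j. j \<in> Y \<and> e m = x j"]) auto
  define \<tau> :: "nat \<Rightarrow> nat + 'a" where "\<tau> m = (if m = 0 then Inl (2*w) else if e m = (\<lambda>_. 0) then Inr 0
     else if e m \<in> x ` Y then Inl (2 * j m) else Inl (2*m+1))" for m
  define T where "T f \<longleftrightarrow> Q (asg \<tau> f)" for f
  have "DL T" unfolding T_def by (rule D_sub[OF Q(1)]) simp
  moreover have "finite {a. T (f(2*w := a))}" for f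
  proof -
    have ne: "j m \<noteq> w" if "e m \<in> x ` Y" for m using j[OF that] assms by auto
    have "asg \<tau> (f(2*w := a)) = (asg \<tau> f)(0 := a)" for a
      using ne by (auto simp: asg_def \<tau>_def fun_eq_iff; presburger)
    then show ?thesis unfolding T_def using Q(2) by simp
  qed
  moreover have "dep ((\<lambda>j. 2*j) ` insert w Y \<union> {m. odd m}) T" unfolding dep_def T_def
  proof (intro allI impI)
    fix f f' :: "nat \<Rightarrow> 'a" assume "\<forall>k\<in>(\<lambda>j. 2*j) ` insert w Y \<union> {m. odd m}. f k = f' k"
    then have "asg \<tau> f = asg \<tau> f'" using j by (auto simp: asg_def \<tau>_def fun_eq_iff)
    then show "Q (asg \<tau> f) = Q (asg \<tau> f')" by simp
  qed
  moreover have "eventually (\<lambda>i. \<exists>\<rho>. range \<rho> \<subseteq> P \<and> T (mix (\<lambda>k. x k i) \<rho>)) U"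
  proof -
    obtain p0 where p0: "p0 \<in> P" using P_nonempty by blast
    have "eventually (\<lambda>i. \<forall>m\<in>K. e m \<in> Pst U \<longrightarrow> e m i \<in> P) U"
      by (intro eventually_ball_finite Q(5)) (auto simp: Pst_def)
    with Q(4) show ?thesis
    proof eventually_elim
      case (elim i)
      define \<rho> where "\<rho> m = (if m \<in> K \<and> e m \<in> Pst U then e m i else p0)" for m
      have "Q (asg \<tau> (mix (\<lambda>k. x k i) \<rho>)) = Q ((\<lambda>m. e m i)(0 := x w i))"
      proof (rule depD[OF Q(6)])
        fix m assume "m \<in> K"
        then show "asg \<tau> (mix (\<lambda>k. x k i) \<rho>) m = ((\<lambda>m. e m i)(0 := x w i)) m"
          using Q(3)[of m] j[of m] by (auto simp: asg_def \<tau>_def mix_def \<rho>_def)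
      qed
      then show ?case unfolding T_def using elim p0 by (intro exI[of _ \<rho>]) (auto simp: \<rho>_def)
    qed
  qed
  ultimately show ?R
    by blast
next
  assume ?R
  then obtain T where T: "DL T" "\<And>f. finite {a. T (f(2*w := a))}"
     "dep ((\<lambda>j. 2*j) ` insert w Y \<union> {m. odd m}) T"
     "eventually (\<lambda>i. \<exists>\<rho>. range \<rho> \<subseteq> P \<and> T (mix (\<lambda>k. x k i) \<rho>)) U" by blast
  define r where "r i = (SOME \<rho>. range \<rho> \<subseteq> P \<and> T (mix (\<lambda>k. x k i) \<rho>))" for i
  have r: "eventually (\<lambda>i. range (r i) \<subseteq> P \<and> T (mix (\<lambda>k. x k i) (r i))) U"
    using T(4)
  proof eventually_elim
    case (elim i)
    then show ?case unfolding r_def by (rule someI_ex)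
  qed
  define e where "e m = (if even m then x (m div 2) else (\<lambda>i. r i (m div 2)))" for m
  show "x w \<in> Acl U (Pst U \<union> x ` Y)"
  proof (rule acl_I[OF T(1,3), of "2*w" e])
    fix k assume k: "k \<in> (\<lambda>j. 2*j) ` insert w Y \<union> {m. odd m}" "k \<noteq> 2*w"
    show "e k \<in> insert (\<lambda>_. 0) (Pst U \<union> x ` Y)"
    proof (cases "even k")
      case True
      then have "k div 2 \<in> Y" using k by auto
      then show ?thesis using True by (simp add: e_def)
    next
      case False
      have "(\<lambda>i. r i (k div 2)) \<in> Pst U" unfolding Pst_def mem_Collect_eq using r by eventually_elim auto
      then show ?thesis using False by (simp add: e_def)
    qed
  next
    have "(\<lambda>k. e k i)(2*w := x w i) = mix (\<lambda>k. x k i) (r i)" for i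
      by (auto simp: e_def mix_def fun_eq_iff)
    then show "eventually (\<lambda>i. T ((\<lambda>k. e k i)(2*w := x w i)) \<and> finite {a. T ((\<lambda>k. e k i)(2*w := a))}) U"
      using r T(2) by (simp add: eventually_conj_iff)
  qed
qed

lemma aclP_transfer:
  assumes "x k \<in> Acl U (Pst U \<union> x ` Y)"
    and tr: "\<And>R'. dep (insert k Y) R' \<Longrightarrow> eventually (\<lambda>i. R' (\<lambda>k. x k i)) U \<Longrightarrow> eventually (\<lambda>i. R' (\<lambda>k. x' k i)) U'"
  shows "x' k \<in> Acl U' (Pst U' \<union> x' ` Y)"
proof (cases "k \<in> Y")
  case True then show ?thesis by (intro acl_ext) blast
next
  case False
  obtain T where T: "DL T" "\<And>f. finite {a. T (f(2*k := a))}"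
     "dep ((\<lambda>j. 2*j) ` insert k Y \<union> {m. odd m}) T"
     "eventually (\<lambda>i. \<exists>\<rho>. range \<rho> \<subseteq> P \<and> T (mix (\<lambda>k. x k i) \<rho>)) U" using aclP_nf[OF False, of x U] assms(1) by blast
  have "eventually (\<lambda>i. \<exists>\<rho>. range \<rho> \<subseteq> P \<and> T (mix (\<lambda>k. x' k i) \<rho>)) U'"
  proof (rule tr[of "\<lambda>f. \<exists>\<rho>. range \<rho> \<subseteq> P \<and> T (mix f \<rho>)"])
    show "dep (insert k Y) (\<lambda>f. \<exists>\<rho>. range \<rho> \<subseteq> P \<and> T (mix f \<rho>))" unfolding dep_def
    proof (intro allI impI)
      fix f f' :: "nat \<Rightarrow> 'a" assume a: "\<forall>m\<in>insert k Y. f m = f' m"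
      have "T (mix f \<rho>) = T (mix f' \<rho>)" for \<rho> by (rule depD[OF T(3)]) (use a in \<open>auto simp: mix_def\<close>)
      then show "(\<exists>\<rho>. range \<rho> \<subseteq> P \<and> T (mix f \<rho>)) = (\<exists>\<rho>. range \<rho> \<subseteq> P \<and> T (mix f' \<rho>))" by simp
    qed
  qed (rule T(4))
  then show ?thesis using aclP_nf[OF False, of x' U'] T by blast
qed

abbreviation rkU :: "'i filter \<Rightarrow> ('i \<Rightarrow> 'a) set \<Rightarrow> ('i \<Rightarrow> 'a) list \<Rightarrow> nat" where
  "rkU U \<equiv> pregeometry.rk (Acl U)"

abbreviation rkP :: "'i filter \<Rightarrow> ('i \<Rightarrow> 'a) list \<Rightarrow> nat" where
  "rkP U \<equiv> rkU U (Pst U)"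

lemma rkP_transfer:
  assumes "ultra U" "ultra U'"
    and "\<And>R'. dep (Y \<union> set ks) R' \<Longrightarrow> eventually (\<lambda>i. R' (\<lambda>k. x k i)) U \<longleftrightarrow> eventually (\<lambda>i. R' (\<lambda>k. x' k i)) U'"
  shows "rkU U (Pst U \<union> x ` Y) (map x ks) = rkU U' (Pst U' \<union> x' ` Y) (map x' ks)"
  using assms(3)
proof (induction ks arbitrary: Y)
  case Nil
  interpret u: pregeometry "Acl U" by (rule acl_pregeometry[OF assms(1)])
  interpret u': pregeometry "Acl U'" by (rule acl_pregeometry[OF assms(2)])
  show ?case by simp
next
  case (Cons k ks)
  interpret u: pregeometry "Acl U" by (rule acl_pregeometry[OF assms(1)])
  interpret u': pregeometry "Acl U'" by (rule acl_pregeometry[OF assms(2)])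
  have "rkU U (Pst U \<union> x ` insert k Y) (map x ks) = rkU U' (Pst U' \<union> x' ` insert k Y) (map x' ks)"
    by (rule Cons.IH) (use Cons.prems in auto)
  moreover have "x k \<in> Acl U (Pst U \<union> x ` Y) \<longleftrightarrow> x' k \<in> Acl U' (Pst U' \<union> x' ` Y)"
  proof
    assume "x k \<in> Acl U (Pst U \<union> x ` Y)"
    then show "x' k \<in> Acl U' (Pst U' \<union> x' ` Y)"
      by (rule aclP_transfer) (use Cons.prems dep_mono[of "insert k Y" _ "Y \<union> set (k # ks)"] in auto)
  next
    assume "x' k \<in> Acl U' (Pst U' \<union> x' ` Y)"
    then show "x k \<in> Acl U (Pst U \<union> x ` Y)"
      by (rule aclP_transfer) (use Cons.prems dep_mono[of "insert k Y" _ "Y \<union> set (k # ks)"] in auto)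
  qed
  ultimately show ?case by simp
qed

section \<open>Presented types\<close>

text \<open>The invariant of the back-and-forth. Independence of \<open>bs\<close> is demanded over
  all of \<open>Pst E\<close>, not just over \<open>S\<close>, so that no further element of
  \<open>P\<close> is hidden in the closure of \<open>S\<close> and \<open>bs\<close>; see
  \<open>pres_new_P\<close>.\<close>

definition pres :: "(nat \<Rightarrow> 'a) filter \<Rightarrow> nat set \<Rightarrow> nat set \<Rightarrow> nat list \<Rightarrow> bool" where
  "pres E X S bs \<longleftrightarrow> finite X \<and> S \<subseteq> X \<and> set bs \<subseteq> X \<and>
     (\<forall>k\<in>S. vr k \<in> Pst E \<and> nonconst E (vr k)) \<and>
     (\<forall>k\<in>S. \<forall>k'\<in>S. k \<noteq> k' \<longrightarrow> \<not> eventually (\<lambda>e. e k = e k') E) \<and>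
     rkP E (map vr bs) = length bs \<and>
     (\<forall>k\<in>X. vr k \<in> Acl E (vr ` (S \<union> set bs)))"

text \<open>Equality of the types in the o-minimal structure on \<open>X\<close>; by
  \<open>agree_sym\<close> one implication carries the other, since ultrafilters decide
  negations.\<close>

definition agree :: "(nat \<Rightarrow> 'a) filter \<Rightarrow> (nat \<Rightarrow> 'a) filter \<Rightarrow> nat set \<Rightarrow> bool" where
  "agree E V X \<longleftrightarrow> (\<forall>Q. DL Q \<longrightarrow> dep X Q \<longrightarrow> eventually Q E \<longrightarrow> eventually Q V)"

lemma agreeD: "agree E V X \<Longrightarrow> DL Q \<Longrightarrow> dep X Q \<Longrightarrow> eventually Q E \<Longrightarrow> eventually Q V"
  unfolding agree_def by blast

lemma dep_not: "dep X Q \<Longrightarrow> dep X (\<lambda>e. \<not> Q e)"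
  unfolding dep_def by blast

lemma agree_sym: assumes "ultra E" "ultra V" "agree E V X" shows "agree V E X"
  unfolding agree_def
proof (intro allI impI)
  fix Q assume Q: "DL Q" "dep X Q" "eventually Q V"
  show "eventually Q E"
  proof (rule ccontr)
    assume "\<not> eventually Q E"
    then have "eventually (\<lambda>e. \<not> Q e) E" using ultra_not[OF assms(1)] by blast
    then have "eventually (\<lambda>e. \<not> Q e) V" by (rule agreeD[OF assms(3) D_not[OF Q(1)] dep_not[OF Q(2)]])
    then show False using ultra_not[OF assms(2)] Q(3) by blast
  qed
qed

lemma agree_coin_left: "agree E V X \<Longrightarrow> coin E E' X \<Longrightarrow> agree E' V X"
  unfolding agree_def coin_def by blast

lemma acl_agree:
  assumes "agree E V X" "insert k Y \<subseteq> X" "vr k \<in> Acl E (vr ` Y)"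
  shows "vr k \<in> Acl V (vr ` Y)"
  by (rule acl_transfer[OF assms(3)]) (use agreeD[OF assms(1)] dep_mono[OF _ assms(2)] in auto)

lemma coin_agree: "coin E V X \<Longrightarrow> agree E V X"
  unfolding agree_def coin_def by blast

lemma dep_eq: "i \<in> X \<Longrightarrow> j \<in> X \<Longrightarrow> dep X (\<lambda>e. e i = e j)"
  unfolding dep_def by auto

lemma dep_eqc: "i \<in> X \<Longrightarrow> dep X (\<lambda>e. e i = c)"
  unfolding dep_def by auto

lemma rkP_coin:
  assumes "ultra E" "ultra V" "coin E V X" "set bs \<subseteq> X"
  shows "rkP E (map vr bs) = rkP V (map vr bs)"
  using rkP_transfer[OF assms(1,2), of "{}" bs vr vr] coinD[OF assms(3) dep_mono[OF _ assms(4)]] by simp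

lemma pres_coin:
  assumes "ultra E" "ultra V" "coin E V X" "pres E X S bs" shows "pres V X S bs"
proof -
  have X: "finite X" "S \<subseteq> X" "set bs \<subseteq> X" using assms(4) by (auto simp: pres_def)
  have "vr k \<in> Acl V (vr ` (S \<union> set bs))" if "k \<in> X" for k
    by (rule acl_agree[OF coin_agree[OF assms(3)]]) (use that assms(4) X in \<open>auto simp: pres_def\<close>)
  moreover have "vr k \<in> Pst V" if "k \<in> S" for k
  proof -
    have "dep X (\<lambda>e. e k \<in> P)" using that X unfolding dep_def by auto
    then show ?thesis using coinD[OF assms(3)] assms(4) that unfolding pres_def Pst_def by blast
  qed
  moreover have "nonconst V (vr k)" if "k \<in> S" for k
    using coinD[OF assms(3) dep_eqc, of k] that assms(4) X unfolding pres_def nonconst_def by auto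
  moreover have "\<not> eventually (\<lambda>e. e k = e k') V" if "k \<in> S" "k' \<in> S" "k \<noteq> k'" for k k'
    using coinD[OF assms(3) dep_eq, of k k'] that assms(4) X unfolding pres_def by auto
  moreover have "rkP V (map vr bs) = length bs"
    using rkP_coin[OF assms(1-3) X(3)] assms(4) by (simp add: pres_def)
  ultimately show ?thesis using X unfolding pres_def by blast
qed

text \<open>Independence of \<open>bs\<close> over \<open>Pst E\<close> lets \<open>bs\<close> be
  dropped from the closure; what remains is independence inside \<open>P\<close>. In the atomic case
  for \<open>P\<close> this confines the possible values to constants and slots of
  \<open>S\<close>.\<close>

lemma pres_new_P:
  assumes U: "ultra E" and p: "pres E X S bs" and q: "q \<in> Pst E" "nonconst E q"
    "\<And>k. k \<in> S \<Longrightarrow> \<not> eventually (\<lambda>e. q e = e k) E"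
  shows "q \<notin> Acl E (vr ` (S \<union> set bs))"
proof
  interpret u: pregeometry "Acl E" by (rule acl_pregeometry[OF U])
  assume a: "q \<in> Acl E (vr ` (S \<union> set bs))"
  have S: "vr ` S \<subseteq> Pst E" using p by (auto simp: pres_def)
  have "q \<in> Acl E (vr ` S)"
  proof (rule u.indep_drop)
    show "q \<in> Acl E (vr ` S \<union> set (map vr bs))" using a by (simp add: image_Un)
    have r: "u.rk (Pst E) (map vr bs) = length (map vr bs)" using p by (simp add: pres_def)
    have "insert q (vr ` S) \<subseteq> Acl E (Pst E)" using S q u.extensive[of "Pst E"] by blast
    from u.rk_indep_antimono[OF _ this, of "map vr bs"] r
    show "u.rk (insert q (vr ` S)) (map vr bs) = length (map vr bs)" by simp
  qed
  moreover have "q \<notin> Acl E (vr ` S)"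
    by (rule Pst_independent[OF U q(1,2)]) (use S q(3) in \<open>auto simp: eq_commute\<close>)
  ultimately show False by blast
qed

text \<open>Compactness for one coordinate: slot \<open>w\<close> is realised anew, subject to a
  directed family of conditions, while the type on all other slots is kept.\<close>

lemma fip_extension:
  assumes V: "ultra V" and ne: "\<F> \<noteq> {}"
    and dir: "\<And>Q S. Q \<in> \<F> \<Longrightarrow> S \<in> \<F> \<Longrightarrow> \<exists>T\<in>\<F>. \<forall>e. T e \<longrightarrow> Q e \<and> S e"
    and ex: "\<And>Q. Q \<in> \<F> \<Longrightarrow> eventually (\<lambda>e. \<exists>a. Q (e(w := a))) V"
  shows "\<exists>V'. ultra V' \<and> (\<forall>Q\<in>\<F>. eventually Q V') \<and> coin V V' (- {w})"
proof -
  define B where "B = {(\<lambda>e. Q e \<and> S e) | Q S. Q \<in> \<F> \<and> dep (- {w}) S \<and> eventually S V}"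
  have "\<exists>U. ultra U \<and> (\<forall>Q\<in>B. eventually Q U)"
  proof (rule ultra_from_base)
    have "dep (- {w}) (\<lambda>_. True)" by (simp add: dep_def)
    moreover obtain Q where "Q \<in> \<F>" using ne by blast
    ultimately have "(\<lambda>e. Q e \<and> True) \<in> B" unfolding B_def
      by (intro CollectI exI[of _ Q] exI[of _ "\<lambda>_. True"]) simp
    then show "B \<noteq> {}" by blast
    fix Q assume "Q \<in> B"
    then obtain Q1 S1 where 1: "Q = (\<lambda>e. Q1 e \<and> S1 e)" "Q1 \<in> \<F>" "dep (- {w}) S1" "eventually S1 V"
      by (auto simp: B_def)
    have "eventually (\<lambda>e. S1 e \<and> (\<exists>a. Q1 (e(w := a)))) V" by (intro eventually_conj 1 ex)
    then obtain e a where e: "S1 e" "Q1 (e(w := a))" using ultra_ex[OF V] by blast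
    have "S1 (e(w := a)) = S1 e" by (rule depD[OF 1(3)]) auto
    then show "\<exists>x. Q x" using 1(1) e by blast
    fix S assume "S \<in> B"
    then obtain Q2 S2 where 2: "S = (\<lambda>e. Q2 e \<and> S2 e)" "Q2 \<in> \<F>" "dep (- {w}) S2" "eventually S2 V"
      by (auto simp: B_def)
    obtain T where T: "T \<in> \<F>" "\<forall>e. T e \<longrightarrow> Q1 e \<and> Q2 e" using dir 1(2) 2(2) by blast
    have "dep (- {w}) (\<lambda>e. S1 e \<and> S2 e)" using 1(3) 2(3) unfolding dep_def by blast
    moreover have "eventually (\<lambda>e. S1 e \<and> S2 e) V" by (intro eventually_conj 1 2)
    ultimately have "(\<lambda>e. T e \<and> (S1 e \<and> S2 e)) \<in> B" using T(1) unfolding B_def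
      by (intro CollectI exI[of _ T] exI[of _ "\<lambda>e. S1 e \<and> S2 e"]) simp
    then show "\<exists>T\<in>B. \<forall>x. T x \<longrightarrow> Q x \<and> S x"
      by (rule rev_bexI) (use 1(1) 2(1) T(2) in auto)
  qed
  then obtain U where U: "ultra U" "\<And>Q. Q \<in> B \<Longrightarrow> eventually Q U" by blast
  have QU: "eventually Q U" if "Q \<in> \<F>" for Q
  proof -
    have "dep (- {w}) (\<lambda>_. True)" by (simp add: dep_def)
    then have "(\<lambda>e. Q e \<and> True) \<in> B" using that unfolding B_def
      by (intro CollectI exI[of _ Q] exI[of _ "\<lambda>_. True"]) simp
    from U(2)[OF this] show ?thesis by simp
  qed
  have SU: "eventually S U" if "dep (- {w}) S" "eventually S V" for S
  proof -
    obtain Q where "Q \<in> \<F>" using ne by blast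
    then have "(\<lambda>e. Q e \<and> S e) \<in> B" using that unfolding B_def by blast
    from U(2)[OF this] show ?thesis by (simp add: eventually_conj_iff)
  qed
  have "coin V U (- {w})" unfolding coin_def
  proof (intro allI impI iffI)
    fix S assume S: "dep (- {w}) S" "eventually S U"
    show "eventually S V"
    proof (rule ccontr)
      assume "\<not> eventually S V"
      then have "eventually (\<lambda>e. \<not> S e) U" using SU[OF dep_not[OF S(1)]] ultra_not[OF V] by blast
      then show False using ultra_not[OF U(1)] S(2) by blast
    qed
  qed (rule SU)
  then show ?thesis using U(1) QU by blast
qed

text \<open>Besides copying the type over \<open>X\<close>, the family \<open>\<G>\<close> imposes a
  requirement on the new coordinate: nothing, membership in \<open>P\<close> with independence, or
  genericity over \<open>P\<close>, according to the three steps below.\<close>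

lemma extend_agree:
  assumes V: "ultra V" and ne: "\<G> \<noteq> {}"
    and dir: "\<And>T S. T \<in> \<G> \<Longrightarrow> S \<in> \<G> \<Longrightarrow> \<exists>T'\<in>\<G>. \<forall>e. T' e \<longrightarrow> T e \<and> S e"
    and ex: "\<And>Q T. DL Q \<Longrightarrow> dep (insert w X) Q \<Longrightarrow> eventually Q E \<Longrightarrow> T \<in> \<G>
       \<Longrightarrow> eventually (\<lambda>e. \<exists>a. Q (e(w := a)) \<and> T (e(w := a))) V"
  shows "\<exists>V'. ultra V' \<and> coin V V' (- {w}) \<and> agree E V' (insert w X) \<and> (\<forall>T\<in>\<G>. eventually T V')"
proof -
  define \<F> where "\<F> = {(\<lambda>e. Q e \<and> T e) | Q T. DL Q \<and> dep (insert w X) Q \<and> eventually Q E \<and> T \<in> \<G>}"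
  have in\<F>: "(\<lambda>e. Q e \<and> T e) \<in> \<F>" if "DL Q" "dep (insert w X) Q" "eventually Q E" "T \<in> \<G>" for Q T
    unfolding \<F>_def using that by blast
  have tr: "DL (\<lambda>_. True)" "dep (insert w X) (\<lambda>_. True)" by (auto simp: D_True dep_def)
  have "\<exists>V'. ultra V' \<and> (\<forall>Q\<in>\<F>. eventually Q V') \<and> coin V V' (- {w})"
  proof (rule fip_extension[OF V])
    obtain T where "T \<in> \<G>" using ne by blast
    then show "\<F> \<noteq> {}" using in\<F>[OF tr] by auto
    fix Q assume "Q \<in> \<F>"
    then obtain Q1 T1 where 1: "Q = (\<lambda>e. Q1 e \<and> T1 e)" "DL Q1" "dep (insert w X) Q1" "eventually Q1 E" "T1 \<in> \<G>"
      by (auto simp: \<F>_def)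
    then show "eventually (\<lambda>e. \<exists>a. Q (e(w := a))) V" using ex by simp
    fix S assume "S \<in> \<F>"
    then obtain Q2 T2 where 2: "S = (\<lambda>e. Q2 e \<and> T2 e)" "DL Q2" "dep (insert w X) Q2" "eventually Q2 E" "T2 \<in> \<G>"
      by (auto simp: \<F>_def)
    obtain T where T: "T \<in> \<G>" "\<forall>e. T e \<longrightarrow> T1 e \<and> T2 e" using dir 1(5) 2(5) by blast
    have "dep (insert w X) (\<lambda>e. Q1 e \<and> Q2 e)" using 1(3) 2(3) unfolding dep_def by blast
    then have "(\<lambda>e. (Q1 e \<and> Q2 e) \<and> T e) \<in> \<F>"
      by (intro in\<F> D_conj 1 2 eventually_conj T)
    then show "\<exists>T\<in>\<F>. \<forall>e. T e \<longrightarrow> Q e \<and> S e" by (rule rev_bexI) (use T(2) 1(1) 2(1) in auto)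
  qed
  then obtain V' where V': "ultra V'" "\<And>Q. Q \<in> \<F> \<Longrightarrow> eventually Q V'" "coin V V' (- {w})" by blast
  have "eventually T V'" if "T \<in> \<G>" for T using V'(2)[OF in\<F>[OF tr _ that]] by simp
  moreover have "agree E V' (insert w X)" unfolding agree_def
  proof (intro allI impI)
    fix Q assume Q: "DL Q" "dep (insert w X) Q" "eventually Q E"
    obtain T where "T \<in> \<G>" using ne by blast
    then have "eventually (\<lambda>e. Q e \<and> T e) V'" by (intro V'(2) in\<F> Q)
    then show "eventually Q V'" by (simp add: eventually_conj_iff)
  qed
  ultimately show ?thesis using V' by blast
qed

lemma dep_ex:
  fixes Q :: "(nat \<Rightarrow> 'a) \<Rightarrow> bool"
  shows "dep (insert w X) Q \<Longrightarrow> dep X (\<lambda>e. \<exists>a. Q (e(w := a)))"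
  "dep (insert w X) Q \<Longrightarrow> dep X (\<lambda>e. infinite {a. Q (e(w := a))})"
proof -
  assume d: "dep (insert w X) Q"
  have *: "Q (e(w := a)) = Q (e'(w := a))" if "\<forall>k\<in>X. e k = e' k" for e e' a
    by (rule depD[OF d]) (use that in auto)
  show "dep X (\<lambda>e. \<exists>a. Q (e(w := a)))" unfolding dep_def
  proof (intro allI impI)
    fix e e' :: "nat \<Rightarrow> 'a" assume h: "\<forall>k\<in>X. e k = e' k"
    show "(\<exists>a. Q (e(w := a))) = (\<exists>a. Q (e'(w := a)))" by (simp only: *[OF h])
  qed
  show "dep X (\<lambda>e. infinite {a. Q (e(w := a))})" unfolding dep_def
  proof (intro allI impI)
    fix e e' :: "nat \<Rightarrow> 'a" assume h: "\<forall>k\<in>X. e k = e' k"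
    show "infinite {a. Q (e(w := a))} = infinite {a. Q (e'(w := a))}" by (simp only: *[OF h])
  qed
qed

text \<open>If the fibres were finite almost everywhere, \<open>Q\<close> itself would witness that
  \<open>w\<close> is algebraic.\<close>

lemma generic_infinite:
  assumes E: "ultra E" and "vr w \<notin> Acl E (vr ` X)" "DL Q" "dep (insert w X) Q" "eventually Q E"
  shows "eventually (\<lambda>e. infinite {a. Q (e(w := a))}) E"
proof (rule ccontr)
  assume "\<not> ?thesis"
  then have "eventually (\<lambda>e. finite {a. Q (e(w := a))}) E" using ultra_not[OF E] by auto
  then have "eventually (\<lambda>e. Q ((\<lambda>k. vr k e)(w := vr w e)) \<and> finite {a. Q ((\<lambda>k. vr k e)(w := a))}) E"
    using assms(5) by eventually_elim simp
  then have "vr w \<in> Acl E (vr ` X)" by (rule acl_I[OF assms(3,4), rotated]) auto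
  then show False using assms(2) by blast
qed

lemma pres_acl:
  assumes "ultra E" "pres E X S bs"
  shows "Acl E (vr ` X) = Acl E (vr ` (S \<union> set bs))"
proof -
  interpret u: pregeometry "Acl E" by (rule acl_pregeometry[OF assms(1)])
  show ?thesis by (rule u.cls_cong) (use assms(2) u.extensive[of "vr ` X"] in \<open>auto simp: pres_def\<close>)
qed

lemma step_alg:
  assumes E: "ultra E" and V: "ultra V" and p: "pres E X S bs" "pres V X S bs" and ag: "agree E V X"
    and w: "w \<notin> X" "vr w \<in> Acl E (vr ` (S \<union> set bs))"
  shows "\<exists>V'. ultra V' \<and> coin V V' (- {w}) \<and> agree E V' (insert w X)
     \<and> pres E (insert w X) S bs \<and> pres V' (insert w X) S bs"
proof -
  have "\<exists>V'. ultra V' \<and> coin V V' (- {w}) \<and> agree E V' (insert w X) \<and> (\<forall>T\<in>{\<lambda>_. True}. eventually T V')"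
  proof (rule extend_agree[OF V])
    fix Q T assume Q: "DL Q" "dep (insert w X) Q" "eventually Q E" "T \<in> {\<lambda>_::nat \<Rightarrow> 'a. True}"
    have "eventually (\<lambda>e. \<exists>a. Q (e(w := a))) E"
      using Q(3) by (rule eventually_mono) (metis fun_upd_triv)
    then have "eventually (\<lambda>e. \<exists>a. Q (e(w := a))) V" by (rule agreeD[OF ag D_ex[OF Q(1)] dep_ex(1)[OF Q(2)]])
    then show "eventually (\<lambda>e. \<exists>a. Q (e(w := a)) \<and> T (e(w := a))) V" using Q(4) by simp
  qed auto
  then obtain V' where V': "ultra V'" "coin V V' (- {w})" "agree E V' (insert w X)" by blast
  have pV: "pres V' X S bs" by (rule pres_coin[OF V V'(1) coin_mono[OF V'(2)] p(2)]) (use w in auto)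
  have "vr w \<in> Acl V' (vr ` (S \<union> set bs))"
    by (rule acl_agree[OF V'(3) _ w(2)]) (use p(1) in \<open>auto simp: pres_def\<close>)
  then have "pres E (insert w X) S bs" "pres V' (insert w X) S bs"
    using p(1) pV w(2) unfolding pres_def by auto
  then show ?thesis using V' by blast
qed

text \<open>A definable condition on a non-algebraic coordinate holds on an interval even after
  finitely many points are removed, and \<open>P\<close> meets every interval. The new realisation
  is independent of all other slots, also of those outside \<open>X\<close>; this is what later
  contradicts functionality.\<close>

lemma step_P:
  assumes E: "ultra E" and V: "ultra V" and p: "pres E X S bs" "pres V X S bs" and ag: "agree E V X"
    and w: "w \<notin> X" "vr w \<in> Pst E" "nonconst E (vr w)" "\<And>k. k \<in> S \<Longrightarrow> \<not> eventually (\<lambda>e. e w = e k) E"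
  shows "\<exists>V'. ultra V' \<and> coin V V' (- {w}) \<and> agree E V' (insert w X)
     \<and> pres E (insert w X) (insert w S) bs \<and> pres V' (insert w X) (insert w S) bs
     \<and> vr w \<notin> Acl V' (vr ` (- {w}))"
proof -
  define \<G> where "\<G> = {(\<lambda>e. e w \<in> P \<and> \<not> T e) | T. DL T \<and> (\<forall>e. finite {a. T (e(w := a))})}"
  have in\<G>: "(\<lambda>e. e w \<in> P \<and> \<not> T e) \<in> \<G>" if "DL T" "\<And>e. finite {a. T (e(w := a))}" for T
    unfolding \<G>_def using that by blast
  have notin: "vr w \<notin> Acl E (vr ` X)"
    unfolding pres_acl[OF E p(1)] by (rule pres_new_P[OF E p(1)]) (use w in auto)
  have "\<exists>V'. ultra V' \<and> coin V V' (- {w}) \<and> agree E V' (insert w X) \<and> (\<forall>T\<in>\<G>. eventually T V')"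
  proof (rule extend_agree[OF V])
    show "\<G> \<noteq> {}" using in\<G>[OF D_False] by auto
  next
    fix T S assume "T \<in> \<G>" "S \<in> \<G>"
    then obtain T1 T2 where T: "T = (\<lambda>e. e w \<in> P \<and> \<not> T1 e)" "S = (\<lambda>e. e w \<in> P \<and> \<not> T2 e)" "DL T1" "DL T2"
      "\<And>e. finite {a. T1 (e(w := a))}" "\<And>e. finite {a. T2 (e(w := a))}" by (auto simp: \<G>_def)
    have "(\<lambda>e. e w \<in> P \<and> \<not> (T1 e \<or> T2 e)) \<in> \<G>"
      by (rule in\<G>) (use T in \<open>auto intro: D_disj\<close>)
    then show "\<exists>T'\<in>\<G>. \<forall>e. T' e \<longrightarrow> T e \<and> S e" by (rule rev_bexI) (auto simp: T(1,2))
  next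
    fix Q T assume Q: "DL Q" "dep (insert w X) Q" "eventually Q E" "T \<in> \<G>"
    then obtain T1 where T: "T = (\<lambda>e. e w \<in> P \<and> \<not> T1 e)" "DL T1" "\<And>e. finite {a. T1 (e(w := a))}" by (auto simp: \<G>_def)
    have "eventually (\<lambda>e. infinite {a. Q (e(w := a))}) E" by (rule generic_infinite[OF E notin Q(1-3)])
    then have "eventually (\<lambda>e. infinite {a. Q (e(w := a))}) V" by (rule agreeD[OF ag D_infinite[OF Q(1)] dep_ex(2)[OF Q(2)]])
    then show "eventually (\<lambda>e. \<exists>a. Q (e(w := a)) \<and> T (e(w := a))) V"
    proof eventually_elim
      case (elim e)
      have "{a. Q (e(w := a)) \<and> \<not> T1 (e(w := a))} = {a. Q (e(w := a))} - {a. T1 (e(w := a))}" by blast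
      then have inf: "infinite {a. Q (e(w := a)) \<and> \<not> T1 (e(w := a))}" using elim T(3) by (metis Diff_infinite_finite)
      have "DL (\<lambda>e. Q e \<and> \<not> T1 e)" by (intro D_conj D_not Q T)
      from infinite_fibre_interval[OF this inf] obtain u v where "u < v" "\<And>a. u < a \<Longrightarrow> a < v \<Longrightarrow> Q (e(w := a)) \<and> \<not> T1 (e(w := a))" by blast
      then obtain a where "a \<in> P" "Q (e(w := a)) \<and> \<not> T1 (e(w := a))" using Pdense by blast
      then show ?case by (auto simp: T(1))
    qed
  qed
  then obtain V' where V': "ultra V'" "coin V V' (- {w})" "agree E V' (insert w X)" "\<And>T. T \<in> \<G> \<Longrightarrow> eventually T V'" by blast
  have pV: "pres V' X S bs" by (rule pres_coin[OF V V'(1) coin_mono[OF V'(2)] p(2)]) (use w in auto)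
  have agV: "agree V' E (insert w X)" by (rule agree_sym[OF E V'(1,3)])
  have wP: "vr w \<in> Pst V'" using V'(4)[OF in\<G>[OF D_False]] by (auto simp: Pst_def)
  have wn: "nonconst V' (vr w)"
    using w(3) agreeD[OF agV D_eqc dep_eqc] unfolding nonconst_def by auto
  have wk: "\<not> eventually (\<lambda>e. e w = e k) V'" if "k \<in> S" for k
    using w(4)[OF that] agreeD[OF agV D_eq dep_eq, of w k] that p(1) unfolding pres_def by auto
  have S: "w \<notin> S" "S \<subseteq> X" using w p(1) by (auto simp: pres_def)
  have sub: "vr ` (S \<union> set bs) \<subseteq> vr ` (insert w S \<union> set bs)" by auto
  have c: "vr k \<in> Acl E' (vr ` (insert w S \<union> set bs))"
    if "k \<in> insert w X" "pres E' X S bs" for k E'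
  proof (cases "k = w")
    case True then show ?thesis by (intro acl_ext) auto
  next
    case False
    then show ?thesis using that acl_mono[OF sub, of UNIV E'] unfolding pres_def by blast
  qed
  have pr: "pres E' (insert w X) (insert w S) bs"
    if "pres E' X S bs" "vr w \<in> Pst E'" "nonconst E' (vr w)" "\<And>k. k \<in> S \<Longrightarrow> \<not> eventually (\<lambda>e. e w = e k) E'" for E'
  proof -
    have "\<not> eventually (\<lambda>e. e k = e w) E'" if "k \<in> S" for k
      using \<open>\<And>k. k \<in> S \<Longrightarrow> \<not> eventually (\<lambda>e. e w = e k) E'\<close>[OF that]
      by (subst eq_commute)
    then show ?thesis using that c[OF _ that(1)] unfolding pres_def by blast
  qed
  have "pres E (insert w X) (insert w S) bs" by (rule pr[OF p(1) w(2-4)])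
  moreover have "pres V' (insert w X) (insert w S) bs" by (rule pr[OF pV wP wn wk])
  moreover have "vr w \<notin> Acl V' (vr ` (- {w}))"
  proof
    assume "vr w \<in> Acl V' (vr ` (- {w}))"
    then have "\<exists>T. DL T \<and> (\<forall>e. finite {a. T (e(w := a))}) \<and> eventually T V'"
      using acl_nf[of w "- {w}" vr V'] by auto
    then obtain T where T: "DL T" "\<And>e. finite {a. T (e(w := a))}" "eventually T V'" by blast
    from V'(4)[OF in\<G>[OF T(1,2)]] have "eventually (\<lambda>e. \<not> T e) V'" by (simp add: eventually_conj_iff)
    then show False using T(3) ultra_not[OF V'(1)] by blast
  qed
  ultimately show ?thesis using V' by blast
qed

text \<open>By \<open>codense\<close> every interval contains a point outside the closure of
  finitely many parameters and boundedly many elements of \<open>P\<close>; this realises the new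
  coordinate generically over \<open>P\<close> and all other slots.\<close>

lemma step_generic:
  assumes E: "ultra E" and V: "ultra V" and p: "pres E X S bs" "pres V X S bs" and ag: "agree E V X"
    and w: "w \<notin> X" "vr w \<notin> Acl E (Pst E \<union> vr ` set bs)"
  shows "\<exists>V'. ultra V' \<and> coin V V' (- {w}) \<and> agree E V' (insert w X)
     \<and> pres E (insert w X) S (bs @ [w]) \<and> pres V' (insert w X) S (bs @ [w])
     \<and> vr w \<notin> Acl V' (Pst V' \<union> vr ` (- {w}))"
proof -
  define \<G> where "\<G> = {(\<lambda>e. \<not> bad T e) | T. DL T \<and> (\<forall>f. finite {a. T (f(2*w := a))})}"
  have in\<G>: "(\<lambda>e. \<not> bad T e) \<in> \<G>" if "DL T" "\<And>f. finite {a. T (f(2*w := a))}" for T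
    unfolding \<G>_def using that by blast
  interpret u: pregeometry "Acl E" by (rule acl_pregeometry[OF E])
  have X: "S \<subseteq> X" "set bs \<subseteq> X" "vr ` S \<subseteq> Pst E" using p(1) by (auto simp: pres_def)
  have notin: "vr w \<notin> Acl E (vr ` X)"
  proof -
    have "Acl E (vr ` X) \<subseteq> Acl E (Pst E \<union> vr ` set bs)"
      unfolding pres_acl[OF E p(1)] by (rule acl_mono) (use X(3) in auto)
    then show ?thesis using w(2) by blast
  qed
  have "\<exists>V'. ultra V' \<and> coin V V' (- {w}) \<and> agree E V' (insert w X) \<and> (\<forall>T\<in>\<G>. eventually T V')"
  proof (rule extend_agree[OF V])
    show "\<G> \<noteq> {}" using in\<G>[OF D_False] by auto
  next
    fix T S assume "T \<in> \<G>" "S \<in> \<G>"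
    then obtain T1 T2 where T: "T = (\<lambda>e. \<not> bad T1 e)" "S = (\<lambda>e. \<not> bad T2 e)" "DL T1" "DL T2"
      "\<And>e. finite {a. T1 (e(2*w := a))}" "\<And>e. finite {a. T2 (e(2*w := a))}" by (auto simp: \<G>_def)
    have "(\<lambda>e. \<not> bad (\<lambda>e. T1 e \<or> T2 e) e) \<in> \<G>"
      by (rule in\<G>) (use T in \<open>auto intro: D_disj\<close>)
    then show "\<exists>T'\<in>\<G>. \<forall>e. T' e \<longrightarrow> T e \<and> S e" by (rule rev_bexI) (auto simp: T(1,2) bad_def)
  next
    fix Q T assume Q: "DL Q" "dep (insert w X) Q" "eventually Q E" "T \<in> \<G>"
    then obtain T1 where T: "T = (\<lambda>e. \<not> bad T1 e)" "DL T1" "\<And>e. finite {a. T1 (e(2*w := a))}" by (auto simp: \<G>_def)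
    obtain A K where A: "finite A" "finite K"
      "\<And>e w y. T1 (e(w := y)) \<Longrightarrow> finite {a. T1 (e(w := a))} \<Longrightarrow> y \<in> mcl (A \<union> e ` (K - {w}))"
      using definable_fibre_mcl[OF T(2)] by blast
    have "eventually (\<lambda>e. infinite {a. Q (e(w := a))}) E" by (rule generic_infinite[OF E notin Q(1-3)])
    then have "eventually (\<lambda>e. infinite {a. Q (e(w := a))}) V" by (rule agreeD[OF ag D_infinite[OF Q(1)] dep_ex(2)[OF Q(2)]])
    then show "eventually (\<lambda>e. \<exists>a. Q (e(w := a)) \<and> T (e(w := a))) V"
    proof eventually_elim
      case (elim e)
      from infinite_fibre_interval[OF Q(1) elim] obtain u v where uv: "u < v" "\<And>a. u < a \<Longrightarrow> a < v \<Longrightarrow> Q (e(w := a))" by blast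
      \<comment> \<open>The entries of the environment read by \<open>T1\<close> are treated as
        parameters; from \<open>P\<close> the predicate takes at most \<open>card K\<close>
        elements.\<close>
      define A' where "A' = A \<union> (\<lambda>m. e (m div 2)) ` K"
      have "finite A'" using A(1,2) by (simp add: A'_def)
      from codense[OF this uv(1), of "card K"] obtain y where y: "u < y" "y < v"
        "\<And>C. C \<subseteq> P \<Longrightarrow> finite C \<Longrightarrow> card C \<le> card K \<Longrightarrow> y \<notin> mcl (A' \<union> C)" by blast
      have "\<not> bad T1 (e(w := y))"
      proof
        assume "bad T1 (e(w := y))"
        then obtain \<rho> where \<rho>: "range \<rho> \<subseteq> P" "T1 ((mix e \<rho>)(2*w := y))" by (auto simp: bad_def mix_upd)
        interpret m: pregeometry mcl by (rule mcl_pregeometry)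
        have "y \<in> mcl (A \<union> mix e \<rho> ` (K - {2*w}))" by (rule A(3)[OF \<rho>(2) T(3)])
        moreover have "A \<union> mix e \<rho> ` (K - {2*w}) \<subseteq> A' \<union> (\<lambda>m. \<rho> (m div 2)) ` K"
          by (auto simp: A'_def mix_def)
        ultimately have "y \<in> mcl (A' \<union> (\<lambda>m. \<rho> (m div 2)) ` K)" using m.mono by blast
        moreover have "y \<notin> mcl (A' \<union> (\<lambda>m. \<rho> (m div 2)) ` K)"
          by (rule y(3)) (use \<rho>(1) A(2) in \<open>auto intro: card_image_le\<close>)
        ultimately show False by blast
      qed
      then show ?case using uv(2)[OF y(1,2)] by (auto simp: T(1))
    qed
  qed
  then obtain V' where V': "ultra V'" "coin V V' (- {w})" "agree E V' (insert w X)" "\<And>T. T \<in> \<G> \<Longrightarrow> eventually T V'" by blast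
  have pV: "pres V' X S bs" by (rule pres_coin[OF V V'(1) coin_mono[OF V'(2)] p(2)]) (use w in auto)
  have gen: "vr w \<notin> Acl V' (Pst V' \<union> vr ` (- {w}))"
  proof
    assume "vr w \<in> Acl V' (Pst V' \<union> vr ` (- {w}))"
    then obtain T where T: "DL T" "\<And>f. finite {a. T (f(2*w := a))}"
       "eventually (\<lambda>i. \<exists>\<rho>. range \<rho> \<subseteq> P \<and> T (mix (\<lambda>k. vr k i) \<rho>)) V'"
      using aclP_nf[of w "- {w}" vr V'] by auto
    from V'(4)[OF in\<G>[OF T(1,2)]] T(3) show False
      using ultra_not[OF V'(1), of "bad T"] by (simp add: bad_def[abs_def])
  qed
  have "vr w \<notin> Acl V' (Pst V' \<union> vr ` set bs)"
  proof -
    have "Pst V' \<union> vr ` set bs \<subseteq> Pst V' \<union> vr ` (- {w})" using X(2) w(1) by auto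
    from acl_mono[OF this] show ?thesis using gen by blast
  qed
  have rk: "rkU E' (Pst E') (map vr (bs @ [w])) = length (bs @ [w])"
    if "ultra E'" "pres E' X S bs" "vr w \<notin> Acl E' (Pst E' \<union> vr ` set bs)" for E'
  proof -
    interpret u': pregeometry "Acl E'" by (rule acl_pregeometry[OF that(1)])
    show ?thesis using that(2,3) by (simp add: u'.rk_append pres_def)
  qed
  have c: "vr k \<in> Acl E' (vr ` (S \<union> set (bs @ [w])))"
    if "k \<in> insert w X" "pres E' X S bs" for k E'
  proof (cases "k = w")
    case True then show ?thesis by (intro acl_ext) auto
  next
    case False
    have sub: "vr ` (S \<union> set bs) \<subseteq> vr ` (S \<union> set (bs @ [w]))" by auto
    show ?thesis using that False acl_mono[OF sub, of UNIV E'] unfolding pres_def by blast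
  qed
  have "pres E (insert w X) S (bs @ [w])" using p(1) rk[OF E p(1) w(2)] c[OF _ p(1)] unfolding pres_def by auto
  moreover have "pres V' (insert w X) S (bs @ [w])"
    using pV rk[OF V'(1) pV] \<open>vr w \<notin> Acl V' (Pst V' \<union> vr ` set bs)\<close> c[OF _ pV] unfolding pres_def by auto
  ultimately show ?thesis using V' gen by blast
qed

end

section \<open>Types in the expansion are determined by presented types\<close>

context omin_pair begin

text \<open>A slot of \<open>ws\<close> outside \<open>X\<close> joins \<open>S\<close>, unless its
  value is constant or repeats a member of \<open>S\<close>; in that case it is algebraic and the
  presentation stays as it is.\<close>

lemma promote_P:
  assumes E: "ultra E" and "\<And>w. w \<in> set ws \<Longrightarrow> vr w \<in> Pst E"
    and "ultra V" "pres E X S bs" "pres V X S bs" "agree E V X"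
  shows "\<exists>V' S'. ultra V' \<and> coin V V' (- (set ws - X)) \<and> S' \<subseteq> S \<union> set ws \<and>
     agree E V' (X \<union> set ws) \<and> pres E (X \<union> set ws) S' bs \<and> pres V' (X \<union> set ws) S' bs"
  using assms(2-)
proof (induction ws arbitrary: V X S)
  case Nil
  then show ?case by (intro exI[of _ V] exI[of _ S]) (auto simp: coin_def)
next
  case (Cons w ws)
  have "\<exists>V1 S1. ultra V1 \<and> coin V V1 (- ({w} - X)) \<and> S1 \<subseteq> insert w S \<and>
     agree E V1 (insert w X) \<and> pres E (insert w X) S1 bs \<and> pres V1 (insert w X) S1 bs"
  proof (cases "w \<in> X")
    case True
    then have "insert w X = X" by blast
    then show ?thesis using Cons.prems by (intro exI[of _ V] exI[of _ S]) (auto simp: coin_def)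
  next
    case False
    then have eq: "- ({w} - X) = - {w}" by blast
    show ?thesis
    proof (cases "nonconst E (vr w) \<and> (\<forall>k\<in>S. \<not> eventually (\<lambda>e. e w = e k) E)")
      case True
      with step_P[OF E Cons.prems(2-5) False] Cons.prems(1)[of w]
      obtain V' where "ultra V'" "coin V V' (- {w})" "agree E V' (insert w X)"
        "pres E (insert w X) (insert w S) bs" "pres V' (insert w X) (insert w S) bs" by auto
      then show ?thesis unfolding eq by (intro exI[of _ V'] exI[of _ "insert w S"]) auto
    next
      case nc: False
      have "vr w \<in> Acl E (vr ` (S \<union> set bs))"
      proof (cases "nonconst E (vr w)")
        case True
        then obtain k where k: "k \<in> S" "eventually (\<lambda>e. e w = e k) E" using nc by blast
        have "vr k \<in> Acl E (vr ` (S \<union> set bs))" using k(1) by (intro acl_ext) auto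
        then show ?thesis by (rule acl_eventually_eq) (use k(2) in \<open>simp add: eq_commute\<close>)
      next
        case False
        then obtain c where "eventually (\<lambda>e. e w = c) E" by (auto simp: nonconst_def)
        then show ?thesis by (intro acl_eventually_eq[OF acl_const[of c UNIV]]) (auto simp: eq_commute)
      qed
      from step_alg[OF E Cons.prems(2-5) False this]
      obtain V' where "ultra V'" "coin V V' (- {w})" "agree E V' (insert w X)"
        "pres E (insert w X) S bs" "pres V' (insert w X) S bs" by auto
      then show ?thesis unfolding eq by (intro exI[of _ V'] exI[of _ S]) auto
    qed
  qed
  then obtain V1 S1 where 1: "ultra V1" "coin V V1 (- ({w} - X))" "S1 \<subseteq> insert w S"
     "agree E V1 (insert w X)" "pres E (insert w X) S1 bs" "pres V1 (insert w X) S1 bs" by blast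
  from Cons.IH[OF _ 1(1,5,6,4)] Cons.prems(1)
  obtain V' S' where 2: "ultra V'" "coin V1 V' (- (set ws - insert w X))" "S' \<subseteq> S1 \<union> set ws"
     "agree E V' (insert w X \<union> set ws)" "pres E (insert w X \<union> set ws) S' bs" "pres V' (insert w X \<union> set ws) S' bs" by auto
  have "coin V V' (- (set (w # ws) - X))"
    by (rule coin_trans[OF coin_mono[OF 1(2)] coin_mono[OF 2(2)]]) auto
  moreover have "insert w X \<union> set ws = X \<union> set (w # ws)" by auto
  ultimately show ?case using 1(3) 2 by (intro exI[of _ V'] exI[of _ S']) auto
qed

text \<open>Elements of \<open>Pst E\<close> are functions on environments and need not be the value
  of any slot; this copies finitely many of them into fresh consecutive slots, where a presentation
  can refer to them.\<close>

definition store :: "nat \<Rightarrow> ((nat \<Rightarrow> 'a) \<Rightarrow> 'a) list \<Rightarrow> (nat \<Rightarrow> 'a) \<Rightarrow> nat \<Rightarrow> 'a" where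
  "store w qs e k = (if w \<le> k \<and> k < w + length qs then (qs ! (k - w)) e else e k)"

lemma store_image: "(\<lambda>k e. store w qs e k) ` {w..<w + length qs} = set qs"
proof -
  have "(\<lambda>k e. store w qs e k) ` {w..<w + length qs} = (\<lambda>k. qs ! (k - w)) ` {w..<w + length qs}"
    by (intro image_cong) (auto simp: store_def)
  also have "\<dots> = set qs"
  proof
    show "set qs \<subseteq> (\<lambda>k. qs ! (k - w)) ` {w..<w + length qs}"
    proof
      fix x assume "x \<in> set qs"
      then obtain i where "i < length qs" "x = qs ! i" by (auto simp: in_set_conv_nth)
      then show "x \<in> (\<lambda>k. qs ! (k - w)) ` {w..<w + length qs}" by (intro image_eqI[of _ _ "w + i"]) auto
    qed
  qed auto
  finally show ?thesis .
qed

lemma ex_above: "finite (X :: nat set) \<Longrightarrow> \<exists>w. \<forall>k\<in>X. k < w"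
  by (metis finite_nat_set_iff_bounded)

lemma store_P:
  assumes E: "ultra E" and p: "pres E X S bs" and T: "set qs \<subseteq> Pst E" and w0: "\<forall>k\<in>X. k < w0"
  defines "E' \<equiv> filtermap (store w0 qs) E" and "ws \<equiv> [w0..<w0 + length qs]"
  shows "ultra E'" "coin E E' (- set ws)" "pres E' X S bs" "\<And>w. w \<in> set ws \<Longrightarrow> vr w \<in> Pst E'"
    "\<And>w Y. w \<notin> set ws \<Longrightarrow> Y \<inter> set ws = {} \<Longrightarrow>
      vr w \<in> Acl E' (vr ` (set ws \<union> Y)) \<longleftrightarrow> vr w \<in> Acl E (set qs \<union> vr ` Y)"
proof -
  show E': "ultra E'" unfolding E'_def by (rule ultra_filtermap[OF E])
  show c: "coin E E' (- set ws)" unfolding E'_def ws_def by (rule coin_filtermap) (auto simp: store_def)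
  show "pres E' X S bs" by (rule pres_coin[OF E E' coin_mono[OF c] p]) (use w0 in \<open>auto simp: ws_def\<close>)
  show "vr w \<in> Pst E'" if "w \<in> set ws" for w
  proof -
    have "qs ! (w - w0) \<in> Pst E" using that T by (auto simp: ws_def)
    then show ?thesis using that by (simp add: Pst_def E'_def eventually_filtermap store_def ws_def)
  qed
  show "vr w \<in> Acl E' (vr ` (set ws \<union> Y)) \<longleftrightarrow> vr w \<in> Acl E (set qs \<union> vr ` Y)"
    if "w \<notin> set ws" "Y \<inter> set ws = {}" for w Y
  proof -
    have "(\<lambda>e. store w0 qs e w) = vr w" using that by (auto simp: store_def ws_def)
    moreover have "(\<lambda>k e. store w0 qs e k) ` Y = vr ` Y"
      by (rule image_cong) (use that(2) in \<open>auto simp: store_def ws_def disjoint_iff\<close>)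
    moreover have "(\<lambda>k e. store w0 qs e k) ` set ws = set qs" using store_image by (simp add: ws_def)
    ultimately show ?thesis unfolding E'_def acl_filtermap by (simp add: image_image image_Un)
  qed
qed

text \<open>Either the new coordinate is independent over \<open>P\<close> and \<open>bs\<close>, or
  it is algebraic over \<open>bs\<close> and finitely many elements of \<open>P\<close>. In the
  second case these elements are stored in fresh slots and promoted, after which the coordinate is
  algebraic over the presentation.\<close>

lemma extend_type:
  assumes E: "ultra E" and V: "ultra V" and p: "pres E X S bs" "pres V X S bs" and ag: "agree E V X"
    and w: "w \<notin> X"
  shows "\<exists>E' V' X' S' bs'. ultra E' \<and> ultra V' \<and> insert w X \<subseteq> X' \<and> coin E E' (insert w X) \<and> coin V V' X \<and>
     pres E' X' S' bs' \<and> pres V' X' S' bs' \<and> agree E' V' X'"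
proof (cases "vr w \<in> Acl E (Pst E \<union> vr ` set bs)")
  case False
  from step_generic[OF E V p ag w False] obtain V' where V': "ultra V'" "coin V V' (- {w})" "agree E V' (insert w X)"
     "pres E (insert w X) S (bs @ [w])" "pres V' (insert w X) S (bs @ [w])" by blast
  have "coin V V' X" by (rule coin_mono[OF V'(2)]) (use w in auto)
  then show ?thesis using V' E by (intro exI[of _ E] exI[of _ V'] exI[of _ "insert w X"] exI[of _ S] exI[of _ "bs @ [w]"]) (auto simp: coin_def)
next
  case True
  interpret u: pregeometry "Acl E" by (rule acl_pregeometry[OF E])
  obtain T where T: "T \<subseteq> Pst E \<union> vr ` set bs" "finite T" "vr w \<in> Acl E T" using u.finchar[OF True] by blast
  obtain qs where qs: "set qs = T \<inter> Pst E" using finite_list[of "T \<inter> Pst E"] T(2) by blast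
  have fX: "finite X" and sub: "set bs \<subseteq> X" "S \<subseteq> X" using p(1) by (auto simp: pres_def)
  obtain w0 where w0: "\<forall>k\<in>insert w X. k < w0" using ex_above[of "insert w X"] fX by auto
  then have w0': "\<forall>k\<in>X. k < w0" by auto
  define E' where "E' = filtermap (store w0 qs) E"
  define ws where "ws = [w0..<w0 + length qs]"
  have qP: "set qs \<subseteq> Pst E" using qs by blast
  note st = store_P[OF E p(1) qP w0', folded E'_def ws_def]
  have ws: "w \<notin> set ws" "X \<inter> set ws = {}" using w0 by (auto simp: ws_def)
  have "vr w \<in> Acl E (set qs \<union> vr ` set bs)" using T(1,3) qs u.mono[of T "set qs \<union> vr ` set bs"] by auto
  then have wE: "vr w \<in> Acl E' (vr ` (set ws \<union> set bs))" using st(5)[of w "set bs"] ws sub by auto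
  have ag': "agree E' V X" by (rule agree_coin_left[OF ag coin_mono[OF st(2)]]) (use ws in auto)
  obtain V1 S1 where 1: "ultra V1" "coin V V1 (- (set ws - X))" "S1 \<subseteq> S \<union> set ws"
     "agree E' V1 (X \<union> set ws)" "pres E' (X \<union> set ws) S1 bs" "pres V1 (X \<union> set ws) S1 bs"
    using promote_P[OF st(1,4) V st(3) p(2) ag'] by blast
  interpret u': pregeometry "Acl E'" by (rule acl_pregeometry[OF st(1)])
  have "vr ` (set ws \<union> set bs) \<subseteq> Acl E' (vr ` (S1 \<union> set bs))" using 1(5) sub(1) by (auto simp: pres_def)
  then have wS: "vr w \<in> Acl E' (vr ` (S1 \<union> set bs))" using u'.cls_subset wE by blast
  have "w \<notin> X \<union> set ws" using w ws by blast
  from step_alg[OF st(1) 1(1,5,6,4) this wS] obtain V' where V': "ultra V'" "coin V1 V' (- {w})"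
    "agree E' V' (insert w (X \<union> set ws))" "pres E' (insert w (X \<union> set ws)) S1 bs" "pres V' (insert w (X \<union> set ws)) S1 bs" by blast
  have "coin V V' X" by (rule coin_trans[OF coin_mono[OF 1(2)] coin_mono[OF V'(2)]]) (use w ws in auto)
  moreover have "coin E E' (insert w X)" by (rule coin_mono[OF st(2)]) (use ws in auto)
  ultimately show ?thesis using V' st(1)
    by (intro exI[of _ E'] exI[of _ V'] exI[of _ "insert w (X \<union> set ws)"] exI[of _ S1] exI[of _ bs]) auto
qed

lemma asg_dep: "(\<And>k j. k \<in> fv \<phi> \<Longrightarrow> \<tau> k = Inl j \<Longrightarrow> j \<in> X) \<Longrightarrow> dep X (\<lambda>e. sat F' R' (asg \<tau> e) \<phi>)"
  unfolding dep_def by (intro allI impI sat_cong) (auto simp: asg_def split: sum.splits)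

lemma asg_evalt_acl:
  assumes "\<And>k j. k \<in> fvt t \<Longrightarrow> \<tau> k = Inl j \<Longrightarrow> j \<in> X"
  shows "(\<lambda>e. evalt F (asg \<tau> e) t) \<in> Acl E (vr ` X)"
proof -
  let ?\<phi> = "Eq t (Var (Suc (Max (insert 0 (fvt t)))))"
  let ?m = "Suc (Max (insert 0 (fvt t)))"
  have m: "?m \<notin> fvt t"
  proof
    assume "?m \<in> fvt t"
    then have "?m \<le> Max (insert 0 (fvt t))" by (intro Max_ge) (auto simp: finite_fvt)
    then show False by simp
  qed
  let ?h = "\<lambda>k. if k = ?m then Inl 0 else (case \<tau> k of Inl j \<Rightarrow> Inl (Suc j) | Inr c \<Rightarrow> Inr c)"
  have ev: "evalt F (asg ?h f) t = evalt F (asg \<tau> (\<lambda>k. f (Suc k))) t" for f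
    by (rule evalt_cong) (use m in \<open>auto simp: asg_def split: sum.splits\<close>)
  have "DL (\<lambda>f. sat F R (asg ?h f) ?\<phi>)" by (rule D_sat) simp
  moreover have "sat F R (asg ?h f) ?\<phi> \<longleftrightarrow> evalt F (asg \<tau> (\<lambda>k. f (Suc k))) t = f 0" for f
    unfolding ev[symmetric] by (simp add: asg_def)
  ultimately have D1: "DL (\<lambda>f. evalt F (asg \<tau> (\<lambda>k. f (Suc k))) t = f 0)" by simp
  show ?thesis
  proof (rule acl_I[OF D1, of "insert 0 (Suc ` X)" 0 "\<lambda>k. vr (k - 1)"])
    show "dep (insert 0 (Suc ` X)) (\<lambda>f. evalt F (asg \<tau> (\<lambda>k. f (Suc k))) t = f 0)"
      unfolding dep_def
    proof (intro allI impI)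
      fix e e' :: "nat \<Rightarrow> 'a" assume a: "\<forall>k\<in>insert 0 (Suc ` X). e k = e' k"
      have "evalt F (asg \<tau> (\<lambda>k. e (Suc k))) t = evalt F (asg \<tau> (\<lambda>k. e' (Suc k))) t"
        by (rule evalt_cong) (use a assms in \<open>auto simp: asg_def split: sum.splits\<close>)
      then show "(evalt F (asg \<tau> (\<lambda>k. e (Suc k))) t = e 0) = (evalt F (asg \<tau> (\<lambda>k. e' (Suc k))) t = e' 0)"
        using a by simp
    qed
  qed auto
qed

text \<open>Induction on the formula. The new atoms say that a term lies in \<open>P\<close>: its
  value is algebraic over the presentation, so by \<open>pres_new_P\<close> it is a constant or the
  value of a slot in \<open>S\<close>, which the o-minimal type decides. Negation uses the symmetry
  of agreement; for a quantifier a witness is stored in a fresh slot and both types are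
  extended.\<close>

theorem types_agree:
  fixes \<phi> :: "('f, 'r option) fm"
  assumes "ultra E" "ultra V" "pres E X S bs" "pres V X S bs" "agree E V X"
    "\<And>k j. k \<in> fv \<phi> \<Longrightarrow> \<tau> k = Inl j \<Longrightarrow> j \<in> X"
    "eventually (\<lambda>e. sat F (expR R P) (asg \<tau> e) \<phi>) E"
  shows "eventually (\<lambda>e. sat F (expR R P) (asg \<tau> e) \<phi>) V"
  using assms
proof (induction \<phi> arbitrary: E V X S bs \<tau>)
  case (Eq s t)
  have "DL (\<lambda>e. sat F R (asg \<tau> e) (Eq s t))" by (rule D_sat) simp
  moreover have "dep X (\<lambda>e. sat F R (asg \<tau> e) (Eq s t))" by (rule asg_dep) (use Eq.prems(6) in auto)
  ultimately show ?case using agreeD[OF Eq.prems(5)] Eq.prems(7) by simp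
next
  case (Rel ro ts)
  show ?case
  proof (cases ro)
    case (Some r)
    have "DL (\<lambda>e. sat F R (asg \<tau> e) (Rel r ts))" by (rule D_sat) simp
    moreover have "dep X (\<lambda>e. sat F R (asg \<tau> e) (Rel r ts))" by (rule asg_dep) (use Rel.prems(6) in auto)
    ultimately show ?thesis using agreeD[OF Rel.prems(5)] Rel.prems(7) Some by (simp add: expR_def)
  next
    case None
    from ultra_ex[OF Rel.prems(1,7)] None obtain t where ts: "ts = [t]" by (auto simp: expR_def)
    define f where "f e = evalt F (asg \<tau> e) t" for e
    have satf: "sat F (expR R P) (asg \<tau> e) (Rel ro ts) \<longleftrightarrow> f e \<in> P" for e
      using None ts by (auto simp: expR_def f_def)
    have tX: "\<And>k j. k \<in> fvt t \<Longrightarrow> \<tau> k = Inl j \<Longrightarrow> j \<in> X" using Rel.prems(6) ts by auto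
    obtain m where m: "m \<notin> fvt t" using ex_fresh finite_fvt by blast
    have fe: "DL (\<lambda>e. f e = c)" "dep X (\<lambda>e. f e = c)" for c
    proof -
      have ev: "evalt F (asg (\<tau>(m := Inr c)) e) t = f e" for e unfolding f_def
        by (rule evalt_cong) (use m in \<open>auto simp: asg_def\<close>)
      have "DL (\<lambda>e. sat F R (asg (\<tau>(m := Inr c)) e) (Eq t (Var m)))" by (rule D_sat) simp
      moreover have "dep X (\<lambda>e. sat F R (asg (\<tau>(m := Inr c)) e) (Eq t (Var m)))"
        by (rule asg_dep) (use tX in \<open>auto split: if_splits\<close>)
      moreover have "sat F R (asg (\<tau>(m := Inr c)) e) (Eq t (Var m)) \<longleftrightarrow> f e = c" for e
        using ev by (simp add: asg_def)
      ultimately show "DL (\<lambda>e. f e = c)" "dep X (\<lambda>e. f e = c)" by simp_all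
    qed
    have fk: "DL (\<lambda>e. f e = e k)" "k \<in> X \<Longrightarrow> dep X (\<lambda>e. f e = e k)" for k
    proof -
      have ev: "evalt F (asg (\<tau>(m := Inl k)) e) t = f e" for e unfolding f_def
        by (rule evalt_cong) (use m in \<open>auto simp: asg_def\<close>)
      have "DL (\<lambda>e. sat F R (asg (\<tau>(m := Inl k)) e) (Eq t (Var m)))" by (rule D_sat) simp
      moreover have "dep X (\<lambda>e. sat F R (asg (\<tau>(m := Inl k)) e) (Eq t (Var m)))" if "k \<in> X"
        by (rule asg_dep) (use tX that in \<open>auto split: if_splits\<close>)
      moreover have "sat F R (asg (\<tau>(m := Inl k)) e) (Eq t (Var m)) \<longleftrightarrow> f e = e k" for e
        using ev by (simp add: asg_def)
      ultimately show "DL (\<lambda>e. f e = e k)" "k \<in> X \<Longrightarrow> dep X (\<lambda>e. f e = e k)" by simp_all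
    qed
    have fP: "f \<in> Pst E" using Rel.prems(7) unfolding satf Pst_def by simp
    have "f \<in> Acl E (vr ` (S \<union> set bs))"
      using asg_evalt_acl[of t \<tau> X E, OF tX] unfolding pres_acl[OF Rel.prems(1,3)] f_def[abs_def] .
    with pres_new_P[OF Rel.prems(1,3) fP] consider "\<not> nonconst E f"
      | k where "k \<in> S" "eventually (\<lambda>e. f e = e k) E" by blast
    then show ?thesis
    proof cases
      case 1
      then obtain c where c: "eventually (\<lambda>e. f e = c) E" by (auto simp: nonconst_def)
      have "eventually (\<lambda>e. f e \<in> P \<and> f e = c) E" using fP c by (auto simp: Pst_def eventually_conj_iff)
      then have "c \<in> P" using ultra_ex[OF Rel.prems(1)] by blast
      moreover have "eventually (\<lambda>e. f e = c) V" by (rule agreeD[OF Rel.prems(5) fe c])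
      ultimately show ?thesis unfolding satf by (auto elim: eventually_mono)
    next
      case (2 k)
      then have "k \<in> X" using Rel.prems(3) by (auto simp: pres_def)
      then have "eventually (\<lambda>e. f e = e k) V" using agreeD[OF Rel.prems(5) fk] 2 by blast
      moreover have "eventually (\<lambda>e. e k \<in> P) V" using Rel.prems(4) 2(1) by (auto simp: pres_def Pst_def)
      ultimately show ?thesis unfolding satf by eventually_elim simp
    qed
  qed
next
  case (Neg \<phi>)
  show ?case
  proof (rule ccontr)
    assume "\<not> ?case"
    then have "eventually (\<lambda>e. sat F (expR R P) (asg \<tau> e) \<phi>) V" using ultra_not[OF Neg.prems(2)] by auto
    then have "eventually (\<lambda>e. sat F (expR R P) (asg \<tau> e) \<phi>) E"
      by (rule Neg.IH[OF Neg.prems(2,1,4,3) agree_sym[OF Neg.prems(1,2,5)], rotated]) (use Neg.prems(6) in auto)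
    then show False using Neg.prems(7) ultra_not[OF Neg.prems(1)] by auto
  qed
next
  case (Conj \<phi>1 \<phi>2)
  have "eventually (\<lambda>e. sat F (expR R P) (asg \<tau> e) \<phi>1) E" "eventually (\<lambda>e. sat F (expR R P) (asg \<tau> e) \<phi>2) E"
    using Conj.prems(7) by (auto simp: eventually_conj_iff)
  then have "eventually (\<lambda>e. sat F (expR R P) (asg \<tau> e) \<phi>1) V" "eventually (\<lambda>e. sat F (expR R P) (asg \<tau> e) \<phi>2) V"
    using Conj.IH(1)[OF Conj.prems(1-5)] Conj.IH(2)[OF Conj.prems(1-5)] Conj.prems(6) by auto
  then show ?case by (simp add: eventually_conj_iff)
next
  case (Ex j \<phi>)
  have fX: "finite X" using Ex.prems(3) by (simp add: pres_def)
  then obtain w where w: "w \<notin> X" using ex_fresh by blast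
  define \<tau>' where "\<tau>' = \<tau>(j := Inl w)"
  have sat': "sat F (expR R P) (asg \<tau>' (e(w := a))) \<phi> \<longleftrightarrow> sat F (expR R P) ((asg \<tau> e)(j := a)) \<phi>" for e a
  proof (rule sat_cong)
    fix k assume "k \<in> fv \<phi>"
    then have "k \<noteq> j \<Longrightarrow> \<tau> k \<noteq> Inl w" using Ex.prems(6)[of k w] w by auto
    then show "asg \<tau>' (e(w := a)) k = ((asg \<tau> e)(j := a)) k" by (auto simp: asg_def \<tau>'_def split: sum.splits)
  qed
  define y where "y e = (SOME a. sat F (expR R P) ((asg \<tau> e)(j := a)) \<phi>)" for e
  have y: "eventually (\<lambda>e. sat F (expR R P) ((asg \<tau> e)(j := y e)) \<phi>) E"
    using Ex.prems(7)
  proof eventually_elim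
    case (elim e)
    then have "\<exists>a. sat F (expR R P) ((asg \<tau> e)(j := a)) \<phi>" by simp
    then show ?case unfolding y_def by (rule someI_ex)
  qed
  define E1 where "E1 = filtermap (\<lambda>e. e(w := y e)) E"
  have E1: "ultra E1" unfolding E1_def by (rule ultra_filtermap[OF Ex.prems(1)])
  have c1: "coin E E1 X" unfolding E1_def by (rule coin_filtermap) (use w in auto)
  have p1: "pres E1 X S bs" by (rule pres_coin[OF Ex.prems(1) E1 c1 Ex.prems(3)])
  have ag1: "agree E1 V X" by (rule agree_coin_left[OF Ex.prems(5) c1])
  have s1: "eventually (\<lambda>e. sat F (expR R P) (asg \<tau>' e) \<phi>) E1"
    unfolding E1_def eventually_filtermap sat' by (rule y)
  obtain E2 V2 X2 S2 bs2 where 2: "ultra E2" "ultra V2" "insert w X \<subseteq> X2" "coin E1 E2 (insert w X)" "coin V V2 X"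
     "pres E2 X2 S2 bs2" "pres V2 X2 S2 bs2" "agree E2 V2 X2"
    using extend_type[OF E1 Ex.prems(2) p1 Ex.prems(4) ag1 w] by blast
  have fvX: "i \<in> insert w X" if "k \<in> fv \<phi>" "\<tau>' k = Inl i" for k i
    using that Ex.prems(6)[of k i] by (auto simp: \<tau>'_def split: if_splits)
  have "dep (insert w X) (\<lambda>e. sat F (expR R P) (asg \<tau>' e) \<phi>)" by (rule asg_dep) (rule fvX)
  then have "eventually (\<lambda>e. sat F (expR R P) (asg \<tau>' e) \<phi>) E2" using coinD[OF 2(4)] s1 by blast
  then have "eventually (\<lambda>e. sat F (expR R P) (asg \<tau>' e) \<phi>) V2"
    by (rule Ex.IH[OF 2(1,2,6,7,8), rotated]) (use fvX 2(3) in blast)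
  then have "eventually (\<lambda>e. sat F (expR R P) (asg \<tau> e) (Ex j \<phi>)) V2"
  proof eventually_elim
    case (elim e)
    then have "sat F (expR R P) ((asg \<tau> e)(j := e w)) \<phi>" using sat'[of e "e w"] by simp
    then show ?case by auto
  qed
  moreover have "dep X (\<lambda>e. sat F (expR R P) (asg \<tau> e) (Ex j \<phi>))" by (rule asg_dep) (rule Ex.prems(6))
  ultimately show ?case using coinD[OF 2(5)] by blast
qed

lemma types_agree_D:
  assumes "ultra E" "ultra V" "pres E X S bs" "pres V X S bs" "agree E V X"
    and Q: "DN Q" "dep X Q" "eventually Q E"
  shows "eventually Q V"
proof -
  obtain \<phi> \<tau> where q: "\<And>k c. k \<in> fv \<phi> \<Longrightarrow> \<tau> k = Inr c \<Longrightarrow> c \<in> UNIV" "\<And>e. Q e \<longleftrightarrow> sat F (expR R P) (asg \<tau> e) \<phi>"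
    using D_E[OF Q(1)] by blast
  \<comment> \<open>Slots outside \<open>X\<close> are replaced by the constant 0, so that every
    slot still read by the formula lies in \<open>X\<close>.\<close>
  define \<tau>' where "\<tau>' k = (case \<tau> k of Inl j \<Rightarrow> if j \<in> X then Inl j else Inr 0 | Inr c \<Rightarrow> Inr c)" for k
  have eq: "Q e \<longleftrightarrow> sat F (expR R P) (asg \<tau>' e) \<phi>" for e
  proof -
    have "asg \<tau>' e = asg \<tau> (\<lambda>k. if k \<in> X then e k else 0)"
      by (rule ext) (auto simp: asg_def \<tau>'_def split: sum.splits)
    then have "sat F (expR R P) (asg \<tau>' e) \<phi> = Q (\<lambda>k. if k \<in> X then e k else 0)" using q(2) by simp
    also have "\<dots> = Q e" by (rule depD[OF Q(2)]) simp
    finally show ?thesis by simp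
  qed
  have "eventually (\<lambda>e. sat F (expR R P) (asg \<tau>' e) \<phi>) V"
  proof (rule types_agree[OF assms(1-5)])
    show "j \<in> X" if "\<tau>' k = Inl j" for k j using that by (auto simp: \<tau>'_def split: sum.splits if_splits)
    show "eventually (\<lambda>e. sat F (expR R P) (asg \<tau>' e) \<phi>) E"
      using Q(3) by (rule eventually_mono) (simp add: eq)
  qed
  then show ?thesis by (rule eventually_mono) (simp add: eq)
qed

end

section \<open>Values of functions definable in the expansion\<close>

lemma (in pregeometry) finite_support:
  assumes "finite A" "A \<subseteq> cls (B \<union> Z)"
  shows "\<exists>B0\<subseteq>B. finite B0 \<and> A \<subseteq> cls (B0 \<union> Z)"
  using assms
proof (induction A rule: finite_induct)
  case empty then show ?case by blast
next
  case (insert a A)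
  then obtain B0 where B0: "B0 \<subseteq> B" "finite B0" "A \<subseteq> cls (B0 \<union> Z)" by blast
  obtain C where C: "C \<subseteq> B \<union> Z" "finite C" "a \<in> cls C" using finchar[of a "B \<union> Z"] insert by blast
  have "a \<in> cls (B0 \<union> (C \<inter> B) \<union> Z)" using C mono[of C "B0 \<union> (C \<inter> B) \<union> Z"] by blast
  moreover have "A \<subseteq> cls (B0 \<union> (C \<inter> B) \<union> Z)" using B0(3) mono[of "B0 \<union> Z" "B0 \<union> (C \<inter> B) \<union> Z"] by blast
  ultimately show ?case using B0 C by (intro exI[of _ "B0 \<union> (C \<inter> B)"]) auto
qed

context omin_pair begin

text \<open>The value of the function is first duplicated in \<open>w2\<close>. If \<open>w\<close>
  is then realised anew so that \<open>Q\<close> still holds, while \<open>w2\<close> and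
  \<open>X\<close> keep their type, functionality forces the new value to equal the old one.\<close>

lemma copied_value:
  fixes Q :: "(nat \<Rightarrow> 'a) \<Rightarrow> bool"
  assumes "V = filtermap (\<lambda>e. e(w2 := e w)) E" "w2 \<notin> insert w X" "dep (insert w X) Q"
    and func: "\<And>e a b. Q (e(w := a)) \<Longrightarrow> Q (e(w := b)) \<Longrightarrow> a = b"
    and "eventually Q E" "eventually Q V2" "coin V V2 (insert w2 X)"
  shows "eventually (\<lambda>e. e w = e w2) V2"
proof -
  have "Q ((e(w2 := e w))(w := (e(w2 := e w)) w2)) = Q e" for e
    by (rule depD[OF assms(3)]) (use assms(2) in auto)
  then have "eventually (\<lambda>e. Q (e(w := e w2))) V"
    unfolding assms(1) eventually_filtermap using assms(5) by simp
  moreover have "dep (insert w2 X) (\<lambda>e. Q (e(w := e w2)))" unfolding dep_def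
  proof (intro allI impI)
    fix e e' :: "nat \<Rightarrow> 'a" assume "\<forall>k\<in>insert w2 X. e k = e' k"
    then show "Q (e(w := e w2)) = Q (e'(w := e' w2))" by (intro depD[OF assms(3)]) auto
  qed
  ultimately have "eventually (\<lambda>e. Q (e(w := e w2))) V2" using coinD[OF assms(7)] by blast
  with assms(6) show ?thesis
  proof eventually_elim
    case (elim e)
    then have "Q (e(w := e w))" "Q (e(w := e w2))" by auto
    then show ?case by (rule func)
  qed
qed

text \<open>If the value in \<open>w\<close> were not algebraic over the presentation, it could be
  realised independently of its own copy \<open>w2\<close>, against \<open>copied_value\<close>.
  When \<open>w\<close> is independent over \<open>P\<close> and \<open>bs\<close>, it is moved
  directly; otherwise it depends on a further element \<open>q\<close> of \<open>P\<close>, and that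
  element is moved.\<close>

lemma functional_closed_env:
  assumes E: "ultra E" and p: "pres E X S bs" and w: "w \<notin> X"
    and Q: "DN Q" "dep (insert w X) Q"
    and func: "\<And>e a b. Q (e(w := a)) \<Longrightarrow> Q (e(w := b)) \<Longrightarrow> a = b"
    and ev: "eventually Q E"
  shows "vr w \<in> Acl E (vr ` (S \<union> set bs))"
proof (rule ccontr)
  assume n: "vr w \<notin> Acl E (vr ` (S \<union> set bs))"
  interpret u: pregeometry "Acl E" by (rule acl_pregeometry[OF E])
  have fX: "finite X" and sub: "S \<subseteq> X" "set bs \<subseteq> X" using p by (auto simp: pres_def)
  show False
  proof (cases "vr w \<in> Acl E (Pst E \<union> vr ` set bs)")
    case False
    obtain w2 where w2: "w2 \<notin> insert w X" using ex_fresh[of "insert w X"] fX by auto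
    define V where "V = filtermap (\<lambda>e. e(w2 := e w)) E"
    have V: "ultra V" unfolding V_def by (rule ultra_filtermap[OF E])
    have c: "coin E V X" unfolding V_def by (rule coin_filtermap) (use w2 in auto)
    from step_generic[OF E V p pres_coin[OF E V c p] coin_agree[OF c] w False]
    obtain V' where V': "ultra V'" "coin V V' (- {w})" "agree E V' (insert w X)"
     "pres E (insert w X) S (bs @ [w])" "pres V' (insert w X) S (bs @ [w])" "vr w \<notin> Acl V' (Pst V' \<union> vr ` (- {w}))" by blast
    have "eventually Q V'" by (rule types_agree_D[OF E V'(1,4,5,3) Q ev])
    have "eventually (\<lambda>e. e w = e w2) V'"
    proof (rule copied_value[OF V_def w2 Q(2) _ ev \<open>eventually Q V'\<close>])
      show "a = b" if "Q (e(w := a))" "Q (e(w := b))" for e a b using that by (rule func)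
      show "coin V V' (insert w2 X)" by (rule coin_mono[OF V'(2)]) (use w w2 in auto)
    qed
    moreover have "vr w2 \<in> Acl V' (Pst V' \<union> vr ` (- {w}))" using w2 by (intro acl_ext) auto
    ultimately have "vr w \<in> Acl V' (Pst V' \<union> vr ` (- {w}))"
      by (elim acl_eventually_eq) (simp add: eq_commute)
    then show False using V'(6) by blast
  next
    case True
    define Z :: "((nat \<Rightarrow> 'a) \<Rightarrow> 'a) set" where "Z = vr ` (S \<union> set bs)"
    have "vr w \<in> Acl E (Pst E \<union> Z)"
      using True u.mono[of "Pst E \<union> vr ` set bs" "Pst E \<union> Z"] by (auto simp: Z_def)
    then have "\<exists>B0\<subseteq>Pst E. finite B0 \<and> {vr w} \<subseteq> Acl E (B0 \<union> Z)" by (intro u.finite_support) auto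
    then have exm: "\<exists>m B0. B0 \<subseteq> Pst E \<and> finite B0 \<and> card B0 = m \<and> vr w \<in> Acl E (B0 \<union> Z)" by auto
    \<comment> \<open>A smallest set of additional elements of \<open>P\<close>: without
      \<open>q\<close> the value is no longer algebraic, so over the remaining elements
      \<open>q\<close> and the value are algebraic over each other.\<close>
    obtain m where m: "\<exists>B0. B0 \<subseteq> Pst E \<and> finite B0 \<and> card B0 = m \<and> vr w \<in> Acl E (B0 \<union> Z)"
      and mleast: "\<And>m'. m' < m \<Longrightarrow> \<not> (\<exists>B0. B0 \<subseteq> Pst E \<and> finite B0 \<and> card B0 = m' \<and> vr w \<in> Acl E (B0 \<union> Z))"
      using exists_least_iff[of "\<lambda>m. \<exists>B0. B0 \<subseteq> Pst E \<and> finite B0 \<and> card B0 = m \<and> vr w \<in> Acl E (B0 \<union> Z)"] exm by auto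
    obtain B0 where B0: "B0 \<subseteq> Pst E" "finite B0" "card B0 = m" "vr w \<in> Acl E (B0 \<union> Z)" using m by blast
    have "B0 \<noteq> {}" using B0(4) n by (auto simp: Z_def)
    then obtain q where q: "q \<in> B0" by blast
    have "card (B0 - {q}) < m" using B0(2,3) q by (metis card_Diff1_less)
    from mleast[OF this] have nq: "vr w \<notin> Acl E ((B0 - {q}) \<union> Z)" using B0(1,2) by auto
    obtain qs where qs: "set qs = B0 - {q}" using finite_list[of "B0 - {q}"] B0(2) by blast
    obtain w0 where w0: "\<forall>k\<in>insert w X. k < w0" using ex_above[of "insert w X"] fX by auto
    define E3 where "E3 = filtermap (store w0 (qs @ [q])) E"
    define ws where "ws = [w0..<w0 + length qs]"
    define wq where "wq = w0 + length qs"
    have wsq: "set [w0..<w0 + length (qs @ [q])] = insert wq (set ws)" by (auto simp: ws_def wq_def)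
    have sP: "set (qs @ [q]) \<subseteq> Pst E" using qs q B0(1) by auto
    have w0': "\<forall>k\<in>X. k < w0" using w0 by auto
    note st = store_P[OF E p sP w0', folded E3_def, unfolded wsq]
    have dj: "w \<notin> set ws" "w \<noteq> wq" "wq \<notin> set ws" "X \<inter> insert wq (set ws) = {}"
      using w0 by (auto simp: ws_def wq_def)
    have im: "(\<lambda>k e. store w0 (qs @ [q]) e k) ` set ws = set qs"
    proof -
      have "(\<lambda>k e. store w0 (qs @ [q]) e k) ` set ws = (\<lambda>k e. store w0 qs e k) ` set ws"
        by (rule image_cong) (auto simp: store_def ws_def nth_append)
      then show ?thesis using store_image[of w0 qs] by (simp add: ws_def)
    qed
    have imY: "(\<lambda>k e. store w0 (qs @ [q]) e k) ` (S \<union> set bs) = Z" unfolding Z_def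
    proof (rule image_cong)
      fix k assume "k \<in> S \<union> set bs"
      then have "k < w0" using w0' sub by auto
      then show "(\<lambda>e. store w0 (qs @ [q]) e k) = vr k" by (auto simp: store_def)
    qed simp
    have sq: "(\<lambda>e. store w0 (qs @ [q]) e wq) = q" by (auto simp: store_def wq_def)
    have sw: "(\<lambda>e. store w0 (qs @ [q]) e w) = vr w" using w0 by (auto simp: store_def)
    have tr: "vr w \<in> Acl E3 (vr ` K) \<longleftrightarrow> vr w \<in> Acl E ((\<lambda>k e. store w0 (qs @ [q]) e k) ` K)" for K
      unfolding E3_def acl_filtermap sw by (simp add: image_image)
    have im2: "(\<lambda>k e. store w0 (qs @ [q]) e k) ` (set ws \<union> (S \<union> set bs)) = (B0 - {q}) \<union> Z"
      unfolding image_Un[of _ "set ws"] im imY qs ..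
    have im3: "(\<lambda>k e. store w0 (qs @ [q]) e k) ` insert wq (set ws \<union> (S \<union> set bs)) = B0 \<union> Z"
      unfolding image_insert im2 sq using q by blast
    have n3: "vr w \<notin> Acl E3 (vr ` (set ws \<union> (S \<union> set bs)))" unfolding tr im2 by (rule nq)
    have i3: "vr w \<in> Acl E3 (vr ` insert wq (set ws \<union> (S \<union> set bs)))" unfolding tr im3 by (rule B0(4))
    interpret u3: pregeometry "Acl E3" by (rule acl_pregeometry[OF st(1)])
    have "agree E3 E3 X" by (simp add: agree_def)
    from promote_P[OF st(1) _ st(1,3,3) this, of ws] st(4)
    obtain V0 S1 where S1: "S1 \<subseteq> S \<union> set ws" "pres E3 (X \<union> set ws) S1 bs" by auto
    have a1: "vr w \<notin> Acl E3 (vr ` (S1 \<union> set bs))"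
      using n3 u3.mono[of "vr ` (S1 \<union> set bs)" "vr ` (set ws \<union> (S \<union> set bs))"] S1(1) by blast
    have "vr ` insert wq (set ws \<union> (S \<union> set bs)) \<subseteq> Acl E3 (vr ` insert wq (S1 \<union> set bs))"
    proof -
      have "vr ` (set ws \<union> (S \<union> set bs)) \<subseteq> Acl E3 (vr ` (S1 \<union> set bs))" using S1(2) sub by (auto simp: pres_def)
      also have "\<dots> \<subseteq> Acl E3 (vr ` insert wq (S1 \<union> set bs))" by (rule u3.mono) auto
      finally show ?thesis using u3.mem[of "vr wq" "vr ` insert wq (S1 \<union> set bs)"] by auto
    qed
    then have a2: "vr w \<in> Acl E3 (vr ` insert wq (S1 \<union> set bs))" using u3.cls_subset i3 by blast
    then have a2': "vr w \<in> Acl E3 (insert (vr wq) (vr ` (S1 \<union> set bs)))" by simp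
    have wqn: "vr wq \<notin> Acl E3 (vr ` (S1 \<union> set bs))" using u3.trans1[OF _ a2'] a1 by blast
    have wqc: "nonconst E3 (vr wq)" unfolding nonconst_def
    proof (intro allI notI)
      fix c assume "eventually (\<lambda>e. e wq = c) E3"
      then have "vr wq \<in> Acl E3 (vr ` (S1 \<union> set bs))"
        by (intro acl_eventually_eq[OF acl_const[of c UNIV]]) (auto simp: eq_commute)
      then show False using wqn by blast
    qed
    have wqd: "\<not> eventually (\<lambda>e. e wq = e k) E3" if k: "k \<in> S1" for k
    proof
      assume e: "eventually (\<lambda>e. e wq = e k) E3"
      have "vr k \<in> Acl E3 (vr ` (S1 \<union> set bs))" using k by (intro acl_ext) auto
      then have "vr wq \<in> Acl E3 (vr ` (S1 \<union> set bs))"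
        by (rule acl_eventually_eq) (use e in \<open>simp add: eq_commute\<close>)
      then show False using wqn by blast
    qed
    define X1 where "X1 = X \<union> set ws"
    have fX1: "finite X1" "w \<notin> X1" "wq \<notin> X1" using fX w dj by (auto simp: X1_def)
    obtain w2 where w2: "w2 \<notin> insert w (insert wq X1)" using ex_fresh[of "insert w (insert wq X1)"] fX1 by auto
    define V where "V = filtermap (\<lambda>e. e(w2 := e w)) E3"
    have V: "ultra V" unfolding V_def by (rule ultra_filtermap[OF st(1)])
    have c: "coin E3 V X1" unfolding V_def by (rule coin_filtermap) (use w2 in auto)
    have p1: "pres E3 X1 S1 bs" using S1(2) by (simp add: X1_def)
    have wqP: "vr wq \<in> Pst E3" by (rule st(4)) simp
    from step_P[OF st(1) V p1 pres_coin[OF st(1) V c p1] coin_agree[OF c] fX1(3) wqP wqc wqd]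
    obtain V1 where V1: "ultra V1" "coin V V1 (- {wq})" "agree E3 V1 (insert wq X1)"
     "pres E3 (insert wq X1) (insert wq S1) bs" "pres V1 (insert wq X1) (insert wq S1) bs"
     "vr wq \<notin> Acl V1 (vr ` (- {wq}))" by blast
    have a3: "vr w \<in> Acl E3 (vr ` (insert wq S1 \<union> set bs))" using a2 by simp
    have "w \<notin> insert wq X1" using fX1 dj by blast
    from step_alg[OF st(1) V1(1,4,5,3) this a3]
    obtain V2 where V2: "ultra V2" "coin V1 V2 (- {w})" "agree E3 V2 (insert w (insert wq X1))"
     "pres E3 (insert w (insert wq X1)) (insert wq S1) bs" "pres V2 (insert w (insert wq X1)) (insert wq S1) bs" by blast
    have evE3: "eventually Q E3"
    proof -
      have "coin E E3 (insert w X)" by (rule coin_mono[OF st(2)]) (use dj in auto)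
      from coinD[OF this Q(2)] show ?thesis using ev by blast
    qed
    have "dep (insert w (insert wq X1)) Q" by (rule dep_mono[OF Q(2)]) (auto simp: X1_def)
    then have "eventually Q V2" by (rule types_agree_D[OF st(1) V2(1,4,5,3) Q(1) _ evE3])
    have eq: "eventually (\<lambda>e. e w = e w2) V2"
    proof (rule copied_value[OF V_def _ Q(2) _ evE3 \<open>eventually Q V2\<close>])
      show "a = b" if "Q (e(w := a))" "Q (e(w := b))" for e a b using that by (rule func)
      show "w2 \<notin> insert w X" using w2 by (auto simp: X1_def)
      show "coin V V2 (insert w2 X)"
        by (rule coin_trans[OF coin_mono[OF V1(2)] coin_mono[OF V2(2)]]) (use w w2 dj in auto)
    qed
    have S1X: "S1 \<subseteq> X1" "set bs \<subseteq> X1" using p1 by (auto simp: pres_def)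
    \<comment> \<open>By exchange \<open>wq\<close> is algebraic over \<open>w\<close>. As
      \<open>w\<close> equals the copy \<open>w2\<close> in \<open>V2\<close>, the slot
      \<open>wq\<close> would be algebraic over slots other than itself, which the choice of
      \<open>V1\<close> forbids.\<close>
    have "vr wq \<in> Acl E3 (insert (vr w) (vr ` (S1 \<union> set bs)))" by (rule u3.exchange[OF a2' a1])
    then have "vr wq \<in> Acl E3 (vr ` insert w (S1 \<union> set bs))" by simp
    then have b1: "vr wq \<in> Acl V2 (vr ` insert w (S1 \<union> set bs))"
      by (rule acl_agree[OF V2(3), rotated]) (use S1X in auto)
    interpret v2: pregeometry "Acl V2" by (rule acl_pregeometry[OF V2(1)])
    have "vr w2 \<in> Acl V2 (vr ` insert w2 (S1 \<union> set bs))" by (rule acl_ext) auto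
    then have "vr w \<in> Acl V2 (vr ` insert w2 (S1 \<union> set bs))"
      by (rule acl_eventually_eq) (use eq in \<open>simp add: eq_commute\<close>)
    then have "vr ` insert w (S1 \<union> set bs) \<subseteq> Acl V2 (vr ` insert w2 (S1 \<union> set bs))"
      using v2.extensive[of "vr ` insert w2 (S1 \<union> set bs)"] by auto
    then have "vr wq \<in> Acl V2 (vr ` insert w2 (S1 \<union> set bs))" using v2.cls_subset b1 by blast
    then have b2: "vr wq \<in> Acl V1 (vr ` insert w2 (S1 \<union> set bs))"
      by (rule acl_agree[OF coin_agree[OF coin_sym[OF V2(2)]], rotated]) (use S1X w2 dj fX1 in auto)
    have "vr ` insert w2 (S1 \<union> set bs) \<subseteq> vr ` (- {wq})" using S1X w2 fX1 by auto
    from acl_mono[OF this] b2 show False using V1(6) by blast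
  qed
qed

text \<open>The general case is brought into the form of a presented type. A subset
  \<open>S0\<close> of least size spanning \<open>S\<close> consists of nonconstant elements that
  differ modulo \<open>U\<close>; it is laid out together with \<open>bs\<close> in fresh
  slots.\<close>

lemma functional_closed:
  fixes U :: "'i filter"
  assumes U: "ultra U" and fX: "finite X" and S: "finite S" "S \<subseteq> Pst U"
    and bs: "rkP U bs = length bs"
    and x: "\<And>k. k \<in> X \<Longrightarrow> x k \<in> Acl U (S \<union> set bs)" and w: "w \<notin> X"
    and Q: "DN Q" "dep (insert w X) Q"
    and func: "\<And>e a b. Q (e(w := a)) \<Longrightarrow> Q (e(w := b)) \<Longrightarrow> a = b"
    and ev: "eventually (\<lambda>i. Q ((\<lambda>k. x k i)(w := f i))) U"
  shows "f \<in> Acl U (S \<union> set bs)"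
proof -
  interpret u: pregeometry "Acl U" by (rule acl_pregeometry[OF U])
  have exm: "\<exists>m S0. S0 \<subseteq> S \<and> card S0 = m \<and> S \<subseteq> Acl U S0" using u.extensive by blast
  obtain m where m: "\<exists>S0. S0 \<subseteq> S \<and> card S0 = m \<and> S \<subseteq> Acl U S0"
    and mleast: "\<And>m'. m' < m \<Longrightarrow> \<not> (\<exists>S0. S0 \<subseteq> S \<and> card S0 = m' \<and> S \<subseteq> Acl U S0)"
    using exists_least_iff[of "\<lambda>m. \<exists>S0. S0 \<subseteq> S \<and> card S0 = m \<and> S \<subseteq> Acl U S0"] exm by auto
  obtain S0 where S0: "S0 \<subseteq> S" "card S0 = m" "S \<subseteq> Acl U S0" using m by blast
  have fS0: "finite S0" using S0(1) S(1) finite_subset by blast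
  have indep: "s \<notin> Acl U (S0 - {s})" if s: "s \<in> S0" for s
  proof
    assume a: "s \<in> Acl U (S0 - {s})"
    then have "S0 \<subseteq> Acl U (S0 - {s})" using u.extensive[of "S0 - {s}"] by blast
    then have "S \<subseteq> Acl U (S0 - {s})" using u.cls_subset S0(3) by blast
    moreover have "card (S0 - {s}) < m" using card_Diff1_less[OF fS0 s] S0(2) by simp
    ultimately show False using mleast[of "card (S0 - {s})"] S0(1) by blast
  qed
  obtain ss where ss: "set ss = S0" "distinct ss" using finite_distinct_list[OF fS0] by blast
  obtain N where N: "\<forall>k\<in>insert w X. k < N" using ex_above[of "insert w X"] fX by auto
  define M where "M = N + length ss"
  define y where "y k = (if k = w then f else if N \<le> k \<and> k < M then ss ! (k - N)
     else if M \<le> k \<and> k < M + length bs then bs ! (k - M) else x k)" for k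
  define E where "E = filtermap (\<lambda>i k. y k i) U"
  have E: "ultra E" unfolding E_def by (rule ultra_filtermap[OF U])
  have tr: "vr k \<in> Acl E (vr ` K) \<longleftrightarrow> y k \<in> Acl U (y ` K)" for k K
    unfolding E_def acl_filtermap by (simp add: image_image)
  define S' where "S' = {N..<M}"
  define bs' where "bs' = [M..<M + length bs]"
  define X' where "X' = X \<union> S' \<union> set bs'"
  have yS: "y k = ss ! (k - N)" "k - N < length ss" if "k \<in> S'" for k
    using that N by (auto simp: y_def S'_def M_def)
  have yb: "map y bs' = bs"
    using N by (intro nth_equalityI) (auto simp: bs'_def y_def M_def)
  have yX: "y k = x k" if "k \<in> X" for k using that N w by (auto simp: y_def M_def)
  have yw: "y w = f" by (simp add: y_def)
  have imS: "y ` S' = S0"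
  proof
    show "y ` S' \<subseteq> S0" using yS ss(1) by auto
    show "S0 \<subseteq> y ` S'"
    proof
      fix s assume "s \<in> S0"
      then obtain i where i: "i < length ss" "ss ! i = s" using ss(1) by (auto simp: in_set_conv_nth)
      then have "N + i \<in> S'" by (auto simp: S'_def M_def)
      then show "s \<in> y ` S'" using yS(1)[of "N + i"] i by (intro image_eqI[of _ _ "N + i"]) auto
    qed
  qed
  have imb: "y ` set bs' = set bs" using yb by (metis set_map)
  have cl0: "Acl U (S0 \<union> set bs) = Acl U (S \<union> set bs)"
  proof (rule u.cls_cong)
    show "S0 \<union> set bs \<subseteq> Acl U (S \<union> set bs)" using S0(1) u.extensive[of "S \<union> set bs"] by blast
    show "S \<union> set bs \<subseteq> Acl U (S0 \<union> set bs)"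
      using S0(3) u.mono[of S0 "S0 \<union> set bs"] u.extensive[of "S0 \<union> set bs"] by blast
  qed
  have pE: "pres E X' S' bs'" unfolding pres_def
  proof (intro conjI ballI impI)
    show "finite X'" using fX by (simp add: X'_def S'_def)
    show "S' \<subseteq> X'" "set bs' \<subseteq> X'" by (auto simp: X'_def)
    show "vr k \<in> Pst E" if "k \<in> S'" for k
    proof -
      have "y k \<in> Pst U" using imS S0(1) S(2) that by blast
      then show ?thesis by (simp add: Pst_def E_def eventually_filtermap)
    qed
    show "nonconst E (vr k)" if "k \<in> S'" for k unfolding nonconst_def
    proof (intro allI notI)
      fix c assume "eventually (\<lambda>e. e k = c) E"
      then have "eventually (\<lambda>i. c = y k i) U" by (simp add: E_def eventually_filtermap eq_commute)
      then have "y k \<in> Acl U (S0 - {y k})" by (rule acl_eventually_eq[OF acl_const[OF UNIV_I]])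
      then show False using indep[of "y k"] imS that by blast
    qed
    show "\<not> eventually (\<lambda>e. e k = e k') E" if "k \<in> S'" "k' \<in> S'" "k \<noteq> k'" for k k'
    proof
      assume "eventually (\<lambda>e. e k = e k') E"
      then have e: "eventually (\<lambda>i. y k i = y k' i) U" by (simp add: E_def eventually_filtermap)
      have "k - N \<noteq> k' - N" using that by (auto simp: S'_def)
      then have "y k \<noteq> y k'" using ss(2) yS[OF that(1)] yS[OF that(2)] by (simp add: nth_eq_iff_index_eq)
      then have "y k \<in> Acl U (S0 - {y k'})" using imS that by (intro acl_ext) auto
      then have "y k' \<in> Acl U (S0 - {y k'})" by (rule acl_eventually_eq[OF _ e])
      then show False using indep[of "y k'"] imS that by blast
    qed
    show "rkP E (map vr bs') = length bs'"
    proof -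
      have "rkU U (Pst U \<union> y ` {}) (map y bs') = rkU E (Pst E \<union> vr ` {}) (map vr bs')"
        by (rule rkP_transfer[OF U E]) (simp add: E_def eventually_filtermap)
      then show ?thesis using bs yb by (simp add: bs'_def)
    qed
    show "vr k \<in> Acl E (vr ` (S' \<union> set bs'))" if "k \<in> X'" for k
    proof -
      have "y k \<in> Acl U (S0 \<union> set bs)"
      proof (cases "k \<in> X")
        case True then show ?thesis using x yX cl0 by simp
      next
        case False
        then have "y k \<in> S0 \<union> set bs" using that imS imb by (auto simp: X'_def)
        then show ?thesis by (rule u.mem)
      qed
      then show ?thesis using tr[of k "S' \<union> set bs'"] by (simp add: image_Un imS imb)
    qed
  qed
  have wX': "w \<notin> X'" using w N by (auto simp: X'_def S'_def bs'_def M_def)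
  have evE: "eventually Q E"
  proof -
    have "Q (\<lambda>k. y k i) = Q ((\<lambda>k. x k i)(w := f i))" for i
      by (rule depD[OF Q(2)]) (use yX yw in auto)
    then show ?thesis using ev by (simp add: E_def eventually_filtermap)
  qed
  have dQ: "dep (insert w X') Q" by (rule dep_mono[OF Q(2)]) (auto simp: X'_def)
  have "vr w \<in> Acl E (vr ` (S' \<union> set bs'))"
  proof (rule functional_closed_env[OF E pE wX' Q(1) dQ _ evE])
    show "a = b" if "Q (e(w := a))" "Q (e(w := b))" for e a b using that by (rule func)
  qed
  then have "y w \<in> Acl U (S0 \<union> set bs)"
    using tr[of w "S' \<union> set bs'"] by (simp add: image_Un imS imb)
  then show ?thesis unfolding cl0 by (simp add: y_def)
qed

lemma presentation_exists:
  assumes U: "ultra U"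
  shows "\<exists>ix S. distinct ix \<and> set ix \<subseteq> {..<length xs} \<and> rkP U (map ((!) xs) ix) = length ix \<and>
    length ix = rkP U xs \<and> finite S \<and> S \<subseteq> Pst U \<and> set xs \<subseteq> Acl U (S \<union> set (map ((!) xs) ix))"
proof -
  interpret u: pregeometry "Acl U" by (rule acl_pregeometry[OF U])
  obtain ix where ix: "distinct ix" "set ix \<subseteq> {..<length xs}" "u.rk (Pst U) (map ((!) xs) ix) = length ix"
     "length ix = u.rk (Pst U) xs" "set xs \<subseteq> Acl U (Pst U \<union> set (map ((!) xs) ix))"
    using u.rk_basis[of xs "Pst U"] by blast
  then show ?thesis using u.finite_support[OF _ ix(5)] by auto
qed

text \<open>Functions are given as relations in which the coordinates in \<open>A\<close> determine
  all others. This suits the graph of a group law, where any two of the three blocks determine the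
  third.\<close>

lemma tuple_closed:
  fixes U :: "'i filter"
  assumes U: "ultra U" and T: "defN N T" and A: "A \<subseteq> {..<N}"
    and func: "\<And>t t'. t \<in> T \<Longrightarrow> t' \<in> T \<Longrightarrow> (\<And>k. k \<in> A \<Longrightarrow> t ! k = t' ! k) \<Longrightarrow> t = t'"
    and ev: "eventually (\<lambda>i. map (\<lambda>k. x k i) [0..<N] \<in> T) U"
    and S: "finite S" "S \<subseteq> Pst U" and bs: "rkP U bs = length bs"
    and x: "\<And>k. k \<in> A \<Longrightarrow> x k \<in> Acl U (S \<union> set bs)" and j: "j < N"
  shows "x j \<in> Acl U (S \<union> set bs)"
proof -
  have fA: "finite A" using A finite_subset by blast
  define Q where "Q e \<longleftrightarrow> (\<exists>vs. length vs = N \<and> vs \<in> T \<and> (\<forall>k\<in>A. vs ! k = e k) \<and> vs ! j = e N)" for e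
  have "DN (\<lambda>e. \<exists>vs. length vs = N \<and>
     (\<lambda>e. map e [Suc N..<Suc N + N] \<in> T \<and> (\<forall>k\<in>A. e (Suc N + k) = e k) \<and> e (Suc N + j) = e N) (upds e (Suc N) vs))"
    by (intro D_exs D_conj D_Ball_finite fA D_eq definable_imp_D[OF T[unfolded definable_def]]) simp
  moreover have "(\<lambda>e. map e [Suc N..<Suc N + N] \<in> T \<and> (\<forall>k\<in>A. e (Suc N + k) = e k) \<and> e (Suc N + j) = e N) (upds e (Suc N) vs)
     \<longleftrightarrow> vs \<in> T \<and> (\<forall>k\<in>A. vs ! k = e k) \<and> vs ! j = e N" if l: "length vs = N" for e vs
  proof -
    have "map (upds e (Suc N) vs) [Suc N..<Suc N + N] = vs" by (rule blk_upds_same[OF l])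
    moreover have "upds e (Suc N) vs (Suc N + k) = vs ! k" if "k < N" for k using that l by (simp add: upds_def)
    moreover have "upds e (Suc N) vs k = e k" if "k \<le> N" for k using that by (simp add: upds_def)
    ultimately show ?thesis using A j by (auto simp: subset_iff)
  qed
  ultimately have QD: "DN Q" unfolding Q_def[abs_def] by (simp cong: conj_cong)
  show ?thesis
  proof (rule functional_closed[OF U fA S bs x _ QD])
    show "N \<notin> A" using A by auto
    show "dep (insert N A) Q" unfolding dep_def Q_def by auto
    show "a = b" if Qab: "Q (e(N := a))" "Q (e(N := b))" for e a b
    proof -
      obtain vs vs' where v: "vs \<in> T" "\<forall>k\<in>A. vs ! k = (e(N := a)) k" "vs ! j = a"
         "vs' \<in> T" "\<forall>k\<in>A. vs' ! k = (e(N := b)) k" "vs' ! j = b" using Qab unfolding Q_def by auto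
      have "vs = vs'" by (rule func[OF v(1,4)]) (use v(2,5) A in auto)
      then show ?thesis using v by simp
    qed
    show "eventually (\<lambda>i. Q ((\<lambda>k. x k i)(N := x j i))) U"
      using ev
    proof eventually_elim
      case (elim i)
      show ?case unfolding Q_def
        by (rule exI[of _ "map (\<lambda>k. x k i) [0..<N]"]) (use elim A j in \<open>auto simp: subset_iff\<close>)
    qed
  qed
qed

lemma tuple_closed_P:
  fixes U :: "'i filter"
  assumes U: "ultra U" and T: "defN N T" and A: "A \<subseteq> {..<N}"
    and func: "\<And>t t'. t \<in> T \<Longrightarrow> t' \<in> T \<Longrightarrow> (\<And>k. k \<in> A \<Longrightarrow> t ! k = t' ! k) \<Longrightarrow> t = t'"
    and ev: "eventually (\<lambda>i. map (\<lambda>k. x k i) [0..<N] \<in> T) U" and j: "j < N"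
  shows "x j \<in> Acl U (Pst U \<union> x ` A)"
proof -
  interpret u: pregeometry "Acl U" by (rule acl_pregeometry[OF U])
  have "finite A" using A finite_subset by blast
  then obtain as where as: "set as = A" using finite_list by blast
  obtain ix S where ix: "set ix \<subseteq> {..<length (map x as)}" "rkP U (map ((!) (map x as)) ix) = length ix"
    "finite S" "S \<subseteq> Pst U" "set (map x as) \<subseteq> Acl U (S \<union> set (map ((!) (map x as)) ix))"
    using presentation_exists[OF U, of "map x as"] by blast
  have "x j \<in> Acl U (S \<union> set (map ((!) (map x as)) ix))"
  proof (rule tuple_closed[OF U T A _ ev ix(3,4) _ _ j])
    show "t = t'" if "t \<in> T" "t' \<in> T" "\<And>k. k \<in> A \<Longrightarrow> t ! k = t' ! k" for t t' using that by (rule func)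
  qed (use ix as in auto)
  moreover have "S \<union> set (map ((!) (map x as)) ix) \<subseteq> Pst U \<union> x ` A"
    using ix(1,4) as by (auto simp: subset_iff)
  ultimately show ?thesis using u.mono by blast
qed

end

section \<open>Definable groups: the generic type is not supported by P\<close>

context pregeometry begin

lemma rk_full_iff: "rk B xs = length xs \<longleftrightarrow> (\<forall>j<length xs. xs ! j \<notin> cls (B \<union> set (take j xs)))"
proof (induction xs rule: rev_induct)
  case (snoc x xs)
  have "rk B (xs @ [x]) = length (xs @ [x]) \<longleftrightarrow> rk B xs = length xs \<and> x \<notin> cls (B \<union> set xs)"
    using rk_le_length[of B xs] by (auto simp: rk_append)
  also have "\<dots> \<longleftrightarrow> (\<forall>j<length (xs @ [x]). (xs @ [x]) ! j \<notin> cls (B \<union> set (take j (xs @ [x]))))"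
    unfolding snoc.IH by (auto simp: nth_append less_Suc_eq)
  finally show ?case .
qed simp

lemma spanning_sublist:
  assumes "set bs \<subseteq> set xs" "rk B bs = rk B xs"
  shows "set xs \<subseteq> cls (B \<union> set bs)"
proof -
  have "rk B (bs @ xs) = rk B xs"
    by (rule rk_eq) (use assms(1) extensive[of "B \<union> set xs"] extensive[of "B \<union> set (bs @ xs)"] in auto)
  then have "rk (B \<union> set bs) xs = 0" using assms(2) by (simp add: rk_append)
  then show ?thesis by (rule rk_0_imp)
qed

end

section \<open>Iterated products, and supports of types in P\<close>

context omin_pair begin

lemma acl_slice:
  assumes "f \<in> Acl (ubind V U) B"
  shows "eventually (\<lambda>i. (\<lambda>j. f (i, j)) \<in> Acl (U i) ((\<lambda>g j. g (i, j)) ` B)) V"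
proof -
  obtain Q e K where Q: "DL Q" "\<And>e. finite {a. Q (e(0 := a))}" "\<And>m. e m \<in> insert (\<lambda>_. 0) B"
    "eventually (\<lambda>z. Q ((\<lambda>m. e m z)(0 := f z))) (ubind V U)" using assms by (rule acl_E) blast
  from Q(4)[unfolded eventually_ubind] show ?thesis
  proof eventually_elim
    case (elim i)
    show ?case
    proof (rule acl_I0[OF Q(1,2), of "\<lambda>m j. e m (i, j)"])
      show "(\<lambda>j. e k (i, j)) \<in> insert (\<lambda>_. 0) ((\<lambda>g j. g (i, j)) ` B)" for k
        using Q(3)[of k] by (cases "e k = (\<lambda>_. 0)") auto
    qed (rule elim)
  qed
qed

text \<open>Once the first component is fixed, functions of it are constants, and sections of
  elements of \<open>P\<close> again belong to \<open>P\<close>; hence dependence in the product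
  descends to almost every fibre.\<close>

lemma acl_ubind:
  assumes V: "ultra V" and U: "\<And>i. ultra (U i)"
    and f: "(\<lambda>z. f (snd z)) \<in> Acl (ubind V U) (Pst (ubind V U) \<union> (\<lambda>g z. g (snd z)) ` Y \<union> range (\<lambda>h z. h (fst z)))"
  shows "eventually (\<lambda>i. f \<in> Acl (U i) (Pst (U i) \<union> Y)) V"
proof -
  let ?W = "ubind V U"
  interpret w: pregeometry "Acl ?W" by (rule acl_pregeometry[OF ultra_ubind[OF V U]])
  obtain B where B: "B \<subseteq> Pst ?W \<union> (\<lambda>g z. g (snd z)) ` Y \<union> range (\<lambda>h z. h (fst z))" "finite B"
    "(\<lambda>z. f (snd z)) \<in> Acl ?W B" using w.finchar[OF f] by blast
  have "eventually (\<lambda>i. \<forall>g\<in>B. g \<in> Pst ?W \<longrightarrow> (\<lambda>j. g (i, j)) \<in> Pst (U i)) V"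
    by (intro eventually_ball_finite B(2)) (auto simp: Pst_def eventually_ubind)
  with acl_slice[OF B(3)] show ?thesis
  proof eventually_elim
    case (elim i)
    interpret u: pregeometry "Acl (U i)" by (rule acl_pregeometry[OF U])
    have "(\<lambda>j. g (i, j)) \<in> Acl (U i) (Pst (U i) \<union> Y)" if g: "g \<in> B" for g
    proof -
      consider "g \<in> Pst ?W" | g' where "g' \<in> Y" "g = (\<lambda>z. g' (snd z))" | h where "g = (\<lambda>z. h (fst z))"
        using B(1) g by blast
      then show ?thesis
      proof cases
        case 1 then show ?thesis using elim(2) g by (intro u.mem) auto
      next
        case (2 g') then show ?thesis by (intro u.mem) auto
      next
        case (3 h) then show ?thesis using acl_const[of "h i" UNIV "U i"] by simp
      qed
    qed
    then have "(\<lambda>g j. g (i, j)) ` B \<subseteq> Acl (U i) (Pst (U i) \<union> Y)" by blast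
    from u.cls_subset[OF this] elim(1) show ?case by auto
  qed
qed

lemma rk_ubind:
  assumes V: "ultra V" and U: "\<And>i. ultra (U i)"
    and rk: "eventually (\<lambda>i. rkP (U i) fs = length fs) V"
  shows "rkU (ubind V U) (Pst (ubind V U) \<union> range (\<lambda>h z. h (fst z))) (map (\<lambda>g z. g (snd z)) fs) = length fs"
proof -
  let ?W = "ubind V U"
  interpret w: pregeometry "Acl ?W" by (rule acl_pregeometry[OF ultra_ubind[OF V U]])
  have "map (\<lambda>g z. g (snd z)) fs ! j \<notin> Acl ?W ((Pst ?W \<union> range (\<lambda>h z. h (fst z))) \<union> set (take j (map (\<lambda>g z. g (snd z)) fs)))"
    if j: "j < length fs" for j
  proof
    assume a: "map (\<lambda>g z. g (snd z)) fs ! j \<in> Acl ?W ((Pst ?W \<union> range (\<lambda>h z. h (fst z))) \<union> set (take j (map (\<lambda>g z. g (snd z)) fs)))"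
    have eq: "(Pst ?W \<union> range (\<lambda>h z. h (fst z))) \<union> set (take j (map (\<lambda>g z. g (snd z)) fs))
      = Pst ?W \<union> (\<lambda>g z. g (snd z)) ` set (take j fs) \<union> range (\<lambda>h z. h (fst z))"
      unfolding take_map set_map by blast
    have nm: "map (\<lambda>g z. g (snd z)) fs ! j = (\<lambda>z. (fs ! j) (snd z))" using j by simp
    from a have "(\<lambda>z. (fs ! j) (snd z)) \<in> Acl ?W (Pst ?W \<union> (\<lambda>g z. g (snd z)) ` set (take j fs) \<union> range (\<lambda>h z. h (fst z)))"
      unfolding eq nm .
    from acl_ubind[OF V U this] rk
    have "eventually (\<lambda>i. False) V"
    proof eventually_elim
      case (elim i)
      interpret u: pregeometry "Acl (U i)" by (rule acl_pregeometry[OF U])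
      show ?case using elim(1) elim(2)[unfolded u.rk_full_iff] j by blast
    qed
    then show False using V by (simp add: ultra_const)
  qed
  then show ?thesis using w.rk_full_iff[of "Pst ?W \<union> range (\<lambda>h z. h (fst z))" "map (\<lambda>g z. g (snd z)) fs"] by simp
qed

text \<open>The elements of \<open>P\<close> on which \<open>A\<close> really depends, described
  without choosing a presentation: by exchange, an element is needed when it can be recovered from
  \<open>A\<close> and the rest of \<open>P\<close>. Elements that agree along \<open>U\<close>
  count as one.\<close>

definition supp :: "'i filter \<Rightarrow> ('i \<Rightarrow> 'a) set \<Rightarrow> ('i \<Rightarrow> 'a) set" where
  "supp U A = {q \<in> Pst U. nonconst U q \<and>
     q \<in> Acl U (A \<union> {p \<in> Pst U. \<not> eventually (\<lambda>i. p i = q i) U})}"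

text \<open>Were \<open>q\<close> absent from \<open>S\<close>, it would be algebraic over
  \<open>bs\<close> and elements of \<open>P\<close> different from it; independence of
  \<open>bs\<close> over \<open>P\<close> removes \<open>bs\<close>, against
  \<open>Pst_independent\<close>.\<close>

lemma supp_subset:
  assumes U: "ultra U" and S: "S \<subseteq> Pst U" and bs: "rkP U bs = length bs"
    and A: "A \<subseteq> Acl U (S \<union> set bs)" and q: "q \<in> supp U A"
  shows "\<exists>s\<in>S. eventually (\<lambda>i. s i = q i) U"
proof (rule ccontr)
  assume n: "\<not> ?thesis"
  interpret u: pregeometry "Acl U" by (rule acl_pregeometry[OF U])
  let ?P = "{p \<in> Pst U. \<not> eventually (\<lambda>i. p i = q i) U}"
  have q': "q \<in> Pst U" "nonconst U q" "q \<in> Acl U (A \<union> ?P)" using q by (auto simp: supp_def)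
  have "S \<union> set bs \<subseteq> Acl U (?P \<union> set bs)" using n S u.extensive[of "?P \<union> set bs"] by blast
  then have "A \<subseteq> Acl U (?P \<union> set bs)" using A u.cls_subset by blast
  then have "A \<union> ?P \<subseteq> Acl U (?P \<union> set bs)" using u.extensive[of "?P \<union> set bs"] by blast
  then have "q \<in> Acl U (?P \<union> set bs)" using u.cls_subset q'(3) by blast
  moreover have "u.rk (insert q ?P) bs = length bs"
    by (rule u.rk_indep_antimono[OF bs]) (use q' u.extensive[of "Pst U"] in auto)
  ultimately have "q \<in> Acl U ?P" by (rule u.indep_drop)
  moreover have "q \<notin> Acl U ?P" by (rule Pst_independent[OF U q'(1,2)]) auto
  ultimately show False by blast
qed

text \<open>Over a smaller \<open>S\<close> some member of \<open>A\<close> is lost, and exchange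
  recovers the omitted element from that member. Together with \<open>supp_subset\<close> this
  identifies a minimal set of needed elements with the support.\<close>

lemma minimal_support:
  assumes U: "ultra U" and S: "finite S" "S \<subseteq> Pst U" and A: "A \<subseteq> Acl U (S \<union> set bs)" and bA: "set bs \<subseteq> A"
    and least: "\<And>S'. S' \<subseteq> S \<Longrightarrow> A \<subseteq> Acl U (S' \<union> set bs) \<Longrightarrow> S' = S"
  shows "S \<subseteq> supp U A" "\<And>s s'. s \<in> S \<Longrightarrow> s' \<in> S \<Longrightarrow> s \<noteq> s' \<Longrightarrow> \<not> eventually (\<lambda>i. s i = s' i) U"
proof -
  interpret u: pregeometry "Acl U" by (rule acl_pregeometry[OF U])
  have indep: "s \<notin> Acl U ((S - {s}) \<union> set bs)" if s: "s \<in> S" for s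
  proof
    assume a: "s \<in> Acl U ((S - {s}) \<union> set bs)"
    then have "S \<union> set bs \<subseteq> Acl U ((S - {s}) \<union> set bs)" using u.extensive[of "(S - {s}) \<union> set bs"] by blast
    then have "A \<subseteq> Acl U ((S - {s}) \<union> set bs)" using u.cls_subset A by blast
    then show False using least[of "S - {s}"] s by blast
  qed
  show dist: "\<not> eventually (\<lambda>i. s i = s' i) U" if ss: "s \<in> S" "s' \<in> S" "s \<noteq> s'" for s s'
  proof
    assume e: "eventually (\<lambda>i. s i = s' i) U"
    have "s \<in> Acl U ((S - {s'}) \<union> set bs)" using ss by (intro u.mem) auto
    then have "s' \<in> Acl U ((S - {s'}) \<union> set bs)" by (rule acl_eventually_eq[OF _ e])
    then show False using indep ss by blast
  qed
  show "S \<subseteq> supp U A"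
  proof
    fix s assume s: "s \<in> S"
    have "nonconst U s" unfolding nonconst_def
    proof (intro allI notI)
      fix c assume "eventually (\<lambda>i. s i = c) U"
      then have "eventually (\<lambda>i. c = s i) U" by (simp add: eq_commute)
      then have "s \<in> Acl U ((S - {s}) \<union> set bs)" by (rule acl_eventually_eq[OF acl_const[OF UNIV_I]])
      then show False using indep s by blast
    qed
    moreover have "\<exists>x\<in>A. x \<notin> Acl U ((S - {s}) \<union> set bs)" using least[of "S - {s}"] s by blast
    then obtain x where x: "x \<in> A" "x \<notin> Acl U ((S - {s}) \<union> set bs)" by blast
    have "insert s ((S - {s}) \<union> set bs) = S \<union> set bs" using s by blast
    then have "x \<in> Acl U (insert s ((S - {s}) \<union> set bs))" using A x(1) by auto
    then have "s \<in> Acl U (insert x ((S - {s}) \<union> set bs))" by (rule u.exchange[OF _ x(2)])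
    moreover have "insert x ((S - {s}) \<union> set bs) \<subseteq> A \<union> {p \<in> Pst U. \<not> eventually (\<lambda>i. p i = s i) U}"
      using x(1) bA S(2) dist s by blast
    ultimately show "s \<in> supp U A" using s S(2) u.mono unfolding supp_def by blast
  qed
qed

lemma supp_filtermap:
  assumes "q \<in> supp (filtermap g U) A"
  shows "(\<lambda>i. q (g i)) \<in> supp U ((\<lambda>f i. f (g i)) ` A)"
proof -
  let ?P = "{p \<in> Pst (filtermap g U). \<not> eventually (\<lambda>i. p i = q i) (filtermap g U)}"
  have q: "q \<in> Pst (filtermap g U)" "nonconst (filtermap g U) q" "q \<in> Acl (filtermap g U) (A \<union> ?P)"
    using assms by (auto simp: supp_def)
  have "(\<lambda>i. q (g i)) \<in> Acl U ((\<lambda>f i. f (g i)) ` (A \<union> ?P))" using q(3) unfolding acl_filtermap .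
  moreover have "(\<lambda>f i. f (g i)) ` (A \<union> ?P) \<subseteq> (\<lambda>f i. f (g i)) ` A \<union> {p \<in> Pst U. \<not> eventually (\<lambda>i. p i = q (g i)) U}"
    by (auto simp: Pst_def eventually_filtermap)
  ultimately have "(\<lambda>i. q (g i)) \<in> Acl U ((\<lambda>f i. f (g i)) ` A \<union> {p \<in> Pst U. \<not> eventually (\<lambda>i. p i = q (g i)) U})"
    using acl_mono by blast
  then show ?thesis using q(1,2) by (simp add: supp_def Pst_def nonconst_def eventually_filtermap)
qed

section \<open>Tuple-valued families and their presentations\<close>

definition cf :: "nat \<Rightarrow> ('i \<Rightarrow> 'a list) \<Rightarrow> ('i \<Rightarrow> 'a) list" where
  "cf n x = map (\<lambda>k i. x i ! k) [0..<n]"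

lemma length_cf [simp]: "length (cf n x) = n"
  by (simp add: cf_def)

lemma nth_cf: "k < n \<Longrightarrow> cf n x ! k = (\<lambda>i. x i ! k)"
  by (simp add: cf_def)

lemma cf_comp: "map (\<lambda>f i. f (g i)) (cf n x) = cf n (\<lambda>i. x (g i))"
  by (simp add: cf_def)

lemma cf_comp_nth: "set ix \<subseteq> {..<n} \<Longrightarrow> map (\<lambda>f i. f (g i)) (map ((!) (cf n x)) ix) = map ((!) (cf n (\<lambda>i. x (g i)))) ix"
  by (auto simp: nth_cf)

abbreviation crd :: "nat \<Rightarrow> ('i \<Rightarrow> 'a list) \<Rightarrow> nat list \<Rightarrow> ('i \<Rightarrow> 'a) list" where
  "crd n x ix \<equiv> map ((!) (cf n x)) ix"

definition rP :: "nat \<Rightarrow> 'i filter \<Rightarrow> ('i \<Rightarrow> 'a list) \<Rightarrow> nat" where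
  "rP n U x = rkP U (cf n x)"

lemma rkP_filtermap:
  assumes U: "ultra U"
  shows "rkU (filtermap g U) (Pst (filtermap g U)) fs = rkP U (map (\<lambda>f i. f (g i)) fs)"
proof -
  let ?x = "\<lambda>k. if k < length fs then fs ! k else (\<lambda>_. 0)"
  have "rkU (filtermap g U) (Pst (filtermap g U) \<union> ?x ` {}) (map ?x [0..<length fs])
     = rkU U (Pst U \<union> (\<lambda>k i. ?x k (g i)) ` {}) (map (\<lambda>k i. ?x k (g i)) [0..<length fs])"
    by (rule rkP_transfer[OF ultra_filtermap[OF U] U]) (simp add: eventually_filtermap)
  moreover have "map ?x [0..<length fs] = fs" by (rule nth_equalityI) auto
  moreover have "map (\<lambda>k i. ?x k (g i)) [0..<length fs] = map (\<lambda>f i. f (g i)) fs" by (rule nth_equalityI) auto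
  ultimately show ?thesis by simp
qed

lemma rP_filtermap: "ultra U \<Longrightarrow> rP n (filtermap g U) x = rP n U (\<lambda>i. x (g i))"
  by (simp add: rP_def rkP_filtermap cf_comp)

lemma rP_le: "ultra U \<Longrightarrow> rP n U x \<le> n"
  unfolding rP_def using pregeometry.rk_le_length[OF acl_pregeometry] by (metis length_cf)

text \<open>The basis over \<open>P\<close> is chosen among the coordinates themselves, so that
  \<open>m = 0\<close> means algebraic over as many of the coordinates as the rank says. Only an
  upper bound on the elements of \<open>P\<close> is recorded, which makes the property monotone in
  \<open>m\<close>.\<close>

definition presented :: "nat \<Rightarrow> nat \<Rightarrow> 'i filter \<Rightarrow> ('i \<Rightarrow> 'a list) \<Rightarrow> bool" where
  "presented n m U x \<longleftrightarrow> (\<exists>ix S. distinct ix \<and> set ix \<subseteq> {..<n} \<and>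
     rkP U (crd n x ix) = length ix \<and> length ix = rP n U x \<and>
     finite S \<and> S \<subseteq> Pst U \<and> card S \<le> m \<and> set (cf n x) \<subseteq> Acl U (S \<union> set (crd n x ix)))"

lemma presented_filtermap:
  assumes U: "ultra U" and p: "presented n m (filtermap g U) x"
  shows "presented n m U (\<lambda>i. x (g i))"
proof -
  let ?E = "filtermap g U"
  obtain ix S where ix: "distinct ix" "set ix \<subseteq> {..<n}" "rkP ?E (crd n x ix) = length ix"
     "length ix = rP n ?E x" "finite S" "S \<subseteq> Pst ?E" "card S \<le> m" "set (cf n x) \<subseteq> Acl ?E (S \<union> set (crd n x ix))"
    using p unfolding presented_def by blast
  let ?S = "(\<lambda>f i. f (g i)) ` S"
  have m: "map (\<lambda>f i. f (g i)) (crd n x ix) = map ((!) (cf n (\<lambda>i. x (g i)))) ix" by (rule cf_comp_nth[OF ix(2)])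
  have sc: "(\<lambda>f i. f (g i)) ` set (cf n x) = set (cf n (\<lambda>i. x (g i)))" unfolding set_map[symmetric] cf_comp ..
  have "rkP U (map ((!) (cf n (\<lambda>i. x (g i)))) ix) = length ix"
    using ix(3) unfolding rkP_filtermap[OF U] m .
  moreover have "length ix = rP n U (\<lambda>i. x (g i))" using ix(4) rP_filtermap[OF U] by simp
  moreover have "finite ?S" "?S \<subseteq> Pst U" using ix(5,6) by (auto simp: Pst_def eventually_filtermap)
  moreover have "card ?S \<le> m" using card_image_le[OF ix(5), of "\<lambda>f i. f (g i)"] ix(7) by simp
  moreover have "set (cf n (\<lambda>i. x (g i))) \<subseteq> Acl U (?S \<union> set (map ((!) (cf n (\<lambda>i. x (g i)))) ix))"
  proof -
    have "(\<lambda>i. f (g i)) \<in> Acl U ((\<lambda>f i. f (g i)) ` (S \<union> set (crd n x ix)))" if "f \<in> set (cf n x)" for f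
      using ix(8) that unfolding acl_filtermap[symmetric] by blast
    moreover have "(\<lambda>f i. f (g i)) ` (S \<union> set (crd n x ix)) = ?S \<union> set (map ((!) (cf n (\<lambda>i. x (g i)))) ix)"
      unfolding image_Un set_map[of "\<lambda>f i. f (g i)", symmetric] m ..
    ultimately show ?thesis unfolding sc[symmetric] by auto
  qed
  ultimately show ?thesis using ix(1,2) unfolding presented_def by blast
qed

end

section \<open>The group law on types\<close>

locale ngroup = omin_pair F R P for F :: "'f \<Rightarrow> 'a::linordered_ab_group_add list \<Rightarrow> 'a"
    and R :: "'r \<Rightarrow> 'a list \<Rightarrow> bool" and P +
  fixes n :: nat and G :: "'a list monoid" (structure)
  assumes ndg: "Ndef_group F R P n G"
begin

lemma grp: "group G"
  using ndg by (simp add: Ndef_group_def)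

interpretation g: group G by (rule grp)

lemma carrier_length: "x \<in> carrier G \<Longrightarrow> length x = n"
  using ndg by (auto simp: Ndef_group_def)

definition M3 :: "'a list set" where
  "M3 = {x @ y @ (x \<otimes> y) | x y. x \<in> carrier G \<and> y \<in> carrier G}"

lemma M3_definable: "defN (3 * n) M3"
  using ndg unfolding Ndef_group_def M3_def by blast

lemma carrier_definable: "defN n (carrier G)"
  using ndg unfolding Ndef_group_def by blast

text \<open>The three blocks of a point of the graph of multiplication as a single family of
  coordinates, the form that \<open>tuple_closed\<close> expects.\<close>

definition tri :: "('i \<Rightarrow> 'a list) \<Rightarrow> ('i \<Rightarrow> 'a list) \<Rightarrow> ('i \<Rightarrow> 'a list) \<Rightarrow> nat \<Rightarrow> 'i \<Rightarrow> 'a" where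
  "tri x y z k i = (if k < n then x i ! k else if k < 2 * n then y i ! (k - n) else z i ! (k - 2 * n))"

lemma tri_list: "length (x i) = n \<Longrightarrow> length (y i) = n \<Longrightarrow> length (z i) = n \<Longrightarrow>
  map (\<lambda>k. tri x y z k i) [0..<3 * n] = x i @ y i @ z i"
  by (rule nth_equalityI) (auto simp: tri_def nth_append mult_2)

lemma image_shift: "(\<lambda>k i. z i ! (k - a)) ` {a..<a + n} = set (cf n z)"
proof -
  have "(\<lambda>k i. z i ! (k - a)) ` {a..<a + n} = (\<lambda>k i. z i ! (k - a)) ` ((+) a ` {0..<n})"
    by (simp add: add.commute)
  also have "\<dots> = set (cf n z)" unfolding image_image cf_def by simp
  finally show ?thesis .
qed

lemma tri_image:
  "tri x y z ` {0..<n} = set (cf n x)" "tri x y z ` {n..<2 * n} = set (cf n y)" "tri x y z ` {2 * n..<3 * n} = set (cf n z)"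
proof -
  show "tri x y z ` {0..<n} = set (cf n x)"
    using image_shift[of x 0] by (subst image_cong[OF refl, of _ _ "\<lambda>k i. x i ! (k - 0)"]) (auto simp: tri_def)
  show "tri x y z ` {n..<2 * n} = set (cf n y)"
    using image_shift[of y n] by (subst image_cong[OF refl, of _ _ "\<lambda>k i. y i ! (k - n)"]) (auto simp: tri_def mult_2)
  have "3 * n = 2 * n + n" by simp
  then show "tri x y z ` {2 * n..<3 * n} = set (cf n z)"
    using image_shift[of z "2 * n"] by (subst image_cong[OF refl, of _ _ "\<lambda>k i. z i ! (k - 2 * n)"]) (auto simp: tri_def)
qed

definition triple :: "'i filter \<Rightarrow> ('i \<Rightarrow> 'a list) \<Rightarrow> ('i \<Rightarrow> 'a list) \<Rightarrow> ('i \<Rightarrow> 'a list) \<Rightarrow> bool" where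
  "triple U x y z \<longleftrightarrow> eventually (\<lambda>i. x i \<in> carrier G \<and> y i \<in> carrier G \<and> z i = x i \<otimes> y i) U"

lemma triple_M3: "triple U x y z \<Longrightarrow> eventually (\<lambda>i. map (\<lambda>k. tri x y z k i) [0..<3 * n] \<in> M3) U"
  unfolding triple_def
proof (erule eventually_mono)
  fix i assume a: "x i \<in> carrier G \<and> y i \<in> carrier G \<and> z i = x i \<otimes> y i"
  then have "map (\<lambda>k. tri x y z k i) [0..<3 * n] = x i @ y i @ z i"
    by (intro tri_list) (auto intro: carrier_length)
  then show "map (\<lambda>k. tri x y z k i) [0..<3 * n] \<in> M3" using a unfolding M3_def by auto
qed

text \<open>Left and right cancellation, in addition to multiplication being a function.\<close>

lemma M3_functional:
  assumes "A = {0..<n} \<union> {n..<2*n} \<or> A = {0..<n} \<union> {2*n..<3*n} \<or> A = {n..<2*n} \<union> {2*n..<3*n}"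
    and t: "t \<in> M3" "t' \<in> M3" and eq: "\<And>k. k \<in> A \<Longrightarrow> t ! k = t' ! k"
  shows "t = t'"
proof -
  obtain x y where x: "t = x @ y @ (x \<otimes> y)" "x \<in> carrier G" "y \<in> carrier G" using t by (auto simp: M3_def)
  obtain x' y' where x': "t' = x' @ y' @ (x' \<otimes> y')" "x' \<in> carrier G" "y' \<in> carrier G" using t by (auto simp: M3_def)
  have l: "length x = n" "length y = n" "length (x \<otimes> y) = n" "length x' = n" "length y' = n" "length (x' \<otimes> y') = n"
    using x x' by (auto intro: carrier_length)
  have 1: "x = x'" if s: "{0..<n} \<subseteq> A"
  proof (rule nth_equalityI)
    fix k assume "k < length x" then show "x ! k = x' ! k" using eq[of k] s l x(1) x'(1) by (auto simp: nth_append)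
  qed (simp add: l)
  have 2: "y = y'" if s: "{n..<2*n} \<subseteq> A"
  proof (rule nth_equalityI)
    fix k assume "k < length y"
    moreover from this have "n + k \<in> A" using s l by auto
    ultimately show "y ! k = y' ! k" using eq[of "n + k"] l x(1) x'(1) by (auto simp: nth_append)
  qed (simp add: l)
  have 3: "x \<otimes> y = x' \<otimes> y'" if s: "{2*n..<3*n} \<subseteq> A"
  proof (rule nth_equalityI)
    fix k assume "k < length (x \<otimes> y)"
    moreover from this have "2*n + k \<in> A" using s l by auto
    ultimately show "(x \<otimes> y) ! k = (x' \<otimes> y') ! k" using eq[of "2*n + k"] l x(1) x'(1) by (auto simp: nth_append)
  qed (simp add: l)
  show ?thesis using assms(1)
  proof (elim disjE)
    assume "A = {0..<n} \<union> {n..<2*n}" then show ?thesis using 1 2 x x' by auto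
  next
    assume "A = {0..<n} \<union> {2*n..<3*n}"
    then have "x = x'" "x \<otimes> y = x' \<otimes> y'" using 1 3 by auto
    then have "y = y'" using g.Units_l_cancel[of x y y'] x x' by (simp add: g.Units_eq)
    then show ?thesis using \<open>x = x'\<close> x x' by simp
  next
    assume "A = {n..<2*n} \<union> {2*n..<3*n}"
    then have "y = y'" "x \<otimes> y = x' \<otimes> y'" using 2 3 by auto
    then have "x = x'" using g.right_cancel[of y x x'] x x' by simp
    then show ?thesis using \<open>y = y'\<close> x x' by simp
  qed
qed

lemma tri_closed:
  assumes U: "ultra U" and tr: "triple U x y z"
    and A: "A = {0..<n} \<union> {n..<2*n} \<or> A = {0..<n} \<union> {2*n..<3*n} \<or> A = {n..<2*n} \<union> {2*n..<3*n}"
    and S: "finite S" "S \<subseteq> Pst U" and bs: "rkP U bs = length bs"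
    and sub: "tri x y z ` A \<subseteq> Acl U (S \<union> set bs)"
  shows "tri x y z ` {0..<3*n} \<subseteq> Acl U (S \<union> set bs)"
proof
  fix f assume "f \<in> tri x y z ` {0..<3*n}"
  then obtain j where j: "f = tri x y z j" "j < 3 * n" by auto
  have "tri x y z j \<in> Acl U (S \<union> set bs)"
  proof (rule tuple_closed[OF U M3_definable _ _ triple_M3[OF tr] S bs _ j(2)])
    show "A \<subseteq> {..<3*n}" using A by auto
    show "t = t'" if "t \<in> M3" "t' \<in> M3" "\<And>k. k \<in> A \<Longrightarrow> t ! k = t' ! k" for t t'
      using A that by (rule M3_functional)
  qed (use sub in auto)
  then show "f \<in> Acl U (S \<union> set bs)" using j by simp
qed

lemma tri_closed_P:
  assumes U: "ultra U" and tr: "triple U x y z"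
    and A: "A = {0..<n} \<union> {n..<2*n} \<or> A = {0..<n} \<union> {2*n..<3*n} \<or> A = {n..<2*n} \<union> {2*n..<3*n}"
  shows "tri x y z ` {0..<3*n} \<subseteq> Acl U (Pst U \<union> tri x y z ` A)"
proof
  fix f assume "f \<in> tri x y z ` {0..<3*n}"
  then obtain j where j: "f = tri x y z j" "j < 3 * n" by auto
  have "tri x y z j \<in> Acl U (Pst U \<union> tri x y z ` A)"
  proof (rule tuple_closed_P[OF U M3_definable _ _ triple_M3[OF tr] j(2)])
    show "A \<subseteq> {..<3*n}" using A by auto
    show "t = t'" if "t \<in> M3" "t' \<in> M3" "\<And>k. k \<in> A \<Longrightarrow> t ! k = t' ! k" for t t'
      using A that by (rule M3_functional)
  qed
  then show "f \<in> Acl U (Pst U \<union> tri x y z ` A)" using j by simp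
qed

lemma tri_all: "tri x y z ` {0..<3*n} = set (cf n x) \<union> set (cf n y) \<union> set (cf n z)"
proof -
  have "{0..<3*n} = {0..<n} \<union> {n..<2*n} \<union> {2*n..<3*n}" by auto
  then show ?thesis by (simp only: image_Un tri_image)
qed

lemma triple_closed:
  assumes "ultra U" "triple U x y z" "finite S" "S \<subseteq> Pst U" "rkP U bs = length bs"
  shows "set (cf n x) \<union> set (cf n y) \<subseteq> Acl U (S \<union> set bs) \<Longrightarrow> set (cf n z) \<subseteq> Acl U (S \<union> set bs)"
    "set (cf n x) \<union> set (cf n z) \<subseteq> Acl U (S \<union> set bs) \<Longrightarrow> set (cf n y) \<subseteq> Acl U (S \<union> set bs)"
    "set (cf n y) \<union> set (cf n z) \<subseteq> Acl U (S \<union> set bs) \<Longrightarrow> set (cf n x) \<subseteq> Acl U (S \<union> set bs)"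
  using tri_closed[OF assms(1,2) _ assms(3-5), of "{0..<n} \<union> {n..<2*n}"]
    tri_closed[OF assms(1,2) _ assms(3-5), of "{0..<n} \<union> {2*n..<3*n}"]
    tri_closed[OF assms(1,2) _ assms(3-5), of "{n..<2*n} \<union> {2*n..<3*n}"]
  unfolding tri_all image_Un tri_image by auto

lemma triple_closed_P:
  assumes "ultra U" "triple U x y z"
  shows "set (cf n z) \<subseteq> Acl U (Pst U \<union> (set (cf n x) \<union> set (cf n y)))"
    "set (cf n y) \<subseteq> Acl U (Pst U \<union> (set (cf n x) \<union> set (cf n z)))"
    "set (cf n x) \<subseteq> Acl U (Pst U \<union> (set (cf n y) \<union> set (cf n z)))"
  using tri_closed_P[OF assms, of "{0..<n} \<union> {n..<2*n}"]
    tri_closed_P[OF assms, of "{0..<n} \<union> {2*n..<3*n}"]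
    tri_closed_P[OF assms, of "{n..<2*n} \<union> {2*n..<3*n}"]
  unfolding tri_all image_Un tri_image by auto

text \<open>This turns out to be the large dimension of the constructed copy and of its
  closure.\<close>

definition kmax :: nat where
  "kmax = Max {rP n U (\<lambda>l. l) | U. ultra U \<and> eventually (\<lambda>l. l \<in> carrier G) U}"

lemma kmax_set: "finite {rP n U (\<lambda>l. l) | U. ultra U \<and> eventually (\<lambda>l. l \<in> carrier G) U}"
  "{rP n U (\<lambda>l. l) | U. ultra U \<and> eventually (\<lambda>l. l \<in> carrier G) U} \<noteq> {}"
proof -
  have "{rP n U (\<lambda>l. l) | U. ultra U \<and> eventually (\<lambda>l. l \<in> carrier G) U} \<subseteq> {..n}" using rP_le by auto
  then show "finite {rP n U (\<lambda>l. l) | U. ultra U \<and> eventually (\<lambda>l. l \<in> carrier G) U}" using finite_subset by blast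
  have "eventually (\<lambda>l. l \<in> carrier G) (principal {\<one>})" by (simp add: eventually_principal)
  then show "{rP n U (\<lambda>l. l) | U. ultra U \<and> eventually (\<lambda>l. l \<in> carrier G) U} \<noteq> {}"
    using ultra_principal[of "\<one>"] by blast
qed

lemma kmax_attained: "\<exists>U. ultra U \<and> eventually (\<lambda>l. l \<in> carrier G) U \<and> rP n U (\<lambda>l. l) = kmax"
  using Max_in[OF kmax_set] unfolding kmax_def[symmetric] by auto

lemma kmax_bound:
  assumes "ultra U" "eventually (\<lambda>i. x i \<in> carrier G) U" shows "rP n U x \<le> kmax"
proof -
  have "rP n (filtermap x U) (\<lambda>l. l) \<le> kmax" unfolding kmax_def
    by (rule Max_ge[OF kmax_set(1)], rule CollectI, rule exI[of _ "filtermap x U"])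
      (use assms ultra_filtermap[OF assms(1), of x] in \<open>auto simp: eventually_filtermap\<close>)
  then show ?thesis using rP_filtermap[OF assms(1), of n x "\<lambda>l. l"] by simp
qed

end

context omin begin

end

section \<open>Thin sets\<close>

context omin_pair begin

text \<open>Dimension at most \<open>k\<close> in the o-minimal sense, expressed through types. The
  rank is over the constants and not over \<open>P\<close>, because the bound has to survive the
  passage to the closure.\<close>

definition thin :: "nat \<Rightarrow> nat \<Rightarrow> 'a list set \<Rightarrow> bool" where
  "thin k m Z \<longleftrightarrow> definable F R m Z \<and> (\<forall>x\<in>Z. length x = m) \<and>
     (\<forall>U. ultra U \<longrightarrow> eventually (\<lambda>l. l \<in> Z) U \<longrightarrow> rkU U {} (cf m (\<lambda>l. l)) \<le> k)"

lemma definable_D: "definable F' R' m Z \<Longrightarrow> D F' R' UNIV (\<lambda>e. blk e a m \<in> Z)"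
  unfolding definable_def by (rule definable_imp_D) simp_all

lemma D_definable: "D F' R' UNIV (\<lambda>e. blk e 0 m \<in> Z) \<Longrightarrow> (\<And>x. x \<in> Z \<Longrightarrow> length x = m) \<Longrightarrow> definable F' R' m Z"
  unfolding definable_def by (rule D_imp_definable)

lemma thin_empty: "thin k m {}"
proof -
  have "definable F R m {}" by (rule D_definable) (auto simp: D_False)
  then show ?thesis by (auto simp: thin_def ultra_const)
qed

lemma thin_Un: assumes "thin k m Z" "thin k m Z'" shows "thin k m (Z \<union> Z')"
proof -
  have "definable F R m (Z \<union> Z')"
  proof (rule D_definable)
    have "DL (\<lambda>e. blk e 0 m \<in> Z \<or> blk e 0 m \<in> Z')"
      by (intro D_disj definable_D) (use assms in \<open>auto simp: thin_def\<close>)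
    then show "DL (\<lambda>e. blk e 0 m \<in> Z \<union> Z')" by simp
  qed (use assms in \<open>auto simp: thin_def\<close>)
  then show ?thesis using assms by (auto simp: thin_def ultra_disj)
qed

text \<open>The finitely many predicates witnessing that the other coordinates are algebraic cut out
  a definable set in which the coordinates \<open>ix\<close> span every type.\<close>

lemma algebraic_thin:
  fixes U :: "'i filter"
  assumes U: "ultra U" and x: "eventually (\<lambda>i. length (x i) = m) U" and ix: "set ix \<subseteq> {..<m}" "length ix \<le> k"
    and alg: "set (cf m x) \<subseteq> Acl U (set (crd m x ix))"
  shows "\<exists>Z. thin k m Z \<and> eventually (\<lambda>i. x i \<in> Z) U"
proof -
  define c where "c y k = (\<lambda>i. y i ! k)" for y :: "'i \<Rightarrow> 'a list" and k
  define cl' where "cl' k = (\<lambda>l :: 'a list. l ! k)" for k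
  have cfc: "cf m x ! j = c x j" if "j < m" for j using that by (simp add: nth_cf c_def)
  have ixc: "set (crd m x ix) = c x ` set ix"
    unfolding set_map by (rule image_cong) (use ix(1) cfc in auto)
  have "\<exists>T. DL T \<and> (\<forall>f. finite {a. T (f(j := a))}) \<and> dep (insert j (set ix)) T \<and> eventually (\<lambda>i. T (\<lambda>k. c x k i)) U"
    if j: "j < m" "j \<notin> set ix" for j
  proof -
    have "cf m x ! j \<in> set (cf m x)" using j(1) by (intro nth_mem) simp
    then have "c x j \<in> Acl U (c x ` set ix)" using alg ixc cfc[OF j(1)] by auto
    then show ?thesis using acl_nf[OF j(2), of "c x" U] by blast
  qed
  then have "\<forall>j\<in>{j. j < m \<and> j \<notin> set ix}. \<exists>T. DL T \<and> (\<forall>f. finite {a. T (f(j := a))}) \<and> dep (insert j (set ix)) T \<and> eventually (\<lambda>i. T (\<lambda>k. c x k i)) U" by blast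
  then obtain T where T: "\<And>j. j < m \<Longrightarrow> j \<notin> set ix \<Longrightarrow> DL (T j)" "\<And>j f. j < m \<Longrightarrow> j \<notin> set ix \<Longrightarrow> finite {a. T j (f(j := a))}"
    "\<And>j. j < m \<Longrightarrow> j \<notin> set ix \<Longrightarrow> dep (insert j (set ix)) (T j)" "\<And>j. j < m \<Longrightarrow> j \<notin> set ix \<Longrightarrow> eventually (\<lambda>i. T j (\<lambda>k. c x k i)) U"
    by (elim bchoice[elim_format] exE) auto
  define J where "J = {j. j < m \<and> j \<notin> set ix}"
  define Z where "Z = {l. length l = m \<and> (\<forall>j\<in>J. T j (\<lambda>k. l ! k))}"
  have Zl: "length l = m" if "l \<in> Z" for l using that by (simp add: Z_def)
  have "DL (\<lambda>e. \<forall>j\<in>J. T j e)" by (rule D_Ball_finite) (use T(1) in \<open>auto simp: J_def\<close>)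
  moreover have "T j (\<lambda>k. blk e 0 m ! k) = T j e" if "j \<in> J" for j e
    by (rule depD[OF T(3)]) (use that ix(1) in \<open>auto simp: J_def\<close>)
  ultimately have "DL (\<lambda>e. blk e 0 m \<in> Z)" by (simp add: Z_def)
  then have "definable F R m Z" by (rule D_definable) (rule Zl)
  moreover have "rkU U' {} (cf m (\<lambda>l. l)) \<le> k" if U': "ultra U'" "eventually (\<lambda>l. l \<in> Z) U'" for U'
  proof -
    interpret u: pregeometry "Acl U'" by (rule acl_pregeometry[OF U'(1)])
    have "cl' j \<in> Acl U' (cl' ` set ix)" if j: "j < m" for j
    proof (cases "j \<in> set ix")
      case True then show ?thesis by (intro u.mem) auto
    next
      case False
      have "eventually (\<lambda>l. T j (\<lambda>k. cl' k l)) U'"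
        using U'(2) by (rule eventually_mono) (use j False in \<open>auto simp: Z_def J_def cl'_def\<close>)
      then show ?thesis using acl_nf[OF False, of cl' U'] T(1-3)[OF j False] by blast
    qed
    moreover have "set (cf m (\<lambda>l. l)) = cl' ` {..<m}" by (auto simp: cf_def cl'_def)
    ultimately have "set (cf m (\<lambda>l. l)) \<subseteq> Acl U' ({} \<union> set (map cl' ix))" by auto
    from u.rk_le[OF this] have "u.rk {} (cf m (\<lambda>l. l)) \<le> u.rk {} (map cl' ix)" .
    also have "\<dots> \<le> k" using u.rk_le_length[of "{}" "map cl' ix"] ix(2) by simp
    finally show ?thesis .
  qed
  moreover have "eventually (\<lambda>i. x i \<in> Z) U"
  proof -
    have "eventually (\<lambda>i. \<forall>j\<in>J. T j (\<lambda>k. c x k i)) U"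
      by (rule eventually_ball_finite) (use T(4) in \<open>auto simp: J_def\<close>)
    with x show ?thesis by eventually_elim (simp add: Z_def c_def)
  qed
  ultimately show ?thesis using Zl unfolding thin_def by blast
qed

lemma presented_mono: "presented n m U x \<Longrightarrow> m \<le> m' \<Longrightarrow> presented n m' U x"
  unfolding presented_def by (meson order_trans)

end

context ngroup begin

interpretation g: group G by (rule grp)

text \<open>There are finitely many lists of positions, so along an ultrafilter one of them is a
  basis almost everywhere.\<close>

lemma constant_basis:
  fixes Uf :: "'i \<Rightarrow> 'a list filter"
  assumes V: "ultra V" and Uf: "\<And>i. ultra (Uf i)" and rk: "eventually (\<lambda>i. rP n (Uf i) (\<lambda>l. l) = a) V"
  shows "\<exists>ix. distinct ix \<and> set ix \<subseteq> {..<n} \<and> length ix = a \<and>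
     eventually (\<lambda>i. rkP (Uf i) (crd n (\<lambda>l. l) ix) = length ix) V"
proof -
  let ?c = "cf n (\<lambda>l::'a list. l)"
  have "\<exists>ix. distinct ix \<and> set ix \<subseteq> {..<n} \<and> length ix = rP n (Uf i) (\<lambda>l. l) \<and> rkP (Uf i) (map ((!) ?c) ix) = length ix" for i
    using presentation_exists[OF Uf, of ?c i] unfolding rP_def by auto
  then obtain ixf where ixf: "\<And>i. distinct (ixf i) \<and> set (ixf i) \<subseteq> {..<n} \<and> length (ixf i) = rP n (Uf i) (\<lambda>l. l)"
    "\<And>i. rkP (Uf i) (map ((!) ?c) (ixf i)) = length (ixf i)" by metis
  let ?A = "{ix. distinct ix \<and> set ix \<subseteq> {..<n} \<and> length ix = a}"
  have "finite ?A" by (rule finite_subset[OF _ finite_lists_length_eq[of "{..<n}" a]]) auto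
  moreover have "eventually (\<lambda>i. \<exists>ix\<in>?A. ixf i = ix) V" using rk by (rule eventually_mono) (use ixf(1) in auto)
  ultimately obtain ix where ix: "ix \<in> ?A" "eventually (\<lambda>i. ixf i = ix) V"
    using ultra_Bex[OF V, of ?A "\<lambda>ix i. ixf i = ix"] by blast
  have "eventually (\<lambda>i. rkP (Uf i) (map ((!) ?c) ix) = length ix) V"
    using ix(2) by (rule eventually_mono) (use ixf(2) in auto)
  then show ?thesis using ix(1) by blast
qed

text \<open>Counterexamples for all \<open>m\<close> are combined along a nonprincipal ultrafilter.
  The limit type has rank \<open>kmax\<close> by maximality, so finitely many elements
  \<open>S\<close> of \<open>P\<close> serve to present it; their sections present almost every
  member of the sequence with \<open>card S\<close> elements, a contradiction once \<open>m\<close>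
  reaches \<open>card S\<close>.\<close>

lemma support_bound:
  "\<exists>m. \<forall>U. ultra U \<longrightarrow> eventually (\<lambda>l. l \<in> carrier G) U \<longrightarrow> rP n U (\<lambda>l. l) = kmax \<longrightarrow> presented n m U (\<lambda>l. l)"
proof (rule ccontr)
  assume "\<not> ?thesis"
  then have "\<forall>m. \<exists>U. ultra U \<and> eventually (\<lambda>l. l \<in> carrier G) U \<and> rP n U (\<lambda>l. l) = kmax \<and> \<not> presented n m U (\<lambda>l. l)" by blast
  then obtain Uf where Uf: "\<And>m. ultra (Uf m)" "\<And>m. eventually (\<lambda>l. l \<in> carrier G) (Uf m)" "\<And>m. rP n (Uf m) (\<lambda>l. l) = kmax"
    "\<And>m. \<not> presented n m (Uf m) (\<lambda>l. l)" by metis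
  obtain V :: "nat filter" where V: "ultra V" "\<And>T. finite T \<Longrightarrow> eventually (\<lambda>x. x \<notin> T) V"
    using ultra_free[OF infinite_UNIV_nat] by blast
  define W where "W = ubind V Uf"
  have W: "ultra W" unfolding W_def by (rule ultra_ubind[OF V(1) Uf(1)])
  interpret w: pregeometry "Acl W" by (rule acl_pregeometry[OF W])
  let ?c = "cf n (\<lambda>l::'a list. l)" and ?cs = "cf n (snd :: nat \<times> 'a list \<Rightarrow> 'a list)"
  have "eventually (\<lambda>i. rP n (Uf i) (\<lambda>l. l) = kmax) V" using Uf(3) by simp
  from constant_basis[OF V(1) Uf(1) this] obtain ix where ix: "set ix \<subseteq> {..<n}" "length ix = kmax"
    "eventually (\<lambda>i. rkP (Uf i) (map ((!) ?c) ix) = length ix) V" "distinct ix" by blast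
  then have rkix: "eventually (\<lambda>m. rkP (Uf m) (map ((!) ?c) ix) = length (map ((!) ?c) ix)) V" by simp
  have mp: "map (\<lambda>g z. g (snd z)) (map ((!) ?c) ix) = map ((!) ?cs) ix"
    using cf_comp_nth[OF ix(1), of snd "\<lambda>l. l"] by simp
  define bs where "bs = map ((!) ?cs) ix"
  have "w.rk (Pst W \<union> range (\<lambda>h z. h (fst z))) bs = length bs"
    using rk_ubind[OF V(1) Uf(1) rkix] unfolding mp W_def[symmetric] bs_def by simp
  then have rkb: "w.rk (Pst W) bs = length bs"
    by (rule w.rk_indep_antimono) (use w.extensive[of "Pst W \<union> range (\<lambda>h z. h (fst z))"] in auto)
  have bsub: "set bs \<subseteq> set ?cs" unfolding bs_def using ix(1) by auto
  have "rP n W snd \<le> kmax" by (rule kmax_bound[OF W]) (use Uf(2) in \<open>simp add: W_def eventually_ubind\<close>)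
  moreover have "w.rk (Pst W) bs \<le> w.rk (Pst W) ?cs"
    by (rule w.rk_le) (use bsub w.extensive[of "Pst W \<union> set ?cs"] in auto)
  ultimately have "w.rk (Pst W) bs = w.rk (Pst W) ?cs" using rkb ix(2) unfolding rP_def bs_def by simp
  from w.spanning_sublist[OF bsub this] have "set ?cs \<subseteq> Acl W (Pst W \<union> set bs)" .
  then obtain S where S: "S \<subseteq> Pst W" "finite S" "set ?cs \<subseteq> Acl W (S \<union> set bs)"
    using w.finite_support[of "set ?cs" "Pst W" "set bs"] by auto
  have e1: "eventually (\<lambda>m. \<forall>f\<in>set ?cs. (\<lambda>j. f (m, j)) \<in> Acl (Uf m) ((\<lambda>g j. g (m, j)) ` (S \<union> set bs))) V"
    by (rule eventually_ball_finite) (use S(3) acl_slice[of _ V Uf, folded W_def] in auto)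
  have e2: "eventually (\<lambda>m. \<forall>s\<in>S. (\<lambda>j. s (m, j)) \<in> Pst (Uf m)) V"
    by (rule eventually_ball_finite) (use S(1,2) in \<open>auto simp: Pst_def W_def eventually_ubind\<close>)
  have e3: "eventually (\<lambda>m. m \<notin> {..<card S}) V" by (rule V(2)) simp
  from e1 e2 e3 ix(3) have "eventually (\<lambda>m. False) V"
  proof eventually_elim
    case (elim m)
    let ?sl = "\<lambda>g j. g (m, j)"
    have slc: "?sl (?cs ! k) = ?c ! k" if "k < n" for k using that by (simp add: nth_cf)
    have slb: "?sl ` set bs = set (map ((!) ?c) ix)" unfolding bs_def using ix(1) slc by (auto simp: image_image intro!: image_cong)
    have slcs: "?sl ` set ?cs = set ?c" by (simp add: cf_def image_image)
    have "presented n (card S) (Uf m) (\<lambda>l. l)" unfolding presented_def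
    proof (intro exI[of _ ix] exI[of _ "?sl ` S"] conjI)
      show "distinct ix" "set ix \<subseteq> {..<n}" "rkP (Uf m) (map ((!) ?c) ix) = length ix"
        using ix elim(4) by auto
      show "length ix = rP n (Uf m) (\<lambda>l. l)" using ix(2) Uf(3) by simp
      show "finite (?sl ` S)" "card (?sl ` S) \<le> card S" using S(2) by (auto intro: card_image_le)
      show "?sl ` S \<subseteq> Pst (Uf m)" using elim(2) by blast
      show "set ?c \<subseteq> Acl (Uf m) (?sl ` S \<union> set (map ((!) ?c) ix))"
        unfolding slcs[symmetric] slb[symmetric] image_Un[symmetric] using elim(1) by blast
    qed
    then have "presented n m (Uf m) (\<lambda>l. l)" by (rule presented_mono) (use elim(3) in auto)
    then show ?case using Uf(4) by blast
  qed
  then show False using V(1) by (simp add: ultra_const)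
qed

text \<open>The second component keeps its rank over all functions of the first, so the ranks add
  up.\<close>

lemma rk_pair:
  fixes U0 :: "'i filter" and Ug :: "'i \<Rightarrow> 'j filter" and x :: "'i \<Rightarrow> 'a list" and y :: "'j \<Rightarrow> 'a list"
  assumes U0: "ultra U0" and Ug: "\<And>i. ultra (Ug i)" and ix: "set ix \<subseteq> {..<n}"
    and rk: "eventually (\<lambda>i. rkP (Ug i) (crd n y ix) = length ix) U0"
  shows "rkU (ubind U0 Ug) (Pst (ubind U0 Ug)) (cf n (\<lambda>z. x (fst z)) @ cf n (\<lambda>z. y (snd z))) \<ge> rP n U0 x + length ix"
proof -
  let ?W = "ubind U0 Ug"
  have W: "ultra ?W" by (rule ultra_ubind[OF U0 Ug])
  interpret w: pregeometry "Acl ?W" by (rule acl_pregeometry[OF W])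
  let ?cx = "cf n (\<lambda>z::'i \<times> 'j. x (fst z))" and ?cy = "cf n (\<lambda>z::'i \<times> 'j. y (snd z))"
  have "filtermap fst ?W = U0" using Ug by (simp add: filter_eq_iff eventually_filtermap eventually_ubind ultra_const)
  then have rx: "w.rk (Pst ?W) ?cx = rP n U0 x" using rP_filtermap[OF W, of n fst x] by (simp add: rP_def)
  define bs where "bs = map ((!) ?cy) ix"
  have mp: "map (\<lambda>g z. g (snd z)) (crd n y ix) = bs"
    unfolding bs_def by (rule cf_comp_nth[OF ix])
  have rk': "eventually (\<lambda>i. rkP (Ug i) (crd n y ix) = length (crd n y ix)) U0"
    using rk by simp
  have "w.rk (Pst ?W \<union> range (\<lambda>h z. h (fst z))) bs = length bs"
    using rk_ubind[OF U0 Ug rk'] unfolding mp by (simp add: bs_def)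
  moreover have "Pst ?W \<union> set ?cx \<subseteq> Pst ?W \<union> range (\<lambda>h z. h (fst z))" by (auto simp: cf_def)
  ultimately have "w.rk (Pst ?W \<union> set ?cx) bs = length bs"
    using w.rk_indep_antimono[of "Pst ?W \<union> range (\<lambda>h z. h (fst z))" bs "Pst ?W \<union> set ?cx"]
      w.extensive[of "Pst ?W \<union> range (\<lambda>h z. h (fst z))"] by blast
  moreover have "set bs \<subseteq> set ?cy" unfolding bs_def using ix by auto
  then have "w.rk (Pst ?W \<union> set ?cx) bs \<le> w.rk (Pst ?W \<union> set ?cx) ?cy"
    by (intro w.rk_le) (use w.extensive[of "(Pst ?W \<union> set ?cx) \<union> set ?cy"] in auto)
  ultimately show ?thesis unfolding w.rk_append rx by (simp add: bs_def)
qed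

text \<open>A generic element whose support has the maximal size l would yield, as a product of two
  independent copies, a generic element whose support contains 2 l elements.\<close>

lemma support_doubling:
  assumes bound: "\<And>U. ultra U \<Longrightarrow> eventually (\<lambda>l. l \<in> carrier G) U \<Longrightarrow> rP n U (\<lambda>l. l) = kmax \<Longrightarrow> presented n l U (\<lambda>l. l)"
    and U: "ultra U" "eventually (\<lambda>l. l \<in> carrier G) U" "rP n U (\<lambda>l. l) = kmax"
    and np: "\<not> presented n (l - 1) U (\<lambda>l. l)" and l0: "l > 0"
  shows False
proof -
  let ?c = "cf n (\<lambda>l::'a list. l)"
  obtain ix S where ix: "distinct ix" "set ix \<subseteq> {..<n}" "rkP U (map ((!) ?c) ix) = length ix" "length ix = kmax"
    and S: "finite S" "S \<subseteq> Pst U" "card S \<le> l" "set ?c \<subseteq> Acl U (S \<union> set (map ((!) ?c) ix))"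
    using bound[OF U] U(3) unfolding presented_def by auto
  define bs where "bs = map ((!) ?c) ix"
  \<comment> \<open>\<open>np\<close> excludes presentations with fewer than \<open>l\<close>
    elements of \<open>P\<close>; hence \<open>S\<close> has exactly \<open>l\<close> elements and
    none can be omitted.\<close>
  have small: "card S' \<ge> l" if "S' \<subseteq> S" "set ?c \<subseteq> Acl U (S' \<union> set bs)" for S'
  proof (rule ccontr)
    assume "\<not> card S' \<ge> l"
    then have c: "card S' \<le> l - 1" by simp
    have f: "finite S'" "S' \<subseteq> Pst U" using that(1) S(1,2) finite_subset by auto
    have "presented n (l - 1) U (\<lambda>l. l)" unfolding presented_def
      by (intro exI[of _ ix] exI[of _ S'] conjI) (use ix U(3) c f that(2) in \<open>auto simp: bs_def\<close>)
    then show False using np by blast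
  qed
  have cS: "card S = l" using small[of S] S by (simp add: bs_def)
  have least: "S' = S" if "S' \<subseteq> S" "set ?c \<subseteq> Acl U (S' \<union> set bs)" for S'
    using card_seteq[OF S(1) that(1)] small[OF that] cS by simp
  have S4: "set ?c \<subseteq> Acl U (S \<union> set bs)" using S(4) by (simp add: bs_def)
  have bsub: "set bs \<subseteq> set ?c" unfolding bs_def using ix(2) by auto
  note ms = minimal_support[OF U(1) S(1,2) S4 bsub least]
  define W where "W = ubind U (\<lambda>_. U)"
  have W: "ultra W" unfolding W_def by (rule ultra_ubind[OF U(1) U(1)])
  interpret w: pregeometry "Acl W" by (rule acl_pregeometry[OF W])
  have evW: "eventually Q W \<longleftrightarrow> eventually (\<lambda>i. eventually (\<lambda>j. Q (i, j)) U) U" for Q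
    by (simp add: W_def eventually_ubind)
  have fm: "filtermap fst W = U" "filtermap snd W = U"
    using U(1) by (simp_all add: filter_eq_iff eventually_filtermap evW ultra_const)
  define z where "z = (\<lambda>p. fst p \<otimes> snd p)"
  have tr: "triple W fst snd z" unfolding triple_def evW z_def
  proof -
    show "eventually (\<lambda>i. eventually (\<lambda>j. fst (i, j) \<in> carrier G \<and> snd (i, j) \<in> carrier G \<and>
        fst (i, j) \<otimes> snd (i, j) = fst (i, j) \<otimes> snd (i, j)) U) U"
      using U(2)
    proof eventually_elim
      case (elim i) then show ?case using U(2) by (auto elim: eventually_mono)
    qed
  qed
  define k where "k = kmax"
  have lift: "rkP W (crd n g ix) = k"
    "set (cf n g) \<subseteq> Acl W ((\<lambda>s p. s (g p)) ` S \<union> set (crd n g ix))"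
    "\<And>s. s \<in> S \<Longrightarrow> (\<lambda>p. s (g p)) \<in> supp W (set (cf n g))"
    "(\<lambda>s p. s (g p)) ` S \<subseteq> Pst W" "w.rk (Pst W) (cf n g) = k"
    if gU: "filtermap g W = U" for g
  proof -
    have mp: "map (\<lambda>f p. f (g p)) bs = crd n g ix"
      unfolding bs_def using cf_comp_nth[OF ix(2), of g "\<lambda>l. l"] by simp
    have mpc: "(\<lambda>f p. f (g p)) ` set ?c = set (cf n g)" using cf_comp[of g n "\<lambda>l. l"] by (metis set_map)
    show "rkP W (crd n g ix) = k"
      using rkP_filtermap[OF W, of g bs] ix(3,4) unfolding gU mp by (simp add: bs_def k_def)
    show "set (cf n g) \<subseteq> Acl W ((\<lambda>s p. s (g p)) ` S \<union> set (crd n g ix))"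
    proof -
      have "(\<lambda>p. f (g p)) \<in> Acl W ((\<lambda>f p. f (g p)) ` (S \<union> set bs))" if "f \<in> set ?c" for f
        using S4 that acl_filtermap[of f UNIV g W "S \<union> set bs"] unfolding gU by blast
      moreover have "(\<lambda>f p. f (g p)) ` (S \<union> set bs) = (\<lambda>s p. s (g p)) ` S \<union> set (crd n g ix)"
        unfolding image_Un mp[symmetric] set_map ..
      ultimately show ?thesis unfolding mpc[symmetric] by auto
    qed
    show "(\<lambda>p. s (g p)) \<in> supp W (set (cf n g))" if "s \<in> S" for s
    proof -
      have "s \<in> supp (filtermap g W) (set ?c)" using ms(1) that unfolding gU by blast
      from supp_filtermap[OF this] show ?thesis unfolding mpc .
    qed
    show "(\<lambda>s p. s (g p)) ` S \<subseteq> Pst W"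
    proof
      fix f assume "f \<in> (\<lambda>s p. s (g p)) ` S"
      then obtain s where s: "s \<in> S" "f = (\<lambda>p. s (g p))" by blast
      then have "s \<in> Pst (filtermap g W)" using S(2) unfolding gU by blast
      then show "f \<in> Pst W" using s by (simp add: Pst_def eventually_filtermap)
    qed
    show "w.rk (Pst W) (cf n g) = k" using rP_filtermap[OF W, of n g "\<lambda>l. l"] U(3) unfolding gU by (simp add: rP_def k_def)
  qed
  note l1 = lift[OF fm(1)] and l2 = lift[OF fm(2)]
  have rkc: "eventually (\<lambda>i. rkP U (map ((!) ?c) ix) = length ix) U" using ix(3) by simp
  have ge: "w.rk (Pst W) (cf n fst @ cf n snd) \<ge> k + k"
    using rk_pair[OF U(1) U(1) ix(2) rkc, of "\<lambda>l. l"] U(3) ix(4) by (simp add: W_def k_def)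
  have zG: "eventually (\<lambda>p. z p \<in> carrier G) W"
    using tr unfolding triple_def by (rule eventually_mono) auto
  have zk: "w.rk (Pst W) (cf n z) \<le> k" using kmax_bound[OF W zG] by (simp add: rP_def k_def)
  note tcP = triple_closed_P[OF W tr]
  have sub2: "w.rk (Pst W) (xs @ ys) \<le> w.rk (Pst W) xs + w.rk (Pst W) ys" for xs ys
    using w.rk_antimono[of "Pst W" "Pst W \<union> set xs" ys] by (simp add: w.rk_append)
  have gez: "w.rk (Pst W) (cf n g @ cf n z) \<ge> k + k" if g: "g = fst \<or> g = snd" for g
  proof -
    have "set (cf n fst @ cf n snd) \<subseteq> Acl W (Pst W \<union> set (cf n g @ cf n z))"
      using g tcP(2,3) w.extensive[of "Pst W \<union> set (cf n g @ cf n z)"] by auto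
    from w.rk_le[OF this] ge show ?thesis by simp
  qed
  \<comment> \<open>Over \<open>P\<close> the pair of factors has rank \<open>k + k\<close> and is
    algebraic over one factor and the product; so the product has rank \<open>k\<close> and is
    generic again.\<close>
  have rz: "w.rk (Pst W) (cf n z) = k" using gez[of fst] sub2[of "cf n fst" "cf n z"] l1(5) zk by simp
  have "presented n l (filtermap z W) (\<lambda>l. l)"
  proof (rule bound)
    show "ultra (filtermap z W)" by (rule ultra_filtermap[OF W])
    show "eventually (\<lambda>l. l \<in> carrier G) (filtermap z W)" using zG by (simp add: eventually_filtermap)
    show "rP n (filtermap z W) (\<lambda>l. l) = kmax" using rP_filtermap[OF W, of n z "\<lambda>l. l"] rz by (simp add: rP_def k_def)
  qed
  from presented_filtermap[OF W this] obtain iz Sz where iz: "set iz \<subseteq> {..<n}" "w.rk (Pst W) (crd n z iz) = length iz"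
    "length iz = k" and Sz: "finite Sz" "Sz \<subseteq> Pst W" "card Sz \<le> l" "set (cf n z) \<subseteq> Acl W (Sz \<union> set (crd n z iz))"
    unfolding presented_def rP_def rz by auto
  define bz where "bz = crd n z iz"
  \<comment> \<open>One factor and the product are again independent over \<open>P\<close>, so their
    bases taken together are independent and present both.\<close>
  have pr: "w.rk (Pst W) (crd n g ix @ bz) = length (crd n g ix @ bz)"
    "set (cf n g) \<union> set (cf n z) \<subseteq> Acl W (((\<lambda>s p. s (g p)) ` S \<union> Sz) \<union> set (crd n g ix @ bz))"
    if g: "g = fst \<or> g = snd" for g
  proof -
    have gU: "filtermap g W = U" using g fm by auto
    note lg = lift[OF gU]
    let ?b = "crd n g ix" and ?Z = "((\<lambda>s p. s (g p)) ` S \<union> Sz) \<union> set (crd n g ix @ bz)"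
    have a1: "set (cf n g) \<subseteq> Acl W ?Z"
      using lg(2) w.mono[of "(\<lambda>s p. s (g p)) ` S \<union> set ?b" ?Z] by (auto simp: subset_iff)
    have a2: "set (cf n z) \<subseteq> Acl W ?Z"
      using Sz(4) w.mono[of "Sz \<union> set bz" ?Z] unfolding bz_def[symmetric] by (auto simp: subset_iff)
    show "set (cf n g) \<union> set (cf n z) \<subseteq> Acl W ?Z" using a1 a2 by blast
    have "?Z \<subseteq> Pst W \<union> set (?b @ bz)" using lg(4) Sz(2) by auto
    then have "set (cf n g @ cf n z) \<subseteq> Acl W (Pst W \<union> set (?b @ bz))" using a1 a2 w.mono[of ?Z "Pst W \<union> set (?b @ bz)"] by auto
    from w.rk_le[OF this] gez[OF g] have "w.rk (Pst W) (?b @ bz) \<ge> k + k" by simp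
    then show "w.rk (Pst W) (?b @ bz) = length (?b @ bz)"
      using w.rk_le_length[of "Pst W" "?b @ bz"] ix(4) iz(3) by (simp add: bz_def k_def)
  qed
  have nc: "nonconst U s" if "s \<in> S" for s using ms(1) that by (auto simp: supp_def)
  \<comment> \<open>The two supports live on different components: an agreement between them would
    make \<open>s'\<close> constant.\<close>
  have cross: "\<not> eventually (\<lambda>p. s (fst p) = s' (snd p)) W" if "s' \<in> S" for s s'
  proof
    assume "eventually (\<lambda>p. s (fst p) = s' (snd p)) W"
    then have "eventually (\<lambda>i. eventually (\<lambda>j. s i = s' j) U) U" by (simp add: evW)
    then obtain i where "eventually (\<lambda>j. s i = s' j) U" using ultra_ex[OF U(1)] by blast
    then have "eventually (\<lambda>j. s' j = s i) U" by (simp add: eq_commute)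
    then show False using nc[OF that] by (auto simp: nonconst_def)
  qed
  \<comment> \<open>The factor \<open>g\<close> is algebraic over the presentation of the other
    factor and the product. Its support therefore lies in the union of \<open>Sz\<close> and the
    copy of \<open>S\<close> along \<open>g'\<close>, and \<open>cross\<close> rules out the
    latter.\<close>
  have crossed: "\<exists>t\<in>Sz. eventually (\<lambda>p. t p = s (g p)) W" if s: "s \<in> S" and g: "g = fst \<and> g' = snd \<or> g = snd \<and> g' = fst" for s and g g' :: "'a list \<times> 'a list \<Rightarrow> 'a list"
  proof -
    let ?S = "(\<lambda>s p. s (g' p)) ` S \<union> Sz" and ?b = "crd n g' ix @ bz"
    have gU: "filtermap g W = U" "filtermap g' W = U" and g': "g' = fst \<or> g' = snd" using g fm by auto
    have fS: "finite ?S" "?S \<subseteq> Pst W" using S(1) Sz lift(4)[OF gU(2)] by auto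
    have "set (cf n g) \<subseteq> Acl W (?S \<union> set ?b)"
      using triple_closed(2,3)[OF W tr fS pr(1)[OF g']] pr(2)[OF g'] g by auto
    from supp_subset[OF W fS(2) pr(1)[OF g'] this lift(3)[OF gU(1) s]]
    obtain t where t: "t \<in> ?S" "eventually (\<lambda>p. t p = s (g p)) W" by auto
    have "t \<notin> (\<lambda>s p. s (g' p)) ` S"
    proof
      assume "t \<in> (\<lambda>s p. s (g' p)) ` S"
      then obtain s' where "s' \<in> S" "t = (\<lambda>p. s' (g' p))" by blast
      then show False using cross[of s' s] cross[OF s, of s'] t(2) g by (auto simp: eq_commute)
    qed
    then show ?thesis using t by blast
  qed
  obtain \<alpha> where \<alpha>: "\<And>s. s \<in> S \<Longrightarrow> \<alpha> s \<in> Sz" "\<And>s. s \<in> S \<Longrightarrow> eventually (\<lambda>p. \<alpha> s p = s (fst p)) W"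
    using crossed[of _ fst snd] by metis
  obtain \<beta> where \<beta>: "\<And>s. s \<in> S \<Longrightarrow> \<beta> s \<in> Sz" "\<And>s. s \<in> S \<Longrightarrow> eventually (\<lambda>p. \<beta> s p = s (snd p)) W"
    using crossed[of _ snd fst] by metis
  have tra: "eventually (\<lambda>p. f p = h p) W" if "eventually (\<lambda>p. t p = f p) W" "eventually (\<lambda>p. t p = h p) W" for t f h :: "'a list \<times> 'a list \<Rightarrow> 'a"
    using that by eventually_elim simp
  have inj: "inj_on \<gamma> S" if gU: "filtermap g W = U" and \<gamma>: "\<And>s. s \<in> S \<Longrightarrow> eventually (\<lambda>p. \<gamma> s p = s (g p)) W" for \<gamma> g
  proof (rule inj_onI)
    fix s s' assume s: "s \<in> S" "s' \<in> S" "\<gamma> s = \<gamma> s'"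
    have "eventually (\<lambda>p. s (g p) = s' (g p)) W" using tra[OF \<gamma>[OF s(1)]] \<gamma>[OF s(2)] s(3) by simp
    then have "eventually (\<lambda>i. s i = s' i) (filtermap g W)" by (simp add: eventually_filtermap)
    then show "s = s'" using ms(2) s unfolding gU by blast
  qed
  have ia: "inj_on \<alpha> S" and ib: "inj_on \<beta> S" using inj[OF fm(1) \<alpha>(2)] inj[OF fm(2) \<beta>(2)] by auto
  have dj: "\<alpha> ` S \<inter> \<beta> ` S = {}"
  proof (rule ccontr)
    assume "\<alpha> ` S \<inter> \<beta> ` S \<noteq> {}"
    then obtain s s' where s: "s \<in> S" "s' \<in> S" "\<alpha> s = \<beta> s'" by blast
    have "eventually (\<lambda>p. s (fst p) = s' (snd p)) W" using tra[OF \<alpha>(2)[OF s(1)]] \<beta>(2)[OF s(2)] s(3) by simp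
    then show False using cross[OF s(2)] by blast
  qed
  have "card (\<alpha> ` S \<union> \<beta> ` S) = l + l"
    using card_Un_disjoint[OF _ _ dj] S(1) card_image[OF ia] card_image[OF ib] cS by simp
  moreover have "\<alpha> ` S \<union> \<beta> ` S \<subseteq> Sz" using \<alpha>(1) \<beta>(1) by blast
  then have "card (\<alpha> ` S \<union> \<beta> ` S) \<le> l" using card_mono[OF Sz(1)] Sz(3) order_trans by blast
  ultimately show False using l0 by simp
qed

text \<open>A least bound on the sizes of all supports exists by \<open>support_bound\<close> and
  cannot be positive by \<open>support_doubling\<close>.\<close>

theorem generic_presented:
  assumes U: "ultra U" "eventually (\<lambda>i. x i \<in> carrier G) U" "rP n U x = kmax"
  shows "presented n 0 U x"
proof -
  let ?B = "\<lambda>m. \<forall>U. ultra U \<longrightarrow> eventually (\<lambda>l. l \<in> carrier G) U \<longrightarrow> rP n U (\<lambda>l. l) = kmax \<longrightarrow> presented n m U (\<lambda>l. l)"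
  obtain l where l: "?B l" "\<And>m. m < l \<Longrightarrow> \<not> ?B m" using exists_least_iff[of ?B] support_bound by auto
  have "l = 0"
  proof (rule ccontr)
    assume "l \<noteq> 0"
    then have l0: "l > 0" by simp
    then have "\<not> ?B (l - 1)" by (intro l(2)) simp
    then obtain U' where U': "ultra U'" "eventually (\<lambda>l. l \<in> carrier G) U'" "rP n U' (\<lambda>l. l) = kmax" "\<not> presented n (l - 1) U' (\<lambda>l. l)" by blast
    show False by (rule support_doubling[OF _ U' l0]) (use l(1) in blast)
  qed
  then have "presented n 0 (filtermap x U) (\<lambda>l. l)"
    using l(1) ultra_filtermap[OF U(1), of x] U(2) rP_filtermap[OF U(1), of n x "\<lambda>l. l"] U(3)
    by (simp add: eventually_filtermap)
  from presented_filtermap[OF U(1) this] show ?thesis by simp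
qed

lemma generic_thin:
  assumes U: "ultra U" "eventually (\<lambda>i. x i \<in> carrier G) U" "rP n U x = kmax"
  shows "\<exists>Z. thin kmax n Z \<and> eventually (\<lambda>i. x i \<in> Z) U"
proof -
  obtain ix S where ix: "set ix \<subseteq> {..<n}" "length ix = kmax" "card S \<le> 0" "finite S"
    "set (cf n x) \<subseteq> Acl U (S \<union> set (crd n x ix))"
    using generic_presented[OF U] U(3) unfolding presented_def by auto
  have "S = {}" using ix(3,4) by simp
  then show ?thesis
    by (intro algebraic_thin[OF U(1) _ ix(1)]) (use ix(2,5) U(2) in \<open>auto elim!: eventually_mono intro: carrier_length\<close>)
qed

end

section \<open>Finitely many translates of a thin set cover the group\<close>

context ngroup begin

interpretation g: group G by (rule grp)

lemma M3_iff: "length x = n \<Longrightarrow> length y = n \<Longrightarrow> length z = n \<Longrightarrow>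
   x @ y @ z \<in> M3 \<longleftrightarrow> x \<in> carrier G \<and> y \<in> carrier G \<and> z = x \<otimes> y"
proof
  assume l: "length x = n" "length y = n" "length z = n" and "x @ y @ z \<in> M3"
  then obtain x' y' where x': "x @ y @ z = x' @ y' @ (x' \<otimes> y')" "x' \<in> carrier G" "y' \<in> carrier G" by (auto simp: M3_def)
  then have "length x' = n" "length y' = n" by (auto intro: carrier_length)
  then show "x \<in> carrier G \<and> y \<in> carrier G \<and> z = x \<otimes> y" using x' l by auto
qed (auto simp: M3_def)

lemma D_mult:
  assumes "a + n \<le> b" "b + n \<le> c"
  shows "DN (\<lambda>e. blk e a n \<in> carrier G \<and> blk e b n \<in> carrier G \<and> blk e c n = blk e a n \<otimes> blk e b n)"
proof -
  have "DN (\<lambda>e. map e ([a..<a+n] @ [b..<b+n] @ [c..<c+n]) \<in> M3)"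
    by (rule definable_imp_D[OF M3_definable[unfolded definable_def]]) simp
  then show ?thesis by (simp add: M3_iff)
qed

lemma D_translate_eq:
  assumes g: "g \<in> carrier G"
  shows "DN (\<lambda>e. blk e a n \<in> carrier G \<and> blk e b n = g \<otimes> blk e a n)"
proof -
  define z where "z = a + n + b + n"
  let ?ix = "[z..<z+n] @ [a..<a+n] @ [b..<b+n]"
  have "DN (\<lambda>e. map e ?ix \<in> M3)"
    by (rule definable_imp_D[OF M3_definable[unfolded definable_def]]) simp
  from D_updc[OF this, of g z] have "DN (\<lambda>e. map (upds e z g) ?ix \<in> M3)" by simp
  moreover have "map (upds e z g) ?ix \<in> M3 \<longleftrightarrow> blk e a n \<in> carrier G \<and> blk e b n = g \<otimes> blk e a n" for e
  proof -
    have eq: "map (upds e z g) ?ix = g @ blk e a n @ blk e b n"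
      unfolding map_append blk_upds_same[OF carrier_length[OF g]]
      by (subst blk_upds_other, simp add: z_def)+ simp
    show ?thesis unfolding eq using M3_iff[of g "blk e a n" "blk e b n"] carrier_length[OF g] g by simp
  qed
  ultimately show ?thesis by (simp only:)
qed

lemma D_translate:
  assumes g: "g \<in> carrier G" and Z: "defN n Z"
  shows "DN (\<lambda>e. blk e a n \<in> carrier G \<and> g \<otimes> blk e a n \<in> Z)"
proof -
  let ?z = "a + n"
  let ?Q = "\<lambda>e. (blk e a n \<in> carrier G \<and> blk e ?z n = g \<otimes> blk e a n) \<and> blk e ?z n \<in> Z"
  have "DN (\<lambda>e. \<exists>zs. length zs = n \<and> ?Q (upds e ?z zs))"
    by (intro D_exs D_conj[OF D_translate_eq[OF g] definable_D[OF Z]])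
  moreover have "(\<exists>zs. length zs = n \<and> ?Q (upds e ?z zs)) \<longleftrightarrow> blk e a n \<in> carrier G \<and> g \<otimes> blk e a n \<in> Z" for e
  proof -
    have q: "?Q (upds e ?z zs) \<longleftrightarrow> blk e a n \<in> carrier G \<and> zs = g \<otimes> blk e a n \<and> zs \<in> Z" if l: "length zs = n" for zs
    proof -
      have 1: "blk (upds e ?z zs) ?z n = zs" by (rule blk_upds_same[OF l])
      have 2: "blk (upds e ?z zs) a n = blk e a n" by (rule blk_upds_other) simp
      show ?thesis unfolding 1 2 by blast
    qed
    have "length (g \<otimes> blk e a n) = n" if "blk e a n \<in> carrier G" using carrier_length[OF g.m_closed[OF g that]] .
    then have "(\<exists>zs. length zs = n \<and> blk e a n \<in> carrier G \<and> zs = g \<otimes> blk e a n \<and> zs \<in> Z) \<longleftrightarrow> blk e a n \<in> carrier G \<and> g \<otimes> blk e a n \<in> Z"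
      by (simp cong: conj_cong) auto
    moreover have "(\<exists>zs. length zs = n \<and> ?Q (upds e ?z zs)) \<longleftrightarrow> (\<exists>zs. length zs = n \<and> blk e a n \<in> carrier G \<and> zs = g \<otimes> blk e a n \<and> zs \<in> Z)"
      by (intro ex_cong1 conj_cong refl q)
    ultimately show ?thesis by (simp only:)
  qed
  ultimately show ?thesis by (simp only:)
qed

lemma thin_definable_N: "thin k m Z \<Longrightarrow> defN m Z"
  by (rule D_definable) (auto simp: thin_def intro: D_expR[OF definable_D[where a=0, simplified]])

text \<open>Compactness over thin sets: they are directed under union, so an ultrafilter
  \<open>V\<close> concentrating on large thin sets merges the escaping types, one for each
  \<open>Z\<close>, into a single type that escapes them all. \<open>constant_basis\<close> keeps
  the rank from dropping in the limit.\<close>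

lemma uncovered_type:
  assumes W: "W \<subseteq> carrier G" and rk: "\<And>U. ultra U \<Longrightarrow> eventually (\<lambda>l. l \<in> W) U \<Longrightarrow> rP n U (\<lambda>l. l) < Suc a"
    and g: "g \<in> carrier G"
    and ex: "\<And>Z. thin kmax n Z \<Longrightarrow> \<exists>U. ultra U \<and> eventually (\<lambda>l. l \<in> W \<and> g \<otimes> l \<notin> Z) U \<and> \<not> rP n U (\<lambda>l. l) < a"
  shows "\<exists>U. ultra U \<and> (\<forall>Z. thin kmax n Z \<longrightarrow> eventually (\<lambda>l. l \<in> W \<and> g \<otimes> l \<notin> Z) U) \<and>
     rP n U (\<lambda>l. l) = a"
proof -
  let ?c = "cf n (\<lambda>l::'a list. l)"
  let ?T = "\<lambda>Z U. ultra U \<and> (thin kmax n Z \<longrightarrow> eventually (\<lambda>l. l \<in> W \<and> g \<otimes> l \<notin> Z) U \<and> rP n U (\<lambda>l. l) = a)"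
  have "\<exists>U. ?T Z U" for Z
  proof (cases "thin kmax n Z")
    case True
    from ex[OF this] obtain U where U: "ultra U" "eventually (\<lambda>l. l \<in> W \<and> g \<otimes> l \<notin> Z) U" "\<not> rP n U (\<lambda>l. l) < a" by blast
    have "eventually (\<lambda>l. l \<in> W) U" using U(2) by (rule eventually_mono) simp
    then have "rP n U (\<lambda>l. l) = a" using rk[OF U(1)] U(3) by simp
    then show ?thesis using U(1,2) by blast
  qed (use ultra_principal[of "[]"] in blast)
  then have "\<forall>Z. \<exists>U. ?T Z U" by (intro allI)
  from choice[OF this] obtain UZ where "\<forall>Z. ?T Z (UZ Z)" by (elim exE)
  then have UZ: "\<And>Z. ultra (UZ Z)" "\<And>Z. thin kmax n Z \<Longrightarrow> eventually (\<lambda>l. l \<in> W \<and> g \<otimes> l \<notin> Z) (UZ Z)"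
    "\<And>Z. thin kmax n Z \<Longrightarrow> rP n (UZ Z) (\<lambda>l. l) = a" by auto
  define B where "B = {(\<lambda>Z'. thin kmax n Z' \<and> Z \<subseteq> Z') | Z. thin kmax n Z}"
  have "\<exists>V. ultra V \<and> (\<forall>Q\<in>B. eventually Q V)"
  proof (rule ultra_from_base)
    have "(\<lambda>Z'. thin kmax n Z' \<and> {} \<subseteq> Z') \<in> B" unfolding B_def using thin_empty by blast
    then show "B \<noteq> {}" by blast
    fix Q assume "Q \<in> B"
    then obtain Z1 where 1: "Q = (\<lambda>Z'. thin kmax n Z' \<and> Z1 \<subseteq> Z')" "thin kmax n Z1" by (auto simp: B_def)
    then show "\<exists>x. Q x" by blast
    fix S assume "S \<in> B"
    then obtain Z2 where 2: "S = (\<lambda>Z'. thin kmax n Z' \<and> Z2 \<subseteq> Z')" "thin kmax n Z2" by (auto simp: B_def)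
    have "(\<lambda>Z'. thin kmax n Z' \<and> Z1 \<union> Z2 \<subseteq> Z') \<in> B" unfolding B_def using thin_Un[OF 1(2) 2(2)] by blast
    then show "\<exists>T\<in>B. \<forall>x. T x \<longrightarrow> Q x \<and> S x" by (rule rev_bexI) (use 1(1) 2(1) in auto)
  qed
  then obtain V where V: "ultra V" "\<And>Q. Q \<in> B \<Longrightarrow> eventually Q V" by blast
  have Vz: "eventually (\<lambda>Z'. thin kmax n Z' \<and> Z \<subseteq> Z') V" if "thin kmax n Z" for Z
    by (rule V(2)) (use that in \<open>auto simp: B_def\<close>)
  have Vt: "eventually (\<lambda>Z'. thin kmax n Z') V" using Vz[OF thin_empty] by simp
  have "eventually (\<lambda>Z. rP n (UZ Z) (\<lambda>l. l) = a) V" using Vt by (rule eventually_mono) (rule UZ(3))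
  from constant_basis[OF V(1) UZ(1) this] obtain ix where ix: "set ix \<subseteq> {..<n}" "length ix = a"
    "eventually (\<lambda>i. rkP (UZ i) (map ((!) ?c) ix) = length ix) V" by blast
  then have rkix: "eventually (\<lambda>m. rkP (UZ m) (map ((!) ?c) ix) = length (map ((!) ?c) ix)) V" by simp
  define Wb where "Wb = ubind V UZ"
  have Wb: "ultra Wb" unfolding Wb_def by (rule ultra_ubind[OF V(1) UZ(1)])
  interpret w: pregeometry "Acl Wb" by (rule acl_pregeometry[OF Wb])
  define U where "U = filtermap snd Wb"
  have U: "ultra U" unfolding U_def by (rule ultra_filtermap[OF Wb])
  interpret u: pregeometry "Acl U" by (rule acl_pregeometry[OF U])
  define bs :: "('a list set \<times> 'a list \<Rightarrow> 'a) list" where "bs = map (\<lambda>g z. g (snd z)) (map ((!) ?c) ix)"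
  have "w.rk (Pst Wb \<union> range (\<lambda>h z. h (fst z))) bs = length bs"
    using rk_ubind[OF V(1) UZ(1) rkix] unfolding Wb_def[symmetric] bs_def by simp
  then have "w.rk (Pst Wb) bs = length bs"
    by (rule w.rk_indep_antimono) (use w.extensive[of "Pst Wb \<union> range (\<lambda>h z. h (fst z))"] in auto)
  then have "rkP U (map ((!) ?c) ix) = a"
    unfolding U_def rkP_filtermap[OF Wb] bs_def[symmetric] using ix(2) by (simp add: bs_def)
  moreover have "set (map ((!) ?c) ix) \<subseteq> set ?c" using ix(1) by auto
  then have "rkP U (map ((!) ?c) ix) \<le> rkP U ?c"
    by (intro u.rk_le) (use u.extensive[of "Pst U \<union> set ?c"] in auto)
  moreover have evZ: "eventually (\<lambda>l. l \<in> W \<and> g \<otimes> l \<notin> Z) U" if Z: "thin kmax n Z" for Z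
    unfolding U_def eventually_filtermap Wb_def eventually_ubind
    using Vz[OF Z]
  proof eventually_elim
    case (elim Z')
    then show ?case using UZ(2)[of Z'] by (auto elim!: eventually_mono)
  qed
  moreover have "eventually (\<lambda>l. l \<in> W) U" using evZ[OF thin_empty] by (rule eventually_mono) simp
  ultimately show ?thesis using rk[OF U] U by (intro exI[of _ U]) (auto simp: rP_def)
qed

text \<open>If every \<open>g\<close> failed, take a generic \<open>g\<close> and an independent
  point of rank \<open>a\<close> whose translate by \<open>g\<close> avoids every thin set. As
  \<open>g\<close> is recovered from the point and the product, the product has rank
  \<open>kmax\<close>, and by \<open>generic_thin\<close> it lies in a thin set after all.\<close>

lemma reduce_rank:
  assumes W: "W \<subseteq> carrier G" and rk: "\<And>U. ultra U \<Longrightarrow> eventually (\<lambda>l. l \<in> W) U \<Longrightarrow> rP n U (\<lambda>l. l) < Suc a"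
  shows "\<exists>g Z. g \<in> carrier G \<and> thin kmax n Z \<and>
     (\<forall>U. ultra U \<longrightarrow> eventually (\<lambda>l. l \<in> W \<and> g \<otimes> l \<notin> Z) U \<longrightarrow> rP n U (\<lambda>l. l) < a)"
proof (rule ccontr)
  assume n: "\<not> ?thesis"
  let ?T = "\<lambda>g U. ultra U \<and> (g \<in> carrier G \<longrightarrow> (\<forall>Z. thin kmax n Z \<longrightarrow> eventually (\<lambda>l. l \<in> W \<and> g \<otimes> l \<notin> Z) U) \<and> rP n U (\<lambda>l. l) = a)"
  have "\<exists>U. ?T g U" for g
  proof (cases "g \<in> carrier G")
    case True
    have nz: "\<exists>U. ultra U \<and> eventually (\<lambda>l. l \<in> W \<and> g \<otimes> l \<notin> Z) U \<and> \<not> rP n U (\<lambda>l. l) < a" if "thin kmax n Z" for Z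
      using n True that by auto
    from uncovered_type[OF W rk True nz] True show ?thesis by simp
  qed (use ultra_principal[of "[]"] in blast)
  then have "\<forall>g. \<exists>U. ?T g U" by (intro allI)
  from choice[OF this] obtain Ug where "\<forall>g. ?T g (Ug g)" by (elim exE)
  then have Ug: "\<And>g. ultra (Ug g)" "\<And>g Z. g \<in> carrier G \<Longrightarrow> thin kmax n Z \<Longrightarrow> eventually (\<lambda>l. l \<in> W \<and> g \<otimes> l \<notin> Z) (Ug g)"
    "\<And>g. g \<in> carrier G \<Longrightarrow> rP n (Ug g) (\<lambda>l. l) = a" by auto
  obtain U0 where U0: "ultra U0" "eventually (\<lambda>l. l \<in> carrier G) U0" "rP n U0 (\<lambda>l. l) = kmax" using kmax_attained by blast
  have "eventually (\<lambda>g. rP n (Ug g) (\<lambda>l. l) = a) U0" using U0(2) by (rule eventually_mono) (rule Ug(3))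
  from constant_basis[OF U0(1) Ug(1) this] obtain ix where ix: "set ix \<subseteq> {..<n}" "length ix = a"
    and rkix: "eventually (\<lambda>g. rkP (Ug g) (crd n (\<lambda>l. l) ix) = length ix) U0" by blast
  define V where "V = ubind U0 Ug"
  have V: "ultra V" unfolding V_def by (rule ultra_ubind[OF U0(1) Ug(1)])
  interpret v: pregeometry "Acl V" by (rule acl_pregeometry[OF V])
  define z where "z = (\<lambda>p. fst p \<otimes> snd p)"
  have evV: "eventually (\<lambda>p. fst p \<in> carrier G \<and> snd p \<in> W \<and> z p \<notin> Z) V" if Z: "thin kmax n Z" for Z
    unfolding V_def eventually_ubind using U0(2)
  proof eventually_elim
    case (elim g)
    then show ?case using Ug(2)[OF elim Z] by (auto simp: z_def elim: eventually_mono)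
  qed
  have ev0: "eventually (\<lambda>p. fst p \<in> carrier G \<and> snd p \<in> W) V"
    using evV[OF thin_empty] by (rule eventually_mono) simp
  have tr: "triple V fst snd z" unfolding triple_def using ev0 by (rule eventually_mono) (use W in \<open>auto simp: z_def\<close>)
  have ge: "v.rk (Pst V) (cf n fst @ cf n snd) \<ge> kmax + a"
    using rk_pair[OF U0(1) Ug(1) ix(1) rkix, of "\<lambda>l. l"] U0(3) ix(2) by (simp add: V_def)
  have "eventually (\<lambda>l. l \<in> W) (filtermap snd V)" using ev0 unfolding eventually_filtermap by (rule eventually_mono) simp
  from rk[OF ultra_filtermap[OF V] this] have le: "v.rk (Pst V) (cf n snd) \<le> a"
    using rP_filtermap[OF V, of n snd "\<lambda>l. l"] by (simp add: rP_def)
  have "set (cf n fst @ cf n snd) \<subseteq> Acl V (Pst V \<union> set (cf n snd @ cf n z))"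
    using triple_closed_P(3)[OF V tr] v.extensive[of "Pst V \<union> set (cf n snd @ cf n z)"] by auto
  from v.rk_le[OF this] ge have "v.rk (Pst V) (cf n snd @ cf n z) \<ge> kmax + a" by simp
  then have "v.rk (Pst V) (cf n z) \<ge> kmax"
    using le v.rk_antimono[of "Pst V" "Pst V \<union> set (cf n snd)" "cf n z"] by (simp add: v.rk_append)
  moreover have zG: "eventually (\<lambda>p. z p \<in> carrier G) V" using tr unfolding triple_def by (rule eventually_mono) auto
  ultimately have "rP n V z = kmax" using kmax_bound[OF V zG] by (simp add: rP_def)
  from generic_thin[OF V zG this] obtain Z where Z: "thin kmax n Z" "eventually (\<lambda>p. z p \<in> Z) V" by blast
  from Z(2) evV[OF Z(1)] have "eventually (\<lambda>p. False) V" by eventually_elim simp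
  then show False using V by (simp add: ultra_const)
qed

text \<open>One translate takes care of all types of the largest possible rank; the uncovered
  remainder is definable and its types have smaller rank.\<close>

lemma cover_rank:
  "defN n W \<Longrightarrow> W \<subseteq> carrier G \<Longrightarrow>
   (\<And>U. ultra U \<Longrightarrow> eventually (\<lambda>l. l \<in> W) U \<Longrightarrow> rP n U (\<lambda>l. l) < a) \<Longrightarrow>
   \<exists>gs Z. set gs \<subseteq> carrier G \<and> thin kmax n Z \<and> (\<forall>x\<in>W. \<exists>g\<in>set gs. g \<otimes> x \<in> Z)"
proof (induction a arbitrary: W)
  case 0
  have "W = {}"
  proof (rule ccontr)
    assume "W \<noteq> {}"
    then obtain x where "x \<in> W" by blast
    then show False using 0(3)[OF ultra_principal[of x]] by (simp add: eventually_principal)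
  qed
  then show ?case using thin_empty by (intro exI[of _ "[]"] exI[of _ "{}"]) auto
next
  case (Suc a)
  obtain g Z where g: "g \<in> carrier G" "thin kmax n Z"
    "\<And>U. ultra U \<Longrightarrow> eventually (\<lambda>l. l \<in> W \<and> g \<otimes> l \<notin> Z) U \<Longrightarrow> rP n U (\<lambda>l. l) < a"
    using reduce_rank[OF Suc.prems(2,3)] by blast
  define W' where "W' = {x \<in> W. g \<otimes> x \<notin> Z}"
  have "DN (\<lambda>e. blk e 0 n \<in> W \<and> \<not> (blk e 0 n \<in> carrier G \<and> g \<otimes> blk e 0 n \<in> Z))"
    by (intro D_conj D_not D_translate[OF g(1) thin_definable_N[OF g(2)]] definable_D Suc.prems(1))
  moreover have "x \<in> W \<and> \<not> (x \<in> carrier G \<and> g \<otimes> x \<in> Z) \<longleftrightarrow> x \<in> W'" for x using Suc.prems(2) by (auto simp: W'_def)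
  ultimately have "DN (\<lambda>e. blk e 0 n \<in> W')" by simp
  then have d: "defN n W'" by (rule D_definable) (use Suc.prems(2) carrier_length in \<open>auto simp: W'_def\<close>)
  have "W' \<subseteq> carrier G" using Suc.prems(2) by (auto simp: W'_def)
  from Suc.IH[OF d this] g(3) obtain gs Z' where gs: "set gs \<subseteq> carrier G" "thin kmax n Z'" "\<forall>x\<in>W'. \<exists>g\<in>set gs. g \<otimes> x \<in> Z'"
    unfolding W'_def by auto
  show ?case
    by (intro exI[of _ "g # gs"] exI[of _ "Z \<union> Z'"]) (use gs g thin_Un in \<open>auto simp: W'_def\<close>)
qed

theorem translates_cover:
  "\<exists>gs Z. set gs \<subseteq> carrier G \<and> thin kmax n Z \<and> (\<forall>x\<in>carrier G. \<exists>g\<in>set gs. g \<otimes> x \<in> Z)"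
  by (rule cover_rank[of _ "Suc n"]) (auto intro: carrier_definable le_imp_less_Suc rP_le)

end

section \<open>Boxes\<close>

definition bx :: "nat \<Rightarrow> (nat \<Rightarrow> 'a::linorder) \<Rightarrow> (nat \<Rightarrow> 'a) \<Rightarrow> 'a list set" where
  "bx k lo hi = {u. length u = k \<and> (\<forall>i<k. lo i < u ! i \<and> u ! i < hi i)}"

context omin begin

text \<open>An iterated infinity quantifier: the first-order form of having full dimension in the
  slots \<open>ws\<close>. By \<open>Big_box_list\<close> and \<open>box_Big\<close> it is the same
  as containing a box.\<close>

fun Big :: "nat list \<Rightarrow> ((nat \<Rightarrow> 'a) \<Rightarrow> bool) \<Rightarrow> (nat \<Rightarrow> 'a) \<Rightarrow> bool" where
  "Big [] Q e = Q e"
| "Big (w # ws) Q e = infinite {a. Big ws Q (e(w := a))}"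

lemma Big_append: "Big (xs @ ys) Q e = Big xs (Big ys Q) e"
  by (induction xs arbitrary: e) auto

lemma Big_single: "Big [w] Q = (\<lambda>e. infinite {a. Q (e(w := a))})"
  by (rule ext) simp

lemma D_Big: "D F R C Q \<Longrightarrow> D F R C (Big ws Q)"
proof (induction ws)
  case Nil then show ?case by simp
next
  case (Cons w ws)
  have "D F R C (\<lambda>e. infinite {a. Big ws Q (e(w := a))})" by (rule D_infinite[OF Cons.IH[OF Cons.prems]])
  then show ?case by simp
qed

lemma Big_move:
  assumes "D F R C Q" "w \<notin> set ws" shows "Big (w # ws) Q e \<longleftrightarrow> Big (ws @ [w]) Q e"
  using assms(2)
proof (induction ws arbitrary: e)
  case (Cons v ws)
  have tw: "e(w := a, v := b) = e(v := b, w := a)" for a b using Cons.prems by (auto simp: fun_upd_twist)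
  have "Big (w # v # ws) Q e \<longleftrightarrow> infinite {a. infinite {b. Big ws Q (e(w := a, v := b))}}" by simp
  also have "\<dots> \<longleftrightarrow> infinite {b. infinite {a. Big ws Q (e(w := a, v := b))}}"
  proof
    show "infinite {b. infinite {a. Big ws Q (e(w := a, v := b))}}" if "infinite {a. infinite {b. Big ws Q (e(w := a, v := b))}}"
      by (rule infinite_swap[OF D_Big[OF assms(1)] _ that]) (use Cons.prems in auto)
    show "infinite {a. infinite {b. Big ws Q (e(w := a, v := b))}}" if "infinite {b. infinite {a. Big ws Q (e(w := a, v := b))}}"
      unfolding tw by (rule infinite_swap[OF D_Big[OF assms(1)]]) (use Cons.prems that in \<open>auto simp: tw\<close>)
  qed
  also have "\<dots> \<longleftrightarrow> infinite {b. Big (w # ws) Q (e(v := b))}" by (simp add: tw)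
  also have "\<dots> \<longleftrightarrow> infinite {b. Big (ws @ [w]) Q (e(v := b))}"
  proof -
    have "Big (w # ws) Q (e(v := b)) = Big (ws @ [w]) Q (e(v := b))" for b
      by (rule Cons.IH) (use Cons.prems in simp)
    then show ?thesis by (simp only:)
  qed
  finally show ?case by simp
qed simp

lemma Big_mono: "(\<And>e. Q e \<Longrightarrow> Q' e) \<Longrightarrow> Big ws Q e \<Longrightarrow> Big ws Q' e"
proof (induction ws arbitrary: e)
  case (Cons w ws)
  have "{a. Big ws Q (e(w := a))} \<subseteq> {a. Big ws Q' (e(w := a))}" using Cons.IH[OF Cons.prems(1)] by blast
  then show ?case using Cons.prems(2) finite_subset by (auto simp del: Collect_mono_iff)
qed simp

lemma Big_disj: "Big ws (\<lambda>e. Q e \<or> Q' e) e \<Longrightarrow> Big ws Q e \<or> Big ws Q' e"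
proof (induction ws arbitrary: e)
  case (Cons w ws)
  have "{a. Big ws (\<lambda>e. Q e \<or> Q' e) (e(w := a))} \<subseteq> {a. Big ws Q (e(w := a))} \<union> {a. Big ws Q' (e(w := a))}"
    using Cons.IH by blast
  then have "infinite ({a. Big ws Q (e(w := a))} \<union> {a. Big ws Q' (e(w := a))})"
    using Cons.prems finite_subset by auto
  then show ?case by auto
qed simp

lemma Big_Bex_finite: "finite I \<Longrightarrow> Big ws (\<lambda>e. \<exists>i\<in>I. Q i e) e \<Longrightarrow> \<exists>i\<in>I. Big ws (Q i) e"
proof (induction I rule: finite_induct)
  case empty
  have "\<not> Big ws (\<lambda>e. False) e" for ws e by (induction ws arbitrary: e) auto
  then show ?case using empty by auto
next
  case (insert i I)
  have "Big ws (\<lambda>e. Q i e \<or> (\<exists>i\<in>I. Q i e)) e" using insert.prems(1) by simp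
  from Big_disj[of ws "Q i" "\<lambda>e. \<exists>i\<in>I. Q i e" e, OF this] show ?case using insert.IH by blast
qed

text \<open>The two auxiliary slots are moved from the innermost to the outermost position, where
  they can be fixed.\<close>

lemma Big_out:
  assumes Q: "D F R C Q" and "c \<notin> set ws" "d \<notin> insert c (set ws)" and b: "Big ws (Big [c, d] Q) e"
  shows "\<exists>x y. Big ws Q (e(d := y, c := x))"
proof -
  have "Big ((ws @ [c]) @ [d]) Q e" using b Big_append[of ws "[c, d]" Q e] by simp
  then have "Big (d # ws @ [c]) Q e" using Big_move[OF Q, of d "ws @ [c]" e] assms by auto
  then have "infinite {y. Big (ws @ [c]) Q (e(d := y))}" by simp
  then obtain y where "Big (ws @ [c]) Q (e(d := y))" using not_finite_existsD by blast
  then have "Big (c # ws) Q (e(d := y))" using Big_move[OF Q, of c ws "e(d := y)"] assms by auto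
  then have "infinite {x. Big ws Q (e(d := y, c := x))}" by simp
  then show ?thesis using not_finite_existsD by blast
qed

text \<open>Induction on the slots. The fibre in slot \<open>w\<close> contains an interval whose
  ends depend on the other slots; since the ends can be moved inwards, infinitely many pairs of ends
  work, and \<open>Big_out\<close> fixes one pair that serves a big set of the remaining slots. This
  takes the place of cell decomposition.\<close>

lemma Big_box:
  assumes "distinct ws" "DL Q" "Big ws Q e"
  shows "\<exists>lo hi. (\<forall>w\<in>set ws. lo w < hi w) \<and>
     (\<forall>f. (\<forall>w\<in>set ws. lo w < f w \<and> f w < hi w) \<longrightarrow> Q (\<lambda>k. if k \<in> set ws then f k else e k))"
  using assms
proof (induction ws arbitrary: Q e)
  case Nil then show ?case by simp
next
  case (Cons w ws)
  obtain K where K: "finite K" "dep K Q" using D_dep[OF Cons.prems(2)] by blast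
  obtain c where c: "c \<notin> K \<union> set (w # ws)" using ex_fresh[of "K \<union> set (w # ws)"] K(1) by auto
  obtain d where d: "d \<notin> insert c (K \<union> set (w # ws))" using ex_fresh[of "insert c (K \<union> set (w # ws))"] K(1) by auto
  define Q2 where "Q2 e \<longleftrightarrow> e c < e d \<and> (\<forall>a. e c < a \<and> a < e d \<longrightarrow> Q (e(w := a)))" for e
  have "DL (\<lambda>e. e c < e d \<and> (\<forall>a. (\<lambda>e. e c < e w \<and> e w < e d \<longrightarrow> Q e) (e(w := a))))"
    by (intro D_conj D_all D_imp D_less Cons.prems(2))
  then have Q2D: "DL Q2" unfolding Q2_def[abs_def] using c d by simp
  have b1: "Big (ws @ [w]) Q e" using Big_move[OF Cons.prems(2), of w ws e] Cons.prems(1,3) by simp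
  have "Big ws (Big [c, d] Q2) e"
  proof (rule Big_mono[where Q="\<lambda>e. infinite {a. Q (e(w := a))}"])
    show "Big ws (\<lambda>e. infinite {a. Q (e(w := a))}) e" using b1 by (simp add: Big_append Big_single)
    fix e assume inf: "infinite {a. Q (e(w := a))}"
    obtain u v where uv: "u < v" "\<And>a. u < a \<Longrightarrow> a < v \<Longrightarrow> Q (e(w := a))"
      using infinite_fibre_interval[OF Cons.prems(2) inf] by blast
    have eq: "Q (e(c := x, d := y, w := a)) = Q (e(w := a))" for x y a
      by (rule depD[OF K(2)]) (use c d in auto)
    have q2: "Q2 (e(c := x, d := y))" if "u < x" "x < y" "y < v" for x y
      using that uv(2) c d by (auto simp: Q2_def eq)
    have "infinite {y. Q2 (e(c := x, d := y))}" if x: "u < x" "x < v" for x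
    proof -
      have "{y. x < y \<and> y < v} \<subseteq> {y. Q2 (e(c := x, d := y))}" using q2 x by auto
      then show ?thesis using infinite_interval[OF x(2)] finite_subset by blast
    qed
    then have "{x. u < x \<and> x < v} \<subseteq> {x. infinite {y. Q2 (e(c := x, d := y))}}" by blast
    then show "Big [c, d] Q2 e" using infinite_interval[OF uv(1)] finite_subset by auto
  qed
  then obtain x y where x: "Big ws Q2 (e(d := y, c := x))" using Big_out[OF Q2D, of c ws d e] c d by auto
  let ?e = "e(d := y, c := x)"
  have "distinct ws" using Cons.prems(1) by simp
  from Cons.IH[OF this Q2D x] obtain lo hi where lh: "\<forall>w\<in>set ws. lo w < hi w"
    "\<And>f. (\<forall>w\<in>set ws. lo w < f w \<and> f w < hi w) \<Longrightarrow> Q2 (\<lambda>k. if k \<in> set ws then f k else ?e k)" by blast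
  have q2: "x < y \<and> (\<forall>a. x < a \<and> a < y \<longrightarrow> Q ((\<lambda>k. if k \<in> set ws then f k else ?e k)(w := a)))"
    if "\<forall>w\<in>set ws. lo w < f w \<and> f w < hi w" for f
    using lh(2)[OF that] c d by (auto simp: Q2_def)
  have "\<forall>w\<in>set ws. \<exists>b. lo w < b \<and> b < hi w" using lh(1) dens by blast
  then obtain f0 where "\<forall>w\<in>set ws. lo w < f0 w \<and> f0 w < hi w" by metis
  then have xy: "x < y" using q2 by blast
  have wws: "w \<notin> set ws" using Cons.prems(1) by simp
  show ?case
  proof (rule exI[of _ "lo(w := x)"], rule exI[of _ "hi(w := y)"], intro conjI allI impI)
    show "\<forall>v\<in>set (w # ws). (lo(w := x)) v < (hi(w := y)) v" using lh(1) xy by auto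
    fix f assume f: "\<forall>v\<in>set (w # ws). (lo(w := x)) v < f v \<and> f v < (hi(w := y)) v"
    have "\<forall>v\<in>set ws. lo v < f v \<and> f v < hi v"
    proof
      fix v assume v: "v \<in> set ws"
      then have "v \<noteq> w" using wws by auto
      then show "lo v < f v \<and> f v < hi v" using f v by auto
    qed
    moreover have "x < f w" "f w < y" using f by auto
    ultimately have "Q ((\<lambda>k. if k \<in> set ws then f k else ?e k)(w := f w))" using q2 by blast
    moreover have "Q ((\<lambda>k. if k \<in> set ws then f k else ?e k)(w := f w)) = Q (\<lambda>k. if k \<in> set (w # ws) then f k else e k)"
      by (rule depD[OF K(2)]) (use c d in auto)
    ultimately show "Q (\<lambda>k. if k \<in> set (w # ws) then f k else e k)" by simp
  qed
qed

lemma Big_box_list: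
  assumes "DL (\<lambda>e. blk e 0 k \<in> A)" "Big [0..<k] (\<lambda>e. blk e 0 k \<in> A) e"
  shows "\<exists>lo hi. (\<forall>i<k. lo i < hi i) \<and> bx k lo hi \<subseteq> A"
proof -
  obtain lo hi where lh: "\<forall>w\<in>set [0..<k]. lo w < hi w"
     "\<And>f. (\<forall>w\<in>set [0..<k]. lo w < f w \<and> f w < hi w) \<Longrightarrow> blk (\<lambda>i. if i \<in> set [0..<k] then f i else e i) 0 k \<in> A"
    using Big_box[OF _ assms] by auto
  have "u \<in> A" if u: "u \<in> bx k lo hi" for u
  proof -
    have "blk (\<lambda>i. if i \<in> set [0..<k] then u ! i else e i) 0 k \<in> A" by (rule lh(2)) (use u in \<open>auto simp: bx_def\<close>)
    moreover have "blk (\<lambda>i. if i \<in> set [0..<k] then u ! i else e i) 0 k = u"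
      using u by (intro nth_equalityI) (auto simp: bx_def)
    ultimately show ?thesis by simp
  qed
  then have "(\<forall>i<k. lo i < hi i) \<and> bx k lo hi \<subseteq> A" using lh(1) by auto
  then show ?thesis by blast
qed

lemma box_Big:
  assumes "\<forall>i<k. lo i < hi i"
  shows "Big [0..<k] (\<lambda>e. blk e 0 k \<in> bx k lo hi) e"
proof -
  have "Big [j..<k] (\<lambda>e. blk e 0 k \<in> bx k lo hi) e" if "j \<le> k" "\<forall>i<j. lo i < e i \<and> e i < hi i" for j e
    using that
  proof (induction "k - j" arbitrary: j e)
    case 0
    then have "j = k" by simp
    then show ?case using 0 by (simp add: bx_def)
  next
    case (Suc m)
    then have jk: "j < k" by simp
    then have up: "[j..<k] = j # [Suc j..<k]" by (simp add: upt_conv_Cons)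
    have "Big [Suc j..<k] (\<lambda>e. blk e 0 k \<in> bx k lo hi) (e(j := a))" if "lo j < a" "a < hi j" for a
      by (rule Suc.hyps(1)) (use Suc.hyps(2) Suc.prems jk that in \<open>auto simp: less_Suc_eq\<close>)
    then have "{a. lo j < a \<and> a < hi j} \<subseteq> {a. Big [Suc j..<k] (\<lambda>e. blk e 0 k \<in> bx k lo hi) (e(j := a))}" by blast
    then have "infinite {a. Big [Suc j..<k] (\<lambda>e. blk e 0 k \<in> bx k lo hi) (e(j := a))}"
      using infinite_interval[of "lo j" "hi j"] assms jk finite_subset by blast
    then show ?case unfolding up by simp
  qed
  from this[of 0 e] show ?thesis by simp
qed

end

section \<open>Generic types and sets of full dimension\<close>

context omin_pair begin

text \<open>Each non-algebraic coordinate contributes one infinity quantifier; they are peeled off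
  from the last coordinate.\<close>

lemma generic_Big:
  assumes "ultra E" "\<And>j. j < length ws \<Longrightarrow> vr (ws ! j) \<notin> Acl E (vr ` set (take j ws))"
    "DL Q" "dep (set ws) Q" "eventually Q E"
  shows "Big ws Q e0"
  using assms(2-)
proof (induction ws arbitrary: Q rule: rev_induct)
  case Nil
  from ultra_ex[OF assms(1) Nil(4)] obtain e where "Q e" by blast
  then show ?case using depD[OF Nil(3), of e e0] by simp
next
  case (snoc w ws)
  have "vr w \<notin> Acl E (vr ` set ws)" using snoc.prems(1)[of "length ws"] by simp
  then have ev: "eventually (\<lambda>e. infinite {a. Q (e(w := a))}) E"
    by (rule generic_infinite[OF assms(1) _ snoc.prems(2) _ snoc.prems(4)]) (use snoc.prems(3) in simp)
  have "Big ws (\<lambda>e. infinite {a. Q (e(w := a))}) e0"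
  proof (rule snoc.IH[OF _ D_infinite[OF snoc.prems(2)] dep_ex(2) ev])
    show "vr (ws ! j) \<notin> Acl E (vr ` set (take j ws))" if "j < length ws" for j
      using snoc.prems(1)[of j] that by (simp add: nth_append)
    show "dep (insert w (set ws)) Q" using snoc.prems(3) by simp
  qed
  then show ?case by (simp add: Big_append Big_single)
qed

lemma generic_Big_list:
  assumes U: "ultra U" and rk: "rkU U {} (cf k x) = k" and A: "DL (\<lambda>e. blk e 0 k \<in> A)"
    and ev: "eventually (\<lambda>i. length (x i) = k \<and> x i \<in> A) U"
  shows "Big [0..<k] (\<lambda>e. blk e 0 k \<in> A) e0"
proof -
  interpret u: pregeometry "Acl U" by (rule acl_pregeometry[OF U])
  define g where "g i = (\<lambda>j. x i ! j)" for i
  define E where "E = filtermap g U"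
  have E: "ultra E" unfolding E_def by (rule ultra_filtermap[OF U])
  have full: "\<forall>j<k. cf k x ! j \<notin> Acl U ({} \<union> set (take j (cf k x)))"
    using rk u.rk_full_iff[of "{}" "cf k x"] by simp
  show ?thesis
  proof (rule generic_Big[OF E _ A])
    show "vr ([0..<k] ! j) \<notin> Acl E (vr ` set (take j [0..<k]))" if j: "j < length [0..<k]" for j
    proof -
      have "(\<lambda>f i. f (g i)) ` vr ` set (take j [0..<k]) = set (take j (cf k x))"
        using j by (simp add: cf_def take_map image_image g_def)
      moreover have "(\<lambda>i. g i j) = cf k x ! j" using j by (simp add: nth_cf g_def)
      ultimately show ?thesis unfolding E_def acl_filtermap using full j by simp
    qed
    show "dep (set [0..<k]) (\<lambda>e. blk e 0 k \<in> A)" using dep_blk by (simp add: lessThan_atLeast0)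
    show "eventually (\<lambda>e. blk e 0 k \<in> A) E" unfolding E_def eventually_filtermap using ev
    proof eventually_elim
      case (elim i)
      then have "blk (g i) 0 k = x i" by (intro nth_equalityI) (auto simp: g_def)
      then show ?case using elim by simp
    qed
  qed
qed

lemma free_not_algebraic:
  assumes U: "ultra U" and free: "\<And>T. finite T \<Longrightarrow> eventually (\<lambda>x. x \<notin> T) U"
    and B: "\<And>b. b \<in> B \<Longrightarrow> \<exists>c. b = (\<lambda>_. c)"
  shows "(\<lambda>x. x) \<notin> Acl U B"
proof
  assume "(\<lambda>x. x) \<in> Acl U B"
  then obtain Q e K where Q: "DL Q" "\<And>e. finite {a. Q (e(0 := a))}" "\<And>k. e k \<in> insert (\<lambda>_. 0) B"
    "eventually (\<lambda>i. Q ((\<lambda>k. e k i)(0 := i))) U" by (rule acl_E) blast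
  have "\<exists>c. e k = (\<lambda>_. c)" for k using Q(3)[of k] B by auto
  then have "\<forall>k. \<exists>c. \<forall>i. e k i = c" by metis
  then obtain c where c: "\<And>k i. e k i = c k" by metis
  have "eventually (\<lambda>i. i \<notin> {a. Q (c(0 := a))}) U" by (rule free[OF Q(2)])
  with Q(4) have "eventually (\<lambda>i. False) U" by eventually_elim (simp add: c)
  then show False using U by (simp add: ultra_const)
qed

text \<open>A nonprincipal ultrafilter is chosen on each infinite fibre. Drawn after
  \<open>a\<close>, the new entry avoids every finite set determined by \<open>a\<close>, hence is
  not algebraic over the earlier entries.\<close>

lemma extend_generic:
  assumes U: "ultra U" and ev: "eventually (\<lambda>a. a \<in> J \<and> length a = k) U" and rk: "rkU U {} (cf k (\<lambda>l. l)) = k"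
    and inf: "\<And>a. a \<in> J \<Longrightarrow> infinite {b. a @ [b] \<in> J'}"
  shows "\<exists>U'. ultra U' \<and> eventually (\<lambda>a. a \<in> J' \<and> length a = Suc k) U' \<and> rkU U' {} (cf (Suc k) (\<lambda>l. l)) = Suc k"
proof -
  have exV: "\<exists>V. ultra V \<and> (\<forall>T. finite T \<longrightarrow> eventually (\<lambda>x. x \<notin> T) V) \<and> (a \<in> J \<longrightarrow> eventually (\<lambda>b. a @ [b] \<in> J') V)" for a
  proof (cases "a \<in> J")
    case True
    from ultra_free[OF inf[OF this]] show ?thesis by auto
  next
    case False
    obtain p :: 'a where p: "p > 0" using ex_pos by blast
    from ultra_free[OF infinite_interval[OF p]] False show ?thesis by auto
  qed
  then obtain V where V: "\<And>a. ultra (V a)" "\<And>a T. finite T \<Longrightarrow> eventually (\<lambda>x. x \<notin> T) (V a)"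
    "\<And>a. a \<in> J \<Longrightarrow> eventually (\<lambda>b. a @ [b] \<in> J') (V a)" by metis
  define W where "W = ubind U V"
  have W: "ultra W" unfolding W_def by (rule ultra_ubind[OF U V(1)])
  interpret w: pregeometry "Acl W" by (rule acl_pregeometry[OF W])
  interpret u: pregeometry "Acl U" by (rule acl_pregeometry[OF U])
  define g where "g = (\<lambda>(a, b :: 'a). a @ [b])"
  define U' where "U' = filtermap g W"
  have U': "ultra U'" unfolding U'_def by (rule ultra_filtermap[OF W])
  interpret u': pregeometry "Acl U'" by (rule acl_pregeometry[OF U'])
  have fm: "filtermap fst W = U" using V(1) by (simp add: filter_eq_iff eventually_filtermap W_def eventually_ubind ultra_const)
  have "eventually (\<lambda>a. a \<in> J' \<and> length a = Suc k) U'"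
    unfolding U'_def eventually_filtermap W_def eventually_ubind using ev
  proof eventually_elim
    case (elim a)
    then show ?case using V(3)[of a] by (auto simp: g_def elim: eventually_mono)
  qed
  moreover have "cf (Suc k) (\<lambda>l. l) ! j \<notin> Acl U' ({} \<union> set (take j (cf (Suc k) (\<lambda>l. l))))" if j: "j < Suc k" for j
  proof
    assume a: "cf (Suc k) (\<lambda>l. l) ! j \<in> Acl U' ({} \<union> set (take j (cf (Suc k) (\<lambda>l. l))))"
    have tk: "set (take j (cf (Suc k) (\<lambda>l::'a list. l))) = (\<lambda>i l. l ! i) ` {..<j}"
      using j by (simp add: cf_def take_map lessThan_atLeast0)
    have a1: "(\<lambda>p. g p ! j) \<in> Acl W ((\<lambda>i p. g p ! i) ` {..<j})"
      using a j unfolding U'_def acl_filtermap tk by (simp add: nth_cf image_image)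
    have evl: "eventually (\<lambda>p. length (fst p) = k) W"
      unfolding W_def eventually_ubind using ev by (rule eventually_mono) simp
    have gi: "eventually (\<lambda>p. g p ! i = fst p ! i) W" if "i < k" for i
      using evl by (rule eventually_mono) (use that in \<open>auto simp: g_def nth_append split: prod.splits\<close>)
    have sub: "(\<lambda>i p. g p ! i) ` {..<j} \<subseteq> Acl W ((\<lambda>i p. fst p ! i) ` {..<j})"
    proof
      fix f assume "f \<in> (\<lambda>i p. g p ! i) ` {..<j}"
      then obtain i where i: "i < j" "f = (\<lambda>p. g p ! i)" by blast
      have "(\<lambda>p. fst p ! i) \<in> Acl W ((\<lambda>i p. fst p ! i) ` {..<j})" using i by (intro w.mem) auto
      then show "f \<in> Acl W ((\<lambda>i p. fst p ! i) ` {..<j})" unfolding i(2)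
        by (rule acl_eventually_eq) (use gi[of i] i j in \<open>simp add: eq_commute\<close>)
    qed
    from w.cls_subset[OF sub] a1 have a2: "(\<lambda>p. g p ! j) \<in> Acl W ((\<lambda>i p. fst p ! i) ` {..<j})" by blast
    show False
    proof (cases "j < k")
      case True
      have "(\<lambda>p. fst p ! j) \<in> Acl W ((\<lambda>i p. fst p ! i) ` {..<j})" by (rule acl_eventually_eq[OF a2 gi[OF True]])
      moreover have "(\<lambda>i (p :: 'a list \<times> 'a). fst p ! i) ` {..<j} = (\<lambda>f p. f (fst p)) ` (\<lambda>i l. l ! i) ` {..<j}" by (simp add: image_image)
      ultimately have "(\<lambda>p. fst p ! j) \<in> Acl W ((\<lambda>f p. f (fst p)) ` (\<lambda>i l. l ! i) ` {..<j})" by (simp only:)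
      then have "(\<lambda>l. l ! j) \<in> Acl (filtermap fst W) ((\<lambda>i l. l ! i) ` {..<j})"
        by (rule acl_filtermap[THEN iffD2])
      then have "cf k (\<lambda>l. l) ! j \<in> Acl U ({} \<union> set (take j (cf k (\<lambda>l. l))))"
        unfolding fm using True by (simp add: nth_cf) (simp add: cf_def take_map lessThan_atLeast0)
      then show False using rk u.rk_full_iff[of "{}" "cf k (\<lambda>l. l)"] True by simp
    next
      case False
      then have jk: "j = k" using j by simp
      have "eventually (\<lambda>p. g p ! j = snd p) W"
        using evl by (rule eventually_mono) (auto simp: g_def nth_append jk split: prod.splits)
      from acl_eventually_eq[OF a2 this] have "snd \<in> Acl W ((\<lambda>i p. fst p ! i) ` {..<j})" by simp
      from acl_slice[OF this[unfolded W_def]]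
      have "eventually (\<lambda>a. False) U"
      proof (rule eventually_mono)
        fix a assume "(\<lambda>b. snd (a, b)) \<in> Acl (V a) ((\<lambda>g b. g (a, b)) ` (\<lambda>i p. fst p ! i) ` {..<j})"
        then have "(\<lambda>b. b) \<in> Acl (V a) ((\<lambda>g b. g (a, b)) ` (\<lambda>i p. fst p ! i) ` {..<j})" by simp
        moreover have "(\<lambda>b. b) \<notin> Acl (V a) ((\<lambda>g b. g (a, b)) ` (\<lambda>i p. fst p ! i) ` {..<j})"
          by (rule free_not_algebraic[OF V(1,2)]) auto
        ultimately show False by blast
      qed
      then show False using U by (simp add: ultra_const)
    qed
  qed
  then have "rkU U' {} (cf (Suc k) (\<lambda>l. l)) = Suc k" using u'.rk_full_iff[of "{}" "cf (Suc k) (\<lambda>l. l)"] by simp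
  ultimately show ?thesis using U' by blast
qed

lemma generic_zero: "\<exists>U. ultra U \<and> eventually (\<lambda>a. a = [] \<and> length a = 0) U \<and> rkU U {} (cf 0 (\<lambda>l. l)) = 0"
proof -
  interpret u: pregeometry "Acl (principal {[]})" by (rule acl_pregeometry[OF ultra_principal])
  have "rkU (principal {[]}) {} (cf 0 (\<lambda>l. l)) = 0" by (simp add: cf_def)
  then show ?thesis using ultra_principal[of "[]"] by (intro exI[of _ "principal {[]}"]) (auto simp: eventually_principal)
qed

lemma box_generic:
  assumes "\<forall>i<k. lo i < hi i"
  shows "\<exists>U. ultra U \<and> eventually (\<lambda>a. a \<in> bx k lo hi \<and> length a = k) U \<and> rkU U {} (cf k (\<lambda>l. l)) = k"
proof -
  have "j \<le> k \<Longrightarrow> \<exists>U. ultra U \<and> eventually (\<lambda>a. a \<in> bx j lo hi \<and> length a = j) U \<and> rkU U {} (cf j (\<lambda>l. l)) = j" for j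
  proof (induction j)
    case 0
    from generic_zero obtain U where U: "ultra U" "eventually (\<lambda>a. a = [] \<and> length a = 0) U" "rkU U {} (cf 0 (\<lambda>l. l)) = 0" by blast
    have "eventually (\<lambda>a. a \<in> bx 0 lo hi \<and> length a = 0) U" using U(2) by (rule eventually_mono) (simp add: bx_def)
    then show ?case using U by blast
  next
    case (Suc j)
    then obtain U where U: "ultra U" "eventually (\<lambda>a. a \<in> bx j lo hi \<and> length a = j) U" "rkU U {} (cf j (\<lambda>l. l)) = j" by auto
    show ?case
    proof (rule extend_generic[OF U])
      fix a assume a: "a \<in> bx j lo hi"
      have "{b. lo j < b \<and> b < hi j} \<subseteq> {b. a @ [b] \<in> bx (Suc j) lo hi}"
        using a by (auto simp: bx_def nth_append less_Suc_eq)
      moreover have "lo j < hi j" using assms Suc.prems by simp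
      ultimately show "infinite {b. a @ [b] \<in> bx (Suc j) lo hi}" using infinite_interval finite_subset by blast
    qed
  qed
  then show ?thesis by simp
qed

end

section \<open>Local sections of a definable set at a generic point\<close>

text \<open>The order provides definable choice from finite fibres: a lexicographically least tuple
  is selected.\<close>

fun lexl :: "'a::linorder list \<Rightarrow> 'a list \<Rightarrow> bool" where
  "lexl (a # l) (b # l') \<longleftrightarrow> a < b \<or> a = b \<and> lexl l l'"
| "lexl [] l' \<longleftrightarrow> False"
| "lexl l [] \<longleftrightarrow> False"

lemma coords_eq_iff:
  "length w = length ix \<Longrightarrow> map ((!) l) ix = w \<longleftrightarrow> (\<forall>j<length ix. l ! (ix ! j) = w ! j)"
  unfolding list_eq_iff_nth_eq by auto

lemma lexl_total: "length l = length l' \<Longrightarrow> \<not> lexl l l' \<Longrightarrow> \<not> lexl l' l \<Longrightarrow> l = l'"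
  by (induction l l' rule: list_induct2) auto

lemma lexl_minimal:
  "finite S \<Longrightarrow> S \<noteq> {} \<Longrightarrow> (\<And>l. l \<in> S \<Longrightarrow> length l = m) \<Longrightarrow> \<exists>l\<in>S. \<forall>l'\<in>S. \<not> lexl l' l"
proof (induction m arbitrary: S)
  case 0
  then obtain l where "l \<in> S" by blast
  then show ?case using 0(3) by (intro bexI[of _ l] ballI) (metis length_0_conv lexl.simps(2))
next
  case (Suc m)
  define a where "a = Min (hd ` S)"
  have a: "a \<in> hd ` S" "\<And>l. l \<in> S \<Longrightarrow> a \<le> hd l" unfolding a_def using Suc.prems(1,2) by auto
  define S' where "S' = {t. a # t \<in> S}"
  have ne: "l = hd l # tl l" if "l \<in> S" for l using Suc.prems(3)[OF that] by (cases l) auto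
  obtain l0 where "l0 \<in> S" "hd l0 = a" using a(1) by blast
  then have "tl l0 \<in> S'" using ne[of l0] by (simp add: S'_def)
  moreover have "finite S'"
  proof -
    have "S' \<subseteq> tl ` S" by (auto simp: S'_def image_iff) (metis list.sel(3))
    then show ?thesis using Suc.prems(1) finite_subset by blast
  qed
  moreover have "length t = m" if "t \<in> S'" for t using Suc.prems(3)[of "a # t"] that by (simp add: S'_def)
  ultimately obtain t where t: "t \<in> S'" "\<forall>t'\<in>S'. \<not> lexl t' t" using Suc.IH[of S'] by blast
  have "\<not> lexl l' (a # t)" if l': "l' \<in> S" for l'
  proof
    assume lx: "lexl l' (a # t)"
    obtain b t' where bt: "l' = b # t'" using ne[OF l'] by blast
    then have "b < a \<or> b = a \<and> lexl t' t" using lx by simp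
    moreover have "a \<le> b" using a(2)[OF l'] bt by simp
    ultimately have "b = a" "lexl t' t" by auto
    then show False using t(2) l' bt by (auto simp: S'_def)
  qed
  then show ?case using t(1) by (intro bexI[of _ "a # t"]) (auto simp: S'_def)
qed

context omin begin

lemma D_lexl: "D F R C (\<lambda>e. lexl (blk e a m) (blk e b m))"
proof (induction m arbitrary: a b)
  case 0 then show ?case by (simp add: D_False)
next
  case (Suc m)
  have up: "[c..<c + Suc m] = c # [Suc c..<Suc c + m]" for c by (simp add: upt_conv_Cons)
  have "D F R C (\<lambda>e. e a < e b \<or> e a = e b \<and> lexl (blk e (Suc a) m) (blk e (Suc b) m))"
    by (intro D_disj D_conj D_less D_eq Suc.IH)
  then show ?case unfolding up by simp
qed

end

context omin_pair begin

lemma definable_selection: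
  assumes W: "definable F R m W" "\<And>l. l \<in> W \<Longrightarrow> length l = m" and ix: "set ix \<subseteq> {..<m}"
    and fin: "\<And>u. finite {l \<in> W. map ((!) l) ix = u}"
  shows "\<exists>Sel. definable F R m Sel \<and> Sel \<subseteq> W \<and> (\<forall>l\<in>W. \<exists>l'\<in>Sel. map ((!) l') ix = map ((!) l) ix) \<and>
     (\<forall>l\<in>Sel. \<forall>l'\<in>Sel. map ((!) l) ix = map ((!) l') ix \<longrightarrow> l = l')"
proof -
  define Sel where "Sel = {l \<in> W. \<forall>l'\<in>W. map ((!) l') ix = map ((!) l) ix \<longrightarrow> \<not> lexl l' l}"
  let ?Q = "\<lambda>e. blk e m m \<in> W \<and> (\<forall>i\<in>set ix. e (m + i) = e i) \<longrightarrow> \<not> lexl (blk e m m) (blk e 0 m)"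
  have "DL (\<lambda>e. blk e 0 m \<in> W \<and> (\<forall>xs. length xs = m \<longrightarrow> ?Q (upds e m xs)))"
    by (intro D_conj D_alls D_imp D_not D_lexl definable_D W(1) D_Ball_finite D_eq) simp
  moreover have "(blk e 0 m \<in> W \<and> (\<forall>xs. length xs = m \<longrightarrow> ?Q (upds e m xs))) \<longleftrightarrow> blk e 0 m \<in> Sel" for e
  proof -
    have q: "?Q (upds e m xs) \<longleftrightarrow> (xs \<in> W \<and> map ((!) xs) ix = map ((!) (blk e 0 m)) ix \<longrightarrow> \<not> lexl xs (blk e 0 m))"
      if l: "length xs = m" for xs
    proof -
      have 1: "blk (upds e m xs) m m = xs" by (rule blk_upds_same[OF l])
      have 2: "blk (upds e m xs) 0 m = blk e 0 m" by (rule blk_upds_other) simp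
      have 3: "(\<forall>i\<in>set ix. upds e m xs (m + i) = upds e m xs i) \<longleftrightarrow> map ((!) xs) ix = map ((!) (blk e 0 m)) ix"
        using ix l by (auto simp: upds_def subset_iff)
      show ?thesis unfolding 1 2 3 ..
    qed
    show ?thesis
    proof
      assume a: "blk e 0 m \<in> W \<and> (\<forall>xs. length xs = m \<longrightarrow> ?Q (upds e m xs))"
      have "\<not> lexl l' (blk e 0 m)" if "l' \<in> W" "map ((!) l') ix = map ((!) (blk e 0 m)) ix" for l'
        using a q[OF W(2)[OF that(1)]] W(2)[OF that(1)] that by blast
      then show "blk e 0 m \<in> Sel" using a unfolding Sel_def by blast
    next
      assume a: "blk e 0 m \<in> Sel"
      have "?Q (upds e m xs)" if "length xs = m" for xs
        unfolding q[OF that] using a unfolding Sel_def by blast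
      then show "blk e 0 m \<in> W \<and> (\<forall>xs. length xs = m \<longrightarrow> ?Q (upds e m xs))" using a unfolding Sel_def by blast
    qed
  qed
  ultimately have "DL (\<lambda>e. blk e 0 m \<in> Sel)" by (simp only:)
  then have "definable F R m Sel" by (rule D_definable) (use W(2) in \<open>auto simp: Sel_def\<close>)
  moreover have "\<exists>l'\<in>Sel. map ((!) l') ix = map ((!) l) ix" if l: "l \<in> W" for l
  proof -
    let ?S = "{l' \<in> W. map ((!) l') ix = map ((!) l) ix}"
    have "\<exists>l'\<in>?S. \<forall>l''\<in>?S. \<not> lexl l'' l'" by (rule lexl_minimal[OF fin, of _ m]) (use l W(2) in auto)
    then show ?thesis unfolding Sel_def by auto
  qed
  moreover have "l = l'" if "l \<in> Sel" "l' \<in> Sel" "map ((!) l) ix = map ((!) l') ix" for l l'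
    by (rule lexl_total) (use that W(2) in \<open>auto simp: Sel_def\<close>)
  ultimately show ?thesis by (intro exI[of _ Sel]) (auto simp: Sel_def)
qed

text \<open>Witnesses, in the coding of \<open>aclP_nf\<close>, that slot \<open>ix ! j\<close> is
  algebraic over \<open>P\<close> and the earlier slots of \<open>ix\<close>; avoiding all of them
  for all \<open>j\<close> is independence over \<open>P\<close>.\<close>

definition badT :: "nat list \<Rightarrow> nat \<Rightarrow> ((nat \<Rightarrow> 'a) \<Rightarrow> bool) \<Rightarrow> bool" where
  "badT ix j T \<longleftrightarrow> DL T \<and> (\<forall>f. finite {a. T (f(2 * (ix ! j) := a))}) \<and>
     dep ((\<lambda>i. 2 * i) ` set (take (Suc j) ix) \<union> {m. odd m}) T"

lemma badT_False: "badT ix j (\<lambda>_. False)"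
  by (auto simp: badT_def D_False dep_def)

lemma badT_disj: "badT ix j T \<Longrightarrow> badT ix j T' \<Longrightarrow> badT ix j (\<lambda>e. T e \<or> T' e)"
  unfolding badT_def
proof (elim conjE, intro conjI)
  assume "dep ((\<lambda>i. 2 * i) ` set (take (Suc j) ix) \<union> {m. odd m}) T" "dep ((\<lambda>i. 2 * i) ` set (take (Suc j) ix) \<union> {m. odd m}) T'"
  then show "dep ((\<lambda>i. 2 * i) ` set (take (Suc j) ix) \<union> {m. odd m}) (\<lambda>e. T e \<or> T' e)" unfolding dep_def by blast
qed (auto intro: D_disj)

text \<open>By compactness, membership in a set definable in the expansion is, at points independent over
  P, decided by a set definable in the o-minimal structure.\<close>

lemma generic_definability:
  assumes E: "ultra E" and p: "pres E X {} ix" and dx: "distinct ix"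
    and Q: "DN Q" "dep X Q" "eventually Q E"
  shows "\<exists>W T. DL W \<and> dep X W \<and> eventually W E \<and> (\<forall>j<length ix. badT ix j (T j)) \<and>
     (\<forall>e. W e \<longrightarrow> (\<forall>j<length ix. \<not> bad (T j) e) \<longrightarrow> Q e)" (is ?R)
proof (rule ccontr)
  assume n: "\<not> ?thesis"
  \<comment> \<open>If no \<open>W\<close> and \<open>T\<close> worked, these conditions would be
    consistent and yield a type \<open>V\<close> with the o-minimal type of \<open>E\<close> on
    \<open>X\<close>, independent over \<open>P\<close>, but outside \<open>Q\<close>;
    \<open>types_agree_D\<close> excludes this.\<close>
  define B where "B = {(\<lambda>e. W e \<and> (\<forall>j<length ix. \<not> bad (T j) e) \<and> \<not> Q e) | W T.
     DL W \<and> dep X W \<and> eventually W E \<and> (\<forall>j<length ix. badT ix j (T j))}"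
  have inB: "(\<lambda>e. W e \<and> (\<forall>j<length ix. \<not> bad (T j) e) \<and> \<not> Q e) \<in> B"
    if "DL W" "dep X W" "eventually W E" "\<And>j. j < length ix \<Longrightarrow> badT ix j (T j)" for W T
    unfolding B_def by (rule CollectI, rule exI[of _ W], rule exI[of _ T]) (use that in auto)
  have tr: "DL (\<lambda>_. True)" "dep X (\<lambda>_. True)" "eventually (\<lambda>_. True) E" by (auto simp: D_True dep_def)
  have "\<exists>V. ultra V \<and> (\<forall>Q\<in>B. eventually Q V)"
  proof (rule ultra_from_base)
    show "B \<noteq> {}" using inB[OF tr badT_False] by auto
    fix S assume "S \<in> B"
    then obtain W T where 1: "S = (\<lambda>e. W e \<and> (\<forall>j<length ix. \<not> bad (T j) e) \<and> \<not> Q e)"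
     "DL W" "dep X W" "eventually W E" "\<forall>j<length ix. badT ix j (T j)" by (auto simp: B_def)
    show "\<exists>x. S x"
    proof (rule ccontr)
      assume "\<not> (\<exists>x. S x)"
      then have "\<forall>e. W e \<longrightarrow> (\<forall>j<length ix. \<not> bad (T j) e) \<longrightarrow> Q e" unfolding 1(1) by blast
      then have ?R
        by (intro exI[of _ W] exI[of _ T]) (use 1 in auto)
      then show False using n by (rule notE[rotated])
    qed
    fix S' assume "S' \<in> B"
    then obtain W' T' where 2: "S' = (\<lambda>e. W' e \<and> (\<forall>j<length ix. \<not> bad (T' j) e) \<and> \<not> Q e)"
     "DL W'" "dep X W'" "eventually W' E" "\<forall>j<length ix. badT ix j (T' j)" by (auto simp: B_def)
    have "(\<lambda>e. (W e \<and> W' e) \<and> (\<forall>j<length ix. \<not> bad (\<lambda>e. T j e \<or> T' j e) e) \<and> \<not> Q e) \<in> B"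
    proof (rule inB)
      show "DL (\<lambda>e. W e \<and> W' e)" by (intro D_conj 1 2)
      show "dep X (\<lambda>e. W e \<and> W' e)" using 1(3) 2(3) unfolding dep_def by blast
      show "eventually (\<lambda>e. W e \<and> W' e) E" by (intro eventually_conj 1 2)
      show "badT ix j (\<lambda>e. T j e \<or> T' j e)" if "j < length ix" for j using badT_disj 1(5) 2(5) that by blast
    qed
    then show "\<exists>T\<in>B. \<forall>x. T x \<longrightarrow> S x \<and> S' x"
      by (rule rev_bexI) (auto simp: 1(1) 2(1) bad_def)
  qed
  then obtain V where V: "ultra V" "\<And>Q. Q \<in> B \<Longrightarrow> eventually Q V" by blast
  have ag: "agree E V X" unfolding agree_def
  proof (intro allI impI)
    fix W assume W: "DL W" "dep X W" "eventually W E"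
    from V(2)[OF inB[OF W, of "\<lambda>_ _. False"]] badT_False show "eventually W V" by (auto elim: eventually_mono)
  qed
  have nb: "eventually (\<lambda>e. \<not> bad T e) V" if j: "j < length ix" and T: "badT ix j T" for j T
  proof -
    let ?T = "\<lambda>i. if i = j then T else (\<lambda>_. False)"
    have "badT ix i (?T i)" for i using T badT_False by auto
    from V(2)[OF inB[OF tr this]] show ?thesis by (rule eventually_mono) (use j in auto)
  qed
  have nQ: "eventually (\<lambda>e. \<not> Q e) V" using V(2)[OF inB[OF tr badT_False]] by (rule eventually_mono) simp
  interpret v: pregeometry "Acl V" by (rule acl_pregeometry[OF V(1)])
  have "map vr ix ! j \<notin> Acl V (Pst V \<union> set (take j (map vr ix)))" if j: "j < length (map vr ix)" for j
  proof
    assume a: "map vr ix ! j \<in> Acl V (Pst V \<union> set (take j (map vr ix)))"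
    have j': "j < length ix" using j by simp
    have nt: "ix ! j \<notin> set (take j ix)"
    proof
      assume "ix ! j \<in> set (take j ix)"
      then obtain i where "i < j" "ix ! i = ix ! j" using j' by (auto simp: in_set_conv_nth)
      then show False using dx j' by (simp add: nth_eq_iff_index_eq)
    qed
    from a have "vr (ix ! j) \<in> Acl V (Pst V \<union> vr ` set (take j ix))" using j' by (simp add: take_map)
    then obtain T where T: "DL T" "\<And>f. finite {a. T (f(2*(ix ! j) := a))}"
     "dep ((\<lambda>j. 2*j) ` insert (ix ! j) (set (take j ix)) \<union> {m. odd m}) T" "eventually (\<lambda>i. \<exists>\<rho>. range \<rho> \<subseteq> P \<and> T (mix (\<lambda>k. vr k i) \<rho>)) V"
      using aclP_nf[OF nt, of vr V] by blast
    have "insert (ix ! j) (set (take j ix)) = set (take (Suc j) ix)" using j' by (simp add: take_Suc_conv_app_nth)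
    then have "badT ix j T" using T(1-3) unfolding badT_def by simp
    from nb[OF j' this] T(4) have "eventually (\<lambda>e. False) V" by eventually_elim (simp add: bad_def)
    then show False using V(1) by (simp add: ultra_const)
  qed
  then have "v.rk (Pst V) (map vr ix) = length (map vr ix :: ((nat \<Rightarrow> 'a) \<Rightarrow> 'a) list)" unfolding v.rk_full_iff by (intro allI impI)
  moreover have "vr k \<in> Acl V (vr ` ({} \<union> set ix))" if "k \<in> X" for k
    by (rule acl_agree[OF ag]) (use that p in \<open>auto simp: pres_def\<close>)
  ultimately have "pres V X {} ix" using p unfolding pres_def by auto
  from types_agree_D[OF E V(1) p this ag Q] have "eventually Q V" .
  then show False using nQ ultra_not[OF V(1)] by blast
qed

lemma algebraic_predicates:
  fixes U :: "'i filter"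
  assumes U: "ultra U" and ix: "set ix \<subseteq> {..<m}"
    and alg: "set (cf m x) \<subseteq> Acl U (set (crd m x ix))"
  shows "\<exists>T. \<forall>j<m. j \<notin> set ix \<longrightarrow> DL (T j) \<and> (\<forall>f. finite {a. T j (f(j := a))}) \<and>
     dep (insert j (set ix)) (T j) \<and> eventually (\<lambda>i. T j (\<lambda>k. x i ! k)) U"
proof -
  define c where "c k = (\<lambda>i. x i ! k)" for k
  have cfc: "cf m x ! j = c j" if "j < m" for j using that by (simp add: nth_cf c_def)
  have ixc: "set (crd m x ix) = c ` set ix"
    unfolding set_map by (rule image_cong) (use ix cfc in auto)
  have "\<exists>T. j < m \<longrightarrow> j \<notin> set ix \<longrightarrow> DL T \<and> (\<forall>f. finite {a. T (f(j := a))}) \<and> dep (insert j (set ix)) T \<and> eventually (\<lambda>i. T (\<lambda>k. c k i)) U" for j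
  proof (cases "j < m \<and> j \<notin> set ix")
    case True
    have "cf m x ! j \<in> set (cf m x)" using True by (intro nth_mem) simp
    then have "c j \<in> Acl U (c ` set ix)" using alg ixc cfc[of j] True by auto
    then show ?thesis using acl_nf[of j "set ix" c U] True by blast
  qed blast
  then have "\<forall>j. \<exists>T. j < m \<longrightarrow> j \<notin> set ix \<longrightarrow> DL T \<and> (\<forall>f. finite {a. T (f(j := a))}) \<and> dep (insert j (set ix)) T \<and> eventually (\<lambda>i. T (\<lambda>k. c k i)) U" by (intro allI)
  from choice[OF this] show ?thesis unfolding c_def by blast
qed

text \<open>Around a generic point without support in \<open>P\<close>, algebraicity cuts out a set
  with finite fibres over the coordinates \<open>ix\<close>; selection makes it a graph, and the
  full rank of \<open>ix\<close> provides a box in its domain. \<open>generic_definability\<close>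
  puts the graph into \<open>A\<close> away from the bad points.\<close>

lemma local_section:
  fixes U :: "'i filter"
  assumes A: "defN m A" and U: "ultra U" and x: "eventually (\<lambda>i. length (x i) = m \<and> x i \<in> A) U"
    and ix: "distinct ix" "set ix \<subseteq> {..<m}" and rk: "rkP U (crd m x ix) = length ix"
    and alg: "set (cf m x) \<subseteq> Acl U (set (crd m x ix))"
  shows "\<exists>Sel T lo hi. definable F R m Sel \<and> (\<forall>l\<in>Sel. length l = m) \<and>
    (\<forall>l\<in>Sel. \<forall>l'\<in>Sel. map ((!) l) ix = map ((!) l') ix \<longrightarrow> l = l') \<and>
    (\<forall>i<length ix. lo i < hi i) \<and> (\<forall>u\<in>bx (length ix) lo hi. \<exists>l\<in>Sel. map ((!) l) ix = u) \<and>
    (\<forall>j<length ix. badT ix j (T j)) \<and> (\<forall>l\<in>Sel. (\<forall>j<length ix. \<not> bad (T j) (\<lambda>i. l ! i)) \<longrightarrow> l \<in> A)"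
proof -
  interpret u: pregeometry "Acl U" by (rule acl_pregeometry[OF U])
  define c where "c k = (\<lambda>i. x i ! k)" for k
  define g where "g i = (\<lambda>k. x i ! k)" for i
  define E where "E = filtermap g U"
  have E: "ultra E" unfolding E_def by (rule ultra_filtermap[OF U])
  have cfc: "cf m x ! j = c j" if "j < m" for j using that by (simp add: nth_cf c_def)
  have mc: "crd m x ix = map c ix" using ix(2) cfc by auto
  have p: "pres E {..<m} {} ix" unfolding pres_def
  proof (intro conjI)
    have "rkU U (Pst U \<union> c ` {}) (map c ix) = rkU E (Pst E \<union> vr ` {}) (map vr ix)"
      by (rule rkP_transfer[OF U E]) (simp add: E_def eventually_filtermap c_def g_def)
    then show "rkP E (map vr ix) = length ix" using rk unfolding mc by simp
    show "\<forall>k\<in>{..<m}. vr k \<in> Acl E (vr ` ({} \<union> set ix))"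
    proof
      fix k assume k: "k \<in> {..<m}"
      then have "cf m x ! k \<in> set (cf m x)" by (intro nth_mem) simp
      then have "c k \<in> Acl U (c ` set ix)" using alg mc cfc[of k] k by auto
      then show "vr k \<in> Acl E (vr ` ({} \<union> set ix))"
        unfolding E_def acl_filtermap by (simp add: image_image g_def c_def)
    qed
  qed (use ix in auto)
  have gb: "eventually (\<lambda>i. blk (g i) 0 m = x i) U" using x
  proof (rule eventually_mono)
    fix i assume "length (x i) = m \<and> x i \<in> A"
    then show "blk (g i) 0 m = x i" by (intro nth_equalityI) (auto simp: g_def)
  qed
  have QE: "eventually (\<lambda>e. blk e 0 m \<in> A) E" unfolding E_def eventually_filtermap using gb x by eventually_elim simp
  obtain W T where W: "DL W" "dep {..<m} W" "eventually W E" "\<forall>j<length ix. badT ix j (T j)"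
    "\<And>e. W e \<Longrightarrow> (\<forall>j<length ix. \<not> bad (T j) e) \<Longrightarrow> blk e 0 m \<in> A"
    using generic_definability[OF E p ix(1) definable_D[OF A, of 0] dep_blk QE] by blast
  obtain T' where T': "\<forall>j<m. j \<notin> set ix \<longrightarrow> DL (T' j) \<and> (\<forall>f. finite {a. T' j (f(j := a))}) \<and>
     dep (insert j (set ix)) (T' j) \<and> eventually (\<lambda>i. T' j (\<lambda>k. x i ! k)) U"
    using algebraic_predicates[OF U ix(2) alg] by blast
  define J where "J = {j. j < m \<and> j \<notin> set ix}"
  have fJ: "finite J" by (simp add: J_def)
  define Ws where "Ws = {l. length l = m \<and> W (\<lambda>k. l ! k) \<and> (\<forall>j\<in>J. T' j (\<lambda>k. l ! k))}"
  have Wl: "length l = m" if "l \<in> Ws" for l using that by (simp add: Ws_def)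
  have "DL (\<lambda>e. W e \<and> (\<forall>j\<in>J. T' j e))"
    by (intro D_conj W(1) D_Ball_finite fJ) (use T' in \<open>auto simp: J_def\<close>)
  moreover have "W (\<lambda>k. blk e 0 m ! k) = W e" for e by (rule depD[OF W(2)]) auto
  moreover have "T' j (\<lambda>k. blk e 0 m ! k) = T' j e" if j: "j \<in> J" for j e
  proof -
    have "dep (insert j (set ix)) (T' j)" using T' j by (auto simp: J_def)
    then show ?thesis by (rule depD) (use j ix(2) in \<open>auto simp: J_def\<close>)
  qed
  ultimately have "DL (\<lambda>e. blk e 0 m \<in> Ws)" by (simp add: Ws_def)
  then have dW: "definable F R m Ws" by (rule D_definable) (rule Wl)
  have fin: "finite {l \<in> Ws. map ((!) l) ix = u}" for u
  proof -
    \<comment> \<open>The entries prescribed by \<open>u\<close>, spread out as an environment;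
      every other entry of a tuple over \<open>u\<close> lies in a finite fibre above it.\<close>
    define f0 where "f0 k = (if k \<in> set ix then u ! (SOME i. i < length ix \<and> ix ! i = k) else 0)" for k
    have f0: "l ! k = f0 k" if "map ((!) l) ix = u" "k \<in> set ix" for l k
    proof -
      have "(SOME i. i < length ix \<and> ix ! i = k) < length ix \<and> ix ! (SOME i. i < length ix \<and> ix ! i = k) = k"
        by (rule someI_ex[of "\<lambda>i. i < length ix \<and> ix ! i = k"]) (use that(2) in \<open>auto simp: in_set_conv_nth\<close>)
      then show ?thesis using that by (auto simp: f0_def)
    qed
    define Fj where "Fj = f0 ` set ix \<union> (\<Union>j\<in>J. {a. T' j (f0(j := a))})"
    have "finite Fj" unfolding Fj_def using fJ T' by (auto simp: J_def)
    then have "finite {l. set l \<subseteq> Fj \<and> length l = m}" by (rule finite_lists_length_eq)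
    moreover have "{l \<in> Ws. map ((!) l) ix = u} \<subseteq> {l. set l \<subseteq> Fj \<and> length l = m}"
    proof
      fix l assume "l \<in> {l \<in> Ws. map ((!) l) ix = u}"
      then have l: "l \<in> Ws" "map ((!) l) ix = u" by auto
      have "l ! k \<in> Fj" if k: "k < m" for k
      proof (cases "k \<in> set ix")
        case True then show ?thesis using f0[OF l(2)] by (auto simp: Fj_def)
      next
        case False
        then have kJ: "k \<in> J" using k by (simp add: J_def)
        have "dep (insert k (set ix)) (T' k)" using T' kJ by (auto simp: J_def)
        then have "T' k (\<lambda>i. l ! i) = T' k (f0(k := l ! k))" by (rule depD) (use f0[OF l(2)] in auto)
        then have "T' k (f0(k := l ! k))" using l(1) kJ by (simp add: Ws_def)
        then show ?thesis using kJ by (auto simp: Fj_def)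
      qed
      then show "l \<in> {l. set l \<subseteq> Fj \<and> length l = m}" using Wl[OF l(1)] by (auto simp: in_set_conv_nth)
    qed
    ultimately show ?thesis using finite_subset by blast
  qed
  obtain Sel where Sel: "definable F R m Sel" "Sel \<subseteq> Ws" "\<forall>l\<in>Ws. \<exists>l'\<in>Sel. map ((!) l') ix = map ((!) l) ix"
     "\<forall>l\<in>Sel. \<forall>l'\<in>Sel. map ((!) l) ix = map ((!) l') ix \<longrightarrow> l = l'"
    using definable_selection[OF dW Wl ix(2) fin] by blast
  have SA: "l \<in> A" if l: "l \<in> Sel" "\<forall>j<length ix. \<not> bad (T j) (\<lambda>i. l ! i)" for l
  proof -
    have lW: "l \<in> Ws" using l(1) Sel(2) by blast
    then have "blk (\<lambda>i. l ! i) 0 m \<in> A" using W(5)[of "\<lambda>i. l ! i"] l(2) by (simp add: Ws_def)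
    moreover have "blk (\<lambda>i. l ! i) 0 m = l" using Wl[OF lW] by (intro nth_equalityI) auto
    ultimately show ?thesis by simp
  qed
  let ?k = "length ix"
  define Df where "Df = {u. length u = ?k \<and> (\<exists>l\<in>Sel. map ((!) l) ix = u)}"
  let ?Q = "\<lambda>e. blk e ?k m \<in> Sel \<and> (\<forall>j\<in>{..<?k}. e (?k + ix ! j) = e j)"
  have "DL (\<lambda>e. \<exists>ls. length ls = m \<and> ?Q (upds e ?k ls))"
    by (intro D_exs D_conj definable_D Sel(1) D_Ball_finite D_eq) simp
  moreover have "(\<exists>ls. length ls = m \<and> ?Q (upds e ?k ls)) \<longleftrightarrow> blk e 0 ?k \<in> Df" for e
  proof -
    have q: "?Q (upds e ?k ls) \<longleftrightarrow> ls \<in> Sel \<and> map ((!) ls) ix = blk e 0 ?k" if l: "length ls = m" for ls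
    proof -
      have 1: "blk (upds e ?k ls) ?k m = ls" by (rule blk_upds_same[OF l])
      have 2: "upds e ?k ls (?k + ix ! j) = ls ! (ix ! j)" if "j < ?k" for j
      proof -
        have "ix ! j < m" using ix(2) nth_mem[OF that] by blast
        then show ?thesis using l by (simp add: upds_def)
      qed
      have 3: "upds e ?k ls j = e j" if "j < ?k" for j using that by (simp add: upds_def)
      have l0: "length (blk e 0 ?k) = ?k" by simp
      have "(\<forall>j\<in>{..<?k}. upds e ?k ls (?k + ix ! j) = upds e ?k ls j) \<longleftrightarrow> map ((!) ls) ix = blk e 0 ?k"
        unfolding coords_eq_iff[OF l0] by (auto simp: 2 3)
      then show ?thesis unfolding 1 by simp
    qed
    have "length l = m" if "l \<in> Sel" for l using that Sel(2) Wl by blast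
    then show ?thesis using q by (auto simp: Df_def)
  qed
  ultimately have dDf: "DL (\<lambda>e. blk e 0 ?k \<in> Df)" by simp
  have xW: "eventually (\<lambda>i. x i \<in> Ws) U"
  proof -
    have "eventually (\<lambda>i. \<forall>j\<in>J. T' j (\<lambda>k. x i ! k)) U"
      by (rule eventually_ball_finite[OF fJ]) (use T' in \<open>auto simp: J_def\<close>)
    moreover have "eventually (\<lambda>i. W (\<lambda>k. x i ! k)) U" using W(3) by (simp add: E_def eventually_filtermap g_def)
    ultimately show ?thesis using x by eventually_elim (simp add: Ws_def)
  qed
  define y where "y i = map ((!) (x i)) ix" for i
  have cy: "cf ?k y = map c ix" by (rule nth_equalityI) (auto simp: nth_cf y_def c_def)
  have "u.rk {} (cf ?k y) = length (map c ix)" unfolding cy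
    by (rule u.rk_indep_antimono[of "Pst U"]) (use rk mc in auto)
  then have rky: "u.rk {} (cf ?k y) = ?k" by simp
  have "eventually (\<lambda>i. length (y i) = ?k \<and> y i \<in> Df) U"
    using xW by (rule eventually_mono) (use Sel(3) in \<open>auto simp: y_def Df_def\<close>)
  from generic_Big_list[OF U rky dDf this] have "Big [0..<?k] (\<lambda>e. blk e 0 ?k \<in> Df) (\<lambda>_. 0)" .
  from Big_box_list[OF dDf this] obtain lo hi where lh: "\<forall>i<?k. lo i < hi i" "bx ?k lo hi \<subseteq> Df" by blast
  show ?thesis
  proof (rule exI[of _ Sel], rule exI[of _ T], rule exI[of _ lo], rule exI[of _ hi], intro conjI)
    show "\<forall>l\<in>Sel. length l = m" using Sel(2) Wl by blast
    show "\<forall>u\<in>bx ?k lo hi. \<exists>l\<in>Sel. map ((!) l) ix = u" using lh(2) by (auto simp: Df_def)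
  qed (use Sel(1,4) lh(1) W(4) SA in auto)
qed

end

section \<open>Continuity on a smaller box\<close>

text \<open>Distance below \<open>\<delta>\<close> in every coordinate, written with order and
  addition alone so that definability is immediate.\<close>

definition near :: "nat \<Rightarrow> 'a::linordered_ab_group_add \<Rightarrow> 'a list \<Rightarrow> 'a list \<Rightarrow> bool" where
  "near k \<delta> u v \<longleftrightarrow> (\<forall>j<k. u ! j < v ! j + \<delta> \<and> v ! j < u ! j + \<delta>)"

lemma near_mono: "near k \<delta> u v \<Longrightarrow> \<delta> \<le> \<delta>' \<Longrightarrow> near k \<delta>' u v"
  unfolding near_def by (meson add_left_mono less_le_trans)

lemma near_refl: "0 < \<delta> \<Longrightarrow> near k \<delta> u u"
  unfolding near_def by simp

lemma near_ebox:
  "v \<in> ebox (map (\<lambda>j. Fin (u ! j - \<delta>)) [0..<k]) (map (\<lambda>j. Fin (u ! j + \<delta>)) [0..<k]) \<longleftrightarrow> length v = k \<and> near k \<delta> u v"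
  by (auto simp: ebox_def near_def less_diff_eq diff_less_eq)

context omin_pair begin

lemma ex_common_delta:
  fixes Pr :: "'i \<Rightarrow> 'a \<Rightarrow> bool"
  assumes "finite I" "\<And>i. i \<in> I \<Longrightarrow> \<exists>\<delta>>0. Pr i \<delta>" "\<And>i \<delta> \<delta>'. Pr i \<delta> \<Longrightarrow> 0 < \<delta>' \<Longrightarrow> \<delta>' \<le> \<delta> \<Longrightarrow> Pr i \<delta>'"
  shows "\<exists>\<delta>>0. \<forall>i\<in>I. Pr i \<delta>"
  using assms(1,2)
proof (induction I rule: finite_induct)
  case empty then show ?case using ex_pos by auto
next
  case (insert i I)
  then obtain \<delta> where d: "\<delta> > 0" "\<forall>i\<in>I. Pr i \<delta>" by blast
  obtain \<delta>' where d': "\<delta>' > 0" "Pr i \<delta>'" using insert.prems by blast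
  have "\<forall>j\<in>insert i I. Pr j (min \<delta> \<delta>')"
    using assms(3)[OF d'(2), of "min \<delta> \<delta>'"] assms(3)[of _ \<delta> "min \<delta> \<delta>'"] d d' by auto
  then show ?case using d(1) d'(1) by (intro exI[of _ "min \<delta> \<delta>'"]) auto
qed

lemma box_near:
  fixes u :: "'a list"
  assumes u: "u \<in> bx k lo hi"
  shows "\<exists>\<delta>>0. \<forall>v. length v = k \<longrightarrow> near k \<delta> u v \<longrightarrow> v \<in> bx k lo hi"
proof -
  let ?Pr = "\<lambda>j \<delta>. \<forall>v. u ! j < v ! j + \<delta> \<and> v ! j < u ! j + \<delta> \<longrightarrow> lo j < v ! j \<and> v ! j < hi j"
  have "\<exists>\<delta>>0. \<forall>j\<in>{..<k}. ?Pr j \<delta>"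
  proof (rule ex_common_delta)
    fix j assume j: "j \<in> {..<k}"
    define \<delta> where "\<delta> = min (u ! j - lo j) (hi j - u ! j)"
    have l: "lo j < u ! j" "u ! j < hi j" using u j by (auto simp: bx_def)
    have "lo j < w \<and> w < hi j" if "u ! j < w + \<delta>" "w < u ! j + \<delta>" for w
    proof
      have "u ! j < w + (u ! j - lo j)" using that(1) by (rule less_le_trans) (simp add: \<delta>_def)
      then show "lo j < w" by (simp add: algebra_simps)
      have "\<delta> \<le> hi j - u ! j" by (simp add: \<delta>_def)
      from less_le_trans[OF that(2) add_left_mono[OF this]] have "w < u ! j + (hi j - u ! j)" .
      then show "w < hi j" by simp
    qed
    moreover have "\<delta> > 0" using l by (simp add: \<delta>_def)
    ultimately show "\<exists>\<delta>>0. ?Pr j \<delta>" by blast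
  next
    fix j \<delta> \<delta>' assume a: "?Pr j \<delta>" "\<delta>' \<le> \<delta>"
    show "?Pr j \<delta>'"
    proof (intro allI impI)
      fix v assume "u ! j < v ! j + \<delta>' \<and> v ! j < u ! j + \<delta>'"
      then have "u ! j < v ! j + \<delta> \<and> v ! j < u ! j + \<delta>" using a(2) by (meson add_left_mono less_le_trans)
      then show "lo j < v ! j \<and> v ! j < hi j" using a(1) by blast
    qed
  qed simp
  then obtain \<delta> where d: "\<delta> > 0" "\<And>j v. j < k \<Longrightarrow> u ! j < v ! j + \<delta> \<and> v ! j < u ! j + \<delta> \<Longrightarrow> lo j < v ! j \<and> v ! j < hi j" by blast
  have "v \<in> bx k lo hi" if "length v = k" "near k \<delta> u v" for v
    using that d(2) unfolding near_def bx_def by blast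
  then show ?thesis using d(1) by blast
qed

lemma box_interior:
  assumes "\<forall>i<k. lo i < (hi i :: 'a)"
  shows "\<exists>u \<delta>. u \<in> bx k lo hi \<and> \<delta> > 0 \<and> (\<forall>v. length v = k \<longrightarrow> near k \<delta> u v \<longrightarrow> v \<in> bx k lo hi)"
proof -
  have "\<forall>i. \<exists>b. i < k \<longrightarrow> lo i < b \<and> b < hi i" using assms dens by auto
  then obtain g where "\<And>i. i < k \<Longrightarrow> lo i < g i \<and> g i < hi i" by metis
  then have "map g [0..<k] \<in> bx k lo hi" by (simp add: bx_def)
  then show ?thesis using box_near by blast
qed

lemma D_less_plus: "D F R C (\<lambda>e. e i < e j + e l)"
proof -
  let ?w = "i + j + l + 1"
  have "D F R C (\<lambda>e. \<exists>a. (\<lambda>e. e j + e l = e ?w \<and> e i < e ?w) (e(?w := a)))"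
    by (intro D_ex D_conj D_less D_plus)
  then show ?thesis by simp
qed

lemma D_near: "D F R C (\<lambda>e. near k (e d) (blk e a k) (blk e b k))"
proof -
  have "D F R C (\<lambda>e. \<forall>j\<in>{..<k}. e (a + j) < e (b + j) + e d \<and> e (b + j) < e (a + j) + e d)"
    by (intro D_Ball_finite D_conj D_less_plus) simp
  moreover have "(\<forall>j\<in>{..<k}. e (a + j) < e (b + j) + e d \<and> e (b + j) < e (a + j) + e d) \<longleftrightarrow> near k (e d) (blk e a k) (blk e b k)" for e :: "nat \<Rightarrow> 'a"
    by (auto simp: near_def)
  ultimately show ?thesis by (simp only:)
qed

lemma D_box: "DL (\<lambda>e. blk e a k \<in> bx k lo hi)"
proof -
  have "DL (\<lambda>e. \<forall>j\<in>{..<k}. lo j < e (a + j) \<and> e (a + j) < hi j)"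
    by (intro D_Ball_finite D_conj D_lec) simp
  moreover have "(\<forall>j\<in>{..<k}. lo j < e (a + j) \<and> e (a + j) < hi j) \<longleftrightarrow> blk e a k \<in> bx k lo hi" for e
    by (auto simp: bx_def)
  ultimately show ?thesis by (simp only:)
qed

lemma D_between:
  assumes Gr: "definable F R (k + m) {u @ f u | u. u \<in> B}" and B: "\<And>u. u \<in> B \<Longrightarrow> length u = k \<and> length (f u) = m"
    and i: "i < m"
  shows "DL (\<lambda>e. blk e a k \<in> B \<and> e c < f (blk e a k) ! i \<and> f (blk e a k) ! i < e d)"
proof -
  define z where "z = a + k + c + d + 1"
  let ?Q = "\<lambda>e. map e ([a..<a+k] @ [z..<z+m]) \<in> {u @ f u | u. u \<in> B} \<and> e c < e (z + i) \<and> e (z + i) < e d"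
  have "DL (\<lambda>e. \<exists>ys. length ys = m \<and> ?Q (upds e z ys))"
    by (intro D_exs D_conj D_less definable_imp_D[OF Gr[unfolded definable_def]]) simp
  moreover have "(\<exists>ys. length ys = m \<and> ?Q (upds e z ys)) \<longleftrightarrow> blk e a k \<in> B \<and> e c < f (blk e a k) ! i \<and> f (blk e a k) ! i < e d" for e
  proof -
    have q: "?Q (upds e z ys) \<longleftrightarrow> blk e a k \<in> B \<and> ys = f (blk e a k) \<and> e c < ys ! i \<and> ys ! i < e d" if l: "length ys = m" for ys
    proof -
      have 1: "map (upds e z ys) ([a..<a+k] @ [z..<z+m]) = blk e a k @ ys"
        unfolding map_append blk_upds_same[OF l] by (subst blk_upds_other) (auto simp: z_def)
      have 2: "upds e z ys (z + i) = ys ! i" "upds e z ys c = e c" "upds e z ys d = e d"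
        using i l by (auto simp: upds_def z_def)
      have 3: "blk e a k @ ys \<in> {u @ f u | u. u \<in> B} \<longleftrightarrow> blk e a k \<in> B \<and> ys = f (blk e a k)"
      proof
        assume "blk e a k @ ys \<in> {u @ f u | u. u \<in> B}"
        then obtain u where u: "blk e a k @ ys = u @ f u" "u \<in> B" by blast
        have "length (blk e a k) = length u" using B[OF u(2)] by simp
        then show "blk e a k \<in> B \<and> ys = f (blk e a k)" using u by auto
      qed blast
      show ?thesis unfolding 1 2 3 by blast
    qed
    show ?thesis using q B by blast
  qed
  ultimately show ?thesis by (simp only:)
qed

lemma eless_lower: "eless a (Fin (x::'a)) \<Longrightarrow> \<exists>c<x. \<forall>y. c < y \<longrightarrow> eless a (Fin y)"
  using ex_less by (cases a) auto

lemma eless_upper: "eless (Fin (x::'a)) a \<Longrightarrow> \<exists>c>x. \<forall>y. y < c \<longrightarrow> eless (Fin y) a"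
  using ex_greater by (cases a) auto

text \<open>A discontinuity at \<open>u\<close> is witnessed by a window around the value that is
  left by points arbitrarily near \<open>u\<close>. Smaller windows are witnesses too, so infinitely
  many windows work; if discontinuities were big, one window would serve a whole box. But then all
  values on that box lie in the window, although points near an inner point leave it.\<close>

lemma continuous_on_box:
  assumes lh: "\<forall>i<k. lo i < hi i"
    and Gr: "definable F R (k + m) {u @ f u | u. u \<in> bx k lo hi}" and fl: "\<And>u. u \<in> bx k lo hi \<Longrightarrow> length (f u) = m"
  shows "\<exists>lo' hi'. (\<forall>i<k. lo' i < hi' i) \<and> bx k lo' hi' \<subseteq> bx k lo hi \<and> cont_on (bx k lo' hi') f"
proof -
  let ?B = "bx k lo hi"
  have Bl: "length u = k \<and> length (f u) = m" if "u \<in> ?B" for u using fl[OF that] that by (simp add: bx_def)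
  define btw where "btw i u c d \<longleftrightarrow> u \<in> ?B \<and> c < f u ! i \<and> f u ! i < d" for i u c d
  define disc where "disc i u c d \<longleftrightarrow> btw i u c d \<and> (\<forall>\<delta>. \<delta> > 0 \<longrightarrow> (\<exists>v. length v = k \<and> v \<in> ?B \<and> near k \<delta> u v \<and> \<not> btw i v c d))" for i u c d
  define NN where "NN i e \<longleftrightarrow> disc i (blk e 0 k) (e k) (e (Suc k))" for i e
  have NND: "DL (NN i)" if i: "i < m" for i
  proof -
    have "DL (\<lambda>e. btw i (blk e 0 k) (e k) (e (Suc k)) \<and> (\<forall>\<delta>. (\<lambda>e. e (k + 2) > 0 \<longrightarrow> (\<exists>v. length v = k \<and>
       (\<lambda>e. blk e (k + 3) k \<in> ?B \<and> near k (e (k + 2)) (blk e 0 k) (blk e (k + 3) k) \<and> \<not> btw i (blk e (k + 3) k) (e k) (e (Suc k)))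
         (upds e (k + 3) v))) (e(k + 2 := \<delta>))))"
      unfolding btw_def by (intro D_conj D_all D_imp D_lec D_exs D_near D_not D_box D_between[OF Gr Bl i])
    moreover have "blk (upds e (k + 3) v) (k + 3) k = v" if "length v = k" for v and e :: "nat \<Rightarrow> 'a" by (rule blk_upds_same[OF that])
    moreover have "blk (upds (e(k + 2 := \<delta>)) (k + 3) v) 0 k = blk e 0 k" for v \<delta> and e :: "nat \<Rightarrow> 'a"
      by (auto simp: upds_def)
    moreover have "upds e (k + 3) v (k + 2) = e (k + 2)" "upds e (k + 3) v k = e k" "upds e (k + 3) v (Suc k) = e (Suc k)"
      for v and e :: "nat \<Rightarrow> 'a" by (auto simp: upds_def)
    ultimately show ?thesis unfolding NN_def[abs_def] disc_def by (simp del: map_eq_conv cong: conj_cong)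
  qed
  have nB: "\<not> Big [0..<k] (\<lambda>e. \<exists>c d. disc i (blk e 0 k) c d) e0" if i: "i < m" for i e0
  proof
    assume "Big [0..<k] (\<lambda>e. \<exists>c d. disc i (blk e 0 k) c d) e0"
    then have "Big [0..<k] (Big [k, Suc k] (NN i)) e0"
    proof (rule Big_mono[rotated])
      fix e assume "\<exists>c d. disc i (blk e 0 k) c d"
      then obtain c d where cd: "disc i (blk e 0 k) c d" by blast
      let ?y = "f (blk e 0 k) ! i"
      have y: "c < ?y" "?y < d" using cd by (auto simp: disc_def btw_def)
      have NNe: "NN i (e(k := c', Suc k := d')) \<longleftrightarrow> disc i (blk e 0 k) c' d'" for c' d'
      proof -
        have "blk (e(k := c', Suc k := d')) 0 k = blk e 0 k" by auto
        then show ?thesis unfolding NN_def by (simp only:) simp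
      qed
      have ds: "disc i (blk e 0 k) c' d'" if "c < c'" "c' < ?y" "?y < d'" "d' < d" for c' d'
        unfolding disc_def
      proof (intro conjI allI impI)
        show "btw i (blk e 0 k) c' d'" using cd that by (auto simp: disc_def btw_def)
        fix \<delta> :: 'a assume "\<delta> > 0"
        then obtain v where v: "length v = k" "v \<in> ?B" "near k \<delta> (blk e 0 k) v" "\<not> btw i v c d" using cd by (auto simp: disc_def)
        moreover have "\<not> btw i v c' d'" using v(2,4) that(1,4) by (auto simp: btw_def)
        ultimately show "\<exists>v. length v = k \<and> v \<in> ?B \<and> near k \<delta> (blk e 0 k) v \<and> \<not> btw i v c' d'" by blast
      qed
      have "infinite {d'. NN i (e(k := c', Suc k := d'))}" if "c < c'" "c' < ?y" for c'
      proof -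
        have "{d'. ?y < d' \<and> d' < d} \<subseteq> {d'. NN i (e(k := c', Suc k := d'))}" unfolding NNe using ds that by blast
        then show ?thesis using infinite_interval[OF y(2)] finite_subset by blast
      qed
      then have "{c'. c < c' \<and> c' < ?y} \<subseteq> {c'. infinite {d'. NN i (e(k := c', Suc k := d'))}}" by blast
      then have "infinite {c'. infinite {d'. NN i (e(k := c', Suc k := d'))}}" using infinite_interval[OF y(1)] finite_subset by blast
      then show "Big [k, Suc k] (NN i) e" by simp
    qed
    then obtain x y where xy: "Big [0..<k] (NN i) (e0(Suc k := y, k := x))"
      using Big_out[OF NND[OF i], of k "[0..<k]" "Suc k" e0] by auto
    obtain lo' hi' where lh': "\<forall>w\<in>set [0..<k]. lo' w < hi' w"
      "\<And>g. (\<forall>w\<in>set [0..<k]. lo' w < g w \<and> g w < hi' w) \<Longrightarrow> NN i (\<lambda>j. if j \<in> set [0..<k] then g j else (e0(Suc k := y, k := x)) j)"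
      using Big_box[OF distinct_upt NND[OF i] xy] by blast
    have inb: "disc i u x y" if u: "u \<in> bx k lo' hi'" for u
    proof -
      have "NN i (\<lambda>j. if j \<in> set [0..<k] then u ! j else (e0(Suc k := y, k := x)) j)"
        by (rule lh'(2)) (use u in \<open>auto simp: bx_def\<close>)
      moreover have "blk (\<lambda>j. if j \<in> set [0..<k] then u ! j else (e0(Suc k := y, k := x)) j) 0 k = u"
        using u by (intro nth_equalityI) (auto simp: bx_def)
      ultimately show ?thesis unfolding NN_def by (simp only:) simp
    qed
    have "\<forall>i<k. lo' i < hi' i" using lh'(1) by simp
    from box_interior[OF this] obtain u \<delta> where u: "u \<in> bx k lo' hi'"
      and d: "\<delta> > 0" "\<And>v. length v = k \<Longrightarrow> near k \<delta> u v \<Longrightarrow> v \<in> bx k lo' hi'" by blast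
    obtain v where v: "length v = k" "near k \<delta> u v" "\<not> btw i v x y"
      using inb[OF u] d(1) unfolding disc_def by blast
    from inb[OF d(2)[OF v(1,2)]] v(3) show False by (simp add: disc_def)
  qed
  define A where "A = {u \<in> ?B. \<not> (\<exists>i\<in>{..<m}. \<exists>c d. disc i u c d)}"
  have "DL (\<lambda>e. blk e 0 k \<in> ?B \<and> \<not> (\<exists>i\<in>{..<m}. \<exists>c. (\<lambda>e. \<exists>d. NN i (e(Suc k := d))) (e(k := c))))"
    by (intro D_conj D_box D_not D_Bex_finite D_ex NND) auto
  moreover have "NN i (e(k := c, Suc k := d)) \<longleftrightarrow> disc i (blk e 0 k) c d" for i e c d
  proof -
    have "blk (e(k := c, Suc k := d)) 0 k = blk e 0 k" by auto
    then show ?thesis unfolding NN_def by (simp only:) simp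
  qed
  ultimately have AD: "DL (\<lambda>e. blk e 0 k \<in> A)" unfolding A_def mem_Collect_eq by (simp only:)
  have "Big [0..<k] (\<lambda>e. blk e 0 k \<in> A \<or> (\<exists>i\<in>{..<m}. \<exists>c d. disc i (blk e 0 k) c d)) (\<lambda>_. 0)"
    by (rule Big_mono[OF _ box_Big[OF lh]]) (auto simp: A_def)
  from Big_disj[OF this] have "Big [0..<k] (\<lambda>e. blk e 0 k \<in> A) (\<lambda>_. 0)"
    using Big_Bex_finite[of "{..<m}" "[0..<k]" "\<lambda>i e. \<exists>c d. disc i (blk e 0 k) c d" "\<lambda>_. 0"] nB by auto
  from Big_box_list[OF AD this] obtain lo' hi' where lh': "\<forall>i<k. lo' i < hi' i" "bx k lo' hi' \<subseteq> A" by blast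
  have "cont_on (bx k lo' hi') f" unfolding cont_on_def
  proof (intro ballI allI impI, elim conjE)
    fix u a b assume u: "u \<in> bx k lo' hi'" and a: "length a = length (f u)" "length b = length (f u)" "f u \<in> ebox a b"
    have uA: "u \<in> A" using u lh'(2) by blast
    then have uB: "u \<in> ?B" by (simp add: A_def)
    let ?Pr = "\<lambda>i \<delta>. \<forall>v. v \<in> ?B \<longrightarrow> near k \<delta> u v \<longrightarrow> eless (a ! i) (Fin (f v ! i)) \<and> eless (Fin (f v ! i)) (b ! i)"
    have "\<exists>\<delta>>0. \<forall>i\<in>{..<m}. ?Pr i \<delta>"
    proof (rule ex_common_delta)
      fix i assume i: "i \<in> {..<m}"
      have e: "eless (a ! i) (Fin (f u ! i))" "eless (Fin (f u ! i)) (b ! i)"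
        using a i fl[OF uB] by (auto simp: ebox_def)
      obtain c where c: "c < f u ! i" "\<And>y. c < y \<Longrightarrow> eless (a ! i) (Fin y)" using eless_lower[OF e(1)] by blast
      obtain d where d: "d > f u ! i" "\<And>y. y < d \<Longrightarrow> eless (Fin y) (b ! i)" using eless_upper[OF e(2)] by blast
      have "\<not> disc i u c d" using uA i by (auto simp: A_def)
      moreover have "btw i u c d" using uB c(1) d(1) by (simp add: btw_def)
      ultimately obtain \<delta> where "\<delta> > 0" "\<And>v. length v = k \<Longrightarrow> v \<in> ?B \<Longrightarrow> near k \<delta> u v \<Longrightarrow> btw i v c d"
        unfolding disc_def by blast
      moreover have "length v = k" if "v \<in> ?B" for v using that by (simp add: bx_def)
      ultimately show "\<exists>\<delta>>0. ?Pr i \<delta>" using c(2) d(2) unfolding btw_def by blast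
    next
      fix i \<delta> \<delta>' assume "?Pr i \<delta>" "\<delta>' \<le> \<delta>"
      then show "?Pr i \<delta>'" using near_mono by blast
    qed simp
    then obtain \<delta> where d: "\<delta> > 0" "\<And>i v. i < m \<Longrightarrow> v \<in> ?B \<Longrightarrow> near k \<delta> u v \<Longrightarrow> eless (a ! i) (Fin (f v ! i)) \<and> eless (Fin (f v ! i)) (b ! i)"
      by auto
    have ul: "length u = k" using u by (simp add: bx_def)
    let ?c = "map (\<lambda>j. Fin (u ! j - \<delta>)) [0..<k]" and ?d = "map (\<lambda>j. Fin (u ! j + \<delta>)) [0..<k]"
    have "f v \<in> ebox a b" if v: "v \<in> bx k lo' hi' \<inter> ebox ?c ?d" for v
    proof -
      have vB: "v \<in> ?B" using v lh'(2) by (auto simp: A_def)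
      have "near k \<delta> u v" using v near_ebox by blast
      then show ?thesis using d(2)[OF _ vB] a(1) fl[OF vB] fl[OF uB] by (simp add: ebox_def)
    qed
    moreover have "u \<in> ebox ?c ?d" using near_ebox near_refl[OF d(1)] ul by blast
    ultimately show "\<exists>c d. length c = length u \<and> length d = length u \<and> u \<in> ebox c d \<and> (\<forall>y\<in>bx k lo' hi' \<inter> ebox c d. f y \<in> ebox a b)"
      by - (rule exI[of _ ?c], rule exI[of _ ?d], simp add: ul)
  qed
  then have "(\<forall>i<k. lo' i < hi' i) \<and> bx k lo' hi' \<subseteq> bx k lo hi \<and> cont_on (bx k lo' hi') f" using lh' by (auto simp: A_def)
  then show ?thesis by blast
qed

end

section \<open>Supercones inside definable sets\<close>

context omin_pair begin

interpretation m: pregeometry mcl by (rule mcl_pregeometry)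

lemma dep_Int: fixes T :: "(nat \<Rightarrow> 'b) \<Rightarrow> bool" shows "dep K T \<Longrightarrow> dep X T \<Longrightarrow> dep (K \<inter> X) T"
  unfolding dep_def
proof (intro allI impI)
  fix e e' :: "nat \<Rightarrow> 'b" assume K: "\<forall>e e'. (\<forall>k\<in>K. e k = e' k) \<longrightarrow> T e = T e'" and X: "\<forall>e e'. (\<forall>k\<in>X. e k = e' k) \<longrightarrow> T e = T e'"
    and eq: "\<forall>k\<in>K \<inter> X. e k = e' k"
  have "T e = T (\<lambda>k. if k \<in> X then e k else e' k)" using X by simp
  also have "\<dots> = T e'" using K[rule_format, of "\<lambda>k. if k \<in> X then e k else e' k" e'] eq by simp
  finally show "T e = T e'" .
qed

lemma bad_cong:
  assumes T: "badT ix j T" and eq: "\<And>i. i \<in> set (take (Suc j) ix) \<Longrightarrow> e i = e' i"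
  shows "bad T e = bad T e'"
proof -
  have "T (mix e \<rho>) = T (mix e' \<rho>)" for \<rho>
    by (rule depD[of "(\<lambda>i. 2 * i) ` set (take (Suc j) ix) \<union> {m. odd m}"]) (use T eq in \<open>auto simp: badT_def mix_def\<close>)
  then show ?thesis unfolding bad_def by simp
qed

text \<open>A tuple shorter than \<open>ix\<close> fills only an initial part of the slots, as the
  recursion along the projections of a supercone requires.\<close>

definition en :: "nat list \<Rightarrow> 'a list \<Rightarrow> nat \<Rightarrow> 'a" where
  "en ix u i = (if i \<in> set (take (length u) ix) then u ! (THE t. t < length ix \<and> ix ! t = i) else 0)"

lemma position: "distinct ix \<Longrightarrow> t < length ix \<Longrightarrow> (THE s. s < length ix \<and> ix ! s = ix ! t) = t"
  by (rule the_equality) (auto simp: nth_eq_iff_index_eq)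

lemma en_nth: "distinct ix \<Longrightarrow> t < length u \<Longrightarrow> t < length ix \<Longrightarrow> en ix u (ix ! t) = u ! t"
  using nth_mem[of t "take (length u) ix"] by (simp add: en_def position)

text \<open>\<open>T\<close> reads finitely many slots, so a bad last entry is algebraic over the
  entries of \<open>a\<close>, finitely many constants and a bounded number of elements of
  \<open>P\<close>.\<close>

lemma bad_codense:
  assumes T: "badT ix j T" and dx: "distinct ix" and j: "j < length ix" and a: "length a = j"
  shows "\<exists>A N. finite A \<and> (\<forall>b. bad T (en ix (a @ [b])) \<longrightarrow> (\<exists>Q\<subseteq>P. finite Q \<and> card Q \<le> N \<and> b \<in> mcl (A \<union> Q)))"
proof -
  have TD: "DL T" using T by (simp add: badT_def)
  obtain A K where AK: "finite A" "finite K" "\<And>e w y. T (e(w := y)) \<Longrightarrow> finite {a. T (e(w := a))} \<Longrightarrow> y \<in> mcl (A \<union> e ` (K - {w}))"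
    using definable_fibre_mcl[OF TD] by blast
  let ?A = "A \<union> insert 0 (set a)"
  have "\<exists>Q\<subseteq>P. finite Q \<and> card Q \<le> card K \<and> b \<in> mcl (?A \<union> Q)" if "bad T (en ix (a @ [b]))" for b
  proof -
    obtain \<rho> where r: "range \<rho> \<subseteq> P" "T (mix (en ix (a @ [b])) \<rho>)" using \<open>bad T _\<close> by (auto simp: bad_def)
    let ?e = "mix (en ix (a @ [b])) \<rho>" and ?w = "2 * (ix ! j)"
    have "?e ?w = b" using en_nth[OF dx, of j "a @ [b]"] j a by (simp add: mix_def nth_append)
    then have "?e = ?e(?w := b)" by auto
    then have "T (?e(?w := b))" using r(2) by simp
    then have b: "b \<in> mcl (A \<union> ?e ` (K - {?w}))" by (rule AK(3)) (use T in \<open>simp add: badT_def\<close>)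
    let ?Q = "(\<lambda>i. \<rho> (i div 2)) ` K"
    have "?e i \<in> ?A \<union> ?Q" if i: "i \<in> K - {?w}" for i
    proof (cases "even i")
      case True
      then obtain h where h: "i = 2 * h" by blast
      have e: "?e i = en ix (a @ [b]) h" by (simp add: h mix_def)
      show ?thesis
      proof (cases "h \<in> set (take (length (a @ [b])) ix)")
        case True
        then obtain t where t: "t < Suc j" "t < length ix" "h = ix ! t" using a by (auto simp: in_set_conv_nth)
        then have "t \<noteq> j" using i h by auto
        then have "t < j" using t(1) by simp
        then show ?thesis unfolding e t(3) using en_nth[OF dx, of t "a @ [b]"] t(2) a by (simp add: nth_append)
      qed (simp add: e en_def)
    qed (use i in \<open>simp add: mix_def\<close>)
    then have "A \<union> ?e ` (K - {?w}) \<subseteq> ?A \<union> ?Q" by blast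
    then have "b \<in> mcl (?A \<union> ?Q)" using b m.mono by blast
    moreover have "?Q \<subseteq> P" using r(1) by auto
    ultimately show ?thesis using AK(2) card_image_le by blast
  qed
  then show ?thesis using AK(1) by (intro exI[of _ ?A]) auto
qed

text \<open>The sequence in \<open>P\<close> is infinite, but \<open>T\<close> depends on finitely
  many slots, so it is enough to quantify over its first \<open>N\<close> members.\<close>

lemma D_bad:
  assumes T: "badT ix i T" and dx: "distinct ix" and i: "i < j" and j: "j \<le> length ix"
  shows "DN (\<lambda>e. bad T (en ix (blk e 0 j)))"
proof -
  have TD: "DL T" using T by (simp add: badT_def)
  obtain K where K: "finite K" "dep K T" using D_dep[OF TD] by blast
  define X where "X = (\<lambda>i. 2 * i) ` set (take (Suc i) ix) \<union> {m. odd m}"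
  have KX: "dep (K \<inter> X) T" by (rule dep_Int[OF K(2)]) (use T in \<open>simp add: badT_def X_def\<close>)
  obtain N where N: "\<And>m. m \<in> K \<Longrightarrow> m < N" using K(1) finite_nat_set_iff_bounded by auto
  obtain p0 where p0: "p0 \<in> P" using ex_pos Pdense by blast
  define \<tau> :: "nat \<Rightarrow> nat + 'a" where
    "\<tau> m = (if even m then Inl (THE t. t < length ix \<and> ix ! t = m div 2) else Inl (j + m div 2))" for m
  let ?Q = "\<lambda>e. (\<forall>i\<in>{..<N}. e (j + i) \<in> P) \<and> T (asg \<tau> e)"
  have "DN (\<lambda>e. \<exists>ps. length ps = N \<and> ?Q (upds e j ps))"
    by (intro D_exs D_conj D_Ball_finite D_P D_sub D_expR TD) auto
  moreover have "(\<exists>ps. length ps = N \<and> ?Q (upds e j ps)) \<longleftrightarrow> bad T (en ix (blk e 0 j))" for e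
  proof -
    have eq: "T (asg \<tau> (upds e j ps)) = T (mix (en ix (blk e 0 j)) \<rho>)"
      if l: "length ps = N" and r: "\<And>i. i < N \<Longrightarrow> ps ! i = \<rho> i" for ps \<rho>
    proof (rule depD[OF KX])
      fix m assume m: "m \<in> K \<inter> X"
      show "asg \<tau> (upds e j ps) m = mix (en ix (blk e 0 j)) \<rho> m"
      proof (cases "even m")
        case True
        then obtain t where t: "t < Suc i" "t < length ix" "m = 2 * (ix ! t)" using m by (auto simp: X_def in_set_conv_nth)
        then have tj: "t < j" using i by simp
        have "\<tau> m = Inl t" using t position[OF dx t(2)] by (simp add: \<tau>_def)
        then have "asg \<tau> (upds e j ps) m = e t" using tj by (simp add: asg_def upds_def)
        moreover have "mix (en ix (blk e 0 j)) \<rho> m = e t" using en_nth[OF dx, of t "blk e 0 j"] t tj by (simp add: mix_def)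
        ultimately show ?thesis by simp
      next
        case False
        have "m div 2 < N" using N[of m] m by simp
        then show ?thesis using False l r by (simp add: \<tau>_def asg_def upds_def mix_def)
      qed
    qed
    show ?thesis
    proof
      assume "\<exists>ps. length ps = N \<and> ?Q (upds e j ps)"
      then obtain ps where ps: "length ps = N" "?Q (upds e j ps)" by blast
      have pP: "ps ! i \<in> P" if "i < N" for i
      proof -
        have "upds e j ps (j + i) \<in> P" using ps(2) that by blast
        then show ?thesis using ps(1) that by (simp add: upds_def)
      qed
      define \<rho> where "\<rho> i = (if i < N then ps ! i else p0)" for i
      have "T (mix (en ix (blk e 0 j)) \<rho>)" using eq[OF ps(1), of \<rho>] ps(2) by (simp add: \<rho>_def)
      moreover have "range \<rho> \<subseteq> P" using pP p0 by (auto simp: \<rho>_def)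
      ultimately show "bad T (en ix (blk e 0 j))" unfolding bad_def by blast
    next
      assume "bad T (en ix (blk e 0 j))"
      then obtain \<rho> where r: "range \<rho> \<subseteq> P" "T (mix (en ix (blk e 0 j)) \<rho>)" by (auto simp: bad_def)
      let ?ps = "map \<rho> [0..<N]"
      have "T (asg \<tau> (upds e j ?ps))" using eq[of ?ps \<rho>] r(2) by simp
      moreover have "upds e j ?ps (j + i) \<in> P" if "i < N" for i using that r(1) by (auto simp: upds_def)
      ultimately show "\<exists>ps. length ps = N \<and> ?Q (upds e j ps)" by (intro exI[of _ ?ps]) simp
    qed
  qed
  ultimately show ?thesis by (simp only:)
qed

text \<open>A function definable in the o-minimal structure sends \<open>k\<close> elements of
  \<open>B\<close> into the closure of finitely many parameters and at most \<open>k * N\<close>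
  elements of \<open>P\<close>; by \<open>codense\<close> such values miss a point of every
  interval.\<close>

lemma small_of_bounded_support:
  assumes C: "defN 1 {[b] | b. b \<in> B}"
    and A: "finite A" and B: "\<And>b. b \<in> B \<Longrightarrow> \<exists>Q\<subseteq>P. finite Q \<and> card Q \<le> N \<and> b \<in> mcl (A \<union> Q)"
  shows "small F R P 1 {[b] | b. b \<in> B}"
  unfolding small_def
proof (intro conjI notI C, elim exE conjE)
  fix k f0 and a0 b0 :: 'a
  assume ab: "a0 < b0" and gr: "definable F R (1 * k + 1) {x @ [f0 x] | x. length x = 1 * k}"
    and sub: "{c. a0 < c \<and> c < b0} \<subseteq> f0 ` tpow {[b] | b. b \<in> B} k"
  let ?G = "{x @ [f0 x] | x. length x = k}"
  have TD: "DL (\<lambda>e. map e [0..<k+1] \<in> ?G)" using definable_D[OF gr, of 0] by simp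
  obtain A1 K1 where A1: "finite A1" "finite K1"
    "\<And>e w y. map (e(w := y)) [0..<k+1] \<in> ?G \<Longrightarrow> finite {a. map (e(w := a)) [0..<k+1] \<in> ?G} \<Longrightarrow> y \<in> mcl (A1 \<union> e ` (K1 - {w}))"
    using definable_fibre_mcl[OF TD] by blast
  let ?A = "A \<union> A1 \<union> {0}"
  obtain y where y: "a0 < y" "y < b0" "\<forall>Q\<subseteq>P. finite Q \<longrightarrow> card Q \<le> k * N \<longrightarrow> y \<notin> mcl (?A \<union> Q)"
    using codense[of ?A a0 b0 "k * N"] A A1(1) ab by auto
  obtain xs where xs: "y = f0 (concat xs)" "length xs = k" "set xs \<subseteq> {[b] | b. b \<in> B}"
    using sub y(1,2) by (auto simp: tpow_def)
  define ys where "ys = map hd xs"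
  have "concat xs = ys" using xs(3) unfolding ys_def by (induction xs) auto
  moreover have "set ys \<subseteq> B" "length ys = k" using xs(2,3) by (auto simp: ys_def)
  ultimately have ys: "y = f0 ys" "set ys \<subseteq> B" "length ys = k" using xs(1) by simp_all
  define e where "e i = (if i < k then ys ! i else 0)" for i
  have me: "map (e(k := a)) [0..<k+1] = ys @ [a]" for a
    using ys(3) by (intro nth_equalityI) (auto simp: e_def nth_append less_Suc_eq)
  have mem: "ys @ [a] \<in> ?G \<longleftrightarrow> a = f0 ys" for a using ys(3) by auto
  have "y \<in> mcl (A1 \<union> e ` (K1 - {k}))" by (rule A1(3)) (unfold me mem, auto simp: ys(1))
  moreover have "A1 \<union> e ` (K1 - {k}) \<subseteq> ?A \<union> set ys" using ys(3) by (auto simp: e_def)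
  ultimately have y1: "y \<in> mcl (?A \<union> set ys)" using m.mono by blast
  have "\<exists>Q\<subseteq>P. finite Q \<and> card Q \<le> length zs * N \<and> set zs \<subseteq> mcl (A \<union> Q)" if "set zs \<subseteq> B" for zs
    using that
  proof (induction zs)
    case Nil then show ?case by (intro exI[of _ "{}"]) simp
  next
    case (Cons z zs)
    then obtain Q where Q: "Q \<subseteq> P" "finite Q" "card Q \<le> length zs * N" "set zs \<subseteq> mcl (A \<union> Q)" by auto
    obtain Q' where Q': "Q' \<subseteq> P" "finite Q'" "card Q' \<le> N" "z \<in> mcl (A \<union> Q')" using B[of z] Cons.prems by auto
    have "mcl (A \<union> Q) \<subseteq> mcl (A \<union> (Q \<union> Q'))" "mcl (A \<union> Q') \<subseteq> mcl (A \<union> (Q \<union> Q'))" by (auto intro!: m.mono)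
    then have "set (z # zs) \<subseteq> mcl (A \<union> (Q \<union> Q'))" using Q(4) Q'(4) by auto
    moreover have "card (Q \<union> Q') \<le> length (z # zs) * N" using card_Un_le[of Q Q'] Q(3) Q'(3) by simp
    ultimately show ?case using Q(1,2) Q'(1,2) by (intro exI[of _ "Q \<union> Q'"]) auto
  qed
  from this[OF ys(2)] obtain Q where Q: "Q \<subseteq> P" "finite Q" "card Q \<le> k * N" "set ys \<subseteq> mcl (A \<union> Q)" using ys(3) by auto
  have "mcl (A \<union> Q) \<subseteq> mcl (?A \<union> Q)" by (rule m.mono) auto
  then have "?A \<union> set ys \<subseteq> mcl (?A \<union> Q)" using Q(4) m.extensive[of "?A \<union> Q"] by blast
  then have "y \<in> mcl (?A \<union> Q)" using y1 m.cls_subset by blast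
  then show False using y(3) Q(1-3) by blast
qed

lemma constant_emap: "Ldef_emap F R k (bx k lo hi) (\<lambda>_. Fin c)" "econt_on (bx k lo hi) (\<lambda>_. Fin c)"
proof -
  have "DL (\<lambda>e. blk e 0 k \<in> bx k lo hi \<and> e k = c)" by (intro D_conj D_box D_eqc) simp
  moreover have "blk e 0 (Suc k) \<in> {x @ [d] | x d. x \<in> bx k lo hi \<and> Fin c = Fin d} \<longleftrightarrow> blk e 0 k \<in> bx k lo hi \<and> e k = c" for e
    by auto
  ultimately have "DL (\<lambda>e. blk e 0 (Suc k) \<in> {x @ [d] | x d. x \<in> bx k lo hi \<and> Fin c = Fin d})" by (simp only:)
  then have "definable F R (Suc k) {x @ [d] | x d. x \<in> bx k lo hi \<and> Fin c = Fin d}"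
    by (rule D_definable) (auto simp: bx_def)
  moreover have "definable F R k {}" by (rule D_definable) (auto simp: D_False)
  ultimately show "Ldef_emap F R k (bx k lo hi) (\<lambda>_. Fin c)" by (simp add: Ldef_emap_def)
  have "x \<in> ebox (replicate (length x) NegInf) (replicate (length x) PosInf)" for x :: "'a list" by (simp add: ebox_def)
  then show "econt_on (bx k lo hi) (\<lambda>_. Fin c)" unfolding econt_on_def by (meson length_replicate)
qed

lemma bx_Suc: "bx (Suc j) lo hi = {a @ [b] | a b. a \<in> bx j lo hi \<and> lo j < b \<and> b < hi j}"
proof (intro Set.set_eqI iffI)
  fix u assume u: "u \<in> bx (Suc j) lo hi"
  then have "u = butlast u @ [u ! j]" by (cases u rule: rev_cases) (auto simp: bx_def)
  moreover have "butlast u \<in> bx j lo hi" using u by (auto simp: bx_def nth_butlast)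
  ultimately show "u \<in> {a @ [b] | a b. a \<in> bx j lo hi \<and> lo j < b \<and> b < hi j}" using u
    by (smt (verit, ccfv_threshold) bx_def lessI mem_Collect_eq)
qed (auto simp: bx_def nth_append less_Suc_eq)

text \<open>All shells are boxes, with constant bounding functions. The bad points of a fibre have
  bounded support, hence form a small set; by \<open>codense\<close> a good point remains in each
  fibre, so the projection is the preceding supercone.\<close>

lemma supercone_box:
  assumes lh: "\<forall>i<length ix. lo i < hi i" and dx: "distinct ix" and T: "\<forall>j<length ix. badT ix j (T j)"
  shows "supercone F R P (length ix) {u \<in> bx (length ix) lo hi. \<forall>i<length ix. \<not> bad (T i) (en ix u)} (bx (length ix) lo hi)"
proof -
  define J where "J j = {u \<in> bx j lo hi. \<forall>i<j. \<not> bad (T i) (en ix u)}" for j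
  have Jl: "length u = j" if "u \<in> J j" for u j using that by (simp add: J_def bx_def)
  have en_app: "bad (T i) (en ix (a @ [b])) = bad (T i) (en ix a)" if "i < length a" "length a < length ix" for i a b
  proof (rule bad_cong[of ix i])
    fix h assume "h \<in> set (take (Suc i) ix)"
    then obtain t where t: "t < Suc i" "t < length ix" "h = ix ! t" by (auto simp: in_set_conv_nth)
    have "t < length a" using t(1) that(1) by simp
    then show "en ix (a @ [b]) h = en ix a h"
      unfolding t(3) using en_nth[OF dx, of t "a @ [b]"] en_nth[OF dx, of t a] t(2) by (simp add: nth_append)
  qed (use T that in auto)
  have JSuc: "a @ [b] \<in> J (Suc j) \<longleftrightarrow> a \<in> J j \<and> lo j < b \<and> b < hi j \<and> \<not> bad (T j) (en ix (a @ [b]))"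
    if "j < length ix" "length a = j" for a b j
    using en_app[of _ a b] that by (auto simp: J_def bx_Suc less_Suc_eq)
  have JD: "defN j (J j)" if j: "j \<le> length ix" for j
  proof (rule D_definable)
    have "DN (\<lambda>e. blk e 0 j \<in> bx j lo hi \<and> (\<forall>i\<in>{..<j}. \<not> bad (T i) (en ix (blk e 0 j))))"
      by (intro D_conj D_expR[OF D_box] D_Ball_finite D_not D_bad[OF _ dx]) (use T j in auto)
    then show "DN (\<lambda>e. blk e 0 j \<in> J j)" by (simp add: J_def Ball_def)
  qed (rule Jl)
  have "j \<le> length ix \<Longrightarrow> supercone F R P j (J j) (bx j lo hi)" for j
  proof (induction j)
    case 0
    have "J 0 = {[]}" "bx 0 lo hi = {[]}" by (auto simp: J_def bx_def)
    then show ?case using supercone.zero by metis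
  next
    case (Suc j)
    then have j: "j < length ix" by simp
    have sc: "supercone F R P j (J j) (bx j lo hi)" using Suc by simp
    have S: "bx (Suc j) lo hi = {a @ [b] | a b. a \<in> bx j lo hi \<and> eless (Fin (lo j)) (Fin b) \<and> eless (Fin b) (Fin (hi j))}"
      unfolding bx_Suc by simp
    show ?case unfolding S
    proof (rule supercone.step[OF sc JD[OF Suc.prems] _ _ constant_emap(1) constant_emap(1) constant_emap(2) constant_emap(2)])
      show "J (Suc j) \<subseteq> {x. length x = Suc j}" using Jl by blast
      show "butlast ` J (Suc j) = J j"
      proof (intro Set.set_eqI iffI)
        fix a assume "a \<in> butlast ` J (Suc j)"
        then obtain u where u: "u \<in> J (Suc j)" "a = butlast u" by blast
        then have "u \<noteq> []" using Jl by fastforce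
        then have "u = a @ [last u]" using u(2) by simp
        moreover have "length a = j" using u Jl by fastforce
        ultimately show "a \<in> J j" using u(1) JSuc[OF j] by metis
      next
        fix a assume a: "a \<in> J j"
        obtain A N where A: "finite A" "\<forall>b. bad (T j) (en ix (a @ [b])) \<longrightarrow> (\<exists>Q\<subseteq>P. finite Q \<and> card Q \<le> N \<and> b \<in> mcl (A \<union> Q))"
          using bad_codense[OF _ dx j Jl[OF a], of "T j"] T j by blast
        obtain b where b: "lo j < b" "b < hi j" "\<forall>Q\<subseteq>P. finite Q \<longrightarrow> card Q \<le> N \<longrightarrow> b \<notin> mcl (A \<union> Q)"
          using codense[OF A(1), of "lo j" "hi j" N] lh j by blast
        then have "\<not> bad (T j) (en ix (a @ [b]))" using A(2) by blast
        then have "a @ [b] \<in> J (Suc j)" using JSuc[OF j Jl[OF a]] a b by blast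
        then show "a \<in> butlast ` J (Suc j)" by force
      qed
      show "\<forall>a\<in>bx j lo hi. eless (Fin (lo j)) (Fin (hi j))" using lh j by simp
      show "\<forall>a\<in>J j. {b. a @ [b] \<in> J (Suc j)} \<subseteq> {b. eless (Fin (lo j)) (Fin b) \<and> eless (Fin b) (Fin (hi j))}"
        using JSuc[OF j Jl] by auto
      show "\<forall>a\<in>J j. small F R P 1 {[b] | b. eless (Fin (lo j)) (Fin b) \<and> eless (Fin b) (Fin (hi j)) \<and> a @ [b] \<notin> J (Suc j)}"
      proof
        fix a assume a: "a \<in> J j"
        let ?B = "{b. eless (Fin (lo j)) (Fin b) \<and> eless (Fin b) (Fin (hi j)) \<and> a @ [b] \<notin> J (Suc j)}"
        obtain A N where A: "finite A" "\<forall>b. bad (T j) (en ix (a @ [b])) \<longrightarrow> (\<exists>Q\<subseteq>P. finite Q \<and> card Q \<le> N \<and> b \<in> mcl (A \<union> Q))"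
          using bad_codense[OF _ dx j Jl[OF a], of "T j"] T j by blast
        have l: "length a = j" by (rule Jl[OF a])
        have "small F R P 1 {[b] | b. b \<in> ?B}"
        proof (rule small_of_bounded_support[OF _ A(1)])
          show "defN 1 {[b] | b. b \<in> ?B}"
          proof (rule D_definable)
            have "DN (\<lambda>e. (lo j < e 0 \<and> e 0 < hi j) \<and> \<not> map (upds e 1 a) ([1..<1+j] @ [0]) \<in> J (Suc j))"
              by (intro D_conj D_expR[OF D_lec(1)] D_expR[OF D_lec(2)] D_not
                 D_updc[where Q="\<lambda>e. map e ([1..<1+j] @ [0]) \<in> J (Suc j)"] definable_imp_D[OF JD[OF Suc.prems, unfolded definable_def]]) simp_all
            moreover have "map (upds e 1 a) ([1..<1+j] @ [0]) = a @ [e 0]" for e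
              unfolding map_append blk_upds_same[OF l] by (simp add: upds_def)
            ultimately show "DN (\<lambda>e. blk e 0 1 \<in> {[b] | b. b \<in> ?B})" by simp
          qed auto
          fix b assume b: "b \<in> ?B"
          then have "bad (T j) (en ix (a @ [b]))" using JSuc[OF j l] a by auto
          then show "\<exists>Q\<subseteq>P. finite Q \<and> card Q \<le> N \<and> b \<in> mcl (A \<union> Q)" using A(2) by blast
        qed
        then show "small F R P 1 {[b] | b. eless (Fin (lo j)) (Fin b) \<and> eless (Fin b) (Fin (hi j)) \<and> a @ [b] \<notin> J (Suc j)}" by simp
      qed
    qed
  qed
  then show ?thesis unfolding J_def by simp
qed

text \<open>The local section, restricted to a box on which it is continuous, parametrises part of
  \<open>A\<close>. It is injective because its argument can be read off from the coordinates
  \<open>ix\<close>, and the supercone is the box without the bad points.\<close>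

lemma supercone_at_generic:
  fixes U :: "'i filter"
  assumes A: "defN m A" and U: "ultra U" and x: "eventually (\<lambda>i. length (x i) = m \<and> x i \<in> A) U"
    and ix: "distinct ix" "set ix \<subseteq> {..<m}" and rk: "rkP U (crd m x ix) = length ix"
    and alg: "set (cf m x) \<subseteq> Acl U (set (crd m x ix))"
  shows "\<exists>J S f. supercone F R P (length ix) J S \<and> Ldef_map F R (length ix) m S f \<and> cont_on S f \<and> inj_on f S \<and> f ` J \<subseteq> A"
proof -
  let ?k = "length ix"
  obtain Sel T lo hi where Sel: "definable F R m Sel" "\<forall>l\<in>Sel. length l = m"
    "\<forall>l\<in>Sel. \<forall>l'\<in>Sel. map ((!) l) ix = map ((!) l') ix \<longrightarrow> l = l'"
    and lh: "\<forall>i<?k. lo i < hi i" "\<forall>u\<in>bx ?k lo hi. \<exists>l\<in>Sel. map ((!) l) ix = u"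
    and T: "\<forall>j<?k. badT ix j (T j)" "\<forall>l\<in>Sel. (\<forall>j<?k. \<not> bad (T j) (\<lambda>i. l ! i)) \<longrightarrow> l \<in> A"
    using local_section[OF A U x ix rk alg] by (elim exE conjE) (rule that; assumption)
  define f where "f u = (SOME l. l \<in> Sel \<and> map ((!) l) ix = u)" for u
  have f: "f u \<in> Sel \<and> map ((!) (f u)) ix = u" if "u \<in> bx ?k lo hi" for u
    unfolding f_def by (rule someI_ex) (use lh(2) that in blast)
  have fl: "length (f u) = m" if "u \<in> bx ?k lo hi" for u using f[OF that] Sel(2) by blast
  have gr: "definable F R (?k + m) {u @ f u | u. u \<in> bx ?k lo' hi'}" if sub: "bx ?k lo' hi' \<subseteq> bx ?k lo hi" for lo' hi'
  proof (rule D_definable)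
    have "DL (\<lambda>e. blk e 0 ?k \<in> bx ?k lo' hi' \<and> blk e ?k m \<in> Sel \<and> (\<forall>j\<in>{..<?k}. e (?k + ix ! j) = e j))"
      by (intro D_conj D_box definable_D[OF Sel(1)] D_Ball_finite D_eq) simp
    moreover have "(blk e 0 ?k \<in> bx ?k lo' hi' \<and> blk e ?k m \<in> Sel \<and> (\<forall>j\<in>{..<?k}. e (?k + ix ! j) = e j)) \<longleftrightarrow>
      blk e 0 (?k + m) \<in> {u @ f u | u. u \<in> bx ?k lo' hi'}" for e
    proof -
      have ixm: "ix ! j < m" if "j < ?k" for j using ix(2) nth_mem[OF that] by blast
      have l0: "length (blk e 0 ?k) = ?k" by simp
      have eq: "(\<forall>j\<in>{..<?k}. e (?k + ix ! j) = e j) \<longleftrightarrow> map ((!) (blk e ?k m)) ix = blk e 0 ?k"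
        unfolding coords_eq_iff[OF l0] by (auto simp: ixm)
      have sp: "blk e 0 (?k + m) = blk e 0 ?k @ blk e ?k m" using blk_split[of e 0 ?k m] by simp
      show ?thesis unfolding sp
      proof
        assume a: "blk e 0 ?k \<in> bx ?k lo' hi' \<and> blk e ?k m \<in> Sel \<and> (\<forall>j\<in>{..<?k}. e (?k + ix ! j) = e j)"
        then have b: "blk e 0 ?k \<in> bx ?k lo hi" using sub by blast
        have "map ((!) (blk e ?k m)) ix = map ((!) (f (blk e 0 ?k))) ix" using a f[OF b] unfolding eq by (simp only:)
        then have "blk e ?k m = f (blk e 0 ?k)" using Sel(3) a f[OF b] by blast
        then show "blk e 0 ?k @ blk e ?k m \<in> {u @ f u | u. u \<in> bx ?k lo' hi'}" using a by blast
      next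
        assume "blk e 0 ?k @ blk e ?k m \<in> {u @ f u | u. u \<in> bx ?k lo' hi'}"
        then obtain u where u: "blk e 0 ?k @ blk e ?k m = u @ f u" "u \<in> bx ?k lo' hi'" by blast
        have "length (blk e 0 ?k) = length u" using u(2) by (simp add: bx_def)
        then have "blk e 0 ?k = u" "blk e ?k m = f u" using u(1) by (metis append_eq_append_conv)+
        moreover have "f u \<in> Sel \<and> map ((!) (f u)) ix = u" using f u(2) sub by blast
        ultimately show "blk e 0 ?k \<in> bx ?k lo' hi' \<and> blk e ?k m \<in> Sel \<and> (\<forall>j\<in>{..<?k}. e (?k + ix ! j) = e j)"
          using u(2) unfolding eq by (simp only: simp_thms)
      qed
    qed
    ultimately show "DL (\<lambda>e. blk e 0 (?k + m) \<in> {u @ f u | u. u \<in> bx ?k lo' hi'})" by (simp only:)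
    show "length x = ?k + m" if "x \<in> {u @ f u | u. u \<in> bx ?k lo' hi'}" for x
      using that fl sub by (auto simp: bx_def)
  qed
  obtain lo' hi' where lh': "\<forall>i<?k. lo' i < hi' i" "bx ?k lo' hi' \<subseteq> bx ?k lo hi" "cont_on (bx ?k lo' hi') f"
    using continuous_on_box[OF lh(1) gr[OF subset_refl] fl] by blast
  let ?S = "bx ?k lo' hi'"
  let ?J = "{u \<in> ?S. \<forall>i<?k. \<not> bad (T i) (en ix u)}"
  have "supercone F R P ?k ?J ?S" by (rule supercone_box[OF lh'(1) ix(1) T(1)])
  moreover have "Ldef_map F R ?k m ?S f" unfolding Ldef_map_def using fl lh'(2) gr[OF lh'(2)] by blast
  moreover have "inj_on f ?S" using f lh'(2) by (metis inj_onI subset_iff)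
  moreover have "f u \<in> A" if u: "u \<in> ?J" for u
  proof -
    have uS: "u \<in> bx ?k lo hi" using u lh'(2) by blast
    have ul: "length u = ?k" using u by (simp add: bx_def)
    have "bad (T j) (\<lambda>i. f u ! i) = bad (T j) (en ix u)" if j: "j < ?k" for j
    proof (rule bad_cong[of ix j])
      fix h assume "h \<in> set (take (Suc j) ix)"
      then obtain t where t: "t < ?k" "h = ix ! t" by (auto simp: in_set_conv_nth)
      have "f u ! (ix ! t) = u ! t" using arg_cong[OF conjunct2[OF f[OF uS]], of "\<lambda>l. l ! t"] t(1) by simp
      then show "f u ! h = en ix u h" unfolding t(2) using en_nth[OF ix(1), of t u] t(1) ul by simp
    qed (use T j in auto)
    then show ?thesis using T(2) f[OF uS] u by blast
  qed
  ultimately have "supercone F R P ?k ?J ?S \<and> Ldef_map F R ?k m ?S f \<and> cont_on ?S f \<and> inj_on f ?S \<and> f ` ?J \<subseteq> A"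
    using lh'(3) by blast
  then show ?thesis by - (rule exI[of _ ?J], rule exI[of _ ?S], rule exI[of _ f])
qed

end

section \<open>Upper bounds for the large dimension\<close>

context omin_pair begin

lemma rk_filtermap:
  assumes U: "ultra U"
  shows "rkU (filtermap g U) B fs = rkU U ((\<lambda>f i. f (g i)) ` B) (map (\<lambda>f i. f (g i)) fs)"
proof -
  interpret u: pregeometry "Acl U" by (rule acl_pregeometry[OF U])
  interpret v: pregeometry "Acl (filtermap g U)" by (rule acl_pregeometry[OF ultra_filtermap[OF U]])
  show ?thesis by (induction fs arbitrary: B) (simp_all add: acl_filtermap)
qed

lemma eless_interval:
  assumes "eless (a::'a ext) b"
  shows "\<exists>u v. u < v \<and> (\<forall>x. u < x \<and> x < v \<longrightarrow> eless a (Fin x) \<and> eless (Fin x) b)"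
proof (cases a)
  case NegInf
  show ?thesis
  proof (cases b)
    case (Fin y)
    obtain u where "u < y" using ex_less by blast
    then show ?thesis using NegInf Fin by auto
  next
    case PosInf
    obtain p :: 'a where "p > 0" using ex_pos by blast
    then show ?thesis using NegInf PosInf by auto
  qed (use assms NegInf in auto)
next
  case (Fin x)
  show ?thesis
  proof (cases b)
    case (Fin y)
    then show ?thesis using assms \<open>a = Fin x\<close> by auto
  next
    case PosInf
    obtain v where "x < v" using ex_greater by blast
    then show ?thesis using \<open>a = Fin x\<close> PosInf by auto
  qed (use assms Fin in auto)
qed (use assms in auto)

lemma hd_graph_definable: "definable F R (1 * 1 + 1) {x @ [hd x] | x. length x = 1 * 1}"
proof (rule D_definable)
  have "DL (\<lambda>e. e 0 = e 1)" by (rule D_eq)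
  moreover have "blk e 0 (1 * 1 + 1) \<in> {x @ [hd x] | x. length x = 1 * 1} \<longleftrightarrow> e 0 = e 1" for e :: "nat \<Rightarrow> 'a"
    by (auto simp: length_Suc_conv)
  ultimately show "DL (\<lambda>e. blk e 0 (1 * 1 + 1) \<in> {x @ [hd x] | x. length x = 1 * 1})" by (simp only:)
qed auto

text \<open>If \<open>B\<close> were finite, its complement in the interval would contain an
  interval, and the identity map shows that such a set is not small.\<close>

lemma small_complement_infinite:
  assumes s: "small F R P 1 {[b] | b. eless l (Fin b) \<and> eless (Fin b) h \<and> b \<notin> B}" and lh: "eless l h"
  shows "infinite B"
proof
  assume fin: "finite B"
  obtain u v where uv: "u < v" "\<And>x. u < x \<Longrightarrow> x < v \<Longrightarrow> eless l (Fin x) \<and> eless (Fin x) h" using eless_interval[OF lh] by blast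
  have "DL (\<lambda>e. (u < e 0 \<and> e 0 < v) \<and> (\<forall>c\<in>B. \<not> e 0 = c))"
    by (intro D_conj D_lec D_Ball_finite fin D_not D_eqc) simp
  moreover have "infinite {x. (u < x \<and> x < v) \<and> (\<forall>c\<in>B. \<not> x = c)}"
  proof -
    have "{x. (u < x \<and> x < v) \<and> (\<forall>c\<in>B. \<not> x = c)} = {x. u < x \<and> x < v} - B" by auto
    then show ?thesis using infinite_interval[OF uv(1)] fin by (simp add: Diff_infinite_finite)
  qed
  ultimately obtain a b where ab: "a < b" "\<And>x. a < x \<Longrightarrow> x < b \<Longrightarrow> (u < x \<and> x < v) \<and> (\<forall>c\<in>B. \<not> x = c)"
    using infinite_imp_interval[of "\<lambda>x. (u < x \<and> x < v) \<and> (\<forall>c\<in>B. \<not> x = c)"] by blast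
  let ?C = "{[b] | b. eless l (Fin b) \<and> eless (Fin b) h \<and> b \<notin> B}"
  have "{c. a < c \<and> c < b} \<subseteq> hd ` tpow ?C 1"
  proof
    fix c assume "c \<in> {c. a < c \<and> c < b}"
    then have "a < c" "c < b" by auto
    then have "[c] \<in> ?C" using ab(2)[of c] uv(2)[of c] by auto
    then have "[c] \<in> tpow ?C 1" unfolding tpow_def by (intro CollectI exI[of _ "[[c]]"]) simp
    then show "c \<in> hd ` tpow ?C 1" by force
  qed
  then have "\<exists>k (f :: 'a list \<Rightarrow> 'a) a b. a < b \<and> definable F R (1 * k + 1) {x @ [f x] | x. length x = 1 * k} \<and>
          {c. a < c \<and> c < b} \<subseteq> f ` tpow ?C k" using ab(1) hd_graph_definable by blast
  then show False using s unfolding small_def by blast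
qed

text \<open>The fibres of a supercone are infinite, so a generic type can be built along the
  recursion.\<close>

lemma supercone_type:
  assumes "supercone F R P k J S"
  shows "J \<subseteq> S \<and> (\<forall>u\<in>S. length u = k) \<and> (\<exists>U. ultra U \<and> eventually (\<lambda>a. a \<in> J \<and> length a = k) U \<and> rkU U {} (cf k (\<lambda>l. l)) = k)"
  using assms
proof induction
  case zero
  obtain U where U: "ultra U" "eventually (\<lambda>a. a = [] \<and> length a = 0) U" "rkU U {} (cf 0 (\<lambda>l. l)) = 0" using generic_zero by blast
  then have "eventually (\<lambda>a. a \<in> {[]} \<and> length a = 0) U" by (auto elim: eventually_mono)
  then show ?case using U by auto
next
  case (step n J' S' J h1 h2)
  obtain U where U: "ultra U" "eventually (\<lambda>a. a \<in> J' \<and> length a = n) U" "rkU U {} (cf n (\<lambda>l. l)) = n" using step.IH by blast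
  have "\<exists>U'. ultra U' \<and> eventually (\<lambda>a. a \<in> J \<and> length a = Suc n) U' \<and> rkU U' {} (cf (Suc n) (\<lambda>l. l)) = Suc n"
  proof (rule extend_generic[OF U])
    fix a assume a: "a \<in> J'"
    then have "a \<in> S'" using step.IH by blast
    then have "eless (h1 a) (h2 a)" using step.hyps by blast
    moreover have "small F R P 1 {[b] | b. eless (h1 a) (Fin b) \<and> eless (Fin b) (h2 a) \<and> b \<notin> {b. a @ [b] \<in> J}}"
      using step.hyps a by auto
    ultimately show "infinite {b. a @ [b] \<in> J}" by (rule small_complement_infinite[rotated])
  qed
  moreover have "u \<in> {a @ [b] | a b. a \<in> S' \<and> eless (h1 a) (Fin b) \<and> eless (Fin b) (h2 a)}" if u: "u \<in> J" for u
  proof -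
    have "length u = Suc n" using step.hyps u by blast
    then have "u \<noteq> []" by auto
    then have eq: "u = butlast u @ [last u]" by simp
    have b: "butlast u \<in> J'" using step.hyps u by blast
    then have "last u \<in> {b. butlast u @ [b] \<in> J}" using eq u by simp
    then have "eless (h1 (butlast u)) (Fin (last u)) \<and> eless (Fin (last u)) (h2 (butlast u))" using step.hyps b by blast
    then show ?thesis using eq b step.IH by blast
  qed
  ultimately show ?case using step.IH by auto
qed

text \<open>By injectivity each argument is algebraic over the entries of the value, so the rank
  cannot drop.\<close>

lemma injective_image_rank:
  assumes U: "ultra U" and ev: "eventually (\<lambda>a. a \<in> S \<and> length a = k) U" and rk: "rkU U {} (cf k (\<lambda>l. l)) = k"
    and f: "Ldef_map F R k m S f" "inj_on f S" and S: "\<forall>u\<in>S. length u = k"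
  shows "k \<le> rkU U {} (cf m f)"
proof -
  interpret u: pregeometry "Acl U" by (rule acl_pregeometry[OF U])
  let ?G = "{x @ f x | x. x \<in> S}"
  have Gr: "definable_over F R UNIV (k + m) ?G" and fl: "\<And>x. x \<in> S \<Longrightarrow> length (f x) = m"
    using f(1) by (auto simp: Ldef_map_def definable_def)
  have G: "us @ y \<in> ?G \<longleftrightarrow> us \<in> S \<and> y = f us" if "length us = k" for us y
  proof
    assume "us @ y \<in> ?G"
    then obtain x where x: "us @ y = x @ f x" "x \<in> S" by blast
    then have "length us = length x" using S that by simp
    then show "us \<in> S \<and> y = f us" using x by simp
  qed blast
  have "(\<lambda>l. l ! j) \<in> Acl U (set (cf m f))" if j: "j < k" for j
  proof -
    let ?z = "Suc m"
    define q where "q e \<longleftrightarrow> map e ([?z..<?z+k] @ [0..<0+m]) \<in> ?G \<and> e (?z + j) = e m" for e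
    define Q where "Q e \<longleftrightarrow> (\<exists>us. length us = k \<and> q (upds e ?z us))" for e
    have QD: "DL Q" unfolding Q_def[abs_def] q_def[abs_def]
      by (intro D_exs D_conj D_eq definable_imp_D[OF Gr]) simp
    have Q: "Q e \<longleftrightarrow> (\<exists>us\<in>S. blk e 0 m = f us \<and> us ! j = e m)" for e
    proof -
      have "q (upds e ?z us) \<longleftrightarrow> us \<in> S \<and> blk e 0 m = f us \<and> us ! j = e m" if l: "length us = k" for us
      proof -
        have 1: "map (upds e ?z us) ([?z..<?z+k] @ [0..<0+m]) = us @ blk e 0 m"
          unfolding map_append blk_upds_same[OF l] by (subst blk_upds_other) auto
        have 2: "upds e ?z us (?z + j) = us ! j" "upds e ?z us m = e m" using j l by (auto simp: upds_def)
        show ?thesis unfolding q_def 1 2 G[OF l] by blast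
      qed
      then show ?thesis unfolding Q_def using S by blast
    qed
    obtain K where K: "dep K Q" using D_dep[OF QD] by blast
    define e where "e i = (if i < m then (\<lambda>l. f l ! i) else (\<lambda>_. 0))" for i
    show ?thesis
    proof (rule acl_I[OF QD K, of m e])
      show "e i \<in> insert (\<lambda>_. 0) (set (cf m f))" for i by (auto simp: e_def cf_def)
      show "eventually (\<lambda>l. Q ((\<lambda>i. e i l)(m := l ! j)) \<and> finite {a. Q ((\<lambda>i. e i l)(m := a))}) U"
        using ev
      proof eventually_elim
        case (elim l)
        have b: "blk ((\<lambda>i. e i l)(m := a)) 0 m = f l" for a
          using fl[of l] elim by (intro nth_equalityI) (auto simp: e_def)
        have "Q ((\<lambda>i. e i l)(m := a)) \<longleftrightarrow> a = l ! j" for a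
          unfolding Q b using elim f(2) by (auto simp: inj_on_def)
        then show ?case by simp
      qed
    qed
  qed
  then have "set (cf k (\<lambda>l. l)) \<subseteq> Acl U ({} \<union> set (cf m f))" by (auto simp: cf_def)
  from u.rk_le[OF this] show ?thesis using rk by simp
qed

text \<open>A point of larger rank near \<open>Z\<close> would give, after projection to independent
  coordinates, a box in the closure of the projection \<open>Wp\<close>. A definable set dense in a
  box contains a box, since otherwise its complement would contain one; a generic point of that box
  lifts to a type in \<open>Z\<close> of rank above \<open>k\<close>.\<close>

lemma closure_rank:
  fixes U :: "'i filter"
  assumes U: "ultra U" and Z: "thin k m Z"
    and ev: "eventually (\<lambda>i. length (x i) = m \<and> (\<forall>\<delta>>0. \<exists>y\<in>Z. near m \<delta> (x i) y)) U"
  shows "rkU U {} (cf m x) \<le> k"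
proof (rule ccontr)
  assume n: "\<not> ?thesis"
  interpret u: pregeometry "Acl U" by (rule acl_pregeometry[OF U])
  obtain ix where ix: "distinct ix" "set ix \<subseteq> {..<m}" "u.rk {} (crd m x ix) = length ix" "length ix = u.rk {} (cf m x)"
    using u.rk_basis[of "cf m x" "{}"] by auto
  let ?r = "length ix"
  have r: "k < ?r" using n ix(4) by simp
  have ixm: "ix ! j < m" if "j < ?r" for j using ix(2) nth_mem[OF that] by blast
  have Zd: "definable F R m Z" "\<And>l. l \<in> Z \<Longrightarrow> length l = m" using Z by (auto simp: thin_def)
  define Wp where "Wp = {w. length w = ?r \<and> (\<exists>l\<in>Z. \<forall>j<?r. l ! (ix ! j) = w ! j)}"
  have Wl: "length w = ?r" if "w \<in> Wp" for w using that by (simp add: Wp_def)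
  define K where "K = {w. length w = ?r \<and> (\<forall>\<delta>>0. \<exists>w'\<in>Wp. near ?r \<delta> w w')}"
  have WD: "DL (\<lambda>e. blk e a ?r \<in> Wp)" for a
  proof -
    let ?z = "a + ?r"
    let ?Q = "\<lambda>e. blk e ?z m \<in> Z \<and> (\<forall>j\<in>{..<?r}. e (?z + ix ! j) = e (a + j))"
    have "DL (\<lambda>e. \<exists>ls. length ls = m \<and> ?Q (upds e ?z ls))"
      by (intro D_exs D_conj definable_D[OF Zd(1)] D_Ball_finite D_eq) simp
    moreover have "(\<exists>ls. length ls = m \<and> ?Q (upds e ?z ls)) \<longleftrightarrow> blk e a ?r \<in> Wp" for e
    proof -
      have q: "?Q (upds e ?z ls) \<longleftrightarrow> ls \<in> Z \<and> (\<forall>j<?r. ls ! (ix ! j) = blk e a ?r ! j)" if l: "length ls = m" for ls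
      proof -
        have 1: "blk (upds e ?z ls) ?z m = ls" by (rule blk_upds_same[OF l])
        have 2: "upds e ?z ls (?z + ix ! j) = ls ! (ix ! j)" "upds e ?z ls (a + j) = blk e a ?r ! j" if "j < ?r" for j
          using ixm[OF that] that l by (simp_all add: upds_def)
        have "(\<forall>j\<in>{..<?r}. upds e ?z ls (?z + ix ! j) = upds e ?z ls (a + j)) \<longleftrightarrow> (\<forall>j\<in>{..<?r}. ls ! (ix ! j) = blk e a ?r ! j)"
          by (rule ball_cong[OF refl]) (simp only: lessThan_iff 2)
        then show ?thesis unfolding 1 by (simp only: Ball_def lessThan_iff)
      qed
      have "length (blk e a ?r) = ?r" by simp
      then show ?thesis unfolding Wp_def mem_Collect_eq using q Zd(2) by blast
    qed
    ultimately show ?thesis by (simp only:)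
  qed
  have KD: "DL (\<lambda>e. blk e 0 ?r \<in> K)"
  proof -
    let ?q = "\<lambda>e. blk e (Suc ?r) ?r \<in> Wp \<and> near ?r (e ?r) (blk e 0 ?r) (blk e (Suc ?r) ?r)"
    let ?Q = "\<lambda>e. e ?r > 0 \<longrightarrow> (\<exists>w. length w = ?r \<and> ?q (upds e (Suc ?r) w))"
    have "DL (\<lambda>e. \<forall>\<delta>. ?Q (e(?r := \<delta>)))"
      by (intro D_all D_imp D_lec D_exs D_conj WD D_near)
    moreover have "(\<forall>\<delta>. ?Q (e(?r := \<delta>))) \<longleftrightarrow> blk e 0 ?r \<in> K" for e
    proof -
      have q: "?q (upds (e(?r := \<delta>)) (Suc ?r) w) \<longleftrightarrow> w \<in> Wp \<and> near ?r \<delta> (blk e 0 ?r) w" if l: "length w = ?r" for w \<delta>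
      proof -
        have 1: "blk (upds (e(?r := \<delta>)) (Suc ?r) w) (Suc ?r) ?r = w" by (rule blk_upds_same[OF l])
        have 2: "blk (upds (e(?r := \<delta>)) (Suc ?r) w) 0 ?r = blk e 0 ?r" by (auto simp: upds_def)
        have 3: "upds (e(?r := \<delta>)) (Suc ?r) w ?r = \<delta>" by (simp add: upds_def)
        show ?thesis unfolding 1 2 3 ..
      qed
      have "(\<exists>w. length w = ?r \<and> ?q (upds (e(?r := \<delta>)) (Suc ?r) w)) \<longleftrightarrow> (\<exists>w'\<in>Wp. near ?r \<delta> (blk e 0 ?r) w')" for \<delta>
        using q Wl by blast
      then show ?thesis unfolding K_def mem_Collect_eq by (simp only: fun_upd_same) simp
    qed
    ultimately show ?thesis by (simp only:)
  qed
  define y where "y i = map ((!) (x i)) ix" for i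
  have cy: "cf ?r y = crd m x ix"
    by (rule nth_equalityI) (auto simp: nth_cf y_def ixm)
  have yK: "eventually (\<lambda>i. length (y i) = ?r \<and> y i \<in> K) U" using ev
  proof eventually_elim
    case (elim i)
    have "\<exists>w'\<in>Wp. near ?r \<delta> (y i) w'" if d: "\<delta> > 0" for \<delta>
    proof -
      obtain l where l: "l \<in> Z" "near m \<delta> (x i) l" using elim d by blast
      have "map ((!) l) ix \<in> Wp" using l(1) by (auto simp: Wp_def)
      moreover have "near ?r \<delta> (y i) (map ((!) l) ix)" using l(2) ixm by (simp add: near_def y_def)
      ultimately show ?thesis by blast
    qed
    then show ?case by (simp add: K_def y_def)
  qed
  have "u.rk {} (cf ?r y) = ?r" unfolding cy by (rule ix(3))
  from Big_box_list[OF KD generic_Big_list[OF U this KD yK, of "\<lambda>_. 0"]]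
  obtain lo hi where lh: "\<forall>i<?r. lo i < hi i" "bx ?r lo hi \<subseteq> K" by blast
  have "Big [0..<?r] (\<lambda>e. blk e 0 ?r \<in> Wp \<or> blk e 0 ?r \<in> bx ?r lo hi - Wp) (\<lambda>_. 0)"
    by (rule Big_mono[OF _ box_Big[OF lh(1)]]) auto
  from Big_disj[OF this] have "Big [0..<?r] (\<lambda>e. blk e 0 ?r \<in> Wp) (\<lambda>_. 0)"
  proof
    assume b: "Big [0..<?r] (\<lambda>e. blk e 0 ?r \<in> bx ?r lo hi - Wp) (\<lambda>_. 0)"
    have "DL (\<lambda>e. blk e 0 ?r \<in> bx ?r lo hi \<and> \<not> blk e 0 ?r \<in> Wp)" by (intro D_conj D_box D_not WD)
    then have "DL (\<lambda>e. blk e 0 ?r \<in> bx ?r lo hi - Wp)" by simp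
    from Big_box_list[OF this b] obtain lo' hi' where lh': "\<forall>i<?r. lo' i < hi' i" "bx ?r lo' hi' \<subseteq> bx ?r lo hi - Wp" by blast
    from box_interior[OF lh'(1)] obtain u \<delta> where u: "u \<in> bx ?r lo' hi'"
      and d: "\<delta> > 0" "\<And>v. length v = ?r \<Longrightarrow> near ?r \<delta> u v \<Longrightarrow> v \<in> bx ?r lo' hi'" by blast
    have "u \<in> K" using u lh'(2) lh(2) by blast
    then obtain w' where w': "w' \<in> Wp" "near ?r \<delta> u w'" using d(1) by (auto simp: K_def)
    then have "w' \<in> bx ?r lo' hi'" using d(2) by (simp add: Wp_def)
    then show ?thesis using w'(1) lh'(2) by blast
  qed
  from Big_box_list[OF WD this] obtain lo1 hi1 where l1: "\<forall>i<?r. lo1 i < hi1 i" "bx ?r lo1 hi1 \<subseteq> Wp" by blast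
  obtain V where V: "ultra V" "eventually (\<lambda>a. a \<in> bx ?r lo1 hi1 \<and> length a = ?r) V" "rkU V {} (cf ?r (\<lambda>l. l)) = ?r"
    using box_generic[OF l1(1)] by blast
  interpret v: pregeometry "Acl V" by (rule acl_pregeometry[OF V(1)])
  define s where "s w = (SOME l. l \<in> Z \<and> (\<forall>j<?r. l ! (ix ! j) = w ! j))" for w
  have s: "s w \<in> Z \<and> (\<forall>j<?r. s w ! (ix ! j) = w ! j)" if "w \<in> Wp" for w
    unfolding s_def by (rule someI_ex) (use that in \<open>auto simp: Wp_def\<close>)
  have "eventually (\<lambda>l. l \<in> Z) (filtermap s V)" unfolding eventually_filtermap
    using V(2) by (rule eventually_mono) (use s l1(2) in blast)
  then have "rkU (filtermap s V) {} (cf m (\<lambda>l. l)) \<le> k" using Z ultra_filtermap[OF V(1)] by (auto simp: thin_def)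
  then have le: "v.rk {} (cf m s) \<le> k" unfolding rk_filtermap[OF V(1)] by (simp add: cf_comp)
  have "(\<lambda>l. l ! j) \<in> Acl V (set (cf m s))" if j: "j < ?r" for j
  proof -
    have "(\<lambda>l. s l ! (ix ! j)) \<in> set (cf m s)" using ixm[OF j] by (auto simp: cf_def)
    then have "(\<lambda>l. s l ! (ix ! j)) \<in> Acl V (set (cf m s))" by (rule v.mem)
    then show ?thesis
      by (rule acl_eventually_eq) (use V(2) s l1(2) j in \<open>auto elim!: eventually_mono\<close>)
  qed
  then have "set (cf ?r (\<lambda>l. l)) \<subseteq> Acl V ({} \<union> set (cf m s))" by (auto simp: cf_def)
  from v.rk_le[OF this] V(3) le r show False by simp
qed

text \<open>The generic type of the supercone is carried by \<open>f\<close> into the closure of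
  \<open>Z\<close> without loss of rank.\<close>

lemma dimension_bound:
  assumes Z: "thin k m Z" and X: "X \<subseteq> Z" and sc: "supercone F R P k' J S" and f: "Ldef_map F R k' m S f" "inj_on f S" "f ` J \<subseteq> cl m X"
  shows "k' \<le> k"
proof -
  obtain U where U: "ultra U" "eventually (\<lambda>a. a \<in> J \<and> length a = k') U" "rkU U {} (cf k' (\<lambda>l. l)) = k'"
    and S: "J \<subseteq> S" "\<forall>u\<in>S. length u = k'" using supercone_type[OF sc] by blast
  have "eventually (\<lambda>a. a \<in> S \<and> length a = k') U" using U(2) by (rule eventually_mono) (use S in blast)
  from injective_image_rank[OF U(1) this U(3) f(1,2) S(2)] have "k' \<le> rkU U {} (cf m f)" .
  also have "\<dots> \<le> k"
  proof (rule closure_rank[OF U(1) Z])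
    show "eventually (\<lambda>i. length (f i) = m \<and> (\<forall>\<delta>>0. \<exists>y\<in>Z. near m \<delta> (f i) y)) U" using U(2)
    proof eventually_elim
      case (elim i)
      then have c: "f i \<in> cl m X" using f(3) by blast
      then have l: "length (f i) = m" by (simp add: cl_def)
      have "\<exists>y\<in>Z. near m \<delta> (f i) y" if d: "\<delta> > 0" for \<delta>
      proof -
        let ?a = "map (\<lambda>j. Fin (f i ! j - \<delta>)) [0..<m]" and ?b = "map (\<lambda>j. Fin (f i ! j + \<delta>)) [0..<m]"
        have "f i \<in> ebox ?a ?b" using near_ebox near_refl[OF d] l by blast
        moreover have "length ?a = m" "length ?b = m" by simp_all
        ultimately obtain y where "y \<in> X" "y \<in> ebox ?a ?b" using c unfolding cl_def by blast
        then show ?thesis using near_ebox X by blast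
      qed
      then show ?case using l by blast
    qed
  qed
  finally show ?thesis .
qed

end

section \<open>The strongly large copy of a definable group\<close>

context omin_pair begin

text \<open>The tag takes finitely many values and is constant along an ultrafilter, so it adds
  nothing to the rank.\<close>

lemma thin_tag:
  assumes Z: "thin k n Z"
  shows "thin k (Suc n) {z @ [c] | z c. z \<in> Z \<and> c \<in> set cs}"
proof -
  let ?Zt = "{z @ [c] | z c. z \<in> Z \<and> c \<in> set cs}"
  have Zd: "definable F R n Z" "\<And>l. l \<in> Z \<Longrightarrow> length l = n" using Z by (auto simp: thin_def)
  have "DL (\<lambda>e. blk e 0 n \<in> Z \<and> (\<exists>c\<in>set cs. e n = c))"
    by (intro D_conj definable_D[OF Zd(1)] D_Bex_finite D_eqc) simp_all
  moreover have "blk e 0 (Suc n) \<in> ?Zt \<longleftrightarrow> blk e 0 n \<in> Z \<and> (\<exists>c\<in>set cs. e n = c)" for e by auto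
  ultimately have "DL (\<lambda>e. blk e 0 (Suc n) \<in> ?Zt)" by (simp only:)
  then have "definable F R (Suc n) ?Zt" by (rule D_definable) (use Zd(2) in auto)
  moreover have "rkU U {} (cf (Suc n) (\<lambda>l. l)) \<le> k" if U: "ultra U" and ev: "eventually (\<lambda>l. l \<in> ?Zt) U" for U
  proof -
    interpret u: pregeometry "Acl U" by (rule acl_pregeometry[OF U])
    have "eventually (\<lambda>l. l \<in> Z) (filtermap (take n) U)"
      unfolding eventually_filtermap using ev by (rule eventually_mono) (use Zd(2) in auto)
    then have "rkU (filtermap (take n) U) {} (cf n (\<lambda>l. l)) \<le> k"
      using Z ultra_filtermap[OF U] by (auto simp: thin_def)
    then have le: "u.rk {} (cf n (take n)) \<le> k" unfolding rk_filtermap[OF U] by (simp add: cf_comp)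
    have "eventually (\<lambda>l. \<exists>c\<in>set cs. l ! n = c) U"
      using ev by (rule eventually_mono) (use Zd(2) in \<open>auto simp: nth_append\<close>)
    then obtain c where c: "eventually (\<lambda>l. l ! n = c) U" using ultra_Bex[OF U, of "set cs" "\<lambda>c l. l ! n = c"] by auto
    have "(\<lambda>l. l ! n) \<in> Acl U (set (cf n (take n)))"
      by (rule acl_eventually_eq[OF acl_const[OF UNIV_I, of c]]) (use c in \<open>simp add: eq_commute\<close>)
    moreover have "(\<lambda>l. l ! j) \<in> Acl U (set (cf n (take n)))" if "j < n" for j
    proof (rule u.mem)
      have "(\<lambda>l. l ! j) = (\<lambda>l. take n l ! j)" using that by simp
      then show "(\<lambda>l. l ! j) \<in> set (cf n (take n))" using that by (auto simp: cf_def)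
    qed
    ultimately have "set (cf (Suc n) (\<lambda>l. l)) \<subseteq> Acl U ({} \<union> set (cf n (take n)))" by (auto simp: cf_def)
    from u.rk_le[OF this] le show ?thesis by simp
  qed
  ultimately show ?thesis using Zd(2) by (auto simp: thin_def)
qed

end

context ngroup begin

interpretation g: group G by (rule grp)

text \<open>The point is recovered over \<open>P\<close> from the translate and \<open>g\<close>,
  whose entries are constants.\<close>

lemma translate_rank:
  assumes U: "ultra U" "eventually (\<lambda>l. l \<in> carrier G) U" "rP n U (\<lambda>l. l) = kmax"
    and g: "g \<in> carrier G" and z: "eventually (\<lambda>l. z l = g \<otimes> l) U"
  shows "rP n U z = kmax"
proof (rule antisym)
  interpret u: pregeometry "Acl U" by (rule acl_pregeometry[OF U(1)])
  have ev: "eventually (\<lambda>l. z l \<in> carrier G) U" using U(2) z by eventually_elim (use g in auto)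
  show "rP n U z \<le> kmax" by (rule kmax_bound[OF U(1) ev])
  have "triple U (\<lambda>_. g) (\<lambda>l. l) z" unfolding triple_def using U(2) z by eventually_elim (use g in auto)
  from triple_closed_P(2)[OF U(1) this]
  have "set (cf n (\<lambda>l. l)) \<subseteq> Acl U (Pst U \<union> (set (cf n (\<lambda>_. g)) \<union> set (cf n z)))" .
  also have "\<dots> \<subseteq> Acl U (Pst U \<union> set (cf n z))"
  proof (rule u.cls_subset)
    have "set (cf n (\<lambda>_. g)) \<subseteq> Acl U (Pst U \<union> set (cf n z))" by (auto simp: cf_def intro: acl_const)
    then show "Pst U \<union> (set (cf n (\<lambda>_. g)) \<union> set (cf n z)) \<subseteq> Acl U (Pst U \<union> set (cf n z))"
      using u.extensive[of "Pst U \<union> set (cf n z)"] by blast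
  qed
  finally show "kmax \<le> rP n U z" using u.rk_le[of "cf n (\<lambda>l. l)" "Pst U" "cf n z"] U(3) by (simp add: rP_def)
qed

end

text \<open>The translates gs ! i of G into the thin set Z are glued along the first index that works; the
  extra coordinate cs ! i keeps them disjoint.\<close>

locale tagged_group = ngroup F R P n G for F :: "'f \<Rightarrow> 'a::linordered_ab_group_add list \<Rightarrow> 'a"
    and R :: "'r \<Rightarrow> 'a list \<Rightarrow> bool" and P n and G :: "'a list monoid" (structure) +
  fixes gs :: "'a list list" and Z :: "'a list set" and cs :: "'a list"
  assumes gs: "set gs \<subseteq> carrier G" and thinZ: "thin kmax n Z"
    and cover: "\<forall>x\<in>carrier G. \<exists>g\<in>set gs. g \<otimes> x \<in> Z"
    and cs: "distinct cs" "length cs = length gs"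
begin

interpretation g: group G by (rule grp)

definition idx :: "'a list \<Rightarrow> nat" where
  "idx x = (LEAST i. i < length gs \<and> gs ! i \<otimes> x \<in> Z)"

definition tag :: "'a list \<Rightarrow> 'a list" where
  "tag x = (gs ! idx x \<otimes> x) @ [cs ! idx x]"

definition H :: "'a list monoid" where
  "H = \<lparr>carrier = tag ` carrier G,
        monoid.mult = \<lambda>h h'. tag (inv_into (carrier G) tag h \<otimes> inv_into (carrier G) tag h'), one = tag \<one>\<rparr>"

lemma idx: assumes "x \<in> carrier G" shows "idx x < length gs \<and> gs ! idx x \<otimes> x \<in> Z"
proof -
  have "\<exists>i. i < length gs \<and> gs ! i \<otimes> x \<in> Z" using cover assms by (metis in_set_conv_nth)
  then show ?thesis unfolding idx_def by (rule LeastI_ex)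
qed

lemma idx_eq: "x \<in> carrier G \<Longrightarrow> i < length gs \<Longrightarrow> idx x = i \<longleftrightarrow> gs ! i \<otimes> x \<in> Z \<and> (\<forall>j\<in>{..<i}. \<not> gs ! j \<otimes> x \<in> Z)"
proof
  assume x: "x \<in> carrier G" "i < length gs" and "idx x = i"
  then show "gs ! i \<otimes> x \<in> Z \<and> (\<forall>j\<in>{..<i}. \<not> gs ! j \<otimes> x \<in> Z)"
    using idx[OF x(1)] not_less_Least[of _ "\<lambda>i. i < length gs \<and> gs ! i \<otimes> x \<in> Z"] unfolding idx_def by auto
next
  assume x: "x \<in> carrier G" "i < length gs" and a: "gs ! i \<otimes> x \<in> Z \<and> (\<forall>j\<in>{..<i}. \<not> gs ! j \<otimes> x \<in> Z)"
  show "idx x = i" unfolding idx_def by (rule Least_equality) (use x a in \<open>auto simp: not_less[symmetric]\<close>)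
qed

lemma gs_nth: "i < length gs \<Longrightarrow> gs ! i \<in> carrier G"
  using gs nth_mem by blast

lemma translate_length: "x \<in> carrier G \<Longrightarrow> i < length gs \<Longrightarrow> length (gs ! i \<otimes> x) = n"
  using gs_nth carrier_length by blast

lemma tag_length: "x \<in> carrier G \<Longrightarrow> length (tag x) = Suc n"
  using translate_length idx unfolding tag_def by simp

text \<open>The tag reveals the index, and translation by a fixed element cancels.\<close>

lemma tag_inj: "inj_on tag (carrier G)"
proof (rule inj_onI)
  fix x y assume xy: "x \<in> carrier G" "y \<in> carrier G" "tag x = tag y"
  then have "cs ! idx x = cs ! idx y" and e: "gs ! idx x \<otimes> x = gs ! idx y \<otimes> y" by (auto simp: tag_def)
  then have "idx x = idx y" using cs idx[OF xy(1)] idx[OF xy(2)] by (simp add: nth_eq_iff_index_eq)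
  then show "x = y" using e xy gs_nth idx[OF xy(1)] by simp
qed

lemma tag_iso: "tag \<in> iso G H"
  by (auto simp: iso_def hom_def H_def bij_betw_def tag_inj)

lemma H_group: "group H"
proof -
  have "group (H\<lparr>one := tag \<one>\<rparr>)" by (rule g.iso_imp_img_group[OF tag_iso])
  then show ?thesis by (simp add: H_def)
qed

lemma D_tag: "DN (\<lambda>e. blk e a n \<in> carrier G \<and> blk e b (Suc n) = tag (blk e a n))"
proof -
  let ?C = "\<lambda>i e. blk e a n \<in> carrier G \<and> gs ! i \<otimes> blk e a n \<in> Z"
  have "DN (\<lambda>e. \<exists>i\<in>{..<length gs}. ?C i e \<and> (\<forall>j\<in>{..<i}. \<not> ?C j e) \<and>
      (blk e a n \<in> carrier G \<and> blk e b n = gs ! i \<otimes> blk e a n) \<and> e (b + n) = cs ! i)"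
    by (intro D_Bex_finite D_conj D_Ball_finite D_not D_translate D_translate_eq D_eqc thin_definable_N[OF thinZ] gs_nth) auto
  moreover have "(\<exists>i\<in>{..<length gs}. ?C i e \<and> (\<forall>j\<in>{..<i}. \<not> ?C j e) \<and>
      (blk e a n \<in> carrier G \<and> blk e b n = gs ! i \<otimes> blk e a n) \<and> e (b + n) = cs ! i) \<longleftrightarrow>
      blk e a n \<in> carrier G \<and> blk e b (Suc n) = tag (blk e a n)" for e
  proof (cases "blk e a n \<in> carrier G")
    case True
    have sp: "blk e b (Suc n) = blk e b n @ [e (b + n)]" by simp
    have "blk e b (Suc n) = tag (blk e a n) \<longleftrightarrow> blk e b n = gs ! idx (blk e a n) \<otimes> blk e a n \<and> e (b + n) = cs ! idx (blk e a n)"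
      unfolding sp tag_def by simp
    moreover have "?C i e \<and> (\<forall>j\<in>{..<i}. \<not> ?C j e) \<longleftrightarrow> idx (blk e a n) = i" if "i < length gs" for i
      unfolding idx_eq[OF True that] using True by blast
    ultimately show ?thesis using idx[OF True] True by auto
  qed blast
  ultimately show ?thesis by (simp only:)
qed

lemma tag_definable: "defN (n + Suc n) {x @ tag x | x. x \<in> carrier G}"
proof (rule D_definable)
  have "blk e 0 (n + Suc n) \<in> {x @ tag x | x. x \<in> carrier G} \<longleftrightarrow> blk e 0 n \<in> carrier G \<and> blk e n (Suc n) = tag (blk e 0 n)" for e
  proof -
    have sp: "blk e 0 (n + Suc n) = blk e 0 n @ blk e n (Suc n)" using blk_split[of e 0 n "Suc n"] by simp
    show ?thesis unfolding sp
    proof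
      assume "blk e 0 n @ blk e n (Suc n) \<in> {x @ tag x | x. x \<in> carrier G}"
      then obtain x where x: "blk e 0 n @ blk e n (Suc n) = x @ tag x" "x \<in> carrier G" by blast
      have "length (blk e 0 n) = length x" using carrier_length[OF x(2)] by simp
      then have "blk e 0 n = x" "blk e n (Suc n) = tag x" using x(1) by (metis append_eq_append_conv)+
      then show "blk e 0 n \<in> carrier G \<and> blk e n (Suc n) = tag (blk e 0 n)" using x(2) by (simp only: simp_thms)
    qed blast
  qed
  then show "DN (\<lambda>e. blk e 0 (n + Suc n) \<in> {x @ tag x | x. x \<in> carrier G})" using D_tag[of 0 n] by (simp only:)
qed (use carrier_length tag_length in auto)

lemma H_carrier_definable: "defN (Suc n) (carrier H)"
proof (rule D_definable)
  let ?Q = "\<lambda>e. blk e (Suc n) n \<in> carrier G \<and> blk e 0 (Suc n) = tag (blk e (Suc n) n)"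
  have "DN (\<lambda>e. \<exists>xs. length xs = n \<and> ?Q (upds e (Suc n) xs))"
    by (rule D_exs[OF D_tag])
  moreover have "(\<exists>xs. length xs = n \<and> ?Q (upds e (Suc n) xs)) \<longleftrightarrow> blk e 0 (Suc n) \<in> carrier H" for e
  proof -
    have "?Q (upds e (Suc n) xs) \<longleftrightarrow> xs \<in> carrier G \<and> blk e 0 (Suc n) = tag xs" if l: "length xs = n" for xs
    proof -
      have 1: "blk (upds e (Suc n) xs) (Suc n) n = xs" by (rule blk_upds_same[OF l])
      have 2: "blk (upds e (Suc n) xs) 0 (Suc n) = blk e 0 (Suc n)" by (rule blk_upds_other) simp
      show ?thesis unfolding 1 2 ..
    qed
    moreover have "carrier H = tag ` carrier G" by (simp add: H_def)
    ultimately show ?thesis using carrier_length by blast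
  qed
  ultimately show "DN (\<lambda>e. blk e 0 (Suc n) \<in> carrier H)" by (simp only:)
qed (use tag_length in \<open>auto simp: H_def\<close>)

lemma H_mult: "x \<in> carrier G \<Longrightarrow> y \<in> carrier G \<Longrightarrow> tag x \<otimes>\<^bsub>H\<^esub> tag y = tag (x \<otimes> y)"
  by (simp add: H_def tag_inj)

lemma H_mult_definable:
  "defN (3 * Suc n) {x @ y @ (x \<otimes>\<^bsub>H\<^esub> y) | x y. x \<in> carrier H \<and> y \<in> carrier H}"
proof -
  let ?m = "Suc n" and ?M = "{tag x @ tag y @ tag (x \<otimes> y) | x y. x \<in> carrier G \<and> y \<in> carrier G}"
  have eq: "{x @ y @ (x \<otimes>\<^bsub>H\<^esub> y) | x y. x \<in> carrier H \<and> y \<in> carrier H} = ?M"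
  proof -
    have "carrier H = tag ` carrier G" by (simp add: H_def)
    then show ?thesis using H_mult by (auto simp: image_iff) (metis, force)
  qed
  let ?z = "3 * ?m"
  let ?Q = "\<lambda>e. (blk e ?z n \<in> carrier G \<and> blk e 0 ?m = tag (blk e ?z n)) \<and>
     (blk e (?z + n) n \<in> carrier G \<and> blk e ?m ?m = tag (blk e (?z + n) n)) \<and>
     (blk e (?z + 2 * n) n \<in> carrier G \<and> blk e (2 * ?m) ?m = tag (blk e (?z + 2 * n) n)) \<and>
     (blk e ?z n \<in> carrier G \<and> blk e (?z + n) n \<in> carrier G \<and> blk e (?z + 2 * n) n = blk e ?z n \<otimes> blk e (?z + n) n)"
  have "DN (\<lambda>e. \<exists>t. length t = 3 * n \<and> ?Q (upds e ?z t))"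
    by (rule D_exs, rule D_conj[OF D_tag D_conj[OF D_tag D_conj[OF D_tag D_mult]]]) simp_all
  moreover have "(\<exists>t. length t = 3 * n \<and> ?Q (upds e ?z t)) \<longleftrightarrow> blk e 0 (3 * ?m) \<in> ?M" for e
  proof -
    have lo: "blk (upds e ?z t) 0 ?m = blk e 0 ?m" "blk (upds e ?z t) ?m ?m = blk e ?m ?m" "blk (upds e ?z t) (2 * ?m) ?m = blk e (2 * ?m) ?m" for t
      by (rule blk_upds_other; simp)+
    have sp: "blk e 0 (3 * ?m) = blk e 0 ?m @ blk e ?m ?m @ blk e (2 * ?m) ?m"
    proof -
      have m3: "3 * ?m = ?m + (?m + ?m)" "2 * ?m = ?m + ?m" by simp_all
      show ?thesis unfolding m3 blk_split by simp
    qed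
    show ?thesis
    proof
      assume "\<exists>t. length t = 3 * n \<and> ?Q (upds e ?z t)"
      then obtain t where t: "?Q (upds e ?z t)" by blast
      define x where "x = blk (upds e ?z t) ?z n"
      define y where "y = blk (upds e ?z t) (?z + n) n"
      define w where "w = blk (upds e ?z t) (?z + 2 * n) n"
      have "blk e 0 ?m = tag x" "blk e ?m ?m = tag y" "blk e (2 * ?m) ?m = tag w" "w = x \<otimes> y" "x \<in> carrier G" "y \<in> carrier G"
        using t unfolding lo x_def[symmetric] y_def[symmetric] w_def[symmetric] by blast+
      then show "blk e 0 (3 * ?m) \<in> ?M" unfolding sp by (intro CollectI exI[of _ x] exI[of _ y]) (simp only: simp_thms)
    next
      assume "blk e 0 (3 * ?m) \<in> ?M"
      then obtain x y where xy: "blk e 0 (3 * ?m) = tag x @ tag y @ tag (x \<otimes> y)" "x \<in> carrier G" "y \<in> carrier G" by blast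
      have xyc: "x \<otimes> y \<in> carrier G" using xy by simp
      have l: "length x = n" "length y = n" "length (x \<otimes> y) = n" using xy xyc carrier_length by blast+
      have tl: "length (tag x) = ?m" "length (tag y) = ?m" using xy tag_length by blast+
      have tg: "blk e 0 ?m = tag x" "blk e ?m ?m = tag y" "blk e (2 * ?m) ?m = tag (x \<otimes> y)"
      proof -
        have "length (blk e 0 ?m) = length (tag x)" "length (blk e ?m ?m) = length (tag y)" using tl by simp_all
        then show "blk e 0 ?m = tag x" "blk e ?m ?m = tag y" "blk e (2 * ?m) ?m = tag (x \<otimes> y)"
          using xy(1) unfolding sp by (metis append_eq_append_conv)+
      qed
      let ?t = "x @ y @ (x \<otimes> y)"
      have b: "blk (upds e ?z ?t) ?z n = x" "blk (upds e ?z ?t) (?z + n) n = y" "blk (upds e ?z ?t) (?z + 2 * n) n = x \<otimes> y"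
        using l by (auto intro!: nth_equalityI simp: upds_def nth_append)
      have "?Q (upds e ?z ?t)" unfolding lo b tg using xy(2,3) xyc by blast
      moreover have "length ?t = 3 * n" using l by simp
      ultimately show "\<exists>t. length t = 3 * n \<and> ?Q (upds e ?z t)" by blast
    qed
  qed
  ultimately have "DN (\<lambda>e. blk e 0 (3 * ?m) \<in> ?M)" by (simp only:)
  then show ?thesis unfolding eq
  proof (rule D_definable)
    fix x assume "x \<in> ?M"
    then obtain a b where "x = tag a @ tag b @ tag (a \<otimes> b)" "a \<in> carrier G" "b \<in> carrier G" by blast
    then show "length x = 3 * ?m" using tag_length g.m_closed by simp
  qed
qed

lemma H_Ndef_group: "Ndef_group F R P (Suc n) H"
  unfolding Ndef_group_def
  using H_group H_carrier_definable H_mult_definable tag_length by (auto simp: H_def)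

text \<open>Along a type of rank \<open>kmax\<close> the index is constantly some \<open>i\<close>,
  so there \<open>tag\<close> is translation by \<open>gs ! i\<close> with a constant appended. The
  translate is generic again, hence without support in \<open>P\<close>, as
  \<open>supercone_at_generic\<close> requires.\<close>

lemma H_large:
  "\<exists>J S f. supercone F R P kmax J S \<and> Ldef_map F R kmax (Suc n) S f \<and> cont_on S f \<and> inj_on f S \<and> f ` J \<subseteq> carrier H"
proof -
  obtain U where U: "ultra U" "eventually (\<lambda>l. l \<in> carrier G) U" "rP n U (\<lambda>l. l) = kmax" using kmax_attained by blast
  have "eventually (\<lambda>l. \<exists>i\<in>{..<length gs}. idx l = i) U" using U(2) by (rule eventually_mono) (use idx in auto)
  then obtain i where i: "i < length gs" "eventually (\<lambda>l. idx l = i) U"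
    using ultra_Bex[OF U(1), of "{..<length gs}" "\<lambda>i l. idx l = i"] by auto
  \<comment> \<open>The default outside the group has length \<open>n\<close>, so that the
    coordinate functions of \<open>x\<close> are those of \<open>z\<close> followed by a constant as
    functions, not merely almost everywhere.\<close>
  define z where "z l = (if l \<in> carrier G then gs ! i \<otimes> l else replicate n 0)" for l
  define x where "x l = z l @ [cs ! i]" for l
  have zl: "length (z l) = n" for l using translate_length[OF _ i(1)] by (simp add: z_def)
  have zG: "eventually (\<lambda>l. z l = gs ! i \<otimes> l) U" using U(2) by (rule eventually_mono) (simp add: z_def)
  have zC: "eventually (\<lambda>l. z l \<in> carrier G) U" using U(2) by (rule eventually_mono) (use gs_nth[OF i(1)] in \<open>simp add: z_def\<close>)
  have rz: "rP n U z = kmax" by (rule translate_rank[OF U gs_nth[OF i(1)] zG])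
  obtain ix S where ix: "distinct ix" "set ix \<subseteq> {..<n}" "rkP U (crd n z ix) = length ix" "length ix = kmax"
    "finite S" "card S \<le> 0" "set (cf n z) \<subseteq> Acl U (S \<union> set (crd n z ix))"
    using generic_presented[OF U(1) zC rz] rz unfolding presented_def by auto
  have S: "S = {}" using ix(5,6) by simp
  have xz: "cf (Suc n) x = cf n z @ [\<lambda>_. cs ! i]" by (auto simp: cf_def x_def zl nth_append)
  have mx: "crd (Suc n) x ix = crd n z ix"
    unfolding xz using ix(2) by (auto simp: nth_append)
  have "\<exists>J S f. supercone F R P (length ix) J S \<and> Ldef_map F R (length ix) (Suc n) S f \<and> cont_on S f \<and> inj_on f S \<and> f ` J \<subseteq> carrier H"
  proof (rule supercone_at_generic[OF H_carrier_definable U(1)])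
    show "eventually (\<lambda>l. length (x l) = Suc n \<and> x l \<in> carrier H) U" using U(2) i(2)
    proof eventually_elim
      case (elim l)
      then have "x l = tag l" by (simp add: x_def z_def tag_def)
      then show ?case using elim by (simp add: H_def tag_length)
    qed
    show "rkP U (crd (Suc n) x ix) = length ix" unfolding mx by (rule ix(3))
    show "set (cf (Suc n) x) \<subseteq> Acl U (set (crd (Suc n) x ix))"
      unfolding mx unfolding xz using ix(7) S acl_const[OF UNIV_I] by auto
  qed (use ix(1,2) in auto)
  then show ?thesis unfolding ix(4) .
qed

lemma H_strongly_large: "strongly_large F R P (Suc n) (carrier H)"
proof -
  let ?m = "Suc n" and ?Zt = "{z @ [c] | z c. z \<in> Z \<and> c \<in> set cs}"
  have sub: "carrier H \<subseteq> ?Zt"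
  proof
    fix h assume "h \<in> carrier H"
    then obtain x where x: "x \<in> carrier G" "h = tag x" by (auto simp: H_def)
    then show "h \<in> ?Zt" using idx[OF x(1)] cs(2) by (auto simp: tag_def)
  qed
  have Hc: "carrier H \<subseteq> cl ?m (carrier H)" using tag_length by (auto simp: cl_def H_def)
  have ne: "carrier H \<noteq> {}" by (auto simp: H_def)
  \<comment> \<open>Both the group and its closure lie in this range, so one computation gives the
    two dimensions.\<close>
  have "ldim F R P ?m X = ereal (real kmax)" if X: "carrier H \<subseteq> X" "X \<subseteq> cl ?m (carrier H)" for X
  proof -
    let ?D = "{ereal (real k) | k. \<exists>J S f. supercone F R P k J S \<and> Ldef_map F R k ?m S f \<and> cont_on S f \<and> inj_on f S \<and> f ` J \<subseteq> X}"
    have "Sup ?D = ereal (real kmax)"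
    proof (rule antisym)
      show "Sup ?D \<le> ereal (real kmax)"
      proof (rule Sup_least)
        fix d assume "d \<in> ?D"
        then obtain k J S f where k: "d = ereal (real k)" "supercone F R P k J S" "Ldef_map F R k ?m S f" "inj_on f S" "f ` J \<subseteq> X" by blast
        have "k \<le> kmax"
          by (rule dimension_bound[OF thin_tag[OF thinZ] sub k(2,3,4)]) (use k(5) X(2) in blast)
        then show "d \<le> ereal (real kmax)" using k(1) by simp
      qed
      obtain J S f where "supercone F R P kmax J S" "Ldef_map F R kmax ?m S f" "cont_on S f" "inj_on f S" "f ` J \<subseteq> carrier H"
        using H_large by blast
      then have "\<exists>J S f. supercone F R P kmax J S \<and> Ldef_map F R kmax ?m S f \<and> cont_on S f \<and> inj_on f S \<and> f ` J \<subseteq> X"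
        using X(1) by blast
      then have "ereal (real kmax) \<in> ?D" by (intro CollectI exI[of _ kmax] conjI refl)
      then show "ereal (real kmax) \<le> Sup ?D" by (rule Sup_upper)
    qed
    moreover have "X \<noteq> {}" using ne X(1) by blast
    ultimately show ?thesis by (simp add: ldim_def)
  qed
  then show ?thesis unfolding strongly_large_def using Hc by simp
qed

end

lemma (in omin_pair) ex_strongly_large_copy:
  assumes "Ndef_group F R P n G"
  shows "\<exists>m (H :: 'a list monoid) \<phi>. Ndef_group F R P m H \<and> strongly_large F R P m (carrier H) \<and> \<phi> \<in> iso G H \<and>
      defN (n + m) {x @ \<phi> x | x. x \<in> carrier G}"
proof -
  interpret ngroup F R P n G by unfold_locales (rule assms)
  obtain gs Z where gs: "set gs \<subseteq> carrier G" "thin kmax n Z" "\<forall>x\<in>carrier G. \<exists>g\<in>set gs. g \<otimes>\<^bsub>G\<^esub> x \<in> Z"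
    using translates_cover by blast
  \<comment> \<open>The interval from 0 to \<open>p\<close> is an infinite set from which distinct
    tags are drawn.\<close>
  obtain p :: 'a where "p > 0" using ex_pos by blast
  from infinite_arbitrarily_large[OF infinite_interval[OF this], of "length gs"]
  obtain C :: "'a set" where C: "finite C" "card C = length gs" by blast
  obtain cs where "set cs = C" and d: "distinct cs" using finite_distinct_list[OF C(1)] by blast
  then have cs: "distinct cs" "length cs = length gs" using distinct_card[OF d] C(2) by simp_all
  interpret tagged_group F R P n G gs Z cs by unfold_locales (use gs cs in auto)
  show ?thesis using H_Ndef_group H_strongly_large tag_iso tag_definable by blast
qed

lemma diagonal_definable:
  assumes "definable F R n X" "\<And>x. x \<in> X \<Longrightarrow> length x = n"
  shows "definable F R (n + n) {x @ x | x. x \<in> X}"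
  unfolding definable_def
proof (rule D_imp_definable)
  have "D F R UNIV (\<lambda>e. blk e 0 n \<in> X \<and> (\<forall>j\<in>{..<n}. e (n + j) = e j))"
    by (intro D_conj D_Ball_finite D_eq definable_imp_D[OF assms(1)[unfolded definable_def]]) simp_all
  moreover have "blk e 0 (n + n) \<in> {x @ x | x. x \<in> X} \<longleftrightarrow> blk e 0 n \<in> X \<and> (\<forall>j\<in>{..<n}. e (n + j) = e j)" for e
  proof -
    have sp: "blk e 0 (n + n) = blk e 0 n @ blk e n n" using blk_split[of e 0 n n] by simp
    have "(\<forall>j\<in>{..<n}. e (n + j) = e j) \<longleftrightarrow> blk e n n = blk e 0 n" unfolding list_eq_iff_nth_eq by auto
    moreover have "blk e 0 n @ blk e n n \<in> {x @ x | x. x \<in> X} \<longleftrightarrow> blk e 0 n \<in> X \<and> blk e n n = blk e 0 n"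
    proof
      assume "blk e 0 n @ blk e n n \<in> {x @ x | x. x \<in> X}"
      then obtain x where x: "blk e 0 n @ blk e n n = x @ x" "x \<in> X" by blast
      have "length (blk e 0 n) = length x" using assms(2)[OF x(2)] by simp
      then have "blk e 0 n = x" "blk e n n = x" using x(1) by (metis append_eq_append_conv)+
      then show "blk e 0 n \<in> X \<and> blk e n n = blk e 0 n" using x(2) by (simp only: simp_thms)
    next
      assume "blk e 0 n \<in> X \<and> blk e n n = blk e 0 n"
      then show "blk e 0 n @ blk e n n \<in> {x @ x | x. x \<in> X}" by (simp only:) blast
    qed
    ultimately show ?thesis unfolding sp by (simp only:)
  qed
  ultimately show "D F R UNIV (\<lambda>e. blk e 0 (n + n) \<in> {x @ x | x. x \<in> X})" by (simp only:)
qed (use assms(2) in auto)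

theorem theorem6p1:
  fixes F :: "'f \<Rightarrow> 'a::linordered_ab_group_add list \<Rightarrow> 'a"
    and R :: "'r \<Rightarrow> 'a list \<Rightarrow> bool"
    and P :: "'a set"
  assumes "expands_ordered_group F R"
    and "o_minimal F R"
    and "dense_in P"
    and "dcl_independent F R P"
  shows "\<forall>n (G :: 'a list monoid). Ndef_group F R P n G \<longrightarrow>
           (\<exists>m (H :: 'a list monoid) \<phi>. Ndef_group F R P m H \<and>
               strongly_large F R P m (carrier H) \<and> \<phi> \<in> iso G H \<and>
               definable F (expR R P) (n + m) {x @ \<phi> x | x. x \<in> carrier G})"
proof (intro allI impI)
  fix n and G :: "'a list monoid" assume G: "Ndef_group F R P n G"
  have dn: "\<exists>p\<in>P. a < p \<and> p < b" if "a < b" for a b using assms(3) that by (simp add: dense_in_def)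
  show "\<exists>m (H :: 'a list monoid) \<phi>. Ndef_group F R P m H \<and> strongly_large F R P m (carrier H) \<and> \<phi> \<in> iso G H \<and>
      definable F (expR R P) (n + m) {x @ \<phi> x | x. x \<in> carrier G}"
  proof (cases "\<exists>a::'a. a \<noteq> 0")
    case True
    interpret omin_pair F R P by unfold_locales (use assms True dn in \<open>blast+\<close>)
    show ?thesis by (rule ex_strongly_large_copy[OF G])
  next
    case False
    \<comment> \<open>The universe is a single point, so there is only one tuple of length
      \<open>n\<close>, the neutral element of the group; the carrier is the whole space, hence
      closed, and the identity is the required isomorphism.\<close>
    have l: "length x = n" if "x \<in> carrier G" for x using G that by (auto simp: Ndef_group_def)
    interpret g: group G using G by (simp add: Ndef_group_def)
    have "x \<in> carrier G" if "length x = n" for x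
    proof -
      have "x = \<one>\<^bsub>G\<^esub>" by (rule nth_equalityI) (use that l[OF g.one_closed] False in \<open>auto, metis\<close>)
      then show ?thesis by simp
    qed
    then have "cl n (carrier G) = carrier G" using l by (auto simp: cl_def)
    then have "strongly_large F R P n (carrier G)" by (simp add: strongly_large_def)
    moreover have "definable F (expR R P) (n + n) {x @ id x | x. x \<in> carrier G}"
      using diagonal_definable[of F "expR R P" n "carrier G"] G l by (simp add: Ndef_group_def)
    moreover have "id \<in> iso G G" by (auto simp: iso_def hom_def)
    ultimately show ?thesis using G by blast
  qed
qed

end
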